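(* Let $\Delta\subset\mathbb{R}^d$ ($d\ge 1$) be a $d$-dimensional bounded convex domain that contains $0$ at its boundary $\partial\Delta$, and suppose that $\partial\Delta$ is smooth in a neighbourhood of $0$. For a random process $\xi(t)$, $t\in\mathbb{R}^d$, put $p_T(\Delta)=P\{\xi(t)<1,\ t\in T\Delta\}$. (1) Let $0<H<1$ and let $\xi=w_H$ be the fractional Brownian motion on $\mathbb{R}^d$ with Hurst parameter $H$. Then $$\frac{\log p_T(\Delta)}{\log T}=H-d+o(1),\qquad T\to\infty .$$ Moreover, let $0<H<1$ and let $\xi(t)$, $t\in\mathbb{R}^d$, $\xi(0)=0$, be a centered Gaussian process such that (a) $\xi$ is isotropic and has stationary increments; (b) $E\xi^2(t)<k|t|^{2H}$ for all $0<|t|<\infty$, for some constant $k$, and $E\xi^2(t)\sim c^2|t|^{2H}$ as $|t|\to\infty$, for some constant $c>0$. (2) (The lower bound.) Assume that $\{t\in\mathbb{R}^d: t^{(1)}=0\}$ is the tangent plane to $\Delta$ at $0$. Then for any $\lambda>1/2$ and all sufficiently large $T$, $$T^{H-d}(\ln T)^{-\lambda}\le P\{\xi(t)<1,\ t\in T\Delta\cap\mathbb{Z}^d\}.$$ If, moreover, the process is self-similar, i.e. $\xi=w_H$, then for any $\lambda>d/(2H)$ and all sufficiently large $T$, $$T^{H-d}(\ln T)^{-\lambda}\le P\{\xi(t)<1,\ t\in T\Delta\}.$$ (3) (The upper bound.) Assume, in addition to (a) and (b), that $\xi$ has an absolutely continuous spectral measure $F(d\lambda)=f(\lambda)\,d\lambda$,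 $\lambda\in\mathbb{R}^d$, such that $f(\lambda)>g(|\lambda|)>0$, where $g(x)$, $x\in[0,\infty)$, is a bounded continuous decreasing function with $$\int_0^\infty\frac{|\log g(x)|}{1+x^2}\,dx<\infty .$$ Then there is a constant $C>0$ such that for all sufficiently large $T$, $$p_T(\Delta)\le \exp\bigl(C\sqrt{\ln T}\bigr)\,T^{-d+H}.$$
   Context: $|\cdot|$ is the Euclidean norm on $\mathbb{R}^d$, $t^{(1)}$ is the first coordinate of $t\in\mathbb{R}^d$, and $T\Delta=\{Tt:t\in\Delta\}$. The notation $a\sim b$ means $a/b\to1$. The fractional Brownian motion $w_H$ with Hurst parameter $0<H<1$ and $d$-dimensional time is the centered Gaussian process on $\mathbb{R}^d$ with covariance $E\,w_H(t)w_H(s)=\tfrac12\left(|t|^{2H}+|s|^{2H}-|t-s|^{2H}\right)$. A process $\xi$ with $\xi(0)=0$ has stationary increments if for each fixed $t_0\in\mathbb{R}^d$ the processes $\{\xi(t+t_0)-\xi(t_0)\}_t$ and $\{\xi(t)\}_t$ have the same finite-dimensional distributions. It is isotropic if for each fixed $O\in SO(d)$ the processes $\{\xi(Ot)\}_t$ and $\{\xi(t)\}_t$ have the same finite-dimensional distributions. Processes are taken with continuous sample paths. A centered Gaussian process with stationary increments and $\xi(0)=0$ has absolutely continuous spectral measure $f(\lambda)\,d\lambda$, $f\ge0$, if $E\xi(t)\xi(s)=\int_{\mathbb{R}^d}(e^{i(t,\lambda)}-1)(e^{-i(s,\lambda)}-1)f(\lambda)\,d\lambda$ for all $t,s\in\mathbb{R}^d$.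 Pointwise conditions on the density $f$ are understood for almost every $\lambda$. *)

theory Defs
  imports "HOL-Probability.Probability" "HOL-Library.Landau_Symbols"
begin

section \<open>Convex domains with smooth boundary near a point\<close>

text \<open>Continuous differentiability up to order \<open>k\<close>; meant for open \<open>S\<close>.\<close>

fun Ck_on :: "nat \<Rightarrow> ('a::euclidean_space \<Rightarrow> real) \<Rightarrow> 'a set \<Rightarrow> bool" where
  "Ck_on 0 f S \<longleftrightarrow> continuous_on S f"
| "Ck_on (Suc k) f S \<longleftrightarrow>
     (\<forall>x\<in>S. f differentiable (at x)) \<and> (\<forall>v. Ck_on k (\<lambda>x. frechet_derivative f (at x) v) S)"

text \<open>Near \<open>p\<close>, the boundary of \<open>D\<close> is the zero set of the \<open>C\<^sup>\<infinity>\<close> function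
  \<open>\<phi>\<close>, whose differential at \<open>p\<close> is nonzero (hence nonzero near \<open>p\<close>).\<close>

definition local_defining_function :: "'a::euclidean_space set \<Rightarrow> 'a \<Rightarrow> ('a \<Rightarrow> real) \<Rightarrow> bool" where
  "local_defining_function D p \<phi> \<longleftrightarrow>
     (\<exists>U. open U \<and> p \<in> U \<and> (\<forall>k. Ck_on k \<phi> U) \<and>
          (\<exists>v. frechet_derivative \<phi> (at p) v \<noteq> 0) \<and>
          frontier D \<inter> U = {x \<in> U. \<phi> x = 0})"

definition smooth_boundary_near :: "'a::euclidean_space set \<Rightarrow> 'a \<Rightarrow> bool" where
  "smooth_boundary_near D p \<longleftrightarrow> (\<exists>\<phi>. local_defining_function D p \<phi>)"

text \<open>The kernel of the differential does not depend on the choice of \<open>\<phi>\<close>.\<close>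

definition tangent_plane_at :: "'a::euclidean_space set \<Rightarrow> 'a \<Rightarrow> 'a set \<Rightarrow> bool" where
  "tangent_plane_at D p P \<longleftrightarrow>
     (\<exists>\<phi>. local_defining_function D p \<phi> \<and> P = {x. frechet_derivative \<phi> (at p) (x - p) = 0})"

text \<open>Whether (part of) the boundary belongs to the domain is left open: open and closed
  convex sets are both \<open>F\<^sub>\<sigma>\<close>, as is an open set together with \<open>0\<close>. Some such
  condition is needed, because a convex set may contain an arbitrary, even nonmeasurable, part of
  its boundary, and then \<open>{\<xi> < 1 on T\<Delta>}\<close> need not be an event.\<close>

definition smooth_convex_domain_at_0 :: "'a::euclidean_space set \<Rightarrow> bool" where
  "smooth_convex_domain_at_0 D \<longleftrightarrow>
     convex D \<and> bounded D \<and> interior D \<noteq> {} \<and> fsigma D \<and>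
     0 \<in> frontier D \<and> smooth_boundary_near D 0"


section \<open>Gaussian random fields\<close>

text \<open>Degenerate (constant) Gaussian variables are allowed.\<close>

definition gaussian_variable :: "'w measure \<Rightarrow> ('w \<Rightarrow> real) \<Rightarrow> bool" where
  "gaussian_variable M X \<longleftrightarrow>
     X \<in> borel_measurable M \<and>
     ((\<exists>m. AE w in M. X w = m) \<or>
      (\<exists>m \<sigma>. \<sigma> > 0 \<and> distributed M lborel X (normal_density m \<sigma>)))"

definition gaussian_process :: "'w measure \<Rightarrow> ('t \<Rightarrow> 'w \<Rightarrow> real) \<Rightarrow> bool" where
  "gaussian_process M \<xi> \<longleftrightarrow>
     (\<forall>I a. finite I \<longrightarrow> gaussian_variable M (\<lambda>w. \<Sum>t\<in>I. a t * \<xi> t w))"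

definition centered_gaussian_process :: "'w measure \<Rightarrow> ('t \<Rightarrow> 'w \<Rightarrow> real) \<Rightarrow> bool" where
  "centered_gaussian_process M \<xi> \<longleftrightarrow>
     gaussian_process M \<xi> \<and> (\<forall>t. (\<integral>w. \<xi> t w \<partial>M) = 0)"

definition continuous_paths :: "'w measure \<Rightarrow> ('t::topological_space \<Rightarrow> 'w \<Rightarrow> real) \<Rightarrow> bool" where
  "continuous_paths M \<xi> \<longleftrightarrow> (\<forall>w\<in>space M. continuous_on UNIV (\<lambda>t. \<xi> t w))"

definition same_fdd :: "'w measure \<Rightarrow> ('t \<Rightarrow> 'w \<Rightarrow> real) \<Rightarrow> ('t \<Rightarrow> 'w \<Rightarrow> real) \<Rightarrow> bool" where
  "same_fdd M \<xi> \<eta> \<longleftrightarrow>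
     (\<forall>I. finite I \<longrightarrow>
        distr M (Pi\<^sub>M I (\<lambda>_. borel)) (\<lambda>w. \<lambda>t\<in>I. \<xi> t w) =
        distr M (Pi\<^sub>M I (\<lambda>_. borel)) (\<lambda>w. \<lambda>t\<in>I. \<eta> t w))"

definition stationary_increments :: "'w measure \<Rightarrow> ('t::real_vector \<Rightarrow> 'w \<Rightarrow> real) \<Rightarrow> bool" where
  "stationary_increments M \<xi> \<longleftrightarrow>
     (AE w in M. \<xi> 0 w = 0) \<and> (\<forall>t0. same_fdd M (\<lambda>t w. \<xi> (t + t0) w - \<xi> t0 w) \<xi>)"

definition isotropic :: "'w measure \<Rightarrow> (real^'n \<Rightarrow> 'w \<Rightarrow> real) \<Rightarrow> bool" where
  "isotropic M \<xi> \<longleftrightarrow>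
     (\<forall>Q :: real^'n^'n. rotation_matrix Q \<longrightarrow> same_fdd M (\<lambda>t. \<xi> (Q *v t)) \<xi>)"

definition fractional_brownian_motion ::
    "'w measure \<Rightarrow> real \<Rightarrow> ('t::euclidean_space \<Rightarrow> 'w \<Rightarrow> real) \<Rightarrow> bool" where
  "fractional_brownian_motion M H \<xi> \<longleftrightarrow>
     centered_gaussian_process M \<xi> \<and>
     (\<forall>t s. (\<integral>w. \<xi> t w * \<xi> s w \<partial>M) =
        (norm t powr (2 * H) + norm s powr (2 * H) - norm (t - s) powr (2 * H)) / 2)"

definition variance_growth :: "'w measure \<Rightarrow> real \<Rightarrow> ('t::euclidean_space \<Rightarrow> 'w \<Rightarrow> real) \<Rightarrow> bool" where
  "variance_growth M H \<xi> \<longleftrightarrow>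
     (\<exists>k. \<forall>t. t \<noteq> 0 \<longrightarrow> (\<integral>w. (\<xi> t w)\<^sup>2 \<partial>M) < k * norm t powr (2 * H)) \<and>
     (\<exists>c>0. (\<lambda>t. \<integral>w. (\<xi> t w)\<^sup>2 \<partial>M) \<sim>[at_infinity] (\<lambda>t. c\<^sup>2 * norm t powr (2 * H)))"

text \<open>Integrability is explicit because the Bochner integral of a non-integrable function is
  \<open>0\<close> by convention.\<close>

definition has_spectral_density ::
    "'w measure \<Rightarrow> ('t::euclidean_space \<Rightarrow> 'w \<Rightarrow> real) \<Rightarrow> ('t \<Rightarrow> real) \<Rightarrow> bool" where
  "has_spectral_density M \<xi> f \<longleftrightarrow>
     f \<in> borel_measurable borel \<and> (AE x in lborel. f x \<ge> 0) \<and>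
     (\<forall>t s. let h = (\<lambda>x. (exp (\<i> * complex_of_real (t \<bullet> x)) - 1) *
                          (exp (- \<i> * complex_of_real (s \<bullet> x)) - 1) * complex_of_real (f x))
            in integrable lborel h \<and>
               complex_of_real (\<integral>w. \<xi> t w * \<xi> s w \<partial>M) = (\<integral>x. h x \<partial>lborel))"

definition spectral_minorant :: "(real \<Rightarrow> real) \<Rightarrow> bool" where
  "spectral_minorant g \<longleftrightarrow>
     (\<forall>x\<ge>0. g x > 0) \<and> bounded (g ` {0..}) \<and> continuous_on {0..} g \<and> antimono_on {0..} g \<and>
     set_integrable lborel {0..} (\<lambda>x. \<bar>ln (g x)\<bar> / (1 + x\<^sup>2))"

definition persistence_prob :: "'w measure \<Rightarrow> ('t \<Rightarrow> 'w \<Rightarrow> real) \<Rightarrow> 't set \<Rightarrow> real" where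
  "persistence_prob M \<xi> A = measure M {w \<in> space M. \<forall>t\<in>A. \<xi> t w < 1}"

definition dilate :: "real \<Rightarrow> 'a::real_vector set \<Rightarrow> 'a set" where
  "dilate T D = (\<lambda>t. T *\<^sub>R t) ` D"

definition integer_lattice :: "(real^'n) set" where
  "integer_lattice = {t. \<forall>i. t $ i \<in> \<int>}"

end

theory Submission
  imports Defs "HOL-Real_Asymp.Real_Asymp"
begin

text \<open>Both bounds come from counting records of the field on a lattice.

  Upper bound: enumerate the lattice points of a ball of radius of order \<open>T\<close> outwards from its centre. By
  stationarity and isotropy a new point exceeds all earlier ones by a fixed amount with at least the
  probability that the field stays below a negative level on a ball touching \<open>0\<close>. The increments
  of the running maximum then sum up to at most its expectation, of order \<open>T\<^sup>H\<close> up to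
  logarithms. A Cameron-Martin shift turns the level \<open>1\<close> into a negative one at the cost of a factor
  \<open>exp (C sqrt (ln T))\<close>; it exists because constants outside the unit ball belong to the
  reproducing kernel space, which is Ingham's theorem on Fourier transforms of compactly supported functions.

  Lower bound: with positive probability the field is below \<open>- c n\<^sup>H\<close> on a whole lattice annulus of
  radius \<open>n\<close>. As it vanishes at \<open>0\<close>, following outward steps produces increments of total size
  \<open>c n\<^sup>H\<close>, taken only at points that dominate the outer part of the cube, which contains a half cube
  around such a point; so \<open>n\<^sup>d\<close> times the half cube probability is at least \<open>n\<^sup>H\<close> up to a
  logarithmic factor. For fractional Brownian motion, self-similarity and a union bound over small cubes pass
  from the lattice to the whole domain.\<close>

section \<open>Gaussian families and the Cameron-Martin shift\<close>

text \<open>Laws are compared only on finite index sets, through covariances; so the upper bound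
  sees the domain only through finite subsets of an inscribed ball. Membership of the constant 1 in
  the reproducing kernel space is used in dual form: the square of the sum of b is at most K times
  the quadratic form of the covariance at b, for b supported outside the unit ball. In spectral
  terms one needs psi with psi^2 / g integrable and Fourier transform zero outside the unit ball;
  the logarithmic integral of g decides how fast such a psi may decay. Fractional Brownian motion
  meets the same criterion, its kernel being a mixture of Gaussian spectra with a polynomial
  minorant. The Cameron-Martin shift is truncated: a tail exp (- L^2 / 2) is given up, and L = sqrt
  (2 d ln T) makes it T^(-d), negligible against T^(H - d), while the price exp (O (L)) is the
  factor in the upper bound. In the lower bound the probability of a low annulus must not depend on
  the fineness m of a net, since m is chosen afterwards, so large that a union bound over about m^d
  cells loses only half of it.\<close>

lemma integrable_bounded_prob:
  fixes f :: "'a \<Rightarrow> 'b::{banach, second_countable_topology}"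
  assumes "prob_space M" "f \<in> borel_measurable M" "\<And>w. norm (f w) \<le> B"
  shows "integrable M f"
proof -
  interpret prob_space M by fact
  show ?thesis by (rule integrable_const_bound[of _ B]) (use assms in auto)
qed

text \<open>The weights, divided by their common mass \<open>c\<close>, are probability densities,
  and the hypothesis is equality of the characteristic functions of the images of these measures
  under \<open>U\<close> and \<open>V\<close>. The frequency 0 shows that the two masses agree; mass
  0 is treated apart since it cannot be normalised.\<close>

lemma weighted_Levy_uniqueness:
  fixes U :: "'a \<Rightarrow> real" and V :: "'b \<Rightarrow> real" and f :: "'a \<Rightarrow> real" and g :: "'b \<Rightarrow> real"
  assumes M: "prob_space M" and N: "prob_space N"
    and [measurable]: "U \<in> borel_measurable M" "V \<in> borel_measurable N"
      "f \<in> borel_measurable M" "g \<in> borel_measurable N"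
    and f0: "\<And>w. 0 \<le> f w" and g0: "\<And>w. 0 \<le> g w" and fK: "\<And>w. f w \<le> K" and gK: "\<And>w. g w \<le> K"
    and ch: "\<And>s. (CLINT w|M. f w * iexp (s * U w)) = (CLINT w|N. g w * iexp (s * V w))"
    and [measurable]: "B \<in> sets borel"
  shows "(LINT w|M. f w * indicator B (U w)) = (LINT w|N. g w * indicator B (V w))"
proof -
  interpret M: prob_space M by fact
  interpret N: prob_space N by fact
  have If: "integrable M f" by (rule integrable_bounded_prob[OF M, where B = K]) (use f0 fK in auto)
  have Ig: "integrable N g" by (rule integrable_bounded_prob[OF N, where B = K]) (use g0 gK in auto)
  define c where "c = (LINT w|M. f w)"
  have c: "c = (LINT w|N. g w)"
  proof -
    have "complex_of_real c = complex_of_real (LINT w|N. g w)"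
      using ch[of 0] unfolding c_def by (simp del: of_real_eq_iff)
    then show ?thesis by (simp only: of_real_eq_iff)
  qed
  have c0: "c \<ge> 0" unfolding c_def by (rule Bochner_Integration.integral_nonneg) (use f0 in auto)
  show ?thesis
  proof (cases "c = 0")
    case True
    have "AE w in M. f w = 0"
      using True f0 If unfolding c_def by (subst (asm) integral_nonneg_eq_0_iff_AE) auto
    then have 1: "(LINT w|M. f w * indicator B (U w)) = 0"
      by (intro integral_eq_zero_AE) auto
    have "AE w in N. g w = 0"
      using True g0 Ig unfolding c by (subst (asm) integral_nonneg_eq_0_iff_AE) auto
    then have 2: "(LINT w|N. g w * indicator B (V w)) = 0"
      by (intro integral_eq_zero_AE) auto
    show ?thesis using 1 2 by simp
  next
    case False
    then have cp: "c > 0" using c0 by simp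
    define \<mu> where "\<mu> = distr (density M (\<lambda>w. ennreal (f w / c))) borel U"
    define \<nu> where "\<nu> = distr (density N (\<lambda>w. ennreal (g w / c))) borel V"
    have pM: "prob_space (density M (\<lambda>w. ennreal (f w / c)))"
    proof
      have "(\<integral>\<^sup>+ w. ennreal (f w / c) \<partial>M) = ennreal (LINT w|M. f w / c)"
        by (rule nn_integral_eq_integral) (use If f0 cp in auto)
      also have "(LINT w|M. f w / c) = 1" using cp c_def by simp
      finally show "emeasure (density M (\<lambda>w. ennreal (f w / c))) (space (density M (\<lambda>w. ennreal (f w / c)))) = 1"
        by (simp add: emeasure_density cong: nn_integral_cong)
    qed
    have pN: "prob_space (density N (\<lambda>w. ennreal (g w / c)))"
    proof
      have "(\<integral>\<^sup>+ w. ennreal (g w / c) \<partial>N) = ennreal (LINT w|N. g w / c)"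
        by (rule nn_integral_eq_integral) (use Ig g0 cp in auto)
      also have "(LINT w|N. g w / c) = 1" using cp c by simp
      finally show "emeasure (density N (\<lambda>w. ennreal (g w / c))) (space (density N (\<lambda>w. ennreal (g w / c)))) = 1"
        by (simp add: emeasure_density cong: nn_integral_cong)
    qed
    have rM: "real_distribution \<mu>" unfolding \<mu>_def
      by (intro real_distribution.intro prob_space.prob_space_distr[OF pM] real_distribution_axioms.intro) auto
    have rN: "real_distribution \<nu>" unfolding \<nu>_def
      by (intro real_distribution.intro prob_space.prob_space_distr[OF pN] real_distribution_axioms.intro) auto
    have chM: "char \<mu> s = (CLINT w|M. f w * iexp (s * U w)) / c" for s
      unfolding char_def \<mu>_def using f0 cp
      by (subst integral_distr) (auto simp: integral_density scaleR_conv_of_real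
          simp flip: integral_divide intro!: Bochner_Integration.integral_cong)
    have chN: "char \<nu> s = (CLINT w|N. g w * iexp (s * V w)) / c" for s
      unfolding char_def \<nu>_def using g0 cp
      by (subst integral_distr) (auto simp: integral_density scaleR_conv_of_real
          simp flip: integral_divide intro!: Bochner_Integration.integral_cong)
    have eq: "\<mu> = \<nu>"
      by (rule Levy_uniqueness[OF rM rN]) (rule ext, simp only: chM chN ch)
    have iM: "(LINT x|\<mu>. indicator B x) = (LINT w|M. f w * indicator B (U w)) / c"
      unfolding \<mu>_def using f0 cp
      by (subst integral_distr) (auto simp: integral_density
          simp flip: integral_divide intro!: Bochner_Integration.integral_cong)
    have iN: "(LINT x|\<nu>. indicator B x) = (LINT w|N. g w * indicator B (V w)) / c"
      unfolding \<nu>_def using g0 cp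
      by (subst integral_distr) (auto simp: integral_density
          simp flip: integral_divide intro!: Bochner_Integration.integral_cong)
    show ?thesis using iM iN eq cp by simp
  qed
qed

text \<open>Coordinates are moved one at a time from the exponential into a product of indicators.
  Each move is a one-dimensional uniqueness statement, in which the remaining factors act as a
  weight. Since weights must be nonnegative, the complex exponential of the other coordinates enters
  through 1 + cos and 1 + sin.\<close>

lemma char_determines_rectangles_aux:
  fixes X :: "'i \<Rightarrow> 'a \<Rightarrow> real" and Y :: "'i \<Rightarrow> 'b \<Rightarrow> real"
  assumes M: "prob_space M" and N: "prob_space N" and I: "finite I"
    and X [measurable]: "\<And>i. X i \<in> borel_measurable M" and Y [measurable]: "\<And>i. Y i \<in> borel_measurable N"
    and ch: "\<And>b. (CLINT w|M. iexp (\<Sum>i\<in>I. b i * X i w)) = (CLINT w|N. iexp (\<Sum>i\<in>I. b i * Y i w))"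
    and B [measurable]: "\<And>i. B i \<in> sets borel"
    and J: "finite J" "J \<subseteq> I"
  shows "(CLINT w|M. complex_of_real (\<Prod>i\<in>J. indicator (B i) (X i w)) * iexp (\<Sum>i\<in>I-J. b i * X i w)) =
         (CLINT w|N. complex_of_real (\<Prod>i\<in>J. indicator (B i) (Y i w)) * iexp (\<Sum>i\<in>I-J. b i * Y i w))"
  using J
proof (induction J arbitrary: b rule: finite_induct)
  case empty
  then show ?case using ch by simp
next
  case (insert j J)
  define W where "W = (\<lambda>w. (\<Prod>i\<in>J. indicator (B i) (X i w)) :: real)"
  define W' where "W' = (\<lambda>w. (\<Prod>i\<in>J. indicator (B i) (Y i w)) :: real)"
  define \<theta> where "\<theta> = (\<lambda>w. \<Sum>i\<in>I - insert j J. b i * X i w)"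
  define \<theta>' where "\<theta>' = (\<lambda>w. \<Sum>i\<in>I - insert j J. b i * Y i w)"
  have [measurable]: "W \<in> borel_measurable M" "\<theta> \<in> borel_measurable M"
     "W' \<in> borel_measurable N" "\<theta>' \<in> borel_measurable N"
    unfolding W_def \<theta>_def W'_def \<theta>'_def by measurable
  have W01: "0 \<le> W w" "W w \<le> 1" for w
    unfolding W_def by (auto intro!: prod_nonneg prod_le_1 simp: indicator_def)
  have W'01: "0 \<le> W' w" "W' w \<le> 1" for w
    unfolding W'_def by (auto intro!: prod_nonneg prod_le_1 simp: indicator_def)
  have IJ: "I - J = insert j (I - insert j J)" "j \<notin> I - insert j J" "finite (I - insert j J)"
    using insert I by auto
  have key: "(CLINT w|M. W w * iexp (s * X j w + r * \<theta> w)) = (CLINT w|N. W' w * iexp (s * Y j w + r * \<theta>' w))" for s r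
  proof -
    \<comment> \<open>The induction hypothesis holds for all coefficients, so coordinate
      \<open>j\<close> gets the free frequency \<open>s\<close> and the rest the common multiplier
      \<open>r\<close>.\<close>
    define b' where "b' = (\<lambda>i. r * b i)(j := s)"
    have 1: "(\<Sum>i\<in>I-J. b' i * X i w) = s * X j w + r * \<theta> w" for w
    proof -
      have "(\<Sum>i\<in>I - insert j J. b' i * X i w) = (\<Sum>i\<in>I - insert j J. r * (b i * X i w))"
        by (rule sum.cong) (auto simp: b'_def)
      then show ?thesis
        unfolding IJ(1) sum.insert[OF IJ(3,2)] \<theta>_def by (simp add: b'_def sum_distrib_left)
    qed
    have 2: "(\<Sum>i\<in>I-J. b' i * Y i w) = s * Y j w + r * \<theta>' w" for w
    proof -
      have "(\<Sum>i\<in>I - insert j J. b' i * Y i w) = (\<Sum>i\<in>I - insert j J. r * (b i * Y i w))"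
        by (rule sum.cong) (auto simp: b'_def)
      then show ?thesis
        unfolding IJ(1) sum.insert[OF IJ(3,2)] \<theta>'_def by (simp add: b'_def sum_distrib_left)
    qed
    show ?thesis
      using insert.IH[of b'] insert.prems unfolding 1 2 W_def W'_def by simp
  qed
  have nW: "norm (complex_of_real (W w) * iexp x) \<le> 1" "norm (complex_of_real (W' w') * iexp x) \<le> 1" for w w' x
    using W01[of w] W'01[of w'] by (auto simp: norm_mult)
  have iM: "integrable M (\<lambda>w. W w * iexp (s * X j w + r * \<theta> w))" for s r
    by (rule integrable_bounded_prob[OF M _ nW(1)]) measurable
  have iN: "integrable N (\<lambda>w. W' w * iexp (s * Y j w + r * \<theta>' w))" for s r
    by (rule integrable_bounded_prob[OF N _ nW(2)]) measurable
  have cosi: "complex_of_real (cos x) = (iexp x + iexp (-x)) / 2" for x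
    by (simp add: cos_exp_eq[symmetric] cos_of_real)
  have sini: "complex_of_real (sin x) = (iexp x - iexp (-x)) / (2 * \<i>)" for x
    using sin_exp_eq[of "complex_of_real x"] by (simp add: sin_of_real)
  \<comment> \<open>By Euler's formulas each weighted exponential is a combination of the instances
    \<open>r\<close> = 0, 1, -1 of \<open>key\<close>.\<close>
  have eM1: "W w * (1 + cos (\<theta> w)) * iexp (s * X j w) = W w * iexp (s * X j w + 0 * \<theta> w) +
       (W w * iexp (s * X j w + 1 * \<theta> w) + W w * iexp (s * X j w + (-1) * \<theta> w)) / 2" for s w
    unfolding of_real_mult of_real_add cosi by (simp add: ring_distribs exp_add field_simps exp_minus exp_diff)
  have eN1: "W' w * (1 + cos (\<theta>' w)) * iexp (s * Y j w) = W' w * iexp (s * Y j w + 0 * \<theta>' w) +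
       (W' w * iexp (s * Y j w + 1 * \<theta>' w) + W' w * iexp (s * Y j w + (-1) * \<theta>' w)) / 2" for s w
    unfolding of_real_mult of_real_add cosi by (simp add: ring_distribs exp_add field_simps exp_minus exp_diff)
  have eM2: "W w * (1 + sin (\<theta> w)) * iexp (s * X j w) = W w * iexp (s * X j w + 0 * \<theta> w) +
       (W w * iexp (s * X j w + 1 * \<theta> w) - W w * iexp (s * X j w + (-1) * \<theta> w)) / (2 * \<i>)" for s w
    unfolding of_real_mult of_real_add sini by (simp add: ring_distribs exp_add field_simps exp_minus exp_diff)
  have eN2: "W' w * (1 + sin (\<theta>' w)) * iexp (s * Y j w) = W' w * iexp (s * Y j w + 0 * \<theta>' w) +
       (W' w * iexp (s * Y j w + 1 * \<theta>' w) - W' w * iexp (s * Y j w + (-1) * \<theta>' w)) / (2 * \<i>)" for s w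
    unfolding of_real_mult of_real_add sini by (simp add: ring_distribs exp_add field_simps exp_minus exp_diff)
  have lin1: "(CLINT w|L. f w + (g w + h w) / 2) = (CLINT w|L. f w) + ((CLINT w|L. g w) + (CLINT w|L. h w)) / 2"
    if "integrable L f" "integrable L g" "integrable L h" for L :: "'z measure" and f g h :: "'z \<Rightarrow> complex"
    using that by simp
  have lin2: "(CLINT w|L. f w + (g w - h w) / (2 * \<i>)) = (CLINT w|L. f w) + ((CLINT w|L. g w) - (CLINT w|L. h w)) / (2 * \<i>)"
    if "integrable L f" "integrable L g" "integrable L h" for L :: "'z measure" and f g h :: "'z \<Rightarrow> complex"
    using that by simp
  have c1: "(CLINT w|M. complex_of_real (W w * (1 + cos (\<theta> w))) * iexp (s * X j w)) =
            (CLINT w|N. complex_of_real (W' w * (1 + cos (\<theta>' w))) * iexp (s * Y j w))" for s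
    unfolding eM1 eN1 lin1[OF iM iM iM] lin1[OF iN iN iN] key ..
  have c2: "(CLINT w|M. complex_of_real (W w * (1 + sin (\<theta> w))) * iexp (s * X j w)) =
            (CLINT w|N. complex_of_real (W' w * (1 + sin (\<theta>' w))) * iexp (s * Y j w))" for s
    unfolding eM2 eN2 lin2[OF iM iM iM] lin2[OF iN iN iN] key ..
  have c0: "(CLINT w|M. complex_of_real (W w) * iexp (s * X j w)) =
            (CLINT w|N. complex_of_real (W' w) * iexp (s * Y j w))" for s
    using key[of s 0] by simp
  have pos: "0 \<le> 1 + cos x" "0 \<le> 1 + sin x" "1 + cos x \<le> 2" "1 + sin x \<le> 2" for x :: real
    using cos_ge_minus_one[of x] sin_ge_minus_one[of x] cos_le_one[of x] sin_le_one[of x] by linarith+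
  have le2: "a * (1 + cos x) \<le> 2" "a * (1 + sin x) \<le> 2" if "0 \<le> a" "a \<le> 1" for a x :: real
    using mult_mono[OF that(2) pos(3)[of x]] mult_mono[OF that(2) pos(4)[of x]] pos that by auto
  let ?i = "\<lambda>w. indicator (B j) (X j w) :: real" and ?i' = "\<lambda>w. indicator (B j) (Y j w) :: real"
  have r1: "(LINT w|M. W w * (1 + cos (\<theta> w)) * ?i w) = (LINT w|N. W' w * (1 + cos (\<theta>' w)) * ?i' w)"
    by (rule weighted_Levy_uniqueness[OF M N _ _ _ _ _ _ _ _ c1, where K = 2])
       (use W01 W'01 pos le2 in auto)
  have r2: "(LINT w|M. W w * (1 + sin (\<theta> w)) * ?i w) = (LINT w|N. W' w * (1 + sin (\<theta>' w)) * ?i' w)"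
    by (rule weighted_Levy_uniqueness[OF M N _ _ _ _ _ _ _ _ c2, where K = 2])
       (use W01 W'01 pos le2 in auto)
  have r0: "(LINT w|M. W w * ?i w) = (LINT w|N. W' w * ?i' w)"
    by (rule weighted_Levy_uniqueness[OF M N _ _ _ _ _ _ _ _ c0, where K = 2])
       (use W01 W'01 in \<open>auto intro: order_trans[of _ 1 2]\<close>)
  have b1: "\<bar>a * x * indicator A y\<bar> \<le> 1" if "0 \<le> a" "a \<le> 1" "\<bar>x\<bar> \<le> 1" for a x :: real and A and y :: real
    using that by (auto simp: indicator_def abs_mult intro: mult_le_one)
  have b0: "\<bar>a * indicator A y\<bar> \<le> 1" if "0 \<le> a" "a \<le> 1" for a :: real and A and y :: real
    using that by (auto simp: indicator_def abs_mult intro: mult_le_one)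
  have JM: "integrable M (\<lambda>w. W w * ?i w)" "integrable M (\<lambda>w. W w * cos (\<theta> w) * ?i w)" "integrable M (\<lambda>w. W w * sin (\<theta> w) * ?i w)"
    by (rule integrable_bounded_prob[OF M, where B = 1], use W01 b0 b1 in auto)+
  have JN: "integrable N (\<lambda>w. W' w * ?i' w)" "integrable N (\<lambda>w. W' w * cos (\<theta>' w) * ?i' w)" "integrable N (\<lambda>w. W' w * sin (\<theta>' w) * ?i' w)"
    by (rule integrable_bounded_prob[OF N, where B = 1], use W'01 b0 b1 in auto)+
  have s1: "(LINT w|M. W w * cos (\<theta> w) * ?i w) = (LINT w|N. W' w * cos (\<theta>' w) * ?i' w)"
    using r1 r0 JM JN by (simp add: ring_distribs)
  have s2: "(LINT w|M. W w * sin (\<theta> w) * ?i w) = (LINT w|N. W' w * sin (\<theta>' w) * ?i' w)"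
    using r2 r0 JM JN by (simp add: ring_distribs)
  have E: "complex_of_real (\<Prod>i\<in>insert j J. indicator (B i) (X i w)) * iexp (\<theta> w) =
      complex_of_real (W w * cos (\<theta> w) * ?i w) + \<i> * complex_of_real (W w * sin (\<theta> w) * ?i w)" for w
    using insert.hyps unfolding W_def by (simp add: exp_Euler cos_of_real sin_of_real algebra_simps)
  have E': "complex_of_real (\<Prod>i\<in>insert j J. indicator (B i) (Y i w)) * iexp (\<theta>' w) =
      complex_of_real (W' w * cos (\<theta>' w) * ?i' w) + \<i> * complex_of_real (W' w * sin (\<theta>' w) * ?i' w)" for w
    using insert.hyps unfolding W'_def by (simp add: exp_Euler cos_of_real sin_of_real algebra_simps)
  have "(CLINT w|M. complex_of_real (\<Prod>i\<in>insert j J. indicator (B i) (X i w)) * iexp (\<theta> w)) =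
     complex_of_real (LINT w|M. W w * cos (\<theta> w) * ?i w) + \<i> * complex_of_real (LINT w|M. W w * sin (\<theta> w) * ?i w)"
    unfolding E using JM by (simp del: of_real_mult)
  moreover have "(CLINT w|N. complex_of_real (\<Prod>i\<in>insert j J. indicator (B i) (Y i w)) * iexp (\<theta>' w)) =
     complex_of_real (LINT w|N. W' w * cos (\<theta>' w) * ?i' w) + \<i> * complex_of_real (LINT w|N. W' w * sin (\<theta>' w) * ?i' w)"
    unfolding E' using JN by (simp del: of_real_mult)
  ultimately show ?case using s1 s2 unfolding \<theta>_def \<theta>'_def by simp
qed

lemma char_determines_rectangles:
  fixes X :: "'i \<Rightarrow> 'a \<Rightarrow> real" and Y :: "'i \<Rightarrow> 'b \<Rightarrow> real"
  assumes M: "prob_space M" and N: "prob_space N" and I: "finite I"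
    and X [measurable]: "\<And>i. X i \<in> borel_measurable M" and Y [measurable]: "\<And>i. Y i \<in> borel_measurable N"
    and ch: "\<And>b. (CLINT w|M. iexp (\<Sum>i\<in>I. b i * X i w)) = (CLINT w|N. iexp (\<Sum>i\<in>I. b i * Y i w))"
    and B [measurable]: "\<And>i. B i \<in> sets borel"
  shows "measure M {w \<in> space M. \<forall>i\<in>I. X i w \<in> B i} = measure N {w \<in> space N. \<forall>i\<in>I. Y i w \<in> B i}"
proof -
  interpret M: prob_space M by fact
  interpret N: prob_space N by fact
  have eM: "indicator {w \<in> space M. \<forall>i\<in>I. X i w \<in> B i} w = (\<Prod>i\<in>I. indicator (B i) (X i w) :: real)"
    if "w \<in> space M" for w
    using that I by (cases "\<forall>i\<in>I. X i w \<in> B i") (auto simp: indicator_def)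
  have eN: "indicator {w \<in> space N. \<forall>i\<in>I. Y i w \<in> B i} w = (\<Prod>i\<in>I. indicator (B i) (Y i w) :: real)"
    if "w \<in> space N" for w
    using that I by (cases "\<forall>i\<in>I. Y i w \<in> B i") (auto simp: indicator_def)
  have SM: "{w \<in> space M. \<forall>i\<in>I. X i w \<in> B i} \<in> sets M" and SN: "{w \<in> space N. \<forall>i\<in>I. Y i w \<in> B i} \<in> sets N"
    using I by measurable
  have "measure M {w \<in> space M. \<forall>i\<in>I. X i w \<in> B i} = (LINT w|M. (\<Prod>i\<in>I. indicator (B i) (X i w)))"
    using SM by (subst Bochner_Integration.integral_cong[OF refl eM[symmetric]]) auto
  moreover have "measure N {w \<in> space N. \<forall>i\<in>I. Y i w \<in> B i} = (LINT w|N. (\<Prod>i\<in>I. indicator (B i) (Y i w)))"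
    using SN by (subst Bochner_Integration.integral_cong[OF refl eN[symmetric]]) auto
  moreover have "complex_of_real (LINT w|M. (\<Prod>i\<in>I. indicator (B i) (X i w))) = complex_of_real (LINT w|N. (\<Prod>i\<in>I. indicator (B i) (Y i w)))"
    using char_determines_rectangles_aux[OF M N I X Y ch B I order_refl, of "\<lambda>i. i" "\<lambda>_. 0"] by (simp del: of_real_prod)
  ultimately show ?thesis by (simp only: of_real_eq_iff)
qed

section \<open>Moments and covariance calculus of centered Gaussian families\<close>

lemma centered_gaussian_cases:
  assumes "prob_space M" "gaussian_variable M Z" "(LINT w|M. Z w) = 0"
  obtains "AE w in M. Z w = 0"
    | \<sigma> where "\<sigma> > 0" "distributed M lborel Z (normal_density 0 \<sigma>)"
proof -
  interpret prob_space M by fact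
  from assms(2) have [measurable]: "Z \<in> borel_measurable M" by (simp add: gaussian_variable_def)
  from assms(2) consider m where "AE w in M. Z w = m" |
      m \<sigma> where "\<sigma> > 0" "distributed M lborel Z (normal_density m \<sigma>)"
    by (auto simp: gaussian_variable_def)
  then show thesis
  proof cases
    case (1 m)
    then have "(LINT w|M. Z w) = (LINT w|M. m)" by (intro integral_cong_AE) auto
    then have "m = 0" using assms(3) by (simp add: prob_space)
    then show ?thesis using 1 that(1) by simp
  next
    case (2 m \<sigma>)
    then have "m = 0" using normal_distributed_expectation[OF 2] assms(3) by simp
    then show ?thesis using 2 that(2) by simp
  qed
qed

context
  fixes M :: "'w measure" and Z :: "'w \<Rightarrow> real"
  assumes M: "prob_space M" and Z: "gaussian_variable M Z" "(LINT w|M. Z w) = 0"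
begin

interpretation prob_space M by (fact M)

lemma gaussian_measurable: "Z \<in> borel_measurable M"
  using Z(1) by (simp add: gaussian_variable_def)

lemma gaussian_integrable: "integrable M Z" "integrable M (\<lambda>w. (Z w)\<^sup>2)"
proof -
  have [measurable]: "Z \<in> borel_measurable M" by (fact gaussian_measurable)
  have "integrable M Z \<and> integrable M (\<lambda>w. (Z w)\<^sup>2)"
    using M Z
  proof (cases rule: centered_gaussian_cases)
    case 1
    have "integrable M Z" "integrable M (\<lambda>w. (Z w)\<^sup>2)"
      by (rule integrable_cong_AE_imp[of M "\<lambda>_. 0"]; use 1 in auto)+
    then show ?thesis by simp
  next
    case (2 \<sigma>)
    have "integrable M (\<lambda>w. (Z w) ^ k)" for k :: nat
      using distributed_integrable[OF 2(2), of "\<lambda>x. x ^ k"] integrable_normal_moment[of \<sigma> 0 k] 2(1) by auto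
    from this[of 1] this[of 2] show ?thesis by auto
  qed
  then show "integrable M Z" "integrable M (\<lambda>w. (Z w)\<^sup>2)" by auto
qed

lemma gaussian_char: "(CLINT w|M. iexp (Z w)) = exp (- (LINT w|M. (Z w)\<^sup>2) / 2)"
proof -
  have [measurable]: "Z \<in> borel_measurable M" by (fact gaussian_measurable)
  show ?thesis using M Z
  proof (cases rule: centered_gaussian_cases)
    case 1
    have "(CLINT w|M. iexp (Z w)) = (CLINT w|M. 1)" by (intro integral_cong_AE) (use 1 in auto)
    moreover have "(LINT w|M. (Z w)\<^sup>2) = (LINT w|M. 0)" by (intro integral_cong_AE) (use 1 in auto)
    ultimately show ?thesis by (simp add: prob_space)
  next
    case (2 \<sigma>)
    have v: "(LINT w|M. (Z w)\<^sup>2) = \<sigma>\<^sup>2"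
      using normal_distributed_variance[OF 2] Z(2) by simp
    have "distributed M lborel (\<lambda>w. (Z w - 0) / \<sigma>) (\<lambda>x. ennreal (std_normal_density x))"
      using normal_standard_normal_convert[OF 2(1), of Z 0] 2(2) by simp
    then have d: "distr M lborel (\<lambda>w. Z w / \<sigma>) = std_normal_distribution"
      by (simp add: distributed_def)
    have "(CLINT w|M. iexp (Z w)) = (CLINT w|M. iexp (\<sigma> * (Z w / \<sigma>)))" using 2 by simp
    also have "\<dots> = (CLINT x|distr M lborel (\<lambda>w. Z w / \<sigma>). iexp (\<sigma> * x))"
      by (subst integral_distr) auto
    also have "\<dots> = exp (- \<sigma>\<^sup>2 / 2)"
      unfolding d using char_std_normal_distribution by (simp add: char_def fun_eq_iff)
    finally show ?thesis using v by simp
  qed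
qed

text \<open>Multiplying the density of variance \<open>\<sigma>\<^sup>2\<close> by exp (x^2 / (4
  \<open>\<sigma>\<^sup>2\<close>)) gives sqrt 2 times the density of variance 2
  \<open>\<sigma>\<^sup>2\<close>; hence the constant 4, and the bound 2 >= sqrt 2. All Gaussian
  tail estimates for suprema and increments below rest on this exponential moment.\<close>

lemma gaussian_exp_square:
  assumes s: "s > 0" "(LINT w|M. (Z w)\<^sup>2) \<le> s\<^sup>2"
  shows "(\<integral>\<^sup>+w. ennreal (exp ((Z w)\<^sup>2 / (4 * s\<^sup>2))) \<partial>M) \<le> 2"
proof -
  have [measurable]: "Z \<in> borel_measurable M" by (fact gaussian_measurable)
  show ?thesis using M Z
  proof (cases rule: centered_gaussian_cases)
    case 1
    have "(\<integral>\<^sup>+w. ennreal (exp ((Z w)\<^sup>2 / (4 * s\<^sup>2))) \<partial>M) = (\<integral>\<^sup>+w. 1 \<partial>M)"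
      by (intro nn_integral_cong_AE) (use 1 in auto)
    then show ?thesis by (simp add: emeasure_space_1)
  next
    case (2 \<sigma>)
    have v: "(LINT w|M. (Z w)\<^sup>2) = \<sigma>\<^sup>2"
      using normal_distributed_variance[OF 2] Z(2) by simp
    have "(\<integral>\<^sup>+w. ennreal (exp ((Z w)\<^sup>2 / (4 * s\<^sup>2))) \<partial>M) \<le> (\<integral>\<^sup>+w. ennreal (exp ((Z w)\<^sup>2 / (4 * \<sigma>\<^sup>2))) \<partial>M)"
      by (intro nn_integral_mono ennreal_leI) (use s v 2(1) in \<open>auto intro!: divide_left_mono\<close>)
    also have "\<dots> = (\<integral>\<^sup>+x. ennreal (exp (x\<^sup>2 / (4 * \<sigma>\<^sup>2))) * normal_density 0 \<sigma> x \<partial>lborel)"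
      using distributed_nn_integral[OF 2(2), of "\<lambda>x. ennreal (exp (x\<^sup>2 / (4 * \<sigma>\<^sup>2)))"]
      by (simp add: mult.commute)
    also have "\<dots> = (\<integral>\<^sup>+x. ennreal (sqrt 2) * normal_density 0 (sqrt 2 * \<sigma>) x \<partial>lborel)"
    proof (intro nn_integral_cong)
      fix x :: real
      have "exp (x\<^sup>2 / (4 * \<sigma>\<^sup>2)) * normal_density 0 \<sigma> x = sqrt 2 * normal_density 0 (sqrt 2 * \<sigma>) x"
        using 2(1) unfolding normal_density_def
        by (simp add: power_mult_distrib real_sqrt_mult mult_exp_exp field_simps)
      then show "ennreal (exp (x\<^sup>2 / (4 * \<sigma>\<^sup>2))) * ennreal (normal_density 0 \<sigma> x) =
          ennreal (sqrt 2) * ennreal (normal_density 0 (sqrt 2 * \<sigma>) x)"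
        by (simp flip: ennreal_mult)
    qed
    also have "\<dots> = ennreal (sqrt 2)"
    proof -
      have "prob_space (density lborel (normal_density 0 (sqrt 2 * \<sigma>)))"
        by (rule prob_space_normal_density) (use 2 in auto)
      then have "(\<integral>\<^sup>+x. normal_density 0 (sqrt 2 * \<sigma>) x \<partial>lborel) = 1"
        using prob_space.emeasure_space_1 by (force simp: emeasure_density)
      then show ?thesis by (simp add: nn_integral_cmult)
    qed
    also have "ennreal (sqrt 2) \<le> 2"
      by (simp add: real_le_lsqrt flip: ennreal_numeral)
    finally show ?thesis .
  qed
qed

end

context
  fixes M :: "'w measure" and X :: "'i \<Rightarrow> 'w \<Rightarrow> real"
  assumes M: "prob_space M" and X: "centered_gaussian_process M X"
begin

interpretation prob_space M by (fact M)

lemma cgp_single: "gaussian_variable M (X i)" "(LINT w|M. X i w) = 0"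
proof -
  from X have "\<forall>I a. finite I \<longrightarrow> gaussian_variable M (\<lambda>w. \<Sum>t\<in>I. a t * X t w)"
    by (simp add: centered_gaussian_process_def gaussian_process_def)
  from this[rule_format, of "{i}" "\<lambda>_. 1"] show "gaussian_variable M (X i)" by simp
  show "(LINT w|M. X i w) = 0" using X by (simp add: centered_gaussian_process_def)
qed

lemma cgp_measurable: "X i \<in> borel_measurable M"
  using cgp_single(1) by (simp add: gaussian_variable_def)

lemma cgp_square_integrable: "integrable M (\<lambda>w. (X i w)\<^sup>2)"
  using gaussian_integrable[OF M cgp_single] by auto

lemma cgp_integrable: "integrable M (X i)"
  using gaussian_integrable[OF M cgp_single] by auto

lemma cgp_mult_integrable: "integrable M (\<lambda>w. X i w * X j w)"
proof (rule Bochner_Integration.integrable_bound)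
  show "integrable M (\<lambda>w. (X i w)\<^sup>2 + (X j w)\<^sup>2)" using cgp_square_integrable by auto
  show "AE w in M. norm (X i w * X j w) \<le> norm ((X i w)\<^sup>2 + (X j w)\<^sup>2)"
  proof (rule AE_I2)
    fix w
    have "2 * \<bar>X i w * X j w\<bar> \<le> (X i w)\<^sup>2 + (X j w)\<^sup>2"
      using sum_squares_bound[of "\<bar>X i w\<bar>" "\<bar>X j w\<bar>"] by (simp add: abs_mult)
    then show "norm (X i w * X j w) \<le> norm ((X i w)\<^sup>2 + (X j w)\<^sup>2)" by simp
  qed
qed (use cgp_measurable in measurable)

lemma cgp_comb:
  assumes "finite I"
  shows "gaussian_variable M (\<lambda>w. \<Sum>i\<in>I. a i * X i w)" "(LINT w|M. (\<Sum>i\<in>I. a i * X i w)) = 0"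
proof -
  show "gaussian_variable M (\<lambda>w. \<Sum>i\<in>I. a i * X i w)"
    using X assms by (simp add: centered_gaussian_process_def gaussian_process_def)
  have "(LINT w|M. (\<Sum>i\<in>I. a i * X i w)) = (\<Sum>i\<in>I. LINT w|M. a i * X i w)"
    by (rule Bochner_Integration.integral_sum) (rule integrable_mult_right[OF cgp_integrable])
  then show "(LINT w|M. (\<Sum>i\<in>I. a i * X i w)) = 0"
    by (simp add: cgp_single(2))
qed

lemma cgp_comb_mult:
  assumes "finite I" "finite J"
  shows "(LINT w|M. (\<Sum>i\<in>I. a i * X i w) * (\<Sum>j\<in>J. b j * X j w)) =
    (\<Sum>i\<in>I. \<Sum>j\<in>J. a i * b j * (LINT w|M. X i w * X j w))"
proof -
  have "(\<Sum>i\<in>I. a i * X i w) * (\<Sum>j\<in>J. b j * X j w) = (\<Sum>i\<in>I. \<Sum>j\<in>J. a i * b j * (X i w * X j w))" for w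
    unfolding sum_product by (intro sum.cong refl) simp
  then have "(LINT w|M. (\<Sum>i\<in>I. a i * X i w) * (\<Sum>j\<in>J. b j * X j w)) =
      (LINT w|M. (\<Sum>i\<in>I. \<Sum>j\<in>J. a i * b j * (X i w * X j w)))"
    by (simp only:)
  also have "\<dots> = (\<Sum>i\<in>I. LINT w|M. (\<Sum>j\<in>J. a i * b j * (X i w * X j w)))"
    by (intro Bochner_Integration.integral_sum Bochner_Integration.integrable_sum integrable_mult_right cgp_mult_integrable)
  also have "\<dots> = (\<Sum>i\<in>I. \<Sum>j\<in>J. LINT w|M. a i * b j * (X i w * X j w))"
    by (intro sum.cong refl Bochner_Integration.integral_sum integrable_mult_right cgp_mult_integrable)
  finally show ?thesis by simp
qed

lemma cgp_comb_square:
  assumes "finite I"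
  shows "(LINT w|M. (\<Sum>i\<in>I. a i * X i w)\<^sup>2) = (\<Sum>i\<in>I. \<Sum>j\<in>I. a i * a j * (LINT w|M. X i w * X j w))"
  unfolding power2_eq_square by (rule cgp_comb_mult[OF assms assms])

lemma cgp_char:
  assumes "finite I"
  shows "(CLINT w|M. iexp (\<Sum>i\<in>I. a i * X i w)) =
    exp (- (\<Sum>i\<in>I. \<Sum>j\<in>I. a i * a j * (LINT w|M. X i w * X j w)) / 2)"
  using gaussian_char[OF M cgp_comb[OF assms, of a]] unfolding cgp_comb_square[OF assms] .

text \<open>Covers every derived family used later: rescalings, rotations, increments from a base
  point.\<close>

lemma cgp_linear_image:
  fixes Y :: "'j \<Rightarrow> 'w \<Rightarrow> real"
  assumes fin: "\<And>s. finite (J s)" and Y: "\<And>s w. Y s w = (\<Sum>t\<in>J s. c s t * X t w)"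
  shows "centered_gaussian_process M Y"
  unfolding centered_gaussian_process_def gaussian_process_def
proof (intro conjI allI impI)
  fix I :: "'j set" and a assume I: "finite I"
  define K where "K = (\<Union>s\<in>I. J s)"
  have K: "finite K" using I fin by (auto simp: K_def)
  have "(\<Sum>s\<in>I. a s * Y s w) = (\<Sum>t\<in>K. (\<Sum>s\<in>I. a s * (if t \<in> J s then c s t else 0)) * X t w)" for w
  proof -
    have "Y s w = (\<Sum>t\<in>K. (if t \<in> J s then c s t else 0) * X t w)" if "s \<in> I" for s
      unfolding Y using that K by (intro sum.mono_neutral_cong_left) (auto simp: K_def)
    then have "(\<Sum>s\<in>I. a s * Y s w) = (\<Sum>s\<in>I. \<Sum>t\<in>K. a s * (if t \<in> J s then c s t else 0) * X t w)"
      by (simp add: sum_distrib_left mult.assoc)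
    also have "\<dots> = (\<Sum>t\<in>K. \<Sum>s\<in>I. a s * (if t \<in> J s then c s t else 0) * X t w)" by (rule sum.swap)
    finally show ?thesis by (simp add: sum_distrib_right)
  qed
  then show "gaussian_variable M (\<lambda>w. \<Sum>s\<in>I. a s * Y s w)"
    using cgp_comb(1)[OF K] by simp
next
  fix s
  show "(LINT w|M. Y s w) = 0" unfolding Y using cgp_comb(2)[OF fin] .
qed

end

text \<open>The characteristic function depends on the covariances alone. Stationarity, rotation
  invariance and self-similarity enter the argument only through this lemma.\<close>

lemma cgp_rectangle_eq:
  fixes X :: "'i \<Rightarrow> 'a \<Rightarrow> real" and Y :: "'i \<Rightarrow> 'b \<Rightarrow> real"
  assumes M: "prob_space M" and N: "prob_space N" and I: "finite I"
    and X: "centered_gaussian_process M X" and Y: "centered_gaussian_process N Y"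
    and cov: "\<And>i j. i \<in> I \<Longrightarrow> j \<in> I \<Longrightarrow> (LINT w|M. X i w * X j w) = (LINT w|N. Y i w * Y j w)"
    and B: "\<And>i. B i \<in> sets borel"
  shows "measure M {w \<in> space M. \<forall>i\<in>I. X i w \<in> B i} = measure N {w \<in> space N. \<forall>i\<in>I. Y i w \<in> B i}"
proof -
  have ch: "(CLINT w|M. iexp (\<Sum>i\<in>I. b i * X i w)) = (CLINT w|N. iexp (\<Sum>i\<in>I. b i * Y i w))" for b
  proof -
    have "(\<Sum>i\<in>I. \<Sum>j\<in>I. b i * b j * (LINT w|M. X i w * X j w)) =
          (\<Sum>i\<in>I. \<Sum>j\<in>I. b i * b j * (LINT w|N. Y i w * Y j w))"
      by (intro sum.cong refl arg_cong2[where f = times] cov)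
    then show ?thesis by (simp only: cgp_char[OF M X I, of b] cgp_char[OF N Y I, of b])
  qed
  show ?thesis
    by (rule char_determines_rectangles[where I = I and X = X and Y = Y and B = B,
          OF M N I cgp_measurable[OF M X] cgp_measurable[OF N Y] ch B])
qed

text \<open>The range of a symmetric matrix is the orthogonal complement of its kernel; for a
  semidefinite one the kernel is the zero set of the quadratic form. The induction on the index set
  is block elimination: the new index \<open>z\<close> is projected onto the old ones, and only the
  Schur complement \<open>v\<close> has to be divided by.\<close>

lemma psd_solve:
  fixes R :: "'i \<Rightarrow> 'i \<Rightarrow> real" and c :: "'i \<Rightarrow> real"
  assumes "finite F" and sym: "\<And>s t. R s t = R t s"
    and "\<And>b. 0 \<le> (\<Sum>s\<in>F. \<Sum>t\<in>F. b s * b t * R s t)"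
    and "\<And>b. (\<Sum>s\<in>F. \<Sum>t\<in>F. b s * b t * R s t) = 0 \<Longrightarrow> (\<Sum>s\<in>F. b s * c s) = 0"
  shows "\<exists>a. \<forall>s\<in>F. (\<Sum>t\<in>F. a t * R t s) = c s"
  using assms(1,3,4)
proof (induction F arbitrary: c rule: finite_induct)
  case empty
  then show ?case by simp
next
  case (insert z F)
  define Q where "Q = (\<lambda>b. \<Sum>s\<in>F. \<Sum>t\<in>F. b s * b t * R s t)"
  have ext: "(\<Sum>s\<in>insert z F. \<Sum>t\<in>insert z F. (b(z := x)) s * (b(z := x)) t * R s t) =
     Q b + 2 * x * (\<Sum>s\<in>F. b s * R s z) + x\<^sup>2 * R z z" for b x
  proof -
    have 1: "(\<Sum>t\<in>insert z F. (b(z := x)) s * (b(z := x)) t * R s t) =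
        (b(z := x)) s * x * R s z + (\<Sum>t\<in>F. (b(z := x)) s * b t * R s t)" for s
    proof -
      have "(\<Sum>t\<in>F. (b(z := x)) s * (b(z := x)) t * R s t) = (\<Sum>t\<in>F. (b(z := x)) s * b t * R s t)"
        using insert.hyps by (intro sum.cong) auto
      then show ?thesis using insert.hyps by simp
    qed
    have 2: "(\<Sum>s\<in>F. (b(z := x)) s * x * R s z + (\<Sum>t\<in>F. (b(z := x)) s * b t * R s t)) =
        (\<Sum>s\<in>F. b s * x * R s z + (\<Sum>t\<in>F. b s * b t * R s t))"
      using insert.hyps by (intro sum.cong) auto
    have 3: "(\<Sum>t\<in>F. x * b t * R z t) = x * (\<Sum>s\<in>F. b s * R s z)"
      unfolding sum_distrib_left using sym by (intro sum.cong refl) (auto simp: mult_ac)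
    have 4: "(\<Sum>s\<in>F. b s * x * R s z) = x * (\<Sum>s\<in>F. b s * R s z)"
      unfolding sum_distrib_left by (intro sum.cong refl) (auto simp: mult_ac)
    have 5: "(\<Sum>s\<in>insert z F. \<Sum>t\<in>insert z F. (b(z := x)) s * (b(z := x)) t * R s t) =
       (x * x * R z z + (\<Sum>t\<in>F. x * b t * R z t)) + (\<Sum>s\<in>F. b s * x * R s z + (\<Sum>t\<in>F. b s * b t * R s t))"
      unfolding 1 sum.insert[OF insert.hyps] 2 by simp
    show ?thesis
      unfolding 5 sum.distrib 3 4 Q_def by (simp add: power2_eq_square)
  qed
  have psd: "0 \<le> Q b" for b
    using insert.prems(1)[of "b(z := 0)"] ext[of b 0] by simp
  have nullR: "(\<Sum>s\<in>F. b s * R s z) = 0" if "Q b = 0" for b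
  proof (rule ccontr)
    let ?y = "\<Sum>s\<in>F. b s * R s z"
    assume y: "?y \<noteq> 0"
    \<comment> \<open>With \<open>x = - ?y / r\<close> the linear term outweighs the quadratic one,
      so a null vector of \<open>F\<close> correlated with \<open>z\<close> would make the enlarged
      form negative. Adding 1 keeps the divisor positive when \<open>R z z = 0\<close>.\<close>
    define r where "r = 1 + \<bar>R z z\<bar>"
    have r: "r > 0" "R z z \<le> r" by (auto simp: r_def)
    define x where "x = - ?y / r"
    have A: "0 \<le> 2 * x * ?y + x\<^sup>2 * R z z"
      using insert.prems(1)[of "b(z := x)"] ext[of b x] that by simp
    have B: "x * ?y = - (?y\<^sup>2 / r)" "x\<^sup>2 * r = ?y\<^sup>2 / r"
      using r by (simp_all add: x_def power2_eq_square)
    have "x\<^sup>2 * R z z \<le> x\<^sup>2 * r" using r by (intro mult_left_mono) auto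
    then have "0 \<le> - (?y\<^sup>2 / r)" using A B by linarith
    moreover have "?y\<^sup>2 / r > 0" using y r by (intro divide_pos_pos) auto
    ultimately show False by linarith
  qed
  have nullc: "(\<Sum>s\<in>F. b s * c s) = 0" if "Q b = 0" for b
  proof -
    have "(\<Sum>s\<in>insert z F. (b(z := 0)) s * c s) = 0"
      using insert.prems(2)[of "b(z := 0)"] ext[of b 0] that by simp
    moreover have "(\<Sum>s\<in>F. (b(z := 0)) s * c s) = (\<Sum>s\<in>F. b s * c s)"
      using insert.hyps by (intro sum.cong) auto
    ultimately show ?thesis using insert.hyps by simp
  qed
  obtain d where d: "\<And>s. s \<in> F \<Longrightarrow> (\<Sum>t\<in>F. d t * R t s) = R s z"
    using insert.IH[of "\<lambda>s. R s z"] psd nullR unfolding Q_def by blast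
  obtain a0 where a0: "\<And>s. s \<in> F \<Longrightarrow> (\<Sum>t\<in>F. a0 t * R t s) = c s"
    using insert.IH[of c] psd nullc unfolding Q_def by blast
  define v where "v = R z z - (\<Sum>t\<in>F. d t * R t z)"
  have a0z: "(\<Sum>t\<in>F. a0 t * R t z) = (\<Sum>u\<in>F. d u * c u)"
  proof -
    have "(\<Sum>t\<in>F. a0 t * R t z) = (\<Sum>t\<in>F. a0 t * (\<Sum>u\<in>F. d u * R u t))"
      using d by (intro sum.cong) auto
    also have "\<dots> = (\<Sum>u\<in>F. \<Sum>t\<in>F. d u * (a0 t * R t u))"
      unfolding sum_distrib_left by (subst sum.swap) (intro sum.cong refl, simp add: sym[of _ "_"] mult_ac)
    also have "\<dots> = (\<Sum>u\<in>F. d u * (\<Sum>t\<in>F. a0 t * R t u))"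
      by (simp add: sum_distrib_left)
    also have "\<dots> = (\<Sum>u\<in>F. d u * c u)" using a0 by (intro sum.cong) auto
    finally show ?thesis .
  qed
  define \<kappa> where "\<kappa> = (if v = 0 then 0 else (c z - (\<Sum>u\<in>F. d u * c u)) / v)"
  have Qd: "Q (\<lambda>s. - d s) + 2 * 1 * (\<Sum>s\<in>F. - d s * R s z) + 1\<^sup>2 * R z z = v"
  proof -
    have "Q (\<lambda>s. - d s) = (\<Sum>s\<in>F. d s * (\<Sum>t\<in>F. d t * R t s))"
      unfolding Q_def sum_distrib_left by (intro sum.cong refl) (simp add: sym[of _ "_"] mult_ac)
    also have "\<dots> = (\<Sum>s\<in>F. d s * R s z)" using d by (intro sum.cong) auto
    finally show ?thesis unfolding v_def by (simp add: sum_negf)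
  qed
  \<comment> \<open>If \<open>v = 0\<close>, the vector with entries \<open>- d\<close> on
    \<open>F\<close> and 1 at \<open>z\<close> is null, so the compatibility hypothesis makes the
    left side vanish and any \<open>\<kappa>\<close> would do.\<close>
  have cz: "c z - (\<Sum>u\<in>F. d u * c u) = \<kappa> * v"
  proof (cases "v = 0")
    case True
    have "(\<Sum>s\<in>insert z F. ((\<lambda>s. - d s)(z := 1)) s * c s) = 0"
      by (rule insert.prems(2)) (use ext[of "\<lambda>s. - d s" 1] Qd True in simp)
    moreover have "(\<Sum>s\<in>F. ((\<lambda>s. - d s)(z := 1)) s * c s) = (\<Sum>s\<in>F. - d s * c s)"
      using insert.hyps by (intro sum.cong) auto
    ultimately show ?thesis using insert.hyps True by (simp add: sum_negf)
  qed (simp add: \<kappa>_def)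
  define a where "a = (\<lambda>t. a0 t - \<kappa> * d t)(z := \<kappa>)"
  have aF: "(\<Sum>t\<in>F. a t * R t s) = (\<Sum>t\<in>F. a0 t * R t s) - \<kappa> * (\<Sum>t\<in>F. d t * R t s)" for s
  proof -
    have "(\<Sum>t\<in>F. a t * R t s) = (\<Sum>t\<in>F. a0 t * R t s - \<kappa> * (d t * R t s))"
      using insert.hyps by (intro sum.cong) (auto simp: a_def algebra_simps)
    then show ?thesis by (simp add: sum_subtractf sum_distrib_left)
  qed
  have "(\<Sum>t\<in>insert z F. a t * R t s) = c s" if "s \<in> insert z F" for s
  proof (cases "s = z")
    case True
    have "(\<Sum>t\<in>insert z F. a t * R t s) = \<kappa> * v + (\<Sum>u\<in>F. d u * c u)"
      using insert.hyps unfolding True by (simp add: aF a0z) (simp add: a_def v_def algebra_simps)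
    then show ?thesis using cz True by simp
  next
    case False
    then have s: "s \<in> F" using that by simp
    have "(\<Sum>t\<in>insert z F. a t * R t s) = \<kappa> * R z s + (c s - \<kappa> * R s z)"
      using insert.hyps s by (simp add: aF a0 d) (simp add: a_def)
    then show ?thesis using sym[of z s] by simp
  qed
  then show ?case by blast
qed

text \<open>The density at \<open>x - s\<close> is exp (x s - s^2 / 2) times the density at
  \<open>x\<close>. On \<open>x\<close> >= \<open>- L\<close> this factor is at least exp (- L s -
  s^2 / 2); below \<open>- L\<close> the density is compared with its translate by \<open>L\<close>,
  which gives the error exp (- L^2 / 2).\<close>

lemma std_normal_shift:
  fixes D :: "real set" and s L :: real
  assumes [measurable]: "D \<in> sets borel" and s: "s \<ge> 0" and L: "L \<ge> 0"
  shows "ennreal (exp (- L * s - s\<^sup>2 / 2)) * emeasure std_normal_distribution D \<le>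
    emeasure std_normal_distribution {z. z + s \<in> D} +
    ennreal (exp (- L * s - s\<^sup>2 / 2)) * ennreal (exp (- L\<^sup>2 / 2))"
proof -
  let ?\<phi> = std_normal_density and ?e = "exp (- L * s - s\<^sup>2 / 2)"
  have em: "emeasure std_normal_distribution A = (\<integral>\<^sup>+x. ennreal (?\<phi> x) * indicator A x \<partial>lborel)"
    if "A \<in> sets borel" for A using that by (simp add: emeasure_density)
  have tot: "(\<integral>\<^sup>+x. ennreal (?\<phi> (x + c)) \<partial>lborel) = 1" for c
  proof -
    have "prob_space std_normal_distribution" by (rule prob_space_normal_density) simp
    then have "(\<integral>\<^sup>+x. ?\<phi> x \<partial>lborel) = 1"
      using prob_space.emeasure_space_1 by (force simp: emeasure_density)
    then show ?thesis
      using nn_integral_real_affine[of "\<lambda>x. ennreal (?\<phi> x)" 1 c] by (simp add: add.commute)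
  qed
  have "ennreal ?e * emeasure std_normal_distribution D =
      (\<integral>\<^sup>+x. ennreal ?e * (ennreal (?\<phi> x) * indicator D x) \<partial>lborel)"
    by (simp add: em nn_integral_cmult)
  also have "\<dots> \<le> (\<integral>\<^sup>+x. ennreal (?\<phi> (x - s)) * indicator D x + ennreal (?e * exp (- L\<^sup>2 / 2)) * ennreal (?\<phi> (x + L)) \<partial>lborel)"
  proof (rule nn_integral_mono)
    fix x
    show "ennreal ?e * (ennreal (?\<phi> x) * indicator D x) \<le>
      ennreal (?\<phi> (x - s)) * indicator D x + ennreal (?e * exp (- L\<^sup>2 / 2)) * ennreal (?\<phi> (x + L))"
    proof (cases "x \<ge> - L")
      case True
      have "?e * ?\<phi> x \<le> ?\<phi> (x - s)"
      proof -
        have "- L * s - s\<^sup>2 / 2 - x\<^sup>2 / 2 \<le> - (x - s)\<^sup>2 / 2"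
          using mult_right_mono[OF True s] by (simp add: power2_eq_square field_simps)
        then show ?thesis unfolding std_normal_density_def
          by (simp add: mult_exp_exp divide_right_mono)
      qed
      then have "ennreal ?e * (ennreal (?\<phi> x) * indicator D x) \<le> ennreal (?\<phi> (x - s)) * indicator D x"
        by (auto simp: indicator_def simp flip: ennreal_mult intro!: ennreal_leI)
      then show ?thesis by (simp add: add_increasing2)
    next
      case False
      have "?e * ?\<phi> x \<le> ?e * exp (- L\<^sup>2 / 2) * ?\<phi> (x + L)"
      proof -
        have "L * (L + x) \<le> 0" using False L by (intro mult_nonneg_nonpos) auto
        then have "- x\<^sup>2 / 2 \<le> - L\<^sup>2 / 2 + - (x + L)\<^sup>2 / 2"
          by (simp add: power2_eq_square field_simps)
        then have "exp (- x\<^sup>2 / 2) \<le> exp (- L\<^sup>2 / 2) * exp (- (x + L)\<^sup>2 / 2)"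
          unfolding mult_exp_exp by simp
        then show ?thesis unfolding std_normal_density_def
          by (simp add: divide_right_mono)
      qed
      then have "ennreal ?e * (ennreal (?\<phi> x) * indicator D x) \<le> ennreal (?e * exp (- L\<^sup>2 / 2)) * ennreal (?\<phi> (x + L))"
        by (auto simp: indicator_def simp flip: ennreal_mult intro!: ennreal_leI)
      then show ?thesis by (simp add: add_increasing)
    qed
  qed
  also have "\<dots> = (\<integral>\<^sup>+x. ennreal (?\<phi> (x - s)) * indicator D x \<partial>lborel) + ennreal (?e * exp (- L\<^sup>2 / 2))"
    by (simp add: nn_integral_add nn_integral_cmult tot)
  also have "(\<integral>\<^sup>+x. ennreal (?\<phi> (x - s)) * indicator D x \<partial>lborel) =
      (\<integral>\<^sup>+x. ennreal (?\<phi> x) * indicator {z. z + s \<in> D} x \<partial>lborel)"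
    by (subst nn_integral_real_affine[where c = 1 and t = s]) (auto simp: indicator_def add.commute intro!: nn_integral_cong)
  also have "\<dots> = emeasure std_normal_distribution {z. z + s \<in> D}"
    by (rule em[symmetric]) measurable
  finally show ?thesis by (simp add: ennreal_mult)
qed

text \<open>\<open>\<phi>\<close> is the covariance of the family with \<open>\<eta>\<close>, the
  combination with coefficients \<open>a\<close>. Shifting the family along \<open>\<phi>\<close>
  amounts to shifting its component along \<open>\<eta>\<close>, a single normal variable, so the
  one-dimensional estimate applies conditionally on the rest.\<close>

lemma cameron_martin:
  fixes X :: "'i \<Rightarrow> 'w \<Rightarrow> real" and a u :: "'i \<Rightarrow> real" and M :: "'w measure" and F :: "'i set"
  defines "\<phi> \<equiv> \<lambda>t. \<Sum>s\<in>F. a s * (LINT w|M. X s w * X t w)"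
  assumes M: "prob_space M" and X: "centered_gaussian_process M X" and F: "finite F"
    and \<kappa>: "(\<Sum>t\<in>F. a t * \<phi> t) \<le> \<kappa>\<^sup>2" "\<kappa> \<ge> 0" and v: "v \<ge> 0" and L: "L \<ge> 0"
  shows "exp (- L * v * \<kappa> - (v * \<kappa>)\<^sup>2 / 2) * (measure M {w \<in> space M. \<forall>t\<in>F. X t w < u t} - exp (- L\<^sup>2 / 2))
     \<le> measure M {w \<in> space M. \<forall>t\<in>F. X t w + v * \<phi> t < u t}"
proof -
  interpret M: prob_space M by fact
  define S where "S = std_normal_distribution"
  interpret S: prob_space S unfolding S_def by (rule prob_space_normal_density) simp
  interpret P: pair_prob_space M S ..
  note [measurable] = cgp_measurable[OF M X]
  have [measurable_cong, simp]: "sets S = sets borel" "space S = UNIV" by (auto simp: S_def)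
  define R where "R = (\<lambda>s t. LINT w|M. X s w * X t w)"
  have R_eq: "(LINT w|M. X s w * X t w) = R s t" for s t by (simp add: R_def)
  have Rsym: "R s t = R t s" for s t unfolding R_def by (simp add: mult.commute)
  define \<eta> where "\<eta> = (\<lambda>w. \<Sum>s\<in>F. a s * X s w)"
  have [measurable]: "\<eta> \<in> borel_measurable M" unfolding \<eta>_def by measurable
  have \<phi>: "\<phi> t = (\<Sum>s\<in>F. a s * R s t)" for t unfolding \<phi>_def R_def ..
  have \<phi>\<eta>: "\<phi> t = (LINT w|M. \<eta> w * X t w)" for t
    using cgp_comb_mult[OF M X F, of "{t}" a "\<lambda>_. 1"] unfolding \<phi>_def \<eta>_def by simp
  define V where "V = (\<Sum>t\<in>F. a t * \<phi> t)"
  have V: "V = (LINT w|M. (\<eta> w)\<^sup>2)"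
    unfolding \<eta>_def cgp_comb_square[OF M X F] R_eq V_def \<phi> sum_distrib_left
    by (intro sum.cong refl) (simp add: Rsym mult_ac)
  then have V0: "V \<ge> 0" by simp
  let ?e = "exp (- L * v * \<kappa> - (v * \<kappa>)\<^sup>2 / 2)"
  let ?p = "measure M {w \<in> space M. \<forall>t\<in>F. X t w < u t}"
  let ?p' = "measure M {w \<in> space M. \<forall>t\<in>F. X t w + v * \<phi> t < u t}"
  have e1: "?e \<le> 1"
    using mult_nonneg_nonneg[OF mult_nonneg_nonneg[OF L v] \<kappa>(2)] zero_le_power2[of "v * \<kappa>"]
    unfolding exp_le_one_iff by linarith
  show "?e * (?p - exp (- L\<^sup>2 / 2)) \<le> ?p'"
  \<comment> \<open>\<open>V\<close> is the variance of \<open>\<eta>\<close>; if it is 0 then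
    \<open>\<phi>\<close> vanishes and there is no shift.\<close>
  proof (cases "V = 0")
    case True
    have "AE w in M. (\<eta> w)\<^sup>2 = 0"
      using integral_nonneg_eq_0_iff_AE[of M "\<lambda>w. (\<eta> w)\<^sup>2"] True V
        gaussian_integrable(2)[OF M cgp_comb[OF M X F, of a]]
      by (simp add: \<eta>_def)
    then have "\<phi> t = 0" for t
      unfolding \<phi>\<eta> by (intro integral_eq_zero_AE) auto
    then have eq: "?p' = ?p" by simp
    have "?e * (?p - exp (- L\<^sup>2 / 2)) \<le> ?e * ?p" by (intro mult_left_mono) auto
    also have "\<dots> \<le> 1 * ?p" using e1 by (intro mult_right_mono) auto
    finally show ?thesis using eq by simp
  next
    case False
    then have Vp: "V > 0" using V0 by simp
    define \<sigma> where "\<sigma> = sqrt V"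
    have \<sigma>: "\<sigma> > 0" "\<sigma>\<^sup>2 = V" using Vp by (auto simp: \<sigma>_def)
    have \<sigma>\<kappa>: "\<sigma> \<le> \<kappa>" using \<kappa> real_le_lsqrt[of \<kappa> V] unfolding \<sigma>_def V_def by simp
    \<comment> \<open>The projection of \<open>X\<close> on \<open>\<eta>\<close> is replaced by the
      same multiple of an independent standard normal \<open>z\<close>. The residual is uncorrelated
      with \<open>\<eta>\<close>, so \<open>Y\<close> has the law of \<open>X\<close>; and
      \<open>z + v * \<sigma>\<close> in place of \<open>z\<close> adds exactly
      \<open>v * \<phi> t\<close>.\<close>
    define Y where "Y = (\<lambda>t (w, z). (X t w - \<phi> t / V * \<eta> w) + \<phi> t / \<sigma> * z)"
    have [measurable]: "Y t \<in> borel_measurable (M \<Otimes>\<^sub>M S)" for t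
      unfolding Y_def by measurable
    have ch: "(CLINT w|M. iexp (\<Sum>t\<in>F. b t * X t w)) = (CLINT p|(M \<Otimes>\<^sub>M S). iexp (\<Sum>t\<in>F. b t * Y t p))" for b
    proof -
      define B where "B = (\<Sum>t\<in>F. b t * \<phi> t)"
      define c where "c = (\<lambda>t. b t - B / V * a t)"
      have 1: "(\<Sum>t\<in>F. b t * Y t (w, z)) = (\<Sum>t\<in>F. c t * X t w) + B / \<sigma> * z" for w z
      proof -
        have "(\<Sum>t\<in>F. b t * Y t (w, z)) =
            (\<Sum>t\<in>F. b t * X t w) - (\<Sum>t\<in>F. b t * \<phi> t) / V * \<eta> w + (\<Sum>t\<in>F. b t * \<phi> t) / \<sigma> * z"
          unfolding Y_def by (simp add: algebra_simps sum.distrib sum_subtractf sum_divide_distrib sum_distrib_left)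
        also have "\<dots> = (\<Sum>t\<in>F. c t * X t w) + B / \<sigma> * z"
          unfolding c_def B_def[symmetric] \<eta>_def
          by (simp add: algebra_simps sum_subtractf sum_divide_distrib sum_distrib_left)
        finally show ?thesis .
      qed
      have 2: "(\<Sum>s\<in>F. \<Sum>t\<in>F. c s * c t * R s t) = (\<Sum>s\<in>F. \<Sum>t\<in>F. b s * b t * R s t) - B\<^sup>2 / V"
      proof -
        have ab: "(\<Sum>s\<in>F. \<Sum>t\<in>F. b s * a t * R s t) = B"
          unfolding B_def \<phi> sum_distrib_left by (intro sum.cong refl) (simp add: Rsym mult_ac)
        have ba: "(\<Sum>s\<in>F. \<Sum>t\<in>F. a s * b t * R s t) = B"
          unfolding ab[symmetric] by (subst sum.swap) (intro sum.cong refl, simp add: Rsym mult_ac)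
        have aa: "(\<Sum>s\<in>F. \<Sum>t\<in>F. a s * a t * R s t) = V"
          unfolding V_def \<phi> sum_distrib_left by (intro sum.cong refl) (simp add: Rsym mult_ac)
        have "c s * c t * R s t = b s * b t * R s t - B / V * (b s * a t * R s t) - B / V * (a s * b t * R s t)
            + (B / V)\<^sup>2 * (a s * a t * R s t)" for s t
          unfolding c_def power2_eq_square by (simp add: algebra_simps)
        then have "(\<Sum>s\<in>F. \<Sum>t\<in>F. c s * c t * R s t) =
          (\<Sum>s\<in>F. \<Sum>t\<in>F. b s * b t * R s t) - B / V * B - B / V * B + (B / V)\<^sup>2 * V"
          by (simp only: sum.distrib sum_subtractf sum_distrib_left[symmetric] ab ba aa)
        then show ?thesis using Vp by (simp add: power2_eq_square)
      qed
      have "(CLINT p|(M \<Otimes>\<^sub>M S). iexp (\<Sum>t\<in>F. b t * Y t p)) =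
          (CLINT w|M. CLINT z|S. iexp (\<Sum>t\<in>F. b t * Y t (w, z)))"
        by (rule P.integral_fst'[symmetric], rule integrable_bounded_prob[OF P.prob_space_axioms, where B = 1]) auto
      also have "\<dots> = (CLINT w|M. CLINT z|S. iexp (\<Sum>t\<in>F. c t * X t w) * iexp (B / \<sigma> * z))"
        unfolding 1 by (simp add: exp_add ring_distribs)
      also have "\<dots> = (CLINT w|M. iexp (\<Sum>t\<in>F. c t * X t w)) * char S (B / \<sigma>)"
        by (simp add: char_def)
      also have "char S (B / \<sigma>) = exp (- (B / \<sigma>)\<^sup>2 / 2)"
        unfolding S_def by (simp add: char_std_normal_distribution)
      also have "(CLINT w|M. iexp (\<Sum>t\<in>F. c t * X t w)) = exp (- (\<Sum>s\<in>F. \<Sum>t\<in>F. c s * c t * R s t) / 2)"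
        using cgp_char[OF M X F, of c] unfolding R_eq .
      also have "complex_of_real (exp (- (\<Sum>s\<in>F. \<Sum>t\<in>F. c s * c t * R s t) / 2)) * complex_of_real (exp (- (B / \<sigma>)\<^sup>2 / 2)) =
          exp (- (\<Sum>s\<in>F. \<Sum>t\<in>F. b s * b t * R s t) / 2)"
        unfolding of_real_mult[symmetric] mult_exp_exp 2 using \<sigma> by (simp add: power_divide field_simps)
      also have "\<dots> = (CLINT w|M. iexp (\<Sum>t\<in>F. b t * X t w))"
        using cgp_char[OF M X F, of b] unfolding R_eq by simp
      finally show ?thesis by simp
    qed
    have rect: "measure M {w \<in> space M. \<forall>t\<in>F. X t w \<in> C t} =
        measure (M \<Otimes>\<^sub>M S) {p \<in> space (M \<Otimes>\<^sub>M S). \<forall>t\<in>F. Y t p \<in> C t}" if "\<And>t. C t \<in> sets borel" for C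
      by (rule char_determines_rectangles[where I = F and X = X and Y = Y and B = C,
          OF M P.prob_space_axioms F _ _ ch that]) auto
    let ?D = "\<lambda>w. {z. \<forall>t\<in>F. Y t (w, z) < u t}" and ?D' = "\<lambda>w. {z. \<forall>t\<in>F. Y t (w, z) + v * \<phi> t < u t}"
    have Dm: "?D w \<in> sets borel" if "w \<in> space M" for w
    proof -
      have "(\<lambda>z. Y t (w, z)) \<in> borel_measurable borel" for t unfolding Y_def by simp
      then show ?thesis using F by measurable
    qed
    have A: "{p \<in> space (M \<Otimes>\<^sub>M S). \<forall>t\<in>F. Y t p < u t} \<in> sets (M \<Otimes>\<^sub>M S)"
      and A': "{p \<in> space (M \<Otimes>\<^sub>M S). \<forall>t\<in>F. Y t p + v * \<phi> t < u t} \<in> sets (M \<Otimes>\<^sub>M S)"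
      using F by measurable
    have p: "ennreal ?p = (\<integral>\<^sup>+w. emeasure S (?D w) \<partial>M)"
    proof -
      have "?p = measure (M \<Otimes>\<^sub>M S) {p \<in> space (M \<Otimes>\<^sub>M S). \<forall>t\<in>F. Y t p < u t}"
        using rect[of "\<lambda>t. {..< u t}"] by simp
      then have "ennreal ?p = emeasure (M \<Otimes>\<^sub>M S) {p \<in> space (M \<Otimes>\<^sub>M S). \<forall>t\<in>F. Y t p < u t}"
        by (simp add: P.emeasure_eq_measure)
      also have "\<dots> = (\<integral>\<^sup>+w. emeasure S (?D w) \<partial>M)"
        unfolding S.emeasure_pair_measure_alt[OF A]
        by (intro nn_integral_cong arg_cong2[where f = emeasure] refl) (auto simp: space_pair_measure)
      finally show ?thesis .
    qed
    have p': "ennreal ?p' = (\<integral>\<^sup>+w. emeasure S (?D' w) \<partial>M)"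
    proof -
      have "?p' = measure (M \<Otimes>\<^sub>M S) {p \<in> space (M \<Otimes>\<^sub>M S). \<forall>t\<in>F. Y t p + v * \<phi> t < u t}"
        using rect[of "\<lambda>t. {..< u t - v * \<phi> t}"] by (simp add: less_diff_eq)
      then have "ennreal ?p' = emeasure (M \<Otimes>\<^sub>M S) {p \<in> space (M \<Otimes>\<^sub>M S). \<forall>t\<in>F. Y t p + v * \<phi> t < u t}"
        by (simp add: P.emeasure_eq_measure)
      also have "\<dots> = (\<integral>\<^sup>+w. emeasure S (?D' w) \<partial>M)"
        unfolding S.emeasure_pair_measure_alt[OF A']
        by (intro nn_integral_cong arg_cong2[where f = emeasure] refl) (auto simp: space_pair_measure)
      finally show ?thesis .
    qed
    let ?f = "exp (- L * (v * \<sigma>) - (v * \<sigma>)\<^sup>2 / 2)"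
    have DD: "{z. z + v * \<sigma> \<in> ?D w} = ?D' w" for w
    proof -
      have "Y t (w, z + v * \<sigma>) = Y t (w, z) + v * \<phi> t" for t z
        unfolding Y_def using \<sigma> by (simp add: field_simps)
      then show ?thesis by auto
    qed
    have "ennreal ?f * ennreal ?p = (\<integral>\<^sup>+w. ennreal ?f * emeasure S (?D w) \<partial>M)"
      unfolding p by (subst nn_integral_cmult) (use S.measurable_emeasure_Pair[OF A] in \<open>simp_all add: space_pair_measure cong: measurable_cong\<close>)
    also have "\<dots> \<le> (\<integral>\<^sup>+w. emeasure S (?D' w) + ennreal ?f * ennreal (exp (- L\<^sup>2 / 2)) \<partial>M)"
      using std_normal_shift[OF Dm, of _ "v * \<sigma>" L] v \<sigma> L unfolding DD S_def[symmetric]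
      by (intro nn_integral_mono) simp
    also have "\<dots> = ennreal ?p' + ennreal ?f * ennreal (exp (- L\<^sup>2 / 2))"
      unfolding p' by (subst nn_integral_add) (use S.measurable_emeasure_Pair[OF A'] in \<open>simp_all add: space_pair_measure M.emeasure_space_1 cong: measurable_cong\<close>)
    finally have "ennreal (?f * ?p) \<le> ennreal (?p' + ?f * exp (- L\<^sup>2 / 2))"
      by (simp add: ennreal_mult)
    then have main: "?f * (?p - exp (- L\<^sup>2 / 2)) \<le> ?p'"
      by (subst (asm) ennreal_le_iff) (auto simp: algebra_simps)
    show ?thesis
    \<comment> \<open>Replacing \<open>\<sigma>\<close> by the larger \<open>\<kappa>\<close>
      decreases the exponential factor, which weakens the inequality only when the bracket is
      nonnegative.\<close>
    proof (cases "?p - exp (- L\<^sup>2 / 2) \<ge> 0")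
      case True
      have "?e \<le> ?f"
      proof -
        have "v * \<sigma> \<le> v * \<kappa>" using v \<sigma>\<kappa> by (rule mult_left_mono[rotated])
        moreover from this have "(v * \<sigma>)\<^sup>2 \<le> (v * \<kappa>)\<^sup>2" using v \<sigma> by (intro power_mono) auto
        moreover have "L * (v * \<sigma>) \<le> L * (v * \<kappa>)" using calculation(1) L by (rule mult_left_mono)
        ultimately show ?thesis by (simp add: mult.assoc)
      qed
      then have "?e * (?p - exp (- L\<^sup>2 / 2)) \<le> ?f * (?p - exp (- L\<^sup>2 / 2))" using True by (rule mult_right_mono)
      then show ?thesis using main by linarith
    next
      case False
      then have "?e * (?p - exp (- L\<^sup>2 / 2)) \<le> 0" by (intro mult_nonneg_nonpos) auto
      then show ?thesis using measure_nonneg[of M] by (meson order_trans)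
    qed
  qed
qed

section \<open>Chaining\<close>

lemma powr_double: "x powr (2 * H) = (x powr H)\<^sup>2" for x H :: real
  using powr_add[of x H H] by (simp add: power2_eq_square)

lemma power_powr: "(x ^ n) powr a = (x powr a) ^ n" if "x > 0" for x a :: real
  using that by (induction n) (simp_all add: powr_mult)

lemma sqrt_le_self: "1 \<le> x \<Longrightarrow> sqrt x \<le> x" for x :: real
  using mult_left_mono[of 1 x x] real_sqrt_le_mono[of x "x * x"] by simp

definition natvec :: "('n::finite \<Rightarrow> nat) \<Rightarrow> real^'n" where
  "natvec u = (\<chi> i. real (u i))"

definition nat_cube :: "nat \<Rightarrow> ('n::finite \<Rightarrow> nat) set" where
  "nat_cube N = {u. \<forall>i. u i < N}"

lemma nat_cube_PiE: "(nat_cube N :: ('n::finite \<Rightarrow> nat) set) = PiE UNIV (\<lambda>_. {..<N})"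
  by (auto simp: nat_cube_def PiE_def Pi_def)

lemma finite_nat_cube [simp]: "finite (nat_cube N :: ('n::finite \<Rightarrow> nat) set)"
  unfolding nat_cube_PiE by (intro finite_PiE) auto

lemma card_nat_cube: "card (nat_cube N :: ('n::finite \<Rightarrow> nat) set) = N ^ CARD('n)"
  unfolding nat_cube_PiE by (simp add: card_PiE)

lemma norm_halving_step:
  fixes v :: "'n::finite \<Rightarrow> nat"
  assumes "l > 0"
  shows "norm ((l / 2 ^ Suc m) *\<^sub>R natvec v - (l / 2 ^ m) *\<^sub>R natvec (\<lambda>i. v i div 2)) \<le> l * real CARD('n) / 2 ^ Suc m"
proof -
  have "norm ((l / 2 ^ Suc m) *\<^sub>R natvec v - (l / 2 ^ m) *\<^sub>R natvec (\<lambda>i. v i div 2))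
     \<le> (\<Sum>i\<in>UNIV. \<bar>((l / 2 ^ Suc m) *\<^sub>R natvec v - (l / 2 ^ m) *\<^sub>R natvec (\<lambda>i. v i div 2)) $ i\<bar>)"
    by (rule norm_le_l1_cart)
  also have "\<dots> \<le> (\<Sum>i\<in>(UNIV :: 'n set). l / 2 ^ Suc m)"
  proof (rule sum_mono)
    fix i
    have "((l / 2 ^ Suc m) *\<^sub>R natvec v - (l / 2 ^ m) *\<^sub>R natvec (\<lambda>i. v i div 2)) $ i =
       (l / 2 ^ Suc m) * (real (v i) - 2 * real (v i div 2))"
      by (simp add: natvec_def field_simps)
    also have "real (v i) - 2 * real (v i div 2) = real (v i mod 2)"
      by (metis add_diff_cancel_left' div_mult_mod_eq mult.commute of_nat_add of_nat_mult of_nat_numeral)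
    finally show "\<bar>((l / 2 ^ Suc m) *\<^sub>R natvec v - (l / 2 ^ m) *\<^sub>R natvec (\<lambda>i. v i div 2)) $ i\<bar> \<le> l / 2 ^ Suc m"
      using assms by (cases "even (v i)") (auto simp: abs_mult odd_iff_mod_2_eq_one)
  qed
  also have "\<dots> = l * real CARD('n) / 2 ^ Suc m" by simp
  finally show ?thesis .
qed

lemma sum_Suc_power_le:
  fixes q :: real
  assumes "0 \<le> q" "q < 1"
  shows "(\<Sum>j<m. real (Suc j) * q ^ j) \<le> 1 / (1 - q)\<^sup>2"
proof -
  have "(\<lambda>n. of_nat (Suc n) * q ^ n) sums (1 / (1 - q)\<^sup>2)"
    by (rule geometric_deriv_sums) (use assms in auto)
  then show ?thesis
    using sum_le_suminf[of "\<lambda>n. of_nat (Suc n) * q ^ n" "{..<m}"] assms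
    by (auto simp: sums_iff)
qed

lemma ennreal_one_plus_double_sum:
  assumes "\<And>m v. 0 \<le> f m v"
  shows "ennreal (1 + (\<Sum>m\<in>A. \<Sum>v\<in>B m. f m v)) = 1 + (\<Sum>m\<in>A. \<Sum>v\<in>B m. ennreal (f m v))"
proof -
  have "(\<Sum>m\<in>A. \<Sum>v\<in>B m. ennreal (f m v)) = ennreal (\<Sum>m\<in>A. \<Sum>v\<in>B m. f m v)"
    using assms by (simp add: sum_ennreal sum_nonneg)
  then show ?thesis using assms by (simp add: sum_nonneg)
qed

lemma ennreal_mult_two: "a \<ge> 0 \<Longrightarrow> ennreal a * 2 = ennreal (2 * a)"
  using ennreal_mult[of 2 a] by (simp add: mult.commute)

lemma of_nat_mult_ennreal: "a \<ge> 0 \<Longrightarrow> of_nat n * ennreal a = ennreal (real n * a)"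
  by (simp add: ennreal_mult ennreal_of_nat_eq_real_of_nat)

text \<open>Sum of the level bounds in \<open>chaining\<close>:
  \<open>sqrt k * real d powr H\<close> is the size of an increment along one dyadic step, 2 comes
  from inverting exp (x^2 / (4 s^2)), \<open>real d + 1\<close> from the logarithm of the level
  weights, and the denominator is the sum of (j + 1) q^j with q = 2^(-H).\<close>

definition chaining_const :: "nat \<Rightarrow> real \<Rightarrow> real \<Rightarrow> real" where
  "chaining_const d H k = 2 * sqrt k * real d powr H * (real d + 1) / (1 - 2 powr (- H))\<^sup>2"

text \<open>Each point of level m + 1 is joined to the point of level m obtained by halving its
  coordinates. One random variable \<open>W\<close> collects the exponential squares of all these
  increments and controls every path at once. Its mean is bounded uniformly in \<open>J\<close>,
  which later permits arbitrarily fine meshes.\<close>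

lemma chaining:
  fixes \<xi> :: "real^'n \<Rightarrow> 'w \<Rightarrow> real"
  assumes M: "prob_space M" and X: "centered_gaussian_process M \<xi>" and H: "H > 0" and k: "k > 0"
    and inc: "\<And>s t. (LINT w|M. (\<xi> s w - \<xi> t w)\<^sup>2) \<le> k * norm (s - t) powr (2 * H)"
    and l: "l > 0"
  obtains W where "W \<in> borel_measurable M" "\<And>w. 1 \<le> W w" "(\<integral>\<^sup>+w. ennreal (W w) \<partial>M) \<le> 3"
    "\<And>u w. u \<in> nat_cube (2 ^ J) \<Longrightarrow>
       \<bar>\<xi> (x0 + (l / 2 ^ J) *\<^sub>R natvec u) w - \<xi> x0 w\<bar>
          \<le> chaining_const CARD('n) H k * l powr H * (1 + sqrt (ln (W w)))"
proof -
  interpret prob_space M by fact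
  note [measurable] = cgp_measurable[OF M X]
  define d where "d = CARD('n)"
  have d: "d \<ge> 1" unfolding d_def by (simp add: Suc_leI)
  define P where "P = (\<lambda>m v. x0 + (l / 2 ^ m) *\<^sub>R natvec v :: real^'n)"
  define \<Delta> where "\<Delta> = (\<lambda>m v w. \<xi> (P (Suc m) v) w - \<xi> (P m (\<lambda>i. v i div 2)) w)"
  define \<sigma> where "\<sigma> = (\<lambda>m. sqrt k * (l * real d / 2 ^ Suc m) powr H)"
  have \<sigma>0: "\<sigma> m > 0" for m using l d k by (auto simp: \<sigma>_def)
  have [measurable]: "\<Delta> m v \<in> borel_measurable M" for m v unfolding \<Delta>_def by measurable
  have var: "(LINT w|M. (\<Delta> m v w)\<^sup>2) \<le> (\<sigma> m)\<^sup>2" for m v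
  proof -
    have "(LINT w|M. (\<Delta> m v w)\<^sup>2) \<le> k * norm (P (Suc m) v - P m (\<lambda>i. v i div 2)) powr (2 * H)"
      unfolding \<Delta>_def by (rule inc)
    also have "\<dots> \<le> k * (l * real d / 2 ^ Suc m) powr (2 * H)"
      using norm_halving_step[OF l, of m v] k H unfolding P_def d_def
      by (intro mult_left_mono powr_mono2) auto
    also have "\<dots> = (\<sigma> m)\<^sup>2"
      using k by (simp only: \<sigma>_def power_mult_distrib powr_double) simp
    finally show ?thesis .
  qed
  have gau: "gaussian_variable M (\<Delta> m v)" "(LINT w|M. \<Delta> m v w) = 0" for m v
  proof -
    define s where "s = P (Suc m) v"
    define t where "t = P m (\<lambda>i. v i div 2)"
    define c where "c = (\<lambda>r. (if r = s then 1 else 0) - (if r = t then 1 else 0) :: real)"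
    have "(\<Sum>r\<in>{s, t}. c r * \<xi> r w) = \<Delta> m v w" for w
      unfolding \<Delta>_def s_def[symmetric] t_def[symmetric] c_def by (cases "s = t") auto
    then show "gaussian_variable M (\<Delta> m v)" "(LINT w|M. \<Delta> m v w) = 0"
      using cgp_comb[OF M X, of "{s, t}" c] by auto
  qed
  define E where "E = (\<lambda>m v w. exp ((\<Delta> m v w)\<^sup>2 / (4 * (\<sigma> m)\<^sup>2)))"
  have [measurable]: "E m v \<in> borel_measurable M" for m v unfolding E_def by measurable
  have Eint: "(\<integral>\<^sup>+w. ennreal (E m v w) \<partial>M) \<le> 2" for m v
    unfolding E_def by (rule gaussian_exp_square[OF M gau \<sigma>0 var])
  have E0: "E m v w \<ge> 0" for m v w by (simp add: E_def)
  \<comment> \<open>Level m + 1 has 2^(d (m + 1)) points and each term has mean at most 2; the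
    additional factor 2^(- (m + 1)) makes the levels summable, to a total of at most 1 + 2.\<close>
  define W where "W = (\<lambda>w. 1 + (\<Sum>m<J. (\<Sum>v\<in>nat_cube (2 ^ Suc m). E m v w) / 2 ^ ((d + 1) * Suc m)))"
  have W1: "1 \<le> W w" for w unfolding W_def by (auto intro!: sum_nonneg divide_nonneg_nonneg E0)
  have Wm [measurable]: "W \<in> borel_measurable M" unfolding W_def by measurable
  have Wint: "(\<integral>\<^sup>+w. ennreal (W w) \<partial>M) \<le> 3"
  proof -
    have "ennreal (W w) = 1 + (\<Sum>m<J. \<Sum>v\<in>nat_cube (2 ^ Suc m). ennreal (1 / 2 ^ ((d + 1) * Suc m)) * ennreal (E m v w))" for w
    proof -
      have "ennreal (W w) = ennreal (1 + (\<Sum>m<J. \<Sum>v\<in>nat_cube (2 ^ Suc m). 1 / 2 ^ ((d + 1) * Suc m) * E m v w))"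
        unfolding W_def by (simp add: sum_divide_distrib)
      also have "\<dots> = 1 + (\<Sum>m<J. \<Sum>v\<in>nat_cube (2 ^ Suc m). ennreal (1 / 2 ^ ((d + 1) * Suc m) * E m v w))"
        by (rule ennreal_one_plus_double_sum) (simp add: E0)
      also have "\<dots> = 1 + (\<Sum>m<J. \<Sum>v\<in>nat_cube (2 ^ Suc m). ennreal (1 / 2 ^ ((d + 1) * Suc m)) * ennreal (E m v w))"
        by (intro arg_cong2[where f = "(+)"] sum.cong refl ennreal_mult E0) simp
      finally show ?thesis .
    qed
    then have "(\<integral>\<^sup>+w. ennreal (W w) \<partial>M) = 1 + (\<Sum>m<J. \<Sum>v\<in>nat_cube (2 ^ Suc m). ennreal (1 / 2 ^ ((d + 1) * Suc m)) * (\<integral>\<^sup>+w. ennreal (E m v w) \<partial>M))"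
      by (simp add: nn_integral_add nn_integral_sum nn_integral_cmult emeasure_space_1 del: power_Suc)
    also have "\<dots> \<le> 1 + (\<Sum>m<J. \<Sum>v\<in>(nat_cube (2 ^ Suc m) :: ('n \<Rightarrow> nat) set). ennreal (1 / 2 ^ ((d + 1) * Suc m)) * 2)"
      by (intro add_left_mono sum_mono mult_left_mono Eint) auto
    also have "\<dots> = 1 + (\<Sum>m<J. ennreal (2 * (1 / 2) ^ Suc m))"
    proof -
      have "(\<Sum>v\<in>(nat_cube (2 ^ Suc m) :: ('n \<Rightarrow> nat) set). ennreal (1 / 2 ^ ((d + 1) * Suc m)) * 2) = ennreal (2 * (1 / 2) ^ Suc m)" for m
      proof -
        have "ennreal (1 / 2 ^ ((d + 1) * Suc m)) * 2 = ennreal (2 / 2 ^ ((d + 1) * Suc m))"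
          using ennreal_mult_two[of "1 / 2 ^ ((d + 1) * Suc m)"] by (simp only: times_divide_eq_right mult_1_right) simp
        then have "(\<Sum>v\<in>(nat_cube (2 ^ Suc m) :: ('n \<Rightarrow> nat) set). ennreal (1 / 2 ^ ((d + 1) * Suc m)) * 2) =
            of_nat ((2 ^ Suc m) ^ d) * ennreal (2 / 2 ^ ((d + 1) * Suc m))"
          by (simp add: card_nat_cube d_def del: power_Suc)
        also have "\<dots> = ennreal (real ((2 ^ Suc m) ^ d) * (2 / 2 ^ ((d + 1) * Suc m)))"
          by (rule of_nat_mult_ennreal) simp
        also have "real ((2 ^ Suc m) ^ d) * (2 / 2 ^ ((d + 1) * Suc m)) = 2 * (1 / 2) ^ Suc m"
        proof -
          have "(2::real) ^ ((d + 1) * Suc m) = (2 ^ Suc m) ^ d * 2 ^ Suc m"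
          proof -
            have "(d + 1) * Suc m = Suc m * d + Suc m" by simp
            then show ?thesis by (simp only: power_add power_mult)
          qed
          then show ?thesis by (simp add: power_divide del: power_Suc)
        qed
        finally show ?thesis .
      qed
      then show ?thesis by simp
    qed
    also have "\<dots> = ennreal (1 + (\<Sum>m<J. 2 * (1 / 2) ^ Suc m))"
      by (subst ennreal_plus) (auto intro!: sum_nonneg simp del: power_Suc)
    also have "(\<Sum>m<J. 2 * (1 / 2) ^ Suc m) \<le> (2::real)"
      using sum_le_suminf[of "\<lambda>m. (1 / 2 :: real) ^ m" "{..<J}"] suminf_geometric[of "1 / 2 :: real"]
      by (simp add: summable_geometric)
    then have "ennreal (1 + (\<Sum>m<J. 2 * (1 / 2) ^ Suc m)) \<le> ennreal 3" by (intro ennreal_leI) linarith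
    finally show ?thesis by simp
  qed
  \<comment> \<open>Each single term of \<open>W\<close> is at most \<open>W\<close>; taking
    logarithms of this bounds the increment.\<close>
  define b where "b = (\<lambda>m w. 2 * \<sigma> m * sqrt (real ((d + 1) * Suc m) + ln (W w)))"
  have step: "\<bar>\<Delta> m v w\<bar> \<le> b m w" if "m < J" "v \<in> nat_cube (2 ^ Suc m)" for m v w
  proof -
    have "E m v w / 2 ^ ((d + 1) * Suc m) \<le> (\<Sum>v\<in>nat_cube (2 ^ Suc m). E m v w) / 2 ^ ((d + 1) * Suc m)"
      using that by (intro divide_right_mono member_le_sum E0) auto
    also have "\<dots> \<le> (\<Sum>m<J. (\<Sum>v\<in>nat_cube (2 ^ Suc m). E m v w) / 2 ^ ((d + 1) * Suc m))"
      using that by (intro member_le_sum) (auto intro!: sum_nonneg divide_nonneg_nonneg E0)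
    also have "\<dots> \<le> W w" by (simp add: W_def)
    finally have "E m v w \<le> 2 ^ ((d + 1) * Suc m) * W w" by (simp add: field_simps)
    then have "ln (E m v w) \<le> ln (2 ^ ((d + 1) * Suc m) * W w)"
      using W1[of w] by (subst ln_le_cancel_iff) (auto simp: E_def)
    also have "\<dots> = real ((d + 1) * Suc m) * ln 2 + ln (W w)"
      using W1[of w] ln_mult[of "2 ^ ((d + 1) * Suc m)" "W w"] ln_realpow[of 2 "(d + 1) * Suc m"]
      by (simp only:) simp
    also have "\<dots> \<le> real ((d + 1) * Suc m) * 1 + ln (W w)"
      using ln_2_less_1 by (intro add_right_mono mult_left_mono) auto
    finally have "(\<Delta> m v w)\<^sup>2 / (4 * (\<sigma> m)\<^sup>2) \<le> real ((d + 1) * Suc m) + ln (W w)"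
      by (simp add: E_def)
    then have "(\<Delta> m v w)\<^sup>2 \<le> (2 * \<sigma> m)\<^sup>2 * (real ((d + 1) * Suc m) + ln (W w))"
      using \<sigma>0[of m] by (simp add: field_simps)
    then have "sqrt ((\<Delta> m v w)\<^sup>2) \<le> sqrt ((2 * \<sigma> m)\<^sup>2 * (real ((d + 1) * Suc m) + ln (W w)))"
      by (rule real_sqrt_le_mono)
    then show ?thesis using \<sigma>0[of m] unfolding b_def by (simp add: real_sqrt_mult)
  qed
  have path: "\<bar>\<xi> (P m u) w - \<xi> x0 w\<bar> \<le> (\<Sum>j<m. b j w)" if "m \<le> J" "u \<in> nat_cube (2 ^ m)" for m u w
    using that
  proof (induction m arbitrary: u)
    case 0
    then have "u = (\<lambda>_. 0)" by (auto simp: nat_cube_def)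
    then have "P 0 u = x0" by (simp add: P_def natvec_def vec_eq_iff)
    then show ?case by simp
  next
    case (Suc m)
    have "(\<lambda>i. u i div 2) \<in> nat_cube (2 ^ m)"
      using Suc.prems by (auto simp: nat_cube_def less_mult_imp_div_less mult.commute)
    then have "\<bar>\<xi> (P m (\<lambda>i. u i div 2)) w - \<xi> x0 w\<bar> \<le> (\<Sum>j<m. b j w)"
      using Suc by auto
    moreover have "\<bar>\<Delta> m u w\<bar> \<le> b m w" using Suc.prems by (intro step) auto
    ultimately show ?case unfolding \<Delta>_def by simp
  qed
  define q where "q = 2 powr (- H)"
  have q: "0 \<le> q" "q < 1" using powr_less_mono[of "- H" 0 2] H by (auto simp: q_def)
  have sig: "\<sigma> j = sqrt k * (l * real d) powr H * q * q ^ j" for j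
  proof -
    have "(2 ^ Suc j :: real) powr (- H) = q * q ^ j"
      using power_powr[of 2 "Suc j" "- H"] by (simp add: q_def)
    then show ?thesis using l d by (simp add: \<sigma>_def powr_divide powr_minus_divide field_simps del: power_Suc)
  qed
  have sumb: "(\<Sum>j<J. b j w) \<le> chaining_const CARD('n) H k * l powr H * (1 + sqrt (ln (W w)))" for w
  proof -
    let ?s = "sqrt (ln (W w))" and ?c = "2 * sqrt k * (l * real d) powr H"
    have s0: "?s \<ge> 0" "ln (W w) \<ge> 0" using W1[of w] by auto
    have c0: "?c \<ge> 0" using k by simp
    have "b j w \<le> ?c * ((real d + 1) * (1 + ?s)) * (real (Suc j) * q ^ j)" for j
    proof -
      have "sqrt (real ((d + 1) * Suc j) + ln (W w)) \<le> sqrt (real ((d + 1) * Suc j)) + ?s"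
        using s0 by (intro sqrt_add_le_add_sqrt) auto
      also have "sqrt (real ((d + 1) * Suc j)) \<le> real ((d + 1) * Suc j)"
      proof -
        have "1 \<le> real ((d + 1) * Suc j)" by simp
        then show ?thesis by (rule sqrt_le_self)
      qed
      also have "real ((d + 1) * Suc j) + ?s \<le> (real d + 1) * (1 + ?s) * real (Suc j)"
      proof -
        have "1 * ?s \<le> ((real d + 1) * real (Suc j)) * ?s" using s0 by (intro mult_right_mono) (auto simp: algebra_simps)
        then show ?thesis by (simp add: algebra_simps)
      qed
      finally have 1: "sqrt (real ((d + 1) * Suc j) + ln (W w)) \<le> (real d + 1) * (1 + ?s) * real (Suc j)" by simp
      have 2: "2 * \<sigma> j \<le> ?c * q ^ j"
      proof -
        have "?c * q ^ j * q \<le> ?c * q ^ j * 1" using q c0 by (intro mult_left_mono) auto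
        then show ?thesis unfolding sig by (simp add: mult_ac)
      qed
      have "b j w \<le> ?c * q ^ j * ((real d + 1) * (1 + ?s) * real (Suc j))"
        unfolding b_def by (rule mult_mono[OF 2 1]) (use q c0 s0 in auto)
      then show ?thesis by (simp add: mult_ac)
    qed
    then have "(\<Sum>j<J. b j w) \<le> (\<Sum>j<J. ?c * ((real d + 1) * (1 + ?s)) * (real (Suc j) * q ^ j))"
      by (intro sum_mono) simp
    also have "\<dots> = ?c * ((real d + 1) * (1 + ?s)) * (\<Sum>j<J. real (Suc j) * q ^ j)"
      by (simp only: sum_distrib_left)
    also have "\<dots> \<le> ?c * ((real d + 1) * (1 + ?s)) * (1 / (1 - q)\<^sup>2)"
      using sum_Suc_power_le[OF q, of J] c0 s0 by (intro mult_left_mono) auto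
    also have "\<dots> = chaining_const CARD('n) H k * l powr H * (1 + ?s)"
      using l unfolding chaining_const_def d_def[symmetric] q_def by (simp add: powr_mult)
    finally show ?thesis .
  qed
  show ?thesis
  proof (rule that[OF Wm W1 Wint])
    fix u w assume "u \<in> (nat_cube (2 ^ J) :: ('n \<Rightarrow> nat) set)"
    from path[OF order_refl this] sumb[of w]
    show "\<bar>\<xi> (x0 + (l / 2 ^ J) *\<^sub>R natvec u) w - \<xi> x0 w\<bar>
          \<le> chaining_const CARD('n) H k * l powr H * (1 + sqrt (ln (W w)))"
      unfolding P_def by (rule order_trans)
  qed
qed

section \<open>Constants in the reproducing kernel space\<close>

text \<open>The sinc function. \<open>sc (\<rho> * x)\<close> is the characteristic function of the
  uniform law on [\<open>- \<rho>\<close>, \<open>\<rho>\<close>], so a product of such factors has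
  a Fourier transform supported in an interval whose half-length is the sum of the
  \<open>\<rho>\<close>.\<close>

definition sc :: "real \<Rightarrow> real" where "sc y = (if y = 0 then 1 else sin y / y)"

lemma sc_measurable [measurable]: "sc \<in> borel_measurable borel"
proof -
  have "sc = (\<lambda>x. if x = 0 then 1 else sin x / x)" by (auto simp: sc_def fun_eq_iff)
  then show ?thesis using borel_measurable_sinc by simp
qed

lemma abs_sc_le_1: "\<bar>sc y\<bar> \<le> 1"
  using abs_sin_x_le_abs_x[of y] by (auto simp: sc_def abs_mult divide_le_eq)

lemma abs_sc_le_inverse: "y \<noteq> 0 \<Longrightarrow> \<bar>sc y\<bar> \<le> 1 / \<bar>y\<bar>"
  by (auto simp: sc_def intro!: divide_right_mono abs_sin_le_one)

lemma sc_ge: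
  assumes "\<bar>y\<bar> \<le> 1"
  shows "sc y \<ge> 1 - y\<^sup>2"
proof (cases "y = 0")
  case False
  have pos: "sc y \<ge> 1 - y\<^sup>2" if y: "y > 0" for y
  proof -
    obtain z where z: "0 < z" "z < y" "sin y - sin 0 = (y - 0) * cos z"
      using MVT2[OF y, of sin cos] by (auto intro: derivative_intros)
    have "cos z = 1 - 2 * (sin (z / 2))\<^sup>2" using cos_double_sin[of "z / 2"] by simp
    moreover have "(sin (z / 2))\<^sup>2 \<le> (z / 2)\<^sup>2"
      using abs_sin_x_le_abs_x[of "z / 2"] by (subst abs_le_square_iff[symmetric]) 
    moreover have "z\<^sup>2 \<le> y\<^sup>2" using z by (intro power_mono) auto
    moreover have "(z / 2)\<^sup>2 = z\<^sup>2 / 4" by (simp add: power_divide)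
    ultimately have "cos z \<ge> 1 - y\<^sup>2" using zero_le_power2[of z] by linarith
    then show ?thesis using z y by (simp add: sc_def)
  qed
  have even: "sc (- y) = sc y" by (simp add: sc_def)
  show ?thesis using pos[of y] pos[of "- y"] False even by (cases "y > 0") auto
qed (simp add: sc_def)

lemma sin_iexp: "complex_of_real (sin y) = (iexp y - iexp (- y)) / (2 * \<i>)"
  using sin_exp_eq[of "complex_of_real y"] by (simp add: sin_of_real)

definition uniform_sym :: "real \<Rightarrow> real measure" where
  "uniform_sym \<rho> = density lborel (\<lambda>u. ennreal (indicator {-\<rho>..\<rho>} u / (2 * \<rho>)))"

lemma uniform_sym:
  assumes "\<rho> > 0"
  shows "prob_space (uniform_sym \<rho>)" "sets (uniform_sym \<rho>) = sets borel"
    "AE u in uniform_sym \<rho>. \<bar>u\<bar> \<le> \<rho>"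
    "(CLINT u|uniform_sym \<rho>. iexp (u * x)) = complex_of_real (sc (\<rho> * x))"
proof -
  show "prob_space (uniform_sym \<rho>)"
  proof
    have "emeasure (uniform_sym \<rho>) UNIV = (\<integral>\<^sup>+u. ennreal (1 / (2 * \<rho>)) * indicator {-\<rho>..\<rho>} u \<partial>lborel)"
      using assms unfolding uniform_sym_def
      by (auto simp: emeasure_density indicator_def intro!: nn_integral_cong)
    also have "\<dots> = ennreal (1 / (2 * \<rho>)) * ennreal (2 * \<rho>)"
      using assms by (simp add: nn_integral_cmult)
    also have "\<dots> = 1" using assms by (simp flip: ennreal_mult)
    finally show "emeasure (uniform_sym \<rho>) (space (uniform_sym \<rho>)) = 1" by (simp add: uniform_sym_def)
  qed
  show "sets (uniform_sym \<rho>) = sets borel" by (simp add: uniform_sym_def)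
  show "AE u in uniform_sym \<rho>. \<bar>u\<bar> \<le> \<rho>"
    unfolding uniform_sym_def using assms by (subst AE_density) (auto simp: indicator_def)
  have "(CLINT u|uniform_sym \<rho>. iexp (u * x)) = (CLBINT u. (indicator {-\<rho>..\<rho>} u / (2 * \<rho>)) *\<^sub>R iexp (u * x))"
    unfolding uniform_sym_def using assms by (subst integral_density) auto
  also have "\<dots> = (CLBINT u. (1 / (2 * \<rho>)) *\<^sub>R (indicat_real {-\<rho>..\<rho>} u *\<^sub>R iexp (u * x)))"
    by (intro Bochner_Integration.integral_cong) auto
  also have "\<dots> = (1 / (2 * \<rho>)) *\<^sub>R (CLBINT u. indicat_real {-\<rho>..\<rho>} u *\<^sub>R iexp (u * x))"
    by (rule integral_scaleR_right)
  also have "(CLBINT u. indicat_real {-\<rho>..\<rho>} u *\<^sub>R iexp (u * x)) = complex_of_real (2 * \<rho> * sc (\<rho> * x))"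
  proof (cases "x = 0")
    case True
    then show ?thesis using assms by (simp add: sc_def scaleR_conv_of_real)
  next
    case False
    have "(CLBINT u. indicat_real {-\<rho>..\<rho>} u *\<^sub>R iexp (u * x)) =
        iexp (\<rho> * x) / (\<i> * x) - iexp (- \<rho> * x) / (\<i> * x)"
    proof (rule integral_FTC_Icc)
      show "((\<lambda>u. iexp (u * x) / (\<i> * x)) has_vector_derivative iexp (u * x)) (at u within {-\<rho>..\<rho>})" for u
      proof -
        have "((\<lambda>z. exp (\<i> * (z * x)) / (\<i> * x)) has_field_derivative exp (\<i> * (u * x))) (at (complex_of_real u))"
          using False by (auto intro!: derivative_eq_intros) (simp add: mult.commute[of _ \<i>])
        from has_vector_derivative_real_field[OF this, of "{-\<rho>..\<rho>}"] show ?thesis by simp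
      qed
    qed (use assms in \<open>auto intro!: continuous_intros\<close>)
    also have "\<dots> = 2 * complex_of_real (sin (\<rho> * x)) / x"
    proof -
      have "iexp (\<rho> * x) - iexp (- \<rho> * x) = 2 * \<i> * complex_of_real (sin (\<rho> * x))"
        using sin_iexp[of "\<rho> * x"] by simp
      then show ?thesis unfolding diff_divide_distrib[symmetric] by simp
    qed
    finally show ?thesis using False assms by (simp add: sc_def)
  qed
  finally show "(CLINT u|uniform_sym \<rho>. iexp (u * x)) = complex_of_real (sc (\<rho> * x))"
    using assms by (simp add: scaleR_conv_of_real)
qed

text \<open>Unlike exact vanishing, this condition passes easily to multiples by sinc factors, at the
  cost of enlarging the interval.\<close>

definition ft_small :: "real \<Rightarrow> real \<Rightarrow> (real \<Rightarrow> real) \<Rightarrow> bool" where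
  "ft_small r \<delta> h \<longleftrightarrow> integrable lborel h \<and>
     (\<forall>t. \<bar>t\<bar> \<ge> r \<longrightarrow> norm (CLBINT x. complex_of_real (h x) * iexp (t * x)) \<le> \<delta>)"

text \<open>Multiplication by \<open>sc (\<rho> * x)\<close> averages the Fourier transform over
  translations by at most \<open>\<rho>\<close>, by Fubini. At distance \<open>r + \<rho>\<close>
  all values averaged are still at distance \<open>r\<close>.\<close>

lemma ft_small_sc:
  assumes h: "ft_small r \<delta> h" and \<rho>: "\<rho> > 0"
  shows "ft_small (r + \<rho>) \<delta> (\<lambda>x. h x * sc (\<rho> * x))"
proof -
  let ?U = "uniform_sym \<rho>"
  note U = uniform_sym[OF \<rho>]
  interpret U: prob_space ?U by (rule U)
  interpret P: pair_sigma_finite lborel ?U ..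
  note [measurable_cong, simp] = U(2)
  have int: "integrable lborel h" using h by (simp add: ft_small_def)
  then have [measurable]: "h \<in> borel_measurable borel" by auto
  have int': "integrable lborel (\<lambda>x. h x * sc (\<rho> * x))"
    by (rule Bochner_Integration.integrable_bound[OF int]) (auto simp: abs_mult intro!: mult_right_le_one_le abs_sc_le_1)
  have "norm (CLBINT x. complex_of_real (h x * sc (\<rho> * x)) * iexp (t * x)) \<le> \<delta>" if t: "\<bar>t\<bar> \<ge> r + \<rho>" for t
  proof -
    have I: "integrable (lborel \<Otimes>\<^sub>M ?U) (\<lambda>(x, u). complex_of_real (h x) * iexp (t * x) * iexp (u * x))"
    proof (rule P.Fubini_integrable)
      show "integrable lborel (\<lambda>x. LINT u|?U. norm (case (x, u) of (x, u) \<Rightarrow> complex_of_real (h x) * iexp (t * x) * iexp (u * x)))"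
        using int by (simp add: norm_mult U.prob_space)
      show "AE x in lborel. integrable ?U (\<lambda>u. case (x, u) of (x, u) \<Rightarrow> complex_of_real (h x) * iexp (t * x) * iexp (u * x))"
      proof (rule AE_I2)
        fix x
        show "integrable ?U (\<lambda>u. case (x, u) of (x, u) \<Rightarrow> complex_of_real (h x) * iexp (t * x) * iexp (u * x))"
          by (rule integrable_bounded_prob[OF U(1), where B = "\<bar>h x\<bar>"])
             (simp_all add: norm_mult measurable_cong_sets[OF U(2) refl])
      qed
    qed measurable
    have "(CLBINT x. complex_of_real (h x * sc (\<rho> * x)) * iexp (t * x)) = (CLBINT x. (CLINT u|?U. complex_of_real (h x) * iexp (t * x) * iexp (u * x)))"
    proof (rule Bochner_Integration.integral_cong[OF refl])
      fix x
      have "(CLINT u|?U. complex_of_real (h x) * iexp (t * x) * iexp (u * x)) = complex_of_real (h x) * iexp (t * x) * (CLINT u|?U. iexp (u * x))"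
        by (rule integral_mult_right_zero)
      then show "complex_of_real (h x * sc (\<rho> * x)) * iexp (t * x) = (CLINT u|?U. complex_of_real (h x) * iexp (t * x) * iexp (u * x))"
        unfolding U(4) by (metis (no_types, lifting) mult.assoc mult.commute of_real_mult)
    qed
    also have "\<dots> = (CLINT u|?U. (CLBINT x. complex_of_real (h x) * iexp (t * x) * iexp (u * x)))"
      by (rule P.Fubini_integral[OF I, symmetric])
    also have "\<dots> = (CLINT u|?U. (CLBINT x. complex_of_real (h x) * iexp ((t + u) * x)))"
      by (simp add: ring_distribs exp_add mult_ac)
    finally have "norm (CLBINT x. complex_of_real (h x * sc (\<rho> * x)) * iexp (t * x)) \<le> (LINT u|?U. norm (CLBINT x. complex_of_real (h x) * iexp ((t + u) * x)))"
      by simp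
    also have "\<dots> \<le> (LINT u|?U. \<delta>)"
    proof (rule integral_mono_AE)
      have b: "norm (CLBINT x. complex_of_real (h x) * iexp ((t + u) * x)) \<le> (LBINT x. \<bar>h x\<bar>)" for u
        using integral_norm_bound[of lborel "\<lambda>x. complex_of_real (h x) * iexp ((t + u) * x)"] by (simp add: norm_mult)
      show "integrable ?U (\<lambda>u. norm (CLBINT x. complex_of_real (h x) * iexp ((t + u) * x)))"
        by (rule integrable_bounded_prob[OF U(1), where B = "LBINT x. \<bar>h x\<bar>"]) (use b in auto)
      show "AE u in ?U. norm (CLBINT x. complex_of_real (h x) * iexp ((t + u) * x)) \<le> \<delta>"
      proof (rule eventually_mono[OF U(3)])
        fix u :: real assume "\<bar>u\<bar> \<le> \<rho>"
        then have "\<bar>t + u\<bar> \<ge> r" using t by linarith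
        then show "norm (CLBINT x. complex_of_real (h x) * iexp ((t + u) * x)) \<le> \<delta>"
          using h unfolding ft_small_def by blast
      qed
    qed simp
    finally show ?thesis by (simp add: U.prob_space)
  qed
  then show ?thesis using int' by (auto simp: ft_small_def)
qed

text \<open>Starting point for the products: a Gaussian is integrable, and its transform beyond
  \<open>r\<close> is tiny when \<open>\<epsilon>\<close> is small. It is removed in the limit
  \<open>\<epsilon>\<close> to 0.\<close>

lemma ft_small_gaussian:
  assumes "\<epsilon> > 0" "r \<ge> 0"
  shows "ft_small r (sqrt (2 * pi) / \<epsilon> * exp (- (r / \<epsilon>)\<^sup>2 / 2)) (\<lambda>x. exp (- (\<epsilon> * x)\<^sup>2 / 2))"
proof -
  have dens: "exp (- (\<epsilon> * x)\<^sup>2 / 2) = sqrt (2 * pi) * std_normal_density (\<epsilon> * x)" for x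
    by (simp add: std_normal_density_def)
  have "integrable lborel (\<lambda>y. std_normal_density y)" by (rule integrable_normal_density) simp
  then have "integrable lborel (\<lambda>x. std_normal_density (0 + \<epsilon> * x))"
    using assms by (subst lborel_integrable_real_affine_iff) auto
  then have int: "integrable lborel (\<lambda>x. exp (- (\<epsilon> * x)\<^sup>2 / 2))" unfolding dens by simp
  have "norm (CLBINT x. complex_of_real (exp (- (\<epsilon> * x)\<^sup>2 / 2)) * iexp (t * x)) \<le> sqrt (2 * pi) / \<epsilon> * exp (- (r / \<epsilon>)\<^sup>2 / 2)"
    if t: "\<bar>t\<bar> \<ge> r" for t
  proof -
    have "char std_normal_distribution (t / \<epsilon>) = (CLBINT y. std_normal_density y *\<^sub>R iexp (t / \<epsilon> * y))"
      unfolding char_def by (subst integral_density) auto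
    also have "\<dots> = \<bar>\<epsilon>\<bar> *\<^sub>R (CLBINT x. std_normal_density (0 + \<epsilon> * x) *\<^sub>R iexp (t / \<epsilon> * (0 + \<epsilon> * x)))"
      by (rule lborel_integral_real_affine) (use assms in simp)
    also have "(CLBINT x. std_normal_density (0 + \<epsilon> * x) *\<^sub>R iexp (t / \<epsilon> * (0 + \<epsilon> * x))) =
        (CLBINT x. (1 / sqrt (2 * pi)) *\<^sub>R (complex_of_real (exp (- (\<epsilon> * x)\<^sup>2 / 2)) * iexp (t * x)))"
      unfolding dens using assms by (intro Bochner_Integration.integral_cong refl) (simp add: scaleR_conv_of_real)
    finally have "char std_normal_distribution (t / \<epsilon>) = (\<epsilon> / sqrt (2 * pi)) *\<^sub>R (CLBINT x. complex_of_real (exp (- (\<epsilon> * x)\<^sup>2 / 2)) * iexp (t * x))"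
      using assms by simp
    then have "(CLBINT x. complex_of_real (exp (- (\<epsilon> * x)\<^sup>2 / 2)) * iexp (t * x)) = (sqrt (2 * pi) / \<epsilon>) *\<^sub>R char std_normal_distribution (t / \<epsilon>)"
      using assms by simp
    also have "norm \<dots> = sqrt (2 * pi) / \<epsilon> * exp (- (t / \<epsilon>)\<^sup>2 / 2)"
      using assms by (simp add: char_std_normal_distribution)
    finally have 1: "norm (CLBINT x. complex_of_real (exp (- (\<epsilon> * x)\<^sup>2 / 2)) * iexp (t * x)) = sqrt (2 * pi) / \<epsilon> * exp (- (t / \<epsilon>)\<^sup>2 / 2)" .
    have "(r / \<epsilon>)\<^sup>2 \<le> (t / \<epsilon>)\<^sup>2"
      unfolding power_divide using t assms by (intro divide_right_mono) (auto simp: abs_le_square_iff[symmetric])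
    then show ?thesis unfolding 1 using assms by (intro mult_left_mono) auto
  qed
  then show ?thesis using int by (auto simp: ft_small_def)
qed

lemma ft_small_sc_power:
  assumes "ft_small r \<delta> h" "\<rho> > 0"
  shows "ft_small (r + real n * \<rho>) \<delta> (\<lambda>x. h x * sc (\<rho> * x) ^ n)"
proof (induction n)
  case (Suc n)
  from ft_small_sc[OF Suc assms(2)] show ?case by (simp add: algebra_simps)
qed (use assms in simp)

lemma ft_small_sc_prod:
  fixes N :: nat
  assumes "ft_small r \<delta> h" "\<And>k. \<rho> k > 0"
  shows "ft_small (r + (\<Sum>k<N. real (n k) * \<rho> k)) \<delta> (\<lambda>x. h x * (\<Prod>k<N. sc (\<rho> k * x) ^ n k))"
proof (induction N)
  case (Suc N)
  from ft_small_sc_power[OF Suc assms(2), of "n N" N] show ?case by (simp add: algebra_simps)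
qed (use assms in simp)

lemma integrable_inverse_1_plus_square': "integrable lborel (\<lambda>x::real. c / (1 + x\<^sup>2))"
proof -
  have "integrable lborel (\<lambda>x::real. c * (indicator (einterval (- \<infinity>) \<infinity>) x *\<^sub>R inverse (1 + x\<^sup>2)))"
    using integrable_inverse_1_plus_square unfolding set_integrable_def by (intro integrable_mult_right)
  then show ?thesis by (simp add: divide_inverse)
qed

lemma one_minus_sum_le_prod:
  fixes a :: "'i \<Rightarrow> real"
  assumes "finite A" "\<And>i. i \<in> A \<Longrightarrow> 0 \<le> a i \<and> a i \<le> 1"
  shows "1 - sum a A \<le> (\<Prod>i\<in>A. 1 - a i)"
  using assms
proof (induction A)
  case (insert i A)
  have p: "0 \<le> (\<Prod>i\<in>A. 1 - a i)" "(\<Prod>i\<in>A. 1 - a i) \<le> 1"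
    using insert by (auto intro!: prod_nonneg prod_le_1)
  have "a i * (\<Prod>i\<in>A. 1 - a i) \<le> a i * 1" using insert.prems p by (intro mult_left_mono) auto
  then show ?case using insert by (simp add: algebra_simps)
qed simp

lemma sc_sq_le: "\<rho> > 0 \<Longrightarrow> (sc (\<rho> * x))\<^sup>2 \<le> (1 + 1 / \<rho>\<^sup>2) / (1 + x\<^sup>2)"
proof (cases "x = 0")
  case False
  assume \<rho>: "\<rho> > 0"
  have 1: "(sc (\<rho> * x))\<^sup>2 \<le> 1" using abs_sc_le_1[of "\<rho> * x"] by (simp add: abs_square_le_1)
  have "\<bar>sc (\<rho> * x)\<bar>\<^sup>2 \<le> (1 / \<bar>\<rho> * x\<bar>)\<^sup>2" using abs_sc_le_inverse[of "\<rho> * x"] \<rho> False by (intro power_mono) auto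
  then have 2: "(sc (\<rho> * x))\<^sup>2 * x\<^sup>2 \<le> 1 / \<rho>\<^sup>2"
    using \<rho> False by (simp add: power_divide power_mult_distrib field_simps)
  show ?thesis using 1 2 by (subst pos_le_divide_eq) (auto simp: algebra_simps add_pos_nonneg)
qed (auto simp: sc_def)

lemma width_to_0:
  assumes "c > 0"
  shows "(\<lambda>N. sqrt (2 * pi) / (1 / real (Suc N)) * exp (- (c / (1 / real (Suc N)))\<^sup>2 / 2)) \<longlonglongrightarrow> 0"
proof (rule Lim_null_comparison)
  show "\<forall>\<^sub>F N in sequentially. norm (sqrt (2 * pi) / (1 / real (Suc N)) * exp (- (c / (1 / real (Suc N)))\<^sup>2 / 2)) \<le>
      (2 * sqrt (2 * pi) / c\<^sup>2) * (1 / real (Suc N))"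
  proof (rule always_eventually, rule allI)
    fix N
    define x where "x = real (Suc N)"
    have x: "x > 0" by (simp add: x_def)
    have "(c * x)\<^sup>2 / 2 \<le> exp ((c * x)\<^sup>2 / 2)" using exp_ge_add_one_self[of "(c * x)\<^sup>2 / 2"] by linarith
    then have "exp (- (c * x)\<^sup>2 / 2) \<le> 2 / (c * x)\<^sup>2"
      using x assms by (simp add: exp_minus field_simps)
    then have "sqrt (2 * pi) * x * exp (- (c * x)\<^sup>2 / 2) \<le> sqrt (2 * pi) * x * (2 / (c * x)\<^sup>2)"
      using x by (intro mult_left_mono) auto
    also have "\<dots> = (2 * sqrt (2 * pi) / c\<^sup>2) * (1 / x)" using x assms by (simp add: power2_eq_square field_simps)
    finally show "norm (sqrt (2 * pi) / (1 / real (Suc N)) * exp (- (c / (1 / real (Suc N)))\<^sup>2 / 2)) \<le>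
      (2 * sqrt (2 * pi) / c\<^sup>2) * (1 / real (Suc N))"
      using x unfolding x_def[symmetric] by simp
  qed
  show "(\<lambda>N. (2 * sqrt (2 * pi) / c\<^sup>2) * (1 / real (Suc N))) \<longlonglongrightarrow> 0"
    using tendsto_mult_left[OF LIMSEQ_inverse_real_of_nat, of "2 * sqrt (2 * pi) / c\<^sup>2"] by (simp add: inverse_eq_divide)
qed

text \<open>The multiplicities in the product are chosen so that the factors of scale \<open>2 ^ - k\<close>
  already push it below \<open>w\<close> on \<open>[2 ^ k, 2 ^ Suc k]\<close>; the summability condition says
  precisely that the total width of the corresponding box kernels is finite.\<close>

lemma ingham:
  fixes w :: "real \<Rightarrow> real" and r :: real
  assumes r: "r > 0" and wpos: "\<And>x. x \<ge> 0 \<Longrightarrow> w x > 0"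
    and wanti: "\<And>x y. 0 \<le> x \<Longrightarrow> x \<le> y \<Longrightarrow> w y \<le> w x"
    and summ: "summable (\<lambda>k. (ln (w 0) - ln (w (2 ^ k))) / 2 ^ k)"
  obtains h :: "real \<Rightarrow> real" and C :: real where "h \<in> borel_measurable borel" "\<And>x. 0 \<le> h x" "\<And>x. h x \<le> 1" "integrable lborel h"
    "(LBINT x. h x) > 0" "\<And>t. \<bar>t\<bar> \<ge> r \<Longrightarrow> (CLBINT x. h x * iexp (t * x)) = 0"
    "C > 0" "\<And>x. h x \<le> C * w \<bar>x\<bar>"
proof -
  define G where "G = (\<lambda>x. ln (w 0) - ln (w x))"
  have Gmono: "G x \<le> G y" if "0 \<le> x" "x \<le> y" for x y
    using that wanti[OF that] wpos[of x] wpos[of y] by (simp add: G_def)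
  have G0: "G x \<ge> 0" if "x \<ge> 0" for x using Gmono[of 0 x] that by (simp add: G_def)
  \<comment> \<open>Half the multiplicity at scale \<open>k\<close>. It dominates \<open>G\<close>
    at the far end of the dyadic interval, and exceeds it by at most 2, so the widths stay summable.
    Doubling it makes all factors nonnegative, and \<open>m k\<close> >= 1 makes the first factor an
    integrable majorant.\<close>
  define m where "m = (\<lambda>k. nat \<lceil>G (2 ^ Suc k)\<rceil> + 1)"
  have m: "G (2 ^ Suc k) \<le> real (m k)" "real (m k) \<le> G (2 ^ Suc k) + 2" "m k \<ge> 1" for k
  proof -
    have "G (2 ^ Suc k) \<ge> 0" by (rule G0) simp
    then have e: "real (m k) = real_of_int \<lceil>G (2 ^ Suc k)\<rceil> + 1"
      by (simp add: m_def del: power_Suc)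
    show "G (2 ^ Suc k) \<le> real (m k)" "real (m k) \<le> G (2 ^ Suc k) + 2"
      unfolding e using ceiling_correct[of "G (2 ^ Suc k)"] by linarith+
    show "m k \<ge> 1" by (simp add: m_def)
  qed
  \<comment> \<open>For |x| >= 2^k this gives |sc| <= 1 / e, so that powers of the factor turn
    directly into exponentials.\<close>
  define \<rho>' where "\<rho>' = (\<lambda>k. exp 1 / 2 ^ k :: real)"
  define A' where "A' = (\<lambda>k. real (2 * m k) * \<rho>' k)"
  have A'0: "A' k \<ge> 0" for k by (simp add: A'_def \<rho>'_def)
  have "summable A'"
  proof (rule summable_comparison_test)
    have "summable (\<lambda>k. 4 * exp 1 * ((ln (w 0) - ln (w (2 ^ Suc k))) / 2 ^ Suc k) + 4 * exp 1 * (1 / 2) ^ k :: real)"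
      using summ[THEN summable_Suc_iff[THEN iffD2]] by (intro summable_add summable_mult summable_geometric) auto
    then show "summable (\<lambda>k. 4 * exp 1 * (G (2 ^ Suc k) / 2 ^ Suc k) + 4 * exp 1 * (1 / 2) ^ k)"
      unfolding G_def .
    have "A' k \<le> 4 * exp 1 * (G (2 ^ Suc k) / 2 ^ Suc k) + 4 * exp 1 * (1 / 2) ^ k" for k
    proof -
      have "A' k \<le> 2 * (G (2 ^ Suc k) + 2) * (exp 1 / 2 ^ k)"
        unfolding A'_def \<rho>'_def using m(2)[of k] by (intro mult_right_mono) auto
      then show ?thesis by (simp add: field_simps power_divide)
    qed
    then show "\<exists>N. \<forall>k\<ge>N. norm (A' k) \<le> 4 * exp 1 * (G (2 ^ Suc k) / 2 ^ Suc k) + 4 * exp 1 * (1 / 2) ^ k"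
      using A'0 by simp
  qed
  \<comment> \<open>The first \<open>k0\<close> scales are dropped to make the total width small.
    Decay is then lost only for |x| <= 2^\<open>k0\<close>, which the constant \<open>C\<close>
    absorbs. The bound \<open>r / 2\<close> leaves room for the Gaussian, the bound 1 serves
    positivity of the integral.\<close>
  then obtain k0 where k0: "norm (\<Sum>i. A' (i + k0)) < min (r / 2) 1"
    using suminf_exist_split[of "min (r / 2) 1" A'] r by auto
  define \<rho> where "\<rho> = (\<lambda>k. \<rho>' (k + k0))"
  define n where "n = (\<lambda>k. m (k + k0))"
  have \<rho>: "\<rho> k > 0" "\<rho> k \<le> exp 1" for k by (auto simp: \<rho>_def \<rho>'_def divide_le_eq)
  have sumA: "(\<Sum>k<N. real (2 * n k) * \<rho> k) \<le> min (r / 2) 1" for N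
  proof -
    have "summable (\<lambda>i. A' (i + k0))" using \<open>summable A'\<close> by (rule summable_ignore_initial_segment)
    then have "(\<Sum>k<N. A' (k + k0)) \<le> (\<Sum>i. A' (i + k0))" by (rule sum_le_suminf) (use A'0 in auto)
    also have "\<dots> \<le> min (r / 2) 1"
      using k0 by (metis abs_ge_self less_imp_le order_trans real_norm_def)
    finally show ?thesis unfolding A'_def n_def \<rho>_def .
  qed
  define p where "p = (\<lambda>N x. \<Prod>k<N. sc (\<rho> k * x) ^ (2 * n k))"
  have fac: "0 \<le> sc (\<rho> k * x) ^ (2 * n k)" "sc (\<rho> k * x) ^ (2 * n k) \<le> 1" for k x
  proof -
    show "0 \<le> sc (\<rho> k * x) ^ (2 * n k)" by (simp add: power_mult)
    have "\<bar>sc (\<rho> k * x)\<bar> ^ (2 * n k) \<le> 1" using abs_sc_le_1 by (intro power_le_one) auto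
    then show "sc (\<rho> k * x) ^ (2 * n k) \<le> 1" by (simp add: power_even_abs)
  qed
  have p0: "0 \<le> p N x" and p1: "p N x \<le> 1" for N x
    using fac by (auto simp: p_def intro!: prod_nonneg prod_le_1)
  have pS: "p (Suc N) x \<le> p N x" for N x
    using mult_left_le[OF fac(2)[of N x] p0[of N x]] by (simp add: p_def)
  have dec: "decseq (\<lambda>N. p N x)" for x by (rule decseq_SucI) (rule pS)
  have "\<exists>L. (\<lambda>N. p N x) \<longlonglongrightarrow> L \<and> (\<forall>N. L \<le> p N x)" for x
  proof -
    obtain L where "(\<lambda>N. p N x) \<longlonglongrightarrow> L" "\<forall>i. L \<le> p i x"
      by (rule decseq_convergent[OF dec[of x], of 0]) (use p0 in auto)
    then show ?thesis by blast
  qed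
  then obtain h where h: "\<And>x. (\<lambda>N. p N x) \<longlonglongrightarrow> h x" "\<And>N x. h x \<le> p N x" by metis
  have [measurable]: "p N \<in> borel_measurable borel" for N unfolding p_def by measurable
  have hm [measurable]: "h \<in> borel_measurable borel" by (rule borel_measurable_LIMSEQ_real[OF h(1)]) measurable
  have h0: "0 \<le> h x" for x by (rule LIMSEQ_le_const[OF h(1)]) (use p0 in auto)
  have h1: "h x \<le> 1" for x using h(2)[of x 0] by (simp add: p_def)
  define D where "D = (\<lambda>x. (1 + 1 / (\<rho> 0)\<^sup>2) / (1 + x\<^sup>2))"
  have Dint: "integrable lborel D" unfolding D_def by (rule integrable_inverse_1_plus_square')
  have pD: "p (Suc N) x \<le> D x" for N x
  proof -
    have "p (Suc N) x \<le> p (Suc 0) x" using dec by (auto simp: decseq_def)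
    also have "\<dots> = (sc (\<rho> 0 * x))\<^sup>2 ^ n 0" by (simp add: p_def power_mult)
    also have "\<dots> \<le> (sc (\<rho> 0 * x))\<^sup>2 ^ 1"
      using m(3)[of k0] abs_sc_le_1[of "\<rho> 0 * x"] by (intro power_decreasing) (auto simp: n_def abs_square_le_1)
    also have "\<dots> \<le> D x" unfolding D_def using sc_sq_le[OF \<rho>(1)] by simp
    finally show ?thesis .
  qed
  have hint: "integrable lborel h"
    by (rule Bochner_Integration.integrable_bound[OF Dint])
       (use h0 h(2) pD in \<open>auto intro!: AE_I2 intro: order_trans[OF h(2) order_trans[OF pD abs_ge_self]]\<close>)
  have vanish: "(CLBINT x. h x * iexp (t * x)) = 0" if t: "\<bar>t\<bar> \<ge> r" for t
  proof -
    \<comment> \<open>Finite products with a vanishing Gaussian damping: half of \<open>r\<close> is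
      used by the Gaussian and half by the boxes. \<open>Suc N\<close> guarantees at least one
      factor, hence the majorant \<open>D\<close>.\<close>
    define f where "f = (\<lambda>N x. exp (- (1 / real (Suc N) * x)\<^sup>2 / 2) * p (Suc N) x)"
    define \<delta> where "\<delta> = (\<lambda>N. sqrt (2 * pi) / (1 / real (Suc N)) * exp (- (r / 2 / (1 / real (Suc N)))\<^sup>2 / 2))"
    have [measurable]: "f N \<in> borel_measurable borel" for N unfolding f_def by measurable
    have f1: "norm (f N x) \<le> D x" for N x
    proof -
      have "norm (f N x) \<le> 1 * p (Suc N) x"
        unfolding f_def norm_mult using p0 by (intro mult_mono) auto
      then show ?thesis using pD[of N x] by simp
    qed
    have nb: "norm (CLBINT x. f N x * iexp (t * x)) \<le> \<delta> N" for N
    proof -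
      have "ft_small (r / 2 + (\<Sum>k<Suc N. real (2 * n k) * \<rho> k)) (\<delta> N) (f N)"
        unfolding f_def p_def \<delta>_def by (intro ft_small_sc_prod ft_small_gaussian \<rho>) (use r in auto)
      moreover have "r / 2 + (\<Sum>k<Suc N. real (2 * n k) * \<rho> k) \<le> \<bar>t\<bar>"
        using t order_trans[OF sumA[of "Suc N"] min.cobounded1] by linarith
      ultimately show ?thesis unfolding ft_small_def by blast
    qed
    have \<delta>0: "\<delta> \<longlonglongrightarrow> 0" using r unfolding \<delta>_def by (intro width_to_0) simp
    have lim0: "(\<lambda>N. CLBINT x. f N x * iexp (t * x)) \<longlonglongrightarrow> 0"
      by (rule Lim_null_comparison[OF _ \<delta>0]) (rule always_eventually, rule allI, rule nb)
    have "(\<lambda>N. CLBINT x. f N x * iexp (t * x)) \<longlonglongrightarrow> (CLBINT x. h x * iexp (t * x))"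
    proof (rule integral_dominated_convergence[OF _ _ Dint])
      show "AE x in lborel. (\<lambda>N. f N x * iexp (t * x)) \<longlonglongrightarrow> h x * iexp (t * x)"
      proof (rule AE_I2)
        fix x
        have "(\<lambda>N. exp (- (1 / real (Suc N) * x)\<^sup>2 / 2)) \<longlonglongrightarrow> 1"
        proof -
          have "(\<lambda>N. - (1 / real (Suc N) * x)\<^sup>2 / 2) \<longlonglongrightarrow> - (0 * x)\<^sup>2 / 2"
            using LIMSEQ_inverse_real_of_nat unfolding inverse_eq_divide by (intro tendsto_intros) simp_all
          from tendsto_exp[OF this] show ?thesis by simp
        qed
        from tendsto_mult[OF this LIMSEQ_Suc[OF h(1)[of x]]]
        have "(\<lambda>N. f N x) \<longlonglongrightarrow> h x" by (simp add: f_def)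
        then show "(\<lambda>N. f N x * iexp (t * x)) \<longlonglongrightarrow> h x * iexp (t * x)"
          by (intro tendsto_intros)
      qed
      show "AE x in lborel. norm (f N x * iexp (t * x)) \<le> D x" for N
        by (rule AE_I2) (simp add: norm_mult f1[unfolded real_norm_def])
    qed measurable
    then show ?thesis using lim0 LIMSEQ_unique by blast
  qed
  have pos: "(LBINT x. h x) > 0"
  proof -
    \<comment> \<open>For |x| <= \<open>y\<close> every argument of sinc is at most 1/2; Bernoulli's
      inequality and the total width at most 1 then keep the whole product above 1/2.\<close>
    define y where "y = 1 / (2 * exp 1 :: real)"
    have y: "y > 0" by (simp add: y_def)
    have low: "h x \<ge> 1 / 2" if x: "\<bar>x\<bar> \<le> y" for x
    proof (rule LIMSEQ_le_const[OF h(1)], intro exI allI impI)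
      fix N
      have 1: "\<bar>\<rho> k * x\<bar> \<le> 1 / 2" for k
      proof -
        have "\<bar>\<rho> k * x\<bar> \<le> exp 1 * y" unfolding abs_mult using \<rho>[of k] x by (intro mult_mono) auto
        then show ?thesis by (simp add: y_def)
      qed
      have 2: "(\<rho> k * x)\<^sup>2 \<le> 1" for k using 1[of k] by (simp add: abs_square_le_1)
      have 3: "1 - real (2 * n k) * (\<rho> k * x)\<^sup>2 \<le> sc (\<rho> k * x) ^ (2 * n k)" for k
      proof -
        have "1 + real (2 * n k) * (- (\<rho> k * x)\<^sup>2) \<le> (1 + - (\<rho> k * x)\<^sup>2) ^ (2 * n k)"
          by (rule Bernoulli_inequality) (use 2[of k] in simp)
        also have "\<dots> \<le> sc (\<rho> k * x) ^ (2 * n k)"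
          using sc_ge[of "\<rho> k * x"] 1[of k] 2[of k] by (intro power_mono) auto
        finally show ?thesis by simp
      qed
      have 4: "real (2 * n k) * (\<rho> k * x)\<^sup>2 \<le> real (2 * n k) * \<rho> k * (1 / 4)" for k
      proof -
        have "\<bar>\<rho> k * x\<bar> * \<bar>x\<bar> \<le> 1 / 2 * (1 / 2)"
        proof (rule mult_mono[OF 1])
          have "y \<le> 1 / 2" using exp_ge_add_one_self[of 1] by (simp add: y_def divide_simps)
          then show "\<bar>x\<bar> \<le> 1 / 2" using x by simp
        qed auto
        then have "\<rho> k * (\<bar>\<rho> k * x\<bar> * \<bar>x\<bar>) \<le> \<rho> k * (1 / 2 * (1 / 2))" using \<rho>[of k] by (intro mult_left_mono) auto
        moreover have "(\<rho> k * x)\<^sup>2 = \<rho> k * (\<bar>\<rho> k * x\<bar> * \<bar>x\<bar>)"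
          using \<rho>(1)[of k] by (simp add: abs_mult power2_eq_square)
        ultimately have "(\<rho> k * x)\<^sup>2 \<le> \<rho> k * (1 / 4)" by simp
        then have "real (2 * n k) * (\<rho> k * x)\<^sup>2 \<le> real (2 * n k) * (\<rho> k * (1 / 4))" by (rule mult_left_mono) simp
        then show ?thesis by simp
      qed
      have 5: "(\<Sum>k<N. real (2 * n k) * (\<rho> k * x)\<^sup>2) \<le> 1 / 4"
      proof -
        have "(\<Sum>k<N. real (2 * n k) * (\<rho> k * x)\<^sup>2) \<le> (\<Sum>k<N. real (2 * n k) * \<rho> k * (1 / 4))"
          by (rule sum_mono) (rule 4)
        also have "\<dots> = (\<Sum>k<N. real (2 * n k) * \<rho> k) * (1 / 4)" by (simp only: sum_distrib_right)
        also have "\<dots> \<le> 1 * (1 / 4)" using sumA[of N] by (intro mult_right_mono) auto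
        finally show ?thesis by simp
      qed
      have 6: "real (2 * n k) * (\<rho> k * x)\<^sup>2 \<le> 1" if "k < N" for k
        using member_le_sum[of k "{..<N}" "\<lambda>k. real (2 * n k) * (\<rho> k * x)\<^sup>2"] 5 that by auto
      have "1 - (\<Sum>k<N. real (2 * n k) * (\<rho> k * x)\<^sup>2) \<le> (\<Prod>k<N. 1 - real (2 * n k) * (\<rho> k * x)\<^sup>2)"
        by (rule one_minus_sum_le_prod) (use 6 in auto)
      also have "\<dots> \<le> p N x" unfolding p_def using 3 6 by (intro prod_mono) auto
      finally show "1 / 2 \<le> p N x" using 5 by simp
    qed
    have "0 < (LBINT x. 1 / 2 * indicat_real {-y..y} x)" using y by simp
    also have "\<dots> \<le> (LBINT x. h x)"
    proof (rule integral_mono[OF _ hint])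
      show "integrable lborel (\<lambda>x. 1 / 2 * indicat_real {-y..y} x)"
        by (intro integrable_mult_right integrable_real_indicator) (use y in auto)
      show "1 / 2 * indicat_real {-y..y} x \<le> h x" for x
        using low[of x] h0[of x] by (cases "x \<in> {-y..y}") auto
    qed
    finally show ?thesis .
  qed
  define x0 where "x0 = (2 ^ k0 :: real)"
  have bound: "h x \<le> 1 / w x0 * w \<bar>x\<bar>" for x :: real
  proof (cases "\<bar>x\<bar> \<le> x0")
    case True
    have "h x \<le> 1" by (rule h1)
    also have "1 \<le> w \<bar>x\<bar> / w x0" using wanti[OF _ True] wpos[of x0] by (simp add: x0_def)
    finally show ?thesis by simp
  next
    case False
    \<comment> \<open>The dyadic scale of \<open>x\<close>. The single factor of this scale, number
      \<open>k - k0\<close> after the shift, already yields the required decay; the others are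
      bounded by 1.\<close>
    define k where "k = nat \<lfloor>log 2 \<bar>x\<bar>\<rfloor>"
    have x1: "\<bar>x\<bar> > 1" using False one_le_power[of "2::real" k0] unfolding x0_def by linarith
    have l0: "log 2 \<bar>x\<bar> \<ge> 0" using x1 by simp
    have kl: "real k \<le> log 2 \<bar>x\<bar>" "log 2 \<bar>x\<bar> < real k + 1" using l0 unfolding k_def by linarith+
    have k1: "2 ^ k \<le> \<bar>x\<bar>"
      using kl(1) x1 by (subst (asm) le_log_iff) (auto simp: powr_realpow)
    have k2: "\<bar>x\<bar> \<le> 2 ^ Suc k"
    proof -
      have "\<bar>x\<bar> < 2 powr (real k + 1)" using kl(2) x1 by (subst (asm) log_less_iff) auto
      then show ?thesis by (simp add: powr_add powr_realpow)
    qed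
    have "k0 < Suc k"
    proof -
      have "(2::real) ^ k0 < 2 ^ Suc k" using False k2 unfolding x0_def by linarith
      then show ?thesis by (rule power_less_imp_less_exp[rotated]) simp
    qed
    then have "k = (k - k0) + k0" by simp
    then obtain j where j: "k = j + k0" ..
    have "h x \<le> p (Suc j) x" by (rule h(2))
    also have "\<dots> \<le> 1 * sc (\<rho> j * x) ^ (2 * n j)"
      unfolding p_def prod.lessThan_Suc using p1[of j x] fac(1)[of j x] by (intro mult_right_mono) (auto simp: p_def)
    also have "\<dots> = \<bar>sc (\<rho> j * x)\<bar> ^ (2 * n j)" by (simp add: power_even_abs)
    also have "\<dots> \<le> (1 / exp 1) ^ (2 * n j)"
    proof (rule power_mono)
      have e: "exp 1 \<le> \<bar>\<rho> j * x\<bar>"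
      proof -
        have "exp 1 = \<rho> j * 2 ^ k" by (simp add: \<rho>_def \<rho>'_def j)
        also have "\<dots> \<le> \<rho> j * \<bar>x\<bar>" using k1 \<rho>(1)[of j] by (intro mult_left_mono) auto
        finally show ?thesis using \<rho>(1)[of j] by (simp add: abs_mult)
      qed
      have "\<bar>sc (\<rho> j * x)\<bar> \<le> 1 / \<bar>\<rho> j * x\<bar>"
        using \<rho>(1)[of j] x1 by (intro abs_sc_le_inverse) auto
      also have "\<dots> \<le> 1 / exp 1" using e by (intro divide_left_mono) (auto intro!: mult_pos_pos order.strict_trans2[OF exp_gt_zero e])
      finally show "\<bar>sc (\<rho> j * x)\<bar> \<le> 1 / exp 1" .
    qed simp
    also have "\<dots> = exp (- real (2 * n j))"
      using exp_of_nat_mult[of "2 * n j" "- 1 :: real"] by (simp add: exp_minus inverse_eq_divide)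
    also have "\<dots> \<le> exp (- G \<bar>x\<bar>)"
    proof -
      have "G \<bar>x\<bar> \<le> G (2 ^ Suc k)" by (rule Gmono) (use k2 in auto)
      also have "\<dots> \<le> real (n j)" using m(1)[of k] by (simp add: n_def j)
      finally show ?thesis by simp
    qed
    also have "\<dots> = w \<bar>x\<bar> / w 0" using wpos[of 0] wpos[of "\<bar>x\<bar>"] by (simp add: G_def exp_diff)
    also have "\<dots> \<le> w \<bar>x\<bar> / w x0"
      using wanti[of 0 x0] wpos[of 0] wpos[of x0] wpos[of "\<bar>x\<bar>"] by (intro divide_left_mono) (auto simp: x0_def)
    finally show ?thesis by simp
  qed
  show ?thesis
    by (rule that[OF hm h0 h1 hint pos vanish _ bound]) (use wpos[of x0] in \<open>auto simp: x0_def\<close>)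
qed

text \<open>Dyadic integral test. ln (g 0) - ln (g x) is increasing, so its value at the left end of
  (d 2^k, d 2^(k+1)] is a lower bound there, while 1 + x^2 is at most its value at the right end.
  The step functions \<open>S\<close> stay below the integrable \<open>\<psi>\<close>.\<close>

lemma minorant_summable:
  assumes g: "spectral_minorant g" and d: "d > 0"
  shows "summable (\<lambda>k. (ln (g 0) - ln (g (d * 2 ^ k))) / 2 ^ k)"
proof -
  from g have gpos: "\<And>x. x \<ge> 0 \<Longrightarrow> g x > 0" and ganti: "antimono_on {0..} g"
    and gint: "set_integrable lborel {0..} (\<lambda>x. \<bar>ln (g x)\<bar> / (1 + x\<^sup>2))"
    by (auto simp: spectral_minorant_def)
  define G where "G = (\<lambda>x. ln (g 0) - ln (g x))"
  have Gmono: "G x \<le> G y" if "0 \<le> x" "x \<le> y" for x y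
  proof -
    have "g y \<le> g x" using ganti that by (auto simp: monotone_on_def)
    then show ?thesis using gpos[of x] gpos[of y] that by (simp add: G_def)
  qed
  have G0: "G x \<ge> 0" if "x \<ge> 0" for x using Gmono[of 0 x] that by (simp add: G_def)
  define \<psi> where "\<psi> = (\<lambda>x. \<bar>ln (g 0)\<bar> / (1 + x\<^sup>2) + indicator {0..} x *\<^sub>R (\<bar>ln (g x)\<bar> / (1 + x\<^sup>2)))"
  have \<psi>int: "integrable lborel \<psi>"
    unfolding \<psi>_def using gint unfolding set_integrable_def
    by (intro Bochner_Integration.integrable_add integrable_inverse_1_plus_square')
  have \<psi>0: "\<psi> x \<ge> 0" for x unfolding \<psi>_def by (simp add: add_nonneg_nonneg)
  have G\<psi>: "G x / (1 + x\<^sup>2) \<le> \<psi> x" if "x \<ge> 0" for x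
  proof -
    have "G x \<le> \<bar>ln (g 0)\<bar> + \<bar>ln (g x)\<bar>" unfolding G_def by linarith
    then have "G x / (1 + x\<^sup>2) \<le> (\<bar>ln (g 0)\<bar> + \<bar>ln (g x)\<bar>) / (1 + x\<^sup>2)"
      by (rule divide_right_mono) (simp add: add_nonneg_nonneg)
    then show ?thesis using that by (simp add: \<psi>_def add_divide_distrib)
  qed
  define c where "c = (\<lambda>k. G (d * 2 ^ k) / (1 + (d * 2 ^ Suc k)\<^sup>2))"
  have c0: "c k \<ge> 0" for k unfolding c_def using d by (intro divide_nonneg_nonneg G0) (auto simp: add_nonneg_nonneg)
  define S where "S = (\<lambda>n x. \<Sum>k<n. c k * indicat_real {d * 2 ^ k<..d * 2 ^ Suc k} x)"
  have S: "S n x \<le> \<psi> x \<and> (x > d * 2 ^ n \<longrightarrow> S n x = 0)" for n x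
  proof (induction n)
    case 0
    show ?case using \<psi>0[of x] by (simp add: S_def)
  next
    case (Suc n)
    have SS: "S (Suc n) x = S n x + c n * indicat_real {d * 2 ^ n<..d * 2 ^ Suc n} x" unfolding S_def by (rule sum.lessThan_Suc)
    have ge: "d * 2 ^ n \<le> d * 2 ^ Suc n" using d by simp
    show ?case
    proof (cases "x \<in> {d * 2 ^ n<..d * 2 ^ Suc n}")
      case True
      then have x: "d * 2 ^ n < x" "x \<le> d * 2 ^ Suc n" by auto
      have d2: "0 < d * 2 ^ n" using d by simp
      then have x0: "x > 0" using x by linarith
      have "x\<^sup>2 \<le> (d * 2 ^ Suc n)\<^sup>2" using x x0 by (intro power_mono) auto
      then have "c n \<le> G x / (1 + x\<^sup>2)"
        unfolding c_def using x x0 d2 G0[of x]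
        by (intro frac_le Gmono) (auto simp: add_pos_nonneg)
      then have "c n \<le> \<psi> x" using G\<psi>[of x] x0 by linarith
      then show ?thesis using Suc x SS True by (simp del: power_Suc)
    next
      case False
      then have eq: "S (Suc n) x = S n x" using SS by simp
      show ?thesis unfolding eq using Suc ge by auto
    qed
  qed
  have Sint: "integrable lborel (S n)" for n
    unfolding S_def by (intro Bochner_Integration.integrable_sum integrable_mult_right integrable_real_indicator)
      (use d in \<open>auto simp: emeasure_lborel_Ioc\<close>)
  have sumc: "(\<Sum>k<n. c k * (d * 2 ^ k)) \<le> (LBINT x. \<psi> x)" for n
  proof -
    have "(\<Sum>k<n. c k * (d * 2 ^ k)) = (LBINT x. S n x)"
    proof -
      have i: "integrable lborel (\<lambda>x. c k * indicat_real {d * 2 ^ k<..d * 2 ^ Suc k} x)" for k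
        by (intro integrable_mult_right integrable_real_indicator) (use d in \<open>auto simp: emeasure_lborel_Ioc\<close>)
      have m: "measure lborel {d * 2 ^ k<..d * 2 ^ Suc k} = d * 2 ^ k" for k
        using d by (simp add: measure_def emeasure_lborel_Ioc)
      have "(LBINT x. S n x) = (\<Sum>k<n. (LBINT x. c k * indicat_real {d * 2 ^ k<..d * 2 ^ Suc k} x))"
        unfolding S_def by (rule Bochner_Integration.integral_sum) (rule i)
      also have "\<dots> = (\<Sum>k<n. c k * (d * 2 ^ k))"
        by (intro sum.cong refl) (simp add: m del: power_Suc)
      finally show ?thesis by simp
    qed
    also have "\<dots> \<le> (LBINT x. \<psi> x)" by (rule integral_mono[OF Sint \<psi>int]) (use S in auto)
    finally show ?thesis .
  qed
  show ?thesis
  proof (rule summableI_nonneg_bounded)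
    \<comment> \<open>Converts 1 / 2^k into interval length divided by 1 + (d 2^(k+1))^2; the two
      agree up to a constant because 2^k >= 1.\<close>
    define K where "K = (1 + 4 * d\<^sup>2) / d"
    fix n
    have "(\<Sum>k<n. (ln (g 0) - ln (g (d * 2 ^ k))) / 2 ^ k) \<le> (\<Sum>k<n. K * (c k * (d * 2 ^ k)))"
    proof (rule sum_mono)
      fix k
      have p: "(2::real) ^ k \<ge> 1" by simp
      have "1 / 2 ^ k \<le> K * (1 / (1 + (d * 2 ^ Suc k)\<^sup>2) * (d * 2 ^ k))"
      proof -
        define P where "P = (2::real) ^ k"
        have P: "P \<ge> 1" "P\<^sup>2 \<ge> 1" using p by (auto simp: P_def intro: one_le_power)
        have pos: "1 + 4 * d\<^sup>2 * P\<^sup>2 > 0" by (simp add: add_pos_nonneg)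
        have "1 + 4 * d\<^sup>2 * P\<^sup>2 \<le> (1 + 4 * d\<^sup>2) * P\<^sup>2" using P by (simp add: algebra_simps)
        then have "1 / P \<le> (1 + 4 * d\<^sup>2) * P / (1 + 4 * d\<^sup>2 * P\<^sup>2)"
          using P pos by (simp add: divide_simps power2_eq_square mult_ac)
        also have "\<dots> = K * (1 / (1 + (d * 2 ^ Suc k)\<^sup>2) * (d * 2 ^ k))"
          using d by (simp add: K_def P_def power_mult_distrib mult_ac)
        finally show ?thesis by (simp add: P_def)
      qed
      from mult_left_mono[OF this G0[of "d * 2 ^ k"]] d
      show "(ln (g 0) - ln (g (d * 2 ^ k))) / 2 ^ k \<le> K * (c k * (d * 2 ^ k))"
        by (simp add: c_def G_def mult_ac)
    qed
    also have "\<dots> \<le> K * (LBINT x. \<psi> x)"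
      unfolding sum_distrib_left[symmetric] using sumc d by (intro mult_left_mono) (auto simp: K_def add_nonneg_nonneg)
    finally show "(\<Sum>k<n. (ln (g 0) - ln (g (d * 2 ^ k))) / 2 ^ k) \<le> K * (LBINT x. \<psi> x)" .
  next
    show "0 \<le> (ln (g 0) - ln (g (d * 2 ^ n))) / 2 ^ n" for n
      using G0[of "d * 2 ^ n"] d by (simp add: G_def)
  qed
qed

text \<open>Polynomial factors do not disturb the decay condition of \<open>ingham\<close>: their
  logarithms at 2^k grow linearly in k.\<close>

lemma summable_ln_one_plus_power4: "summable (\<lambda>k. ln (1 + (2 ^ k)\<^sup>2) / 2 ^ k :: real)"
proof (rule summable_comparison_test)
  have "summable (\<lambda>k. of_nat (Suc k) * (1 / 2 :: real) ^ k)"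
    using geometric_deriv_sums[of "1 / 2 :: real"] by (auto simp: sums_iff)
  then show "summable (\<lambda>k. 2 * (real (Suc k) * (1 / 2) ^ k))" by (intro summable_mult) simp
  show "\<exists>N. \<forall>k\<ge>N. norm (ln (1 + (2 ^ k)\<^sup>2) / 2 ^ k :: real) \<le> 2 * (real (Suc k) * (1 / 2) ^ k)"
  proof (intro exI allI impI)
    fix k :: nat
    have "(1::real) \<le> (2 ^ k)\<^sup>2" by simp
    moreover have "(2::real) ^ (2 * Suc k) = 4 * (2 ^ k)\<^sup>2" unfolding power_even_eq by (simp add: power_mult_distrib)
    ultimately have le: "1 + (2 ^ k)\<^sup>2 \<le> (2::real) ^ (2 * Suc k)" by linarith
    have "ln (1 + (2 ^ k)\<^sup>2 :: real) \<le> ln (2 ^ (2 * Suc k))"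
      using le by (subst ln_le_cancel_iff) (auto simp: add_pos_pos)
    also have "\<dots> = real (2 * Suc k) * ln 2" by (rule ln_realpow)
    also have "\<dots> \<le> real (2 * Suc k) * 1" using ln_2_less_1 by (intro mult_left_mono) auto
    finally have "ln (1 + (2 ^ k)\<^sup>2 :: real) \<le> 2 * real (Suc k)" by simp
    moreover have "ln (1 + (2 ^ k)\<^sup>2 :: real) \<ge> 0" by simp
    ultimately show "norm (ln (1 + (2 ^ k)\<^sup>2) / 2 ^ k :: real) \<le> 2 * (real (Suc k) * (1 / 2) ^ k)"
      by (simp add: divide_right_mono power_divide del: of_nat_Suc)
  qed
qed

section \<open>Passage to several dimensions in the spectral criterion\<close>

lemma lborel_prod_coords:
  fixes f :: "'a::euclidean_space \<Rightarrow> real \<Rightarrow> 'b::{real_normed_field,banach,second_countable_topology}"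
  assumes "\<And>b. b \<in> Basis \<Longrightarrow> integrable lborel (f b)"
  shows "integrable lborel (\<lambda>x::'a. \<Prod>b\<in>Basis. f b (x \<bullet> b))"
    and "(LBINT x. (\<Prod>b\<in>Basis. f b (x \<bullet> b))) = (\<Prod>b\<in>Basis. (LBINT y. f b y))"
proof -
  interpret product_sigma_finite "\<lambda>_::'a. lborel :: real measure" ..
  have L: "(lborel :: 'a measure) = distr (Pi\<^sub>M Basis (\<lambda>b. lborel)) borel (\<lambda>f. \<Sum>b\<in>Basis. f b *\<^sub>R b)"
    by (simp add: lborel_def[where 'a='a] lborel_eq_real)
  have coord: "(\<Sum>b'\<in>Basis. y b' *\<^sub>R b') \<bullet> b = y b" if "b \<in> Basis" for y and b :: 'a
    using that by (simp add: inner_sum_left inner_Basis if_distrib cong: if_cong)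
  have [measurable]: "f b \<in> borel_measurable borel" if "b \<in> Basis" for b
    using assms[OF that] by auto
  have meas: "(\<lambda>x::'a. \<Prod>b\<in>Basis. f b (x \<bullet> b)) \<in> borel_measurable borel"
    by measurable
  have e: "(\<Prod>b\<in>Basis. f b ((\<Sum>b'\<in>Basis. y b' *\<^sub>R b') \<bullet> b)) = (\<Prod>b\<in>Basis. f b (y b))" for y
    by (intro prod.cong refl) (simp add: coord)
  show "integrable lborel (\<lambda>x::'a. \<Prod>b\<in>Basis. f b (x \<bullet> b))"
    unfolding L by (subst integrable_distr_eq) (use meas assms in \<open>auto simp: e intro!: product_integrable_prod\<close>)
  show "(LBINT x. (\<Prod>b\<in>Basis. f b (x \<bullet> b))) = (\<Prod>b\<in>Basis. (LBINT y. f b y))"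
    unfolding L by (subst integral_distr) (use meas assms in \<open>auto simp: e intro!: product_integral_prod\<close>)
qed

lemma minorant_radial_measurable:
  assumes "continuous_on {0..} g"
  shows "(\<lambda>x::'a::euclidean_space. g (norm x)) \<in> borel_measurable borel"
proof -
  have "continuous_on UNIV (\<lambda>x::'a. g (norm x))"
    using assms by (rule continuous_on_compose2) (auto intro: continuous_intros)
  then show ?thesis by (rule borel_measurable_continuous_onI)
qed

text \<open>The test function is a product of one-dimensional Ingham functions; its Fourier transform
  is constant outside the unit ball up to the subtracted value at \<open>0\<close>, so it exhibits
  the constant function as an element of the reproducing kernel space there.\<close>

lemma rkhs_constant:
  fixes g :: "real \<Rightarrow> real"
  assumes gpos: "\<And>x. x \<ge> 0 \<Longrightarrow> g x > 0" and gmono: "\<And>x y. 0 \<le> x \<Longrightarrow> x \<le> y \<Longrightarrow> g y \<le> g x"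
    and gcont: "continuous_on {0..} g"
    and gsum: "\<And>d. d > 0 \<Longrightarrow> summable (\<lambda>k. (ln (g 0) - ln (g (d * 2 ^ k))) / 2 ^ k)"
  shows "\<exists>K>0. \<forall>F b. finite F \<and> (\<forall>t\<in>F. norm (t::'a::euclidean_space) \<ge> 1) \<longrightarrow>
    ennreal ((\<Sum>t\<in>F. b t)\<^sup>2) \<le> ennreal K *
      (\<integral>\<^sup>+x. ennreal ((cmod (\<Sum>t\<in>F. complex_of_real (b t) * (iexp (t \<bullet> x) - 1)))\<^sup>2 * g (norm x)) \<partial>lborel)"
proof -
  note [measurable] = minorant_radial_measurable[OF gcont, where 'a='a]
  define d where "d = real DIM('a)"
  have d: "d \<ge> 1" unfolding d_def using DIM_positive[where 'a='a] by linarith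
  \<comment> \<open>The square root appears because the squared test function is divided by
    \<open>g\<close>; the denominator makes the remaining product integrable; the argument
    \<open>d * x\<close> is there because the norm of a vector is at most \<open>d\<close> times its
    largest coordinate.\<close>
  define w where "w = (\<lambda>x. sqrt (g (d * x)) / (1 + x\<^sup>2))"
  have pos1: "1 + x\<^sup>2 > 0" for x :: real by (simp add: add_pos_nonneg)
  have wpos: "w x > 0" if "x \<ge> 0" for x
    unfolding w_def using gpos[of "d * x"] that d pos1[of x] by (intro divide_pos_pos) auto
  have wanti: "w y \<le> w x" if "0 \<le> x" "x \<le> y" for x y
    unfolding w_def using that d gpos[of "d * y"] gpos[of "d * x"]
    by (intro frac_le) (auto intro!: gmono mult_left_mono power_mono simp: pos1)
  have "summable (\<lambda>k. (1 / 2) * ((ln (g 0) - ln (g (d * 2 ^ k))) / 2 ^ k) + ln (1 + (2 ^ k)\<^sup>2) / 2 ^ k)"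
    by (intro summable_add summable_mult gsum summable_ln_one_plus_power4) (use d in simp)
  moreover have "(1 / 2) * ((ln (g 0) - ln (g (d * 2 ^ k))) / 2 ^ k) + ln (1 + (2 ^ k)\<^sup>2) / 2 ^ k =
      (ln (w 0) - ln (w (2 ^ k))) / 2 ^ k" for k
  proof -
    have "ln (w x) = (1 / 2) * ln (g (d * x)) - ln (1 + x\<^sup>2)" if "x \<ge> 0" for x
    proof -
      have gp: "g (d * x) > 0" using gpos[of "d * x"] that d by simp
      then have "ln (w x) = ln (sqrt (g (d * x))) - ln (1 + x\<^sup>2)"
        unfolding w_def using pos1[of x] by (simp add: ln_div)
      then show ?thesis using ln_sqrt[of "g (d * x)"] gp by simp
    qed
    from this[of 0] have A: "ln (w 0) = ln (g 0) / 2" by simp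
    from \<open>\<And>x. x \<ge> 0 \<Longrightarrow> ln (w x) = (1 / 2) * ln (g (d * x)) - ln (1 + x\<^sup>2)\<close>[of "2 ^ k"]
    have B: "ln (w (2 ^ k)) = ln (g (d * 2 ^ k)) / 2 - ln (1 + (2 ^ k)\<^sup>2)" by simp
    show ?thesis unfolding A B by (simp add: diff_divide_distrib)
  qed
  ultimately have summ: "summable (\<lambda>k. (ln (w 0) - ln (w (2 ^ k))) / 2 ^ k)" by simp
  \<comment> \<open>A vector of norm at least 1 has a coordinate of modulus at least
    \<open>1 / d\<close>, and one vanishing factor kills the whole product.\<close>
  have r: "1 / d > 0" using d by simp
  obtain h :: "real \<Rightarrow> real" and C :: real where hm [measurable]: "h \<in> borel_measurable borel" and h0: "\<And>x. 0 \<le> h x"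
    and h1: "\<And>x. h x \<le> 1" and hint: "integrable lborel h" and hpos: "(LBINT x. h x) > 0"
    and hvan: "\<And>t. \<bar>t\<bar> \<ge> 1 / d \<Longrightarrow> (CLBINT x. h x * iexp (t * x)) = 0"
    and C: "C > 0" and hw: "\<And>x. h x \<le> C * w \<bar>x\<bar>"
    by (rule ingham[OF r wpos wanti summ]) (assumption | (rule that; assumption))+
  define \<Psi> where "\<Psi> = (\<lambda>x::'a. \<Prod>b\<in>Basis. h (x \<bullet> b))"
  have \<Psi>0: "\<Psi> x \<ge> 0" for x unfolding \<Psi>_def by (intro prod_nonneg) (simp add: h0)
  have [measurable]: "\<Psi> \<in> borel_measurable borel" unfolding \<Psi>_def by measurable
  define c where "c = (LBINT x. \<Psi> x)"
  have \<Psi>int: "integrable lborel \<Psi>" and c: "c > 0"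
    using lborel_prod_coords[where 'a='a and f = "\<lambda>_. h"] hint hpos unfolding \<Psi>_def c_def by auto
  have van: "(CLBINT x. complex_of_real (\<Psi> x) * iexp (t \<bullet> x)) = 0" if t: "norm t \<ge> 1" for t
  proof -
    have ih: "integrable lborel (\<lambda>y. complex_of_real (h y) * iexp (s * y))" for s
      by (rule Bochner_Integration.integrable_bound[OF hint]) (auto simp: norm_mult)
    have e: "complex_of_real (\<Psi> x) * iexp (t \<bullet> x) = (\<Prod>b\<in>Basis. complex_of_real (h (x \<bullet> b)) * iexp ((t \<bullet> b) * (x \<bullet> b)))" for x
    proof -
      have "iexp (t \<bullet> x) = (\<Prod>b\<in>Basis. iexp ((t \<bullet> b) * (x \<bullet> b)))"
        unfolding euclidean_inner[of t x] by (simp only: of_real_sum sum_distrib_left exp_sum[OF finite_Basis])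
      then show ?thesis by (simp only: \<Psi>_def prod.distrib of_real_prod)
    qed
    have "\<exists>b\<in>Basis. \<bar>t \<bullet> b\<bar> \<ge> 1 / d"
    proof (rule ccontr)
      assume "\<not> ?thesis"
      then have "(\<Sum>b\<in>Basis. \<bar>t \<bullet> b\<bar>) < (\<Sum>b\<in>(Basis :: 'a set). 1 / d)" by (intro sum_strict_mono) auto
      also have "\<dots> = 1" using d by (simp add: d_def)
      finally show False using norm_le_l1[of t] t by simp
    qed
    then obtain b where b: "b \<in> Basis" "(CLBINT y. complex_of_real (h y) * iexp ((t \<bullet> b) * y)) = 0" using hvan by blast
    have "(CLBINT x. complex_of_real (\<Psi> x) * iexp (t \<bullet> x)) = (\<Prod>b\<in>Basis. (CLBINT y. complex_of_real (h y) * iexp ((t \<bullet> b) * y)))"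
      unfolding e by (rule lborel_prod_coords(2)) (rule ih)
    also have "\<dots> = 0" using b by (intro prod_zero) auto
    finally show ?thesis .
  qed
  define m where "m = max 1 (g 0)"
  define Q where "Q = (\<lambda>x::'a. \<Prod>b\<in>Basis. 1 / (1 + (x \<bullet> b)\<^sup>2))"
  have Qint: "integrable lborel Q" unfolding Q_def
    by (rule lborel_prod_coords(1)) (rule integrable_inverse_1_plus_square')
  have Q0: "Q x \<ge> 0" for x unfolding Q_def by (intro prod_nonneg) (auto simp: add_nonneg_nonneg)
  define N where "N = DIM('a)"
  define K0 where "K0 = (C\<^sup>2 * m) ^ N * (LBINT x. Q x)"
  have K00: "K0 \<ge> 0" unfolding K0_def m_def by (intro mult_nonneg_nonneg Bochner_Integration.integral_nonneg Q0 zero_le_power) (use C in auto)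
  have \<Psi>Q: "(\<Psi> x)\<^sup>2 / g (norm x) \<le> (C\<^sup>2 * m) ^ N * Q x" for x
  proof -
    \<comment> \<open>The coordinate of largest modulus supplies the factor
      \<open>g (norm x)\<close> that cancels the division; in all other coordinates \<open>g\<close>
      is merely bounded by \<open>m\<close>.\<close>
    have "Max ((\<lambda>b. \<bar>x \<bullet> b\<bar>) ` Basis) \<in> (\<lambda>b. \<bar>x \<bullet> b\<bar>) ` Basis" by (rule Max_in) auto
    then obtain b0 where b0: "Max ((\<lambda>b. \<bar>x \<bullet> b\<bar>) ` Basis) = \<bar>x \<bullet> b0\<bar>" "b0 \<in> Basis" by (rule imageE)
    have le: "\<bar>x \<bullet> b\<bar> \<le> \<bar>x \<bullet> b0\<bar>" if "b \<in> Basis" for b unfolding b0(1)[symmetric] using that by (intro Max_ge) auto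
    have "(\<Sum>b\<in>Basis. \<bar>x \<bullet> b\<bar>) \<le> (\<Sum>b\<in>(Basis :: 'a set). \<bar>x \<bullet> b0\<bar>)" by (rule sum_mono) (rule le)
    with norm_le_l1[of x] have "norm x \<le> (\<Sum>b\<in>(Basis :: 'a set). \<bar>x \<bullet> b0\<bar>)" by (rule order_trans)
    then have nx: "norm x \<le> d * \<bar>x \<bullet> b0\<bar>" by (simp add: d_def)
    have hb: "(h y)\<^sup>2 \<le> C\<^sup>2 * g (d * \<bar>y\<bar>) * (1 / (1 + y\<^sup>2))" for y
    proof -
      have gp: "g (d * \<bar>y\<bar>) > 0" using gpos d by simp
      have "(h y)\<^sup>2 \<le> (C * w \<bar>y\<bar>)\<^sup>2" using hw h0 by (intro power_mono) auto
      also have "\<dots> = C\<^sup>2 * g (d * \<bar>y\<bar>) * (1 / (1 + y\<^sup>2))\<^sup>2"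
        unfolding w_def using gp by (simp add: power_mult_distrib power_divide)
      also have "\<dots> \<le> C\<^sup>2 * g (d * \<bar>y\<bar>) * (1 / (1 + y\<^sup>2)) ^ 1"
        using gp pos1[of y] by (intro mult_left_mono power_decreasing) (auto simp: divide_le_eq)
      finally show ?thesis by simp
    qed
    have gm: "0 \<le> g (d * \<bar>y\<bar>)" "g (d * \<bar>y\<bar>) \<le> m" for y
    proof -
      have "g (d * \<bar>y\<bar>) \<le> g 0" by (rule gmono) (use d in auto)
      then show "g (d * \<bar>y\<bar>) \<le> m" by (simp add: m_def)
      show "0 \<le> g (d * \<bar>y\<bar>)" using gpos[of "d * \<bar>y\<bar>"] d by simp
    qed
    have m1: "m \<ge> 1" by (simp add: m_def)
    have prodg: "(\<Prod>b\<in>Basis. g (d * \<bar>x \<bullet> b\<bar>)) \<le> g (norm x) * m ^ N"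
    proof -
      have "(\<Prod>b\<in>Basis. g (d * \<bar>x \<bullet> b\<bar>)) = g (d * \<bar>x \<bullet> b0\<bar>) * (\<Prod>b\<in>Basis - {b0}. g (d * \<bar>x \<bullet> b\<bar>))"
        using b0 by (subst prod.remove[of _ b0]) auto
      also have "\<dots> \<le> g (norm x) * (\<Prod>b\<in>Basis - {b0}. m)"
        using gm gpos[of "norm x"] nx by (intro mult_mono prod_mono prod_nonneg gmono) auto
      also have "\<dots> \<le> g (norm x) * m ^ N"
      proof -
        have "(\<Prod>b\<in>(Basis - {b0}). m) \<le> m ^ N" using m1 by (auto simp: N_def intro!: power_increasing card_mono)
        then show ?thesis using gpos[of "norm x"] by (intro mult_left_mono) auto
      qed
      finally show ?thesis .
    qed
    have "(\<Psi> x)\<^sup>2 = (\<Prod>b\<in>Basis. (h (x \<bullet> b))\<^sup>2)" unfolding \<Psi>_def by (simp add: prod_power_distrib)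
    also have "\<dots> \<le> (\<Prod>b\<in>Basis. C\<^sup>2 * g (d * \<bar>x \<bullet> b\<bar>) * (1 / (1 + (x \<bullet> b)\<^sup>2)))"
      by (intro prod_mono conjI hb) auto
    also have "\<dots> = (C\<^sup>2) ^ N * (\<Prod>b\<in>Basis. g (d * \<bar>x \<bullet> b\<bar>)) * Q x"
      by (simp only: prod.distrib prod_constant Q_def N_def)
    also have "\<dots> \<le> (C\<^sup>2) ^ N * (g (norm x) * m ^ N) * Q x"
      using prodg Q0[of x] by (intro mult_right_mono mult_left_mono) auto
    finally show ?thesis using gpos[of "norm x"] by (simp add: pos_divide_le_eq power_mult_distrib mult_ac)
  qed
  define K where "K = (K0 + 1) / c\<^sup>2"
  have K: "K > 0" using K00 c by (simp add: K_def add_nonneg_pos)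
  show ?thesis
  proof (intro exI conjI allI impI)
    show "K > 0" by (rule K)
    fix F :: "'a set" and b :: "'a \<Rightarrow> real"
    assume F: "finite F \<and> (\<forall>t\<in>F. norm t \<ge> 1)"
    define S where "S = (\<lambda>x. \<Sum>t\<in>F. complex_of_real (b t) * (iexp (t \<bullet> x) - 1))"
    have [measurable]: "S \<in> borel_measurable borel" unfolding S_def by measurable
    let ?I = "\<integral>\<^sup>+x. ennreal ((cmod (S x))\<^sup>2 * g (norm x)) \<partial>lborel"
    have it: "integrable lborel (\<lambda>x. complex_of_real (\<Psi> x) * iexp (t \<bullet> x))" for t
      by (rule Bochner_Integration.integrable_bound[OF \<Psi>int]) (auto simp: norm_mult)
    have i1: "integrable lborel (\<lambda>x. complex_of_real (\<Psi> x))" using \<Psi>int by simp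
    have Se: "complex_of_real (\<Psi> x) * S x = (\<Sum>t\<in>F. complex_of_real (b t) * (complex_of_real (\<Psi> x) * iexp (t \<bullet> x) - complex_of_real (\<Psi> x)))" for x
      unfolding S_def sum_distrib_left by (intro sum.cong refl) (simp add: algebra_simps)
    have itS: "integrable lborel (\<lambda>x. complex_of_real (\<Psi> x) * S x)"
      unfolding Se by (intro Bochner_Integration.integrable_sum integrable_mult_right Bochner_Integration.integrable_diff it i1)
    have "(CLBINT x. complex_of_real (\<Psi> x) * S x) = (\<Sum>t\<in>F. (CLBINT x. complex_of_real (b t) * (complex_of_real (\<Psi> x) * iexp (t \<bullet> x) - complex_of_real (\<Psi> x))))"
      unfolding Se by (intro Bochner_Integration.integral_sum integrable_mult_right Bochner_Integration.integrable_diff it i1)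
    also have "\<dots> = (\<Sum>t\<in>F. complex_of_real (b t) * (0 - complex_of_real c))"
    proof (intro sum.cong refl)
      fix t assume "t \<in> F"
      then have "(CLBINT x. complex_of_real (\<Psi> x) * iexp (t \<bullet> x)) = 0" using F van by blast
      then show "(CLBINT x. complex_of_real (b t) * (complex_of_real (\<Psi> x) * iexp (t \<bullet> x) - complex_of_real (\<Psi> x))) = complex_of_real (b t) * (0 - complex_of_real c)"
        by (simp only: integral_mult_right_zero Bochner_Integration.integral_diff[OF it i1] integral_complex_of_real c_def)
    qed
    also have "\<dots> = complex_of_real (- c * (\<Sum>t\<in>F. b t))" by (simp add: sum_distrib_left sum_negf mult.commute)
    \<comment> \<open>Testing against \<open>\<Psi>\<close> sends each iexp (t . x) - 1 to
      \<open>- c\<close>, so the sum of the coefficients appears. Splitting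
      \<open>\<Psi> * S\<close> with sqrt g and applying Cauchy-Schwarz then separates the quadratic
      form from the integral of \<open>\<Psi>\<^sup>2 / g\<close>.\<close>
    finally have "ennreal \<bar>c * (\<Sum>t\<in>F. b t)\<bar> = ennreal (norm (CLBINT x. complex_of_real (\<Psi> x) * S x))"
      by (simp only: norm_of_real mult_minus_left abs_minus_cancel)
    also have "\<dots> \<le> (\<integral>\<^sup>+x. ennreal (norm (complex_of_real (\<Psi> x) * S x)) \<partial>lborel)"
      by (rule integral_norm_bound_ennreal[OF itS])
    also have "\<dots> = (\<integral>\<^sup>+x. ennreal (cmod (S x) * sqrt (g (norm x))) * ennreal (\<Psi> x / sqrt (g (norm x))) \<partial>lborel)"
    proof (rule nn_integral_cong)
      fix x :: 'a
      have "g (norm x) > 0" using gpos by simp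
      then show "ennreal (norm (complex_of_real (\<Psi> x) * S x)) = ennreal (cmod (S x) * sqrt (g (norm x))) * ennreal (\<Psi> x / sqrt (g (norm x)))"
        using \<Psi>0[of x] by (subst ennreal_mult[symmetric]) (auto simp: norm_mult)
    qed
    finally have 1: "ennreal \<bar>c * (\<Sum>t\<in>F. b t)\<bar> \<le> \<dots>" .
    have "ennreal ((c * (\<Sum>t\<in>F. b t))\<^sup>2) = (ennreal \<bar>c * (\<Sum>t\<in>F. b t)\<bar>)\<^sup>2" by (simp add: ennreal_power)
    also have "\<dots> \<le> (\<integral>\<^sup>+x. ennreal (cmod (S x) * sqrt (g (norm x))) * ennreal (\<Psi> x / sqrt (g (norm x))) \<partial>lborel)\<^sup>2"
      using 1 by (rule power_mono) simp
    also have "\<dots> \<le> (\<integral>\<^sup>+x. (ennreal (cmod (S x) * sqrt (g (norm x))))\<^sup>2 \<partial>lborel) * (\<integral>\<^sup>+x. (ennreal (\<Psi> x / sqrt (g (norm x))))\<^sup>2 \<partial>lborel)"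
      by (rule Cauchy_Schwarz_nn_integral) measurable
    also have "(\<integral>\<^sup>+x. (ennreal (cmod (S x) * sqrt (g (norm x))))\<^sup>2 \<partial>lborel) = ?I"
    proof (rule nn_integral_cong)
      fix x :: 'a
      have "g (norm x) > 0" using gpos by simp
      then show "(ennreal (cmod (S x) * sqrt (g (norm x))))\<^sup>2 = ennreal ((cmod (S x))\<^sup>2 * g (norm x))"
        by (simp add: ennreal_power power_mult_distrib)
    qed
    also have "(\<integral>\<^sup>+x. (ennreal (\<Psi> x / sqrt (g (norm x))))\<^sup>2 \<partial>lborel) \<le> (\<integral>\<^sup>+x. ennreal ((C\<^sup>2 * m) ^ N * Q x) \<partial>lborel)"
    proof (rule nn_integral_mono)
      fix x :: 'a
      have gp: "g (norm x) > 0" using gpos by simp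
      then have "(ennreal (\<Psi> x / sqrt (g (norm x))))\<^sup>2 = ennreal ((\<Psi> x)\<^sup>2 / g (norm x))"
        using \<Psi>0[of x] by (simp add: ennreal_power power_divide)
      then show "(ennreal (\<Psi> x / sqrt (g (norm x))))\<^sup>2 \<le> ennreal ((C\<^sup>2 * m) ^ N * Q x)"
        using \<Psi>Q by (simp add: ennreal_leI)
    qed
    also have "\<dots> = ennreal K0"
      using Qint Q0 unfolding K0_def m_def by (subst nn_integral_eq_integral) auto
    also have "\<dots> \<le> ennreal (K0 + 1)" by (intro ennreal_leI) simp
    finally have 2: "ennreal ((c * (\<Sum>t\<in>F. b t))\<^sup>2) \<le> ?I * ennreal (K0 + 1)" by (simp add: mult_left_mono)
    have "ennreal ((\<Sum>t\<in>F. b t)\<^sup>2) = ennreal (1 / c\<^sup>2) * ennreal ((c * (\<Sum>t\<in>F. b t))\<^sup>2)"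
      using c by (subst ennreal_mult[symmetric]) (auto simp: power_mult_distrib)
    also have "\<dots> \<le> ennreal (1 / c\<^sup>2) * (?I * ennreal (K0 + 1))" using 2 by (rule mult_left_mono) simp
    also have "\<dots> = ennreal K * ?I"
    proof -
      have "ennreal K = ennreal (1 / c\<^sup>2) * ennreal (K0 + 1)"
        using c K00 unfolding K_def by (subst ennreal_mult[symmetric]) auto
      then show ?thesis by (simp only: mult_ac)
    qed
    finally show "ennreal ((\<Sum>t\<in>F. b t)\<^sup>2) \<le> ennreal K *
      (\<integral>\<^sup>+x. ennreal ((cmod (\<Sum>t\<in>F. complex_of_real (b t) * (iexp (t \<bullet> x) - 1)))\<^sup>2 * g (norm x)) \<partial>lborel)"
      unfolding S_def .
  qed
qed

section \<open>Fractional Brownian motion as a mixture of Gaussian spectra\<close>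

definition fbm_kernel :: "real \<Rightarrow> 'a::euclidean_space \<Rightarrow> 'a \<Rightarrow> real" where
  "fbm_kernel H t s = (norm t powr (2 * H) + norm s powr (2 * H) - norm (t - s) powr (2 * H)) / 2"

text \<open>Near 0 the bound 1 - exp (-x) <= x leaves x^(-H), integrable since H < 1 and dominated
  by the integrand of Gamma (1 - H); beyond 1 the bound by x^(-H-1) is integrable since H >
  0.\<close>

lemma integrable_schoenberg_kernel:
  assumes H: "0 < H" "H < 1"
  shows "integrable lborel (\<lambda>x. indicator {0<..} x * (x powr (- H - 1) * (1 - exp (- x))) :: real)"
proof -
  define A where "A = (\<lambda>x. indicator {0<..} x * (x powr ((1 - H) - 1) / exp x) :: real)"
  define B where "B = (\<lambda>x. x powr (- H - 1) * indicator {1..} x :: real)"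
  have "(\<lambda>t. complex_of_real t powr (complex_of_real (1 - H) - 1) / of_real (exp t)) absolutely_integrable_on {0<..}"
    by (rule absolutely_integrable_Gamma_integral') (use H in simp)
  then have "integrable lebesgue (\<lambda>t. norm (indicat_real {0<..} t *\<^sub>R (complex_of_real t powr (complex_of_real (1 - H) - 1) / of_real (exp t))))"
    unfolding set_integrable_def by (rule integrable_norm)
  moreover have "norm (indicat_real {0<..} t *\<^sub>R (complex_of_real t powr (complex_of_real (1 - H) - 1) / of_real (exp t))) = A t" for t
  proof (cases "t > 0")
    case True
    have "complex_of_real t powr (complex_of_real (1 - H) - 1) = complex_of_real (t powr ((1 - H) - 1))"
      using powr_of_real[of t "(1 - H) - 1"] True by simp
    then show ?thesis using True by (simp add: A_def norm_divide del: of_real_diff)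
  qed (simp add: A_def)
  ultimately have "integrable lebesgue A" by simp
  then have Aint: "integrable lborel A"
    by (subst (asm) integrable_completion) (auto simp: A_def)
  have Bint: "integrable lborel B"
  proof (rule integrableI_nonneg)
    have "(\<integral>\<^sup>+x. ennreal (x powr (- H - 1)) * indicator {1..} x \<partial>lborel) = ennreal (0 - (- (1 powr (- H)) / H))"
    proof (rule nn_integral_FTC_atLeast)
      show "((\<lambda>x. - (x powr (- H)) / H) has_real_derivative x powr (- H - 1)) (at x)" if "1 \<le> x" for x
        using that H by (auto intro!: derivative_eq_intros)
      show "((\<lambda>x. - (x powr (- H)) / H) \<longlongrightarrow> 0) at_top" using H by real_asymp
    qed auto
    moreover have "(\<integral>\<^sup>+x. ennreal (B x) \<partial>lborel) = (\<integral>\<^sup>+x. ennreal (x powr (- H - 1)) * indicator {1..} x \<partial>lborel)"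
      unfolding B_def by (intro nn_integral_cong) (auto simp: indicator_def)
    ultimately show "(\<integral>\<^sup>+x. ennreal (B x) \<partial>lborel) < \<infinity>" by simp
  qed (auto simp: B_def)
  show ?thesis
  proof (rule Bochner_Integration.integrable_bound)
    show "integrable lborel (\<lambda>x. exp 1 * A x + B x)" using Aint Bint by simp
    show "AE x in lborel. norm (indicator {0<..} x * (x powr (- H - 1) * (1 - exp (- x))) :: real) \<le> norm (exp 1 * A x + B x)"
    proof (rule AE_I2)
      fix x :: real
      have nn: "A x \<ge> 0" "B x \<ge> 0" by (auto simp: A_def B_def)
      have "indicator {0<..} x * (x powr (- H - 1) * (1 - exp (- x))) \<le> exp 1 * A x + B x"
      proof (cases "x > 0")
        case True
        have e: "1 - exp (- x) \<le> x" "1 - exp (- x) \<le> 1" "0 \<le> 1 - exp (- x)"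
          using exp_ge_add_one_self[of "- x"] True by auto
        show ?thesis
        proof (cases "x \<ge> 1")
          case True
          have "x powr (- H - 1) * (1 - exp (- x)) \<le> x powr (- H - 1) * 1" by (intro mult_left_mono e) auto
          also have "\<dots> = B x" using True by (simp add: B_def)
          finally show ?thesis using nn True by (simp add: add_increasing)
        next
          case False
          have "x powr (- H - 1) * (1 - exp (- x)) \<le> x powr (- H - 1) * x" by (intro mult_left_mono e) auto
          also have "\<dots> = x powr (- H)" using powr_mult_base[of x "- H - 1"] \<open>x > 0\<close> by (simp add: mult.commute)
          also have "\<dots> \<le> exp 1 * A x"
          proof -
            have "exp x \<le> exp 1" using False by simp
            then have "1 \<le> exp 1 / exp x" by simp
            then have "x powr (- H) * 1 \<le> x powr (- H) * (exp 1 / exp x)" by (intro mult_left_mono) auto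
            then show ?thesis using \<open>x > 0\<close> by (simp add: A_def mult.commute)
          qed
          finally show ?thesis using nn \<open>x > 0\<close> by simp
        qed
      qed (use nn in auto)
      moreover have "0 \<le> indicator {0<..} x * (x powr (- H - 1) * (1 - exp (- x)))"
        by (auto simp: indicator_def intro!: mult_nonneg_nonneg)
      ultimately show "norm (indicator {0<..} x * (x powr (- H - 1) * (1 - exp (- x))) :: real) \<le> norm (exp 1 * A x + B x)"
        using nn by simp
    qed
  qed simp
qed

text \<open>The substitution of r^2 x for x scales the integral by r^(2H). It writes the variance of
  fractional Brownian motion as a mixture of the functions 1 - exp (- x r^2), each with an explicit
  Gaussian spectrum.\<close>

lemma schoenberg:
  assumes H: "0 < H" "H < 1"
  obtains C :: real where "C \<ge> 0" "\<And>r. r \<ge> 0 \<Longrightarrow> has_bochner_integral lborel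
    (\<lambda>x. indicat_real {0<..} x * (x powr (- H - 1) * (1 - exp (- x * r\<^sup>2)))) (C * r powr (2 * H))"
proof
  define f where "f = (\<lambda>x. indicator {0<..} x * (x powr (- H - 1) * (1 - exp (- x))) :: real)"
  define C where "C = (LBINT x. f x)"
  show "C \<ge> 0" unfolding C_def f_def
    by (rule Bochner_Integration.integral_nonneg) (auto simp: indicator_def intro!: mult_nonneg_nonneg)
  have f: "has_bochner_integral lborel f C"
    unfolding C_def by (rule has_bochner_integral_integrable) (use integrable_schoenberg_kernel[OF H] in \<open>simp add: f_def\<close>)
  fix r :: real assume r: "r \<ge> 0"
  show "has_bochner_integral lborel (\<lambda>x. indicat_real {0<..} x * (x powr (- H - 1) * (1 - exp (- x * r\<^sup>2)))) (C * r powr (2 * H))"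
  proof (cases "r = 0")
    case True
    then show ?thesis by (simp add: has_bochner_integral_zero)
  next
    case False
    then have rp: "r > 0" "r\<^sup>2 > 0" using r by auto
    have "has_bochner_integral lborel (\<lambda>x. f (0 + r\<^sup>2 * x)) (C /\<^sub>R \<bar>r\<^sup>2\<bar>)"
      using f rp by (subst lborel_has_bochner_integral_real_affine_iff[symmetric]) auto
    then have "has_bochner_integral lborel (\<lambda>x. (r\<^sup>2) powr (H + 1) * f (0 + r\<^sup>2 * x)) ((r\<^sup>2) powr (H + 1) * (C /\<^sub>R \<bar>r\<^sup>2\<bar>))"
      by (rule has_bochner_integral_mult_right)
    moreover have 2: "(r\<^sup>2) powr (H + 1) * f (0 + r\<^sup>2 * x) = indicat_real {0<..} x * (x powr (- H - 1) * (1 - exp (- x * r\<^sup>2)))" for x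
    proof (cases "x > 0")
      case True
      have "(r\<^sup>2) powr (H + 1) * (r\<^sup>2 * x) powr (- H - 1) = ((r\<^sup>2) powr (H + 1) * (r\<^sup>2) powr (- H - 1)) * x powr (- H - 1)"
        using True rp by (simp add: powr_mult)
      also have "(r\<^sup>2) powr (H + 1) * (r\<^sup>2) powr (- H - 1) = 1" using rp by (simp add: powr_add[symmetric])
      finally show ?thesis using True rp by (simp add: f_def mult.commute)
    next
      case False
      then show ?thesis using rp by (simp add: f_def zero_less_mult_iff)
    qed
    moreover have 3: "(r\<^sup>2) powr (H + 1) * (C /\<^sub>R \<bar>r\<^sup>2\<bar>) = C * r powr (2 * H)"
    proof -
      have "r powr (2 * H) = (r\<^sup>2) powr H" using rp powr_powr[of r 2 H] by simp
      then show ?thesis using rp by (simp add: powr_add field_simps)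
    qed
    ultimately show ?thesis by (simp only:)
  qed
qed

lemma normal_char_integral:
  assumes "\<sigma> > 0"
  shows "integrable lborel (\<lambda>y. complex_of_real (normal_density 0 \<sigma> y) * iexp (s * y))"
    and "(CLBINT y. complex_of_real (normal_density 0 \<sigma> y) * iexp (s * y)) = exp (- (\<sigma> * s)\<^sup>2 / 2)"
proof -
  have "integrable lborel (normal_density 0 \<sigma>)" by (rule integrable_normal_density) (rule assms)
  then show "integrable lborel (\<lambda>y. complex_of_real (normal_density 0 \<sigma> y) * iexp (s * y))"
    by (rule Bochner_Integration.integrable_bound) (auto simp: norm_mult)
  have dens: "\<sigma> * normal_density 0 \<sigma> (\<sigma> * y) = std_normal_density y" for y
    using assms by (simp add: normal_density_def power_mult_distrib real_sqrt_mult)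
  have "(CLBINT y. complex_of_real (normal_density 0 \<sigma> y) * iexp (s * y)) =
      \<bar>\<sigma>\<bar> *\<^sub>R (CLBINT y. complex_of_real (normal_density 0 \<sigma> (0 + \<sigma> * y)) * iexp (s * (0 + \<sigma> * y)))"
    by (rule lborel_integral_real_affine) (use assms in simp)
  also have "\<dots> = (CLBINT y. \<sigma> *\<^sub>R (complex_of_real (normal_density 0 \<sigma> (0 + \<sigma> * y)) * iexp (s * (0 + \<sigma> * y))))"
    using assms by (subst integral_scaleR_right) simp
  also have "\<dots> = (CLBINT y. std_normal_density y *\<^sub>R iexp ((\<sigma> * s) * y))"
    by (intro Bochner_Integration.integral_cong refl) (simp add: scaleR_conv_of_real dens[symmetric] mult_ac)
  also have "\<dots> = char std_normal_distribution (\<sigma> * s)"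
    unfolding char_def by (subst integral_density) auto
  also have "\<dots> = exp (- (\<sigma> * s)\<^sup>2 / 2)" by (simp add: char_std_normal_distribution)
  finally show "(CLBINT y. complex_of_real (normal_density 0 \<sigma> y) * iexp (s * y)) = exp (- (\<sigma> * s)\<^sup>2 / 2)" .
qed

text \<open>The heat kernel at time \<open>x\<close>: variance \<open>2 * x\<close> in each
  coordinate, so that its Fourier transform is exp (- x |t|^2).\<close>

definition gauss_density :: "real \<Rightarrow> 'a::euclidean_space \<Rightarrow> real" where
  "gauss_density x l = (\<Prod>b\<in>Basis. normal_density 0 (sqrt (2 * x)) (l \<bullet> b))"

lemma gauss_density_char:
  assumes "x > 0"
  shows "integrable lborel (\<lambda>l::'a::euclidean_space. complex_of_real (gauss_density x l) * iexp (t \<bullet> l))"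
    and "(CLBINT l. complex_of_real (gauss_density x l) * iexp ((t::'a) \<bullet> l)) = exp (- x * (norm t)\<^sup>2)"
proof -
  have s: "sqrt (2 * x) > 0" using assms by simp
  have e: "complex_of_real (gauss_density x l) * iexp (t \<bullet> l) =
      (\<Prod>b\<in>Basis. complex_of_real (normal_density 0 (sqrt (2 * x)) (l \<bullet> b)) * iexp ((t \<bullet> b) * (l \<bullet> b)))" for l
  proof -
    have "iexp (t \<bullet> l) = (\<Prod>b\<in>Basis. iexp ((t \<bullet> b) * (l \<bullet> b)))"
      unfolding euclidean_inner[of t l] by (simp only: of_real_sum sum_distrib_left exp_sum[OF finite_Basis])
    then show ?thesis by (simp only: gauss_density_def prod.distrib of_real_prod)
  qed
  show "integrable lborel (\<lambda>l. complex_of_real (gauss_density x l) * iexp (t \<bullet> l))"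
    unfolding e by (rule lborel_prod_coords(1)) (rule normal_char_integral[OF s])
  have "(CLBINT l. complex_of_real (gauss_density x l) * iexp (t \<bullet> l)) =
      (\<Prod>b\<in>Basis. (CLBINT y. complex_of_real (normal_density 0 (sqrt (2 * x)) y) * iexp ((t \<bullet> b) * y)))"
    unfolding e by (rule lborel_prod_coords(2)) (rule normal_char_integral[OF s])
  also have "\<dots> = (\<Prod>b\<in>Basis. complex_of_real (exp (- x * (t \<bullet> b)\<^sup>2)))"
    unfolding normal_char_integral(2)[OF s] using assms by (intro prod.cong refl) (simp add: power_mult_distrib)
  also have "\<dots> = complex_of_real (exp (\<Sum>b\<in>Basis. - x * (t \<bullet> b)\<^sup>2))"
    by (simp only: exp_sum[OF finite_Basis] of_real_prod)
  also have "(\<Sum>b\<in>Basis. - x * (t \<bullet> b)\<^sup>2) = - x * (norm t)\<^sup>2"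
    unfolding norm_eq_sqrt_inner euclidean_inner[of t t] by (simp add: sum_nonneg sum_distrib_left power2_eq_square)
  finally show "(CLBINT l. complex_of_real (gauss_density x l) * iexp (t \<bullet> l)) = exp (- x * (norm t)\<^sup>2)" .
qed

lemma gauss_density_nonneg: "gauss_density x l \<ge> 0"
  unfolding gauss_density_def by (intro prod_nonneg) auto

lemma gauss_density_eq:
  assumes "x > 0"
  shows "gauss_density x (l::'a::euclidean_space) = (1 / sqrt (4 * pi * x)) ^ DIM('a) * exp (- (norm l)\<^sup>2 / (4 * x))"
proof -
  have "gauss_density x l = (\<Prod>b\<in>Basis. (1 / sqrt (4 * pi * x)) * exp (- (l \<bullet> b)\<^sup>2 / (4 * x)))"
    unfolding gauss_density_def normal_density_def using assms by (intro prod.cong refl) (simp add: mult_ac)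
  also have "\<dots> = (1 / sqrt (4 * pi * x)) ^ DIM('a) * exp (\<Sum>b\<in>Basis. - (l \<bullet> b)\<^sup>2 / (4 * x))"
    by (simp only: prod.distrib prod_constant exp_sum[OF finite_Basis])
  also have "(\<Sum>b\<in>Basis. - (l \<bullet> b)\<^sup>2 / (4 * x)) = - (norm l)\<^sup>2 / (4 * x)"
    unfolding norm_eq_sqrt_inner euclidean_inner[of l l]
    by (simp add: sum_nonneg sum_divide_distrib sum_negf power2_eq_square)
  finally show ?thesis .
qed

text \<open>Only the times \<open>x\<close> between \<open>p\<close> and \<open>2 * p\<close> are
  kept. There |l|^2 <= x, so the exponential is at least exp (-1/4), and all powers of
  \<open>x\<close> are comparable to powers of \<open>p\<close>. The result decays polynomially in
  |l|.\<close>

lemma gauss_mixture_lower: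
  fixes l :: "'a::euclidean_space"
  assumes H: "H > 0"
  defines "p \<equiv> 1 + (norm l)\<^sup>2"
  shows "ennreal (2 powr (- H - 1) * (1 / sqrt (8 * pi)) ^ DIM('a) * exp (- 1 / 4) * (p powr (- H) * (1 / sqrt p) ^ DIM('a)))
    \<le> (\<integral>\<^sup>+x. ennreal (indicator {0<..} x * (x powr (- H - 1) * gauss_density x l)) \<partial>lborel)"
proof -
  define c where "c = (2 * p) powr (- H - 1) * ((1 / sqrt (8 * pi * p)) ^ DIM('a) * exp (- 1 / 4))"
  have p: "p \<ge> 1" "(norm l)\<^sup>2 \<le> p" by (auto simp: p_def)
  have c0: "c \<ge> 0" unfolding c_def using p by (intro mult_nonneg_nonneg zero_le_power) auto
  have "c * p = ((2 * p) powr (- H - 1) * p) * ((1 / sqrt (8 * pi * p)) ^ DIM('a) * exp (- 1 / 4))" by (simp add: c_def)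
  also have "(2 * p) powr (- H - 1) * p = 2 powr (- H - 1) * p powr (- H)"
    using p powr_mult_base[of p "- H - 1"] by (simp add: powr_mult mult_ac)
  also have "(1 / sqrt (8 * pi * p)) ^ DIM('a) = (1 / sqrt (8 * pi)) ^ DIM('a) * (1 / sqrt p) ^ DIM('a)"
    by (simp add: real_sqrt_mult power_mult_distrib power_divide)
  finally have cp: "2 powr (- H - 1) * (1 / sqrt (8 * pi)) ^ DIM('a) * exp (- 1 / 4) * (p powr (- H) * (1 / sqrt p) ^ DIM('a)) = c * p"
    by (simp add: mult_ac)
  have "ennreal (c * p) = (\<integral>\<^sup>+x. ennreal c * indicator {p..2 * p} x \<partial>lborel)"
    using p c0 by (simp add: nn_integral_cmult ennreal_mult)
  also have "\<dots> \<le> (\<integral>\<^sup>+x. ennreal (indicator {0<..} x * (x powr (- H - 1) * gauss_density x l)) \<partial>lborel)"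
  proof (rule nn_integral_mono)
    fix x :: real
    show "ennreal c * indicator {p..2 * p} x \<le> ennreal (indicator {0<..} x * (x powr (- H - 1) * gauss_density x l))"
    proof (cases "x \<in> {p..2 * p}")
      case True
      then have x: "p \<le> x" "x \<le> 2 * p" "x > 0" using p by auto
      have "c \<le> x powr (- H - 1) * gauss_density x l"
        unfolding c_def gauss_density_eq[OF x(3)]
      proof (intro mult_mono power_mono)
        show "(2 * p) powr (- H - 1) \<le> x powr (- H - 1)" using x H by (intro powr_mono2') auto
        have "sqrt (4 * pi * x) \<le> sqrt (8 * pi * p)" using x by simp
        then show "1 / sqrt (8 * pi * p) \<le> 1 / sqrt (4 * pi * x)" using x by (intro divide_left_mono) auto
        have "(norm l)\<^sup>2 / (4 * x) \<le> x / (4 * x)" using p x by (intro divide_right_mono) auto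
        then show "exp (- 1 / 4) \<le> exp (- (norm l)\<^sup>2 / (4 * x))" using x by simp
      qed (use x p in auto)
      then show ?thesis using True x by (simp add: ennreal_leI)
    qed simp
  qed
  finally show ?thesis unfolding cp .
qed

text \<open>Expanding the squared modulus gives four exponentials per pair, whose integrals are
  known. Nonnegativity is stated separately because \<open>ennreal\<close> would hide a negative
  value.\<close>

lemma gauss_quadratic_form:
  fixes F :: "'a::euclidean_space set" and b :: "'a \<Rightarrow> real"
  assumes x: "x > 0"
  shows "(\<integral>\<^sup>+l. ennreal (gauss_density x l * (cmod (\<Sum>t\<in>F. complex_of_real (b t) * (iexp (t \<bullet> l) - 1)))\<^sup>2) \<partial>lborel) =
    ennreal (\<Sum>t\<in>F. \<Sum>s\<in>F. b t * b s * ((1 - exp (- x * (norm t)\<^sup>2)) + (1 - exp (- x * (norm s)\<^sup>2)) - (1 - exp (- x * (norm (t - s))\<^sup>2))))"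
    and "0 \<le> (\<Sum>t\<in>F. \<Sum>s\<in>F. b t * b s * ((1 - exp (- x * (norm t)\<^sup>2)) + (1 - exp (- x * (norm s)\<^sup>2)) - (1 - exp (- x * (norm (t - s))\<^sup>2))))"
proof -
  define S where "S = (\<lambda>l. \<Sum>t\<in>F. complex_of_real (b t) * (iexp (t \<bullet> l) - 1))"
  define f where "f = (\<lambda>l. gauss_density x l * (cmod (S l))\<^sup>2)"
  define q where "q = (\<Sum>t\<in>F. \<Sum>s\<in>F. b t * b s * ((1 - exp (- x * (norm t)\<^sup>2)) + (1 - exp (- x * (norm s)\<^sup>2)) - (1 - exp (- x * (norm (t - s))\<^sup>2))))"
  define E where "E = (\<lambda>(t::'a) l. complex_of_real (gauss_density x l) * iexp (t \<bullet> l :: real))"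
  have Eint: "integrable lborel (E t)" "(CLBINT l. E t l) = exp (- x * (norm t)\<^sup>2)" for t
    unfolding E_def using gauss_density_char[OF x, of t] by auto
  have e: "complex_of_real (f l) = (\<Sum>t\<in>F. \<Sum>s\<in>F. complex_of_real (b t * b s) * (E (t - s) l - E t l - E (- s) l + E 0 l))" for l
  proof -
    have "complex_of_real ((cmod (S l))\<^sup>2) = S l * cnj (S l)" by (rule complex_norm_square)
    also have "\<dots> = (\<Sum>t\<in>F. \<Sum>s\<in>F. (complex_of_real (b t) * (iexp (t \<bullet> l) - 1)) * (complex_of_real (b s) * (iexp (- s \<bullet> l) - 1)))"
      unfolding S_def by (simp add: sum_product exp_cnj)
    finally have "complex_of_real (f l) = (\<Sum>t\<in>F. \<Sum>s\<in>F. complex_of_real (gauss_density x l) * ((complex_of_real (b t) * (iexp (t \<bullet> l) - 1)) * (complex_of_real (b s) * (iexp (- s \<bullet> l) - 1))))"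
      unfolding f_def by (simp only: of_real_mult sum_distrib_left)
    also have "\<dots> = (\<Sum>t\<in>F. \<Sum>s\<in>F. complex_of_real (b t * b s) * (E (t - s) l - E t l - E (- s) l + E 0 l))"
    proof (intro sum.cong refl)
      fix t s :: 'a
      have "iexp ((t - s) \<bullet> l) = iexp (t \<bullet> l) * iexp (- s \<bullet> l)"
        unfolding exp_add[symmetric] by (simp add: inner_diff_left algebra_simps)
      then show "complex_of_real (gauss_density x l) * ((complex_of_real (b t) * (iexp (t \<bullet> l) - 1)) * (complex_of_real (b s) * (iexp (- s \<bullet> l) - 1))) =
        complex_of_real (b t * b s) * (E (t - s) l - E t l - E (- s) l + E 0 l)"
        unfolding E_def by (simp only:) (simp add: algebra_simps)
    qed
    finally show ?thesis .
  qed
  have fint': "integrable lborel (\<lambda>l. complex_of_real (f l))"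
    unfolding e by (intro Bochner_Integration.integrable_sum integrable_mult_right Bochner_Integration.integrable_add Bochner_Integration.integrable_diff Eint(1))
  then have fint: "integrable lborel f" by (rule complex_of_real_integrable_eq[THEN iffD1])
  have "complex_of_real (LBINT l. f l) = (CLBINT l. complex_of_real (f l))" by simp
  also have "\<dots> = (\<Sum>t\<in>F. (CLBINT l. (\<Sum>s\<in>F. complex_of_real (b t * b s) * (E (t - s) l - E t l - E (- s) l + E 0 l))))"
    unfolding e by (intro Bochner_Integration.integral_sum Bochner_Integration.integrable_sum integrable_mult_right Bochner_Integration.integrable_add Bochner_Integration.integrable_diff Eint(1))
  also have "\<dots> = (\<Sum>t\<in>F. \<Sum>s\<in>F. (CLBINT l. complex_of_real (b t * b s) * (E (t - s) l - E t l - E (- s) l + E 0 l)))"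
    by (intro sum.cong refl Bochner_Integration.integral_sum integrable_mult_right Bochner_Integration.integrable_add Bochner_Integration.integrable_diff Eint(1))
  also have "\<dots> = (\<Sum>t\<in>F. \<Sum>s\<in>F. complex_of_real (b t * b s) * (exp (- x * (norm (t - s))\<^sup>2) - exp (- x * (norm t)\<^sup>2) - exp (- x * (norm (- s))\<^sup>2) + exp (- x * (norm (0::'a))\<^sup>2)))"
  proof (intro sum.cong refl)
    fix t s :: 'a
    have "(CLBINT l. complex_of_real (b t * b s) * (E (t - s) l - E t l - E (- s) l + E 0 l)) =
       complex_of_real (b t * b s) * ((CLBINT l. E (t - s) l) - (CLBINT l. E t l) - (CLBINT l. E (- s) l) + (CLBINT l. E 0 l))"
      by (simp only: integral_mult_right_zero Bochner_Integration.integral_add Bochner_Integration.integral_diff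
          Bochner_Integration.integrable_diff Eint(1))
    then show "(CLBINT l. complex_of_real (b t * b s) * (E (t - s) l - E t l - E (- s) l + E 0 l)) =
       complex_of_real (b t * b s) * (exp (- x * (norm (t - s))\<^sup>2) - exp (- x * (norm t)\<^sup>2) - exp (- x * (norm (- s))\<^sup>2) + exp (- x * (norm (0::'a))\<^sup>2))"
      unfolding Eint(2) by simp
  qed
  also have "\<dots> = complex_of_real q"
    unfolding q_def of_real_sum by (intro sum.cong refl) (simp add: algebra_simps)
  finally have L: "(LBINT l. f l) = q" by (simp only: of_real_eq_iff)
  have f0: "f l \<ge> 0" for l unfolding f_def by (intro mult_nonneg_nonneg gauss_density_nonneg) simp
  show "(\<integral>\<^sup>+l. ennreal (gauss_density x l * (cmod (\<Sum>t\<in>F. complex_of_real (b t) * (iexp (t \<bullet> l) - 1)))\<^sup>2) \<partial>lborel) =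
    ennreal (\<Sum>t\<in>F. \<Sum>s\<in>F. b t * b s * ((1 - exp (- x * (norm t)\<^sup>2)) + (1 - exp (- x * (norm s)\<^sup>2)) - (1 - exp (- x * (norm (t - s))\<^sup>2))))"
    using nn_integral_eq_integral[OF fint] f0 unfolding L unfolding f_def S_def q_def by simp
  have "0 \<le> (LBINT l. f l)" by (rule Bochner_Integration.integral_nonneg) (rule f0)
  then show "0 \<le> (\<Sum>t\<in>F. \<Sum>s\<in>F. b t * b s * ((1 - exp (- x * (norm t)\<^sup>2)) + (1 - exp (- x * (norm s)\<^sup>2)) - (1 - exp (- x * (norm (t - s))\<^sup>2))))"
    unfolding L q_def .
qed

text \<open>The mixture of heat kernels plays the role of the spectral density, so no explicit
  density is computed. Its polynomial minorant \<open>g\<close> satisfies the decay condition, and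
  Tonelli's theorem identifies the integral of the mixture against the squared trigonometric sum
  with the quadratic form of the kernel.\<close>

lemma fbm_rkhs:
  assumes H: "0 < H" "H < 1"
  shows "\<exists>K\<ge>0. \<forall>F b. finite F \<and> (\<forall>t\<in>F. norm (t::'a::euclidean_space) \<ge> 1) \<longrightarrow>
    (\<Sum>t\<in>F. b t)\<^sup>2 \<le> K * (\<Sum>t\<in>F. \<Sum>s\<in>F. b t * b s * fbm_kernel H t s)"
proof -
  obtain C where C: "C \<ge> 0" and sch: "\<And>r. r \<ge> 0 \<Longrightarrow> has_bochner_integral lborel
    (\<lambda>x. indicat_real {0<..} x * (x powr (- H - 1) * (1 - exp (- x * r\<^sup>2)))) (C * r powr (2 * H))"
    by (rule schoenberg[OF H]) blast
  define d where "d = DIM('a)"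
  define c1 where "c1 = 2 powr (- H - 1) * (1 / sqrt (8 * pi)) ^ d * exp (- 1 / 4)"
  have c1: "c1 > 0" unfolding c1_def by (intro mult_pos_pos zero_less_power) auto
  define g where "g = (\<lambda>r::real. c1 * ((1 + r\<^sup>2) powr (- H) * (1 / sqrt (1 + r\<^sup>2)) ^ d))"
  have pos1: "1 + r\<^sup>2 > 0" for r :: real by (simp add: add_pos_nonneg)
  have pos2: "1 / sqrt (1 + r\<^sup>2) > 0" for r :: real using pos1[of r] by simp
  have gpos: "g x > 0" for x
    unfolding g_def using c1 pos1[of x] pos2[of x] by (intro mult_pos_pos zero_less_power) auto
  have gmono: "g y \<le> g x" if "0 \<le> x" "x \<le> y" for x y
  proof -
    have "x\<^sup>2 \<le> y\<^sup>2" using that by (intro power_mono) auto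
    then show ?thesis unfolding g_def using c1 H pos1[of x] pos1[of y] pos2[of x] pos2[of y]
      by (intro mult_left_mono mult_mono power_mono powr_mono2' frac_le) auto
  qed
  have gcont: "continuous_on {0..} g"
    unfolding g_def using pos1 by (intro continuous_intros) (auto simp: less_imp_neq[symmetric] add_nonneg_eq_0_iff)
  have gln: "ln (g x) = ln c1 - (H + real d / 2) * ln (1 + x\<^sup>2)" for x
  proof -
    have "ln (g x) = ln c1 + (ln ((1 + x\<^sup>2) powr (- H)) + ln ((1 / sqrt (1 + x\<^sup>2)) ^ d))"
      unfolding g_def using c1 pos1[of x] pos2[of x] by (simp add: ln_mult)
    also have "ln ((1 / sqrt (1 + x\<^sup>2)) ^ d) = - real d / 2 * ln (1 + x\<^sup>2)"
      using pos1[of x] by (simp add: ln_realpow ln_div ln_sqrt)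
    also have "ln ((1 + x\<^sup>2) powr (- H)) = - H * ln (1 + x\<^sup>2)" using pos1[of x] by (simp add: ln_powr)
    finally show ?thesis by (simp add: algebra_simps)
  qed
  \<comment> \<open>ln \<open>g\<close> is a multiple of ln (1 + x^2) up to a constant, and 1 +
    (\<open>\<delta>\<close> y)^2 <= (1 + \<open>\<delta>\<^sup>2\<close>) (1 + y^2) separates the
    scale \<open>\<delta>\<close>.\<close>
  have gsum: "summable (\<lambda>k. (ln (g 0) - ln (g (\<delta> * 2 ^ k))) / 2 ^ k)" if \<delta>: "\<delta> > 0" for \<delta> :: real
  proof (rule summable_comparison_test)
    show "summable (\<lambda>k. (H + real d / 2) * (ln (1 + \<delta>\<^sup>2) * (1 / 2) ^ k + ln (1 + (2 ^ k)\<^sup>2) / 2 ^ k))"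
      by (intro summable_mult summable_add summable_ln_one_plus_power4 summable_geometric) auto
    show "\<exists>N. \<forall>k\<ge>N. norm ((ln (g 0) - ln (g (\<delta> * 2 ^ k))) / 2 ^ k) \<le> (H + real d / 2) * (ln (1 + \<delta>\<^sup>2) * (1 / 2) ^ k + ln (1 + (2 ^ k)\<^sup>2) / 2 ^ k)"
    proof (intro exI allI impI)
      fix k :: nat
      define y where "y = (2::real) ^ k"
      have y: "y > 0" by (simp add: y_def)
      have "ln (1 + (\<delta> * y)\<^sup>2) \<le> ln ((1 + \<delta>\<^sup>2) * (1 + y\<^sup>2))"
        using pos1[of "\<delta> * y"] pos1[of \<delta>] pos1[of y] by (subst ln_le_cancel_iff) (simp, simp, simp add: algebra_simps power_mult_distrib)
      also have "\<dots> = ln (1 + \<delta>\<^sup>2) + ln (1 + y\<^sup>2)" using pos1[of \<delta>] pos1[of y] by (simp add: ln_mult)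
      finally have l: "ln (1 + (\<delta> * y)\<^sup>2) / y \<le> ln (1 + \<delta>\<^sup>2) * (1 / y) + ln (1 + y\<^sup>2) / y"
        using y by (simp add: divide_right_mono add_divide_distrib[symmetric])
      have eq: "(ln (g 0) - ln (g (\<delta> * y))) / y = (H + real d / 2) * (ln (1 + (\<delta> * y)\<^sup>2) / y)"
        unfolding gln by simp
      have nn: "ln (1 + (\<delta> * y)\<^sup>2) / y \<ge> 0" using y by simp
      have "norm ((ln (g 0) - ln (g (\<delta> * y))) / y) = (H + real d / 2) * (ln (1 + (\<delta> * y)\<^sup>2) / y)"
        unfolding eq using nn H by (simp only: real_norm_def) (intro abs_of_nonneg mult_nonneg_nonneg; simp)
      also have "\<dots> \<le> (H + real d / 2) * (ln (1 + \<delta>\<^sup>2) * (1 / y) + ln (1 + y\<^sup>2) / y)"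
        using l H by (intro mult_left_mono) auto
      finally show "norm ((ln (g 0) - ln (g (\<delta> * 2 ^ k))) / 2 ^ k) \<le> (H + real d / 2) * (ln (1 + \<delta>\<^sup>2) * (1 / 2) ^ k + ln (1 + (2 ^ k)\<^sup>2) / 2 ^ k)"
        unfolding y_def by (simp add: power_divide)
    qed
  qed
  obtain K where K: "K > 0" and rk: "\<And>F b. finite F \<and> (\<forall>t\<in>F. norm (t::'a) \<ge> 1) \<Longrightarrow>
    ennreal ((\<Sum>t\<in>F. b t)\<^sup>2) \<le> ennreal K *
      (\<integral>\<^sup>+x. ennreal ((cmod (\<Sum>t\<in>F. complex_of_real (b t) * (iexp (t \<bullet> x) - 1)))\<^sup>2 * g (norm x)) \<partial>lborel)"
    using rkhs_constant[where 'a='a, OF gpos gmono gcont gsum] by blast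
  show ?thesis
  proof (intro exI conjI allI impI)
    show "0 \<le> K * (2 * C)" using K C by simp
    fix F :: "'a set" and b :: "'a \<Rightarrow> real"
    assume F: "finite F \<and> (\<forall>t\<in>F. norm t \<ge> 1)"
    define S where "S = (\<lambda>l. (cmod (\<Sum>t\<in>F. complex_of_real (b t) * (iexp (t \<bullet> l) - 1)))\<^sup>2)"
    have [measurable]: "S \<in> borel_measurable borel" unfolding S_def by measurable
    have S0: "S l \<ge> 0" for l by (simp add: S_def)
    define \<phi> where "\<phi> = (\<lambda>x t. 1 - exp (- x * (norm (t::'a))\<^sup>2))"
    define A where "A = (\<lambda>x. \<Sum>t\<in>F. \<Sum>s\<in>F. b t * b s * (\<phi> x t + \<phi> x s - \<phi> x (t - s)))"
    define k where "k = (\<lambda>x. indicat_real {0<..} x * x powr (- H - 1))"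
    have k0: "k x \<ge> 0" for x by (simp add: k_def)
    have [measurable]: "k \<in> borel_measurable borel" unfolding k_def by measurable
    have [measurable]: "(\<lambda>(l::'a, x). gauss_density x l) \<in> borel_measurable (borel \<Otimes>\<^sub>M borel)"
      unfolding gauss_density_def normal_density_def by measurable
    define v where "v = (\<Sum>t\<in>F. \<Sum>s\<in>F. b t * b s * fbm_kernel H t s)"
    have A0: "A x \<ge> 0" if "x > 0" for x
      using gauss_quadratic_form(2)[OF that, of b F] unfolding A_def \<phi>_def .
    have kA: "has_bochner_integral lborel (\<lambda>x. k x * A x) (C * (2 * v))"
    proof -
      have h: "has_bochner_integral lborel (\<lambda>x. k x * \<phi> x t) (C * norm t powr (2 * H))" for t
        using sch[of "norm t"] unfolding k_def \<phi>_def by (simp add: mult.assoc)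
      have "has_bochner_integral lborel (\<lambda>x. \<Sum>t\<in>F. \<Sum>s\<in>F. (b t * b s) * (k x * \<phi> x t + k x * \<phi> x s - k x * \<phi> x (t - s)))
         (\<Sum>t\<in>F. \<Sum>s\<in>F. (b t * b s) * (C * norm t powr (2 * H) + C * norm s powr (2 * H) - C * norm (t - s) powr (2 * H)))"
        by (intro has_bochner_integral_sum has_bochner_integral_mult_right has_bochner_integral_add has_bochner_integral_diff h)
      moreover have "(\<Sum>t\<in>F. \<Sum>s\<in>F. (b t * b s) * (k x * \<phi> x t + k x * \<phi> x s - k x * \<phi> x (t - s))) = k x * A x" for x
        unfolding A_def sum_distrib_left by (intro sum.cong refl) (simp add: algebra_simps)
      moreover have "(\<Sum>t\<in>F. \<Sum>s\<in>F. (b t * b s) * (C * norm t powr (2 * H) + C * norm s powr (2 * H) - C * norm (t - s) powr (2 * H))) = C * (2 * v)"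
        unfolding v_def sum_distrib_left fbm_kernel_def by (intro sum.cong refl) (simp add: algebra_simps)
      ultimately show ?thesis by (simp only:)
    qed
    have kA0: "k x * A x \<ge> 0" for x using A0[of x] k0[of x] by (cases "x > 0") (auto simp: k_def)
    have v0: "C * (2 * v) \<ge> 0"
      using has_bochner_integral_integral_eq[OF kA] Bochner_Integration.integral_nonneg[of lborel "\<lambda>x. k x * A x"] kA0 by simp
    have "(\<integral>\<^sup>+l. ennreal (S l * g (norm l)) \<partial>lborel) \<le> (\<integral>\<^sup>+l. (\<integral>\<^sup>+x. ennreal (S l) * ennreal (k x * gauss_density x l) \<partial>lborel) \<partial>lborel)"
    proof (rule nn_integral_mono)
      fix l :: 'a
      have "ennreal (S l * g (norm l)) = ennreal (S l) * ennreal (g (norm l))"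
        using S0 gpos[of "norm l"] by (intro ennreal_mult) auto
      also have "\<dots> \<le> ennreal (S l) * (\<integral>\<^sup>+x. ennreal (k x * gauss_density x l) \<partial>lborel)"
        using gauss_mixture_lower[OF H(1), of l] unfolding g_def c1_def d_def k_def by (intro mult_left_mono) (auto simp: mult.assoc)
      also have "\<dots> = (\<integral>\<^sup>+x. ennreal (S l) * ennreal (k x * gauss_density x l) \<partial>lborel)"
        by (rule nn_integral_cmult[symmetric]) measurable
      finally show "ennreal (S l * g (norm l)) \<le> (\<integral>\<^sup>+x. ennreal (S l) * ennreal (k x * gauss_density x l) \<partial>lborel)" .
    qed
    also have "\<dots> = (\<integral>\<^sup>+x. (\<integral>\<^sup>+l. ennreal (S l) * ennreal (k x * gauss_density x l) \<partial>lborel) \<partial>lborel)"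
      by (rule lborel_pair.Fubini'[symmetric]) measurable
    also have "\<dots> = (\<integral>\<^sup>+x. ennreal (k x * A x) \<partial>lborel)"
    proof (rule nn_integral_cong)
      fix x :: real
      show "(\<integral>\<^sup>+l. ennreal (S l) * ennreal (k x * gauss_density x l) \<partial>lborel) = ennreal (k x * A x)"
      proof (cases "x > 0")
        case True
        have "(\<integral>\<^sup>+l. ennreal (S l) * ennreal (k x * gauss_density x l) \<partial>lborel) = (\<integral>\<^sup>+l. ennreal (k x) * ennreal (gauss_density x l * S l) \<partial>lborel)"
        proof (rule nn_integral_cong)
          fix l :: 'a
          show "ennreal (S l) * ennreal (k x * gauss_density x l) = ennreal (k x) * ennreal (gauss_density x l * S l)"
            using S0[of l] k0[of x] gauss_density_nonneg[of x l] by (simp add: ennreal_mult[symmetric] mult_ac)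
        qed
        also have "\<dots> = ennreal (k x) * (\<integral>\<^sup>+l. ennreal (gauss_density x l * S l) \<partial>lborel)"
          by (rule nn_integral_cmult) measurable
        also have "\<dots> = ennreal (k x) * ennreal (A x)"
          unfolding S_def gauss_quadratic_form(1)[OF True] A_def \<phi>_def ..
        also have "\<dots> = ennreal (k x * A x)" using k0 A0[OF True] by (simp add: ennreal_mult)
        finally show ?thesis .
      qed (simp add: k_def)
    qed
    also have "\<dots> = ennreal (C * (2 * v))"
      using kA kA0 by (subst nn_integral_eq_integral) (auto simp: has_bochner_integral_iff)
    finally have 1: "(\<integral>\<^sup>+l. ennreal (S l * g (norm l)) \<partial>lborel) \<le> ennreal (C * (2 * v))" .
    have "ennreal ((\<Sum>t\<in>F. b t)\<^sup>2) \<le> ennreal K * (\<integral>\<^sup>+l. ennreal (S l * g (norm l)) \<partial>lborel)"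
      unfolding S_def by (rule rk[OF F])
    also have "\<dots> \<le> ennreal K * ennreal (C * (2 * v))" using 1 by (rule mult_left_mono) simp
    also have "\<dots> = ennreal (K * (C * (2 * v)))" using K v0 by (simp add: ennreal_mult)
    finally show "(\<Sum>t\<in>F. b t)\<^sup>2 \<le> K * (2 * C) * (\<Sum>t\<in>F. \<Sum>s\<in>F. b t * b s * fbm_kernel H t s)"
      using mult_nonneg_nonneg[OF less_imp_le[OF K] v0] unfolding v_def[symmetric] by (subst (asm) ennreal_le_iff) (auto simp: mult_ac)
  qed
qed

section \<open>Isotropic fields with stationary increments\<close>

text \<open>Stationarity and isotropy are recorded through the covariance alone, \<open>V\<close>
  being the variance as a function of the distance. Invariance then holds under every orthogonal
  map, reflections included, whereas isotropy is assumed for rotations only.\<close>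

definition iso_field :: "'w measure \<Rightarrow> (real \<Rightarrow> real) \<Rightarrow> ('t::euclidean_space \<Rightarrow> 'w \<Rightarrow> real) \<Rightarrow> bool" where
  "iso_field M V \<xi> \<longleftrightarrow> centered_gaussian_process M \<xi> \<and> V 0 = 0 \<and>
     (\<forall>t s. (LINT w|M. \<xi> t w * \<xi> s w) = (V (norm t) + V (norm s) - V (norm (t - s))) / 2)"

context
  fixes M :: "'w measure" and \<xi> :: "'t::euclidean_space \<Rightarrow> 'w \<Rightarrow> real" and V :: "real \<Rightarrow> real"
  assumes M: "prob_space M" and iso: "iso_field M V \<xi>"
begin

lemma iso_field_cgp: "centered_gaussian_process M \<xi>"
  and iso_field_V0: "V 0 = 0"
  and iso_field_cov: "(LINT w|M. \<xi> t w * \<xi> s w) = (V (norm t) + V (norm s) - V (norm (t - s))) / 2"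
  using iso by (auto simp: iso_field_def)

lemma iso_field_var: "(LINT w|M. (\<xi> t w)\<^sup>2) = V (norm t)"
  using iso_field_cov[of t t] iso_field_V0 by (simp add: power2_eq_square)

lemma iso_field_increment_cov:
  "(LINT w|M. (\<xi> s w - \<xi> t w) * (\<xi> s' w - \<xi> t w)) =
    (V (norm (s - t)) + V (norm (s' - t)) - V (norm (s - s'))) / 2"
proof -
  note i = cgp_mult_integrable[OF M iso_field_cgp]
  have "(LINT w|M. (\<xi> s w - \<xi> t w) * (\<xi> s' w - \<xi> t w)) =
      (LINT w|M. \<xi> s w * \<xi> s' w - \<xi> s w * \<xi> t w - \<xi> t w * \<xi> s' w + \<xi> t w * \<xi> t w)"
    by (intro Bochner_Integration.integral_cong refl) (simp add: algebra_simps)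
  also have "\<dots> = (LINT w|M. \<xi> s w * \<xi> s' w) - (LINT w|M. \<xi> s w * \<xi> t w) - (LINT w|M. \<xi> t w * \<xi> s' w) + (LINT w|M. \<xi> t w * \<xi> t w)"
    using i by simp
  also have "\<dots> = (V (norm (s - t)) + V (norm (s' - t)) - V (norm (s - s'))) / 2"
    unfolding iso_field_cov by (simp add: iso_field_V0 norm_minus_commute field_simps)
  finally show ?thesis .
qed

lemma iso_field_increment_var: "(LINT w|M. (\<xi> s w - \<xi> t w)\<^sup>2) = V (norm (s - t))"
  using iso_field_increment_cov[of s t s] iso_field_V0 by (simp add: power2_eq_square)

lemma iso_field_transform:
  fixes Q :: "'t \<Rightarrow> 't"
  assumes Q: "orthogonal_transformation Q"
  shows "iso_field M V (\<lambda>t. \<xi> (Q t))"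
  unfolding iso_field_def
proof (intro conjI allI)
  show "centered_gaussian_process M (\<lambda>t. \<xi> (Q t))"
    by (rule cgp_linear_image[OF M iso_field_cgp, where J = "\<lambda>t. {Q t}" and c = "\<lambda>_ _. 1"]) auto
  have "linear Q" using Q by (simp add: orthogonal_transformation)
  then show "(LINT w|M. \<xi> (Q t) w * \<xi> (Q s) w) = (V (norm t) + V (norm s) - V (norm (t - s))) / 2" for t s
    unfolding iso_field_cov using Q by (simp add: linear_diff[symmetric] orthogonal_transformation_norm)
qed (rule iso_field_V0)

lemma cgp_increments: "centered_gaussian_process M (\<lambda>s w. \<xi> s w - \<xi> t w)"
proof (rule cgp_linear_image[OF M iso_field_cgp, where J = "\<lambda>s. {s, t}"
      and c = "\<lambda>s r. (if r = s then 1 else 0) - (if r = t then 1 else 0)"])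
  show "\<xi> s w - \<xi> t w = (\<Sum>r\<in>{s, t}. ((if r = s then 1 else 0) - (if r = t then 1 else 0)) * \<xi> r w)" for s w
    by (cases "s = t") auto
qed auto

text \<open>Seen from \<open>t\<close>, and after an orthogonal map, the field has the same
  covariances. This is how a record at \<open>t\<close> becomes a persistence event at 0.\<close>

lemma increments_rectangle:
  fixes Q :: "'t \<Rightarrow> 't"
  assumes F: "finite F" and Q: "orthogonal_transformation Q"
  shows "measure M {w \<in> space M. \<forall>s\<in>F. \<xi> s w - \<xi> t w < u s} = measure M {w \<in> space M. \<forall>s\<in>F. \<xi> (Q (s - t)) w < u s}"
proof -
  have lin: "linear Q" using Q by (simp add: orthogonal_transformation)
  have Y: "centered_gaussian_process M (\<lambda>s. \<xi> (Q (s - t)))"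
    by (rule cgp_linear_image[OF M iso_field_cgp, where J = "\<lambda>s. {Q (s - t)}" and c = "\<lambda>_ _. 1"]) auto
  have cov: "(LINT w|M. (\<xi> i w - \<xi> t w) * (\<xi> j w - \<xi> t w)) = (LINT w|M. \<xi> (Q (i - t)) w * \<xi> (Q (j - t)) w)" for i j
    unfolding iso_field_increment_cov iso_field_cov
    using Q lin by (simp add: linear_diff[symmetric] orthogonal_transformation_norm)
  from cgp_rectangle_eq[OF M M F cgp_increments Y cov, where B = "\<lambda>s. {..<u s}"]
  show ?thesis by simp
qed

end

lemma iso_field_fbm:
  fixes \<xi> :: "'t::euclidean_space \<Rightarrow> 'w \<Rightarrow> real"
  assumes "fractional_brownian_motion M H \<xi>"
  shows "iso_field M (\<lambda>r. r powr (2 * H)) \<xi>"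
  using assms unfolding fractional_brownian_motion_def iso_field_def by simp

lemma same_fdd_second_moment:
  assumes M: "prob_space M" and fdd: "same_fdd M \<xi> \<eta>"
    and [measurable]: "\<And>t. \<xi> t \<in> borel_measurable M" "\<And>t. \<eta> t \<in> borel_measurable M"
  shows "(LINT w|M. (\<xi> t w)\<^sup>2) = (LINT w|M. (\<eta> t w)\<^sup>2)"
proof -
  have eq: "distr M (Pi\<^sub>M {t} (\<lambda>_. borel)) (\<lambda>w. \<lambda>t\<in>{t}. \<xi> t w) =
        distr M (Pi\<^sub>M {t} (\<lambda>_. borel)) (\<lambda>w. \<lambda>t\<in>{t}. \<eta> t w)"
    using fdd unfolding same_fdd_def by auto
  have "(LINT x|distr M (Pi\<^sub>M {t} (\<lambda>_. borel)) (\<lambda>w. \<lambda>t\<in>{t}. \<xi> t w). (x t)\<^sup>2) = (LINT w|M. (\<xi> t w)\<^sup>2)"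
    by (subst integral_distr) auto
  moreover have "(LINT x|distr M (Pi\<^sub>M {t} (\<lambda>_. borel)) (\<lambda>w. \<lambda>t\<in>{t}. \<eta> t w). (x t)\<^sup>2) = (LINT w|M. (\<eta> t w)\<^sup>2)"
    by (subst integral_distr) auto
  ultimately show ?thesis unfolding eq by simp
qed

text \<open>The covariance follows from the variances of increments by polarisation. That the
  variance is radial uses transitivity of rotations on spheres when the dimension is at least 2; in
  dimension 1 the only rotation is the identity, and the symmetry v (-t) = v t is taken from
  stationarity of increments.\<close>

lemma iso_field_stationary:
  fixes \<xi> :: "real^'n \<Rightarrow> 'w \<Rightarrow> real" and k :: 'n
  assumes M: "prob_space M" and X: "centered_gaussian_process M \<xi>"
    and iso: "isotropic M \<xi>" and st: "stationary_increments M \<xi>"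
  shows "iso_field M (\<lambda>r. LINT w|M. (\<xi> (r *\<^sub>R axis k 1) w)\<^sup>2) \<xi>"
proof -
  define v where "v = (\<lambda>t. LINT w|M. (\<xi> t w)\<^sup>2)"
  note [measurable] = cgp_measurable[OF M X]
  have zero: "AE w in M. \<xi> 0 w = 0" using st by (simp add: stationary_increments_def)
  have v0: "v 0 = 0" unfolding v_def by (rule integral_eq_zero_AE) (use zero in auto)
  have inc: "(LINT w|M. (\<xi> (t + t0) w - \<xi> t0 w)\<^sup>2) = v t" for t t0
    unfolding v_def by (rule same_fdd_second_moment[OF M]) (use st in \<open>auto simp: stationary_increments_def\<close>)
  have neg: "v (- t) = v t" for t
  proof -
    have "v (- t) = (LINT w|M. (\<xi> 0 w - \<xi> t w)\<^sup>2)" using inc[of "- t" t] by simp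
    also have "\<dots> = v t" unfolding v_def by (intro integral_cong_AE) (use zero in auto)
    finally show ?thesis .
  qed
  have rot: "v (Q *v t) = v t" if "rotation_matrix Q" for Q t
    unfolding v_def by (rule same_fdd_second_moment[OF M]) (use iso that in \<open>auto simp: isotropic_def\<close>)
  have radial: "v t = v (norm t *\<^sub>R axis k 1)" for t
  proof -
    obtain f where f: "orthogonal_transformation f" "2 \<le> CARD('n) \<Longrightarrow> det (matrix f) = 1" "f (norm t *\<^sub>R axis k 1) = t"
      by (rule rotation_rightward_line[where a = t and k = k]) blast
    show ?thesis
    proof (cases "2 \<le> CARD('n)")
      case True
      have "rotation_matrix (matrix f)"
        using f(1,2) True by (simp add: rotation_matrix_def orthogonal_transformation_matrix)
      moreover have "matrix f *v (norm t *\<^sub>R axis k 1) = t"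
        using f(1,3) by (simp add: orthogonal_transformation_matrix matrix_works orthogonal_transformation_linear)
      ultimately show ?thesis using rot by metis
    next
      case False
      have "CARD('n) > 0" by simp
      then have "CARD('n) = 1" using False by linarith
      then obtain c where c: "(UNIV :: 'n set) = {c}" by (auto simp: card_1_singleton_iff)
      then have k: "i = k" for i by (metis UNIV_I singletonD)
      have nt: "norm t = \<bar>t $ k\<bar>"
      proof -
        have U: "(UNIV :: 'n set) = {k}" using k by auto
        show ?thesis unfolding norm_vec_def L2_set_def by (subst U) simp
      qed
      have "t = t $ k *\<^sub>R axis k 1"
      proof (subst vec_eq_iff, rule allI)
        fix i
        have "i = k" by (rule k)
        then show "t $ i = (t $ k *\<^sub>R axis k 1) $ i" by (simp add: axis_def)
      qed
      then have "t = norm t *\<^sub>R axis k 1 \<or> t = - (norm t *\<^sub>R axis k 1)"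
        unfolding nt by (cases "t $ k \<ge> 0") auto
      then show ?thesis using neg by metis
    qed
  qed
  note i = cgp_mult_integrable[OF M X]
  have cov: "(LINT w|M. \<xi> t w * \<xi> s w) = (v t + v s - v (t - s)) / 2" for t s
  proof -
    have "v (t - s) = (LINT w|M. (\<xi> t w - \<xi> s w)\<^sup>2)" using inc[of "t - s" s] by simp
    also have "\<dots> = (LINT w|M. \<xi> t w * \<xi> t w + \<xi> s w * \<xi> s w - 2 * (\<xi> t w * \<xi> s w))"
      by (intro Bochner_Integration.integral_cong refl) (simp add: power2_eq_square algebra_simps)
    also have "\<dots> = (LINT w|M. \<xi> t w * \<xi> t w) + (LINT w|M. \<xi> s w * \<xi> s w) - 2 * (LINT w|M. \<xi> t w * \<xi> s w)"
      using i by simp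
    finally show ?thesis by (simp add: v_def power2_eq_square)
  qed
  show ?thesis
    unfolding iso_field_def using X v0 cov radial by (auto simp: v_def)
qed

section \<open>Upper bound by records\<close>

text \<open>The Tikhonov term \<open>\<epsilon>\<close> allows the reproducing kernel bound to hold for the covariance only
  up to a small error; the shift function is then at least \<open>1/2\<close> instead of \<open>1\<close>, which
  is why \<open>v\<close> is doubled.\<close>

lemma persistence_shift:
  fixes X :: "'i \<Rightarrow> 'w \<Rightarrow> real"
  assumes M: "prob_space M" and X: "centered_gaussian_process M X" and F: "finite F"
    and K: "K \<ge> 0" and \<epsilon>: "\<epsilon> \<ge> 0" "K * \<epsilon> \<le> 1 / 4" and L: "L \<ge> 0" and v: "v \<ge> 0"
    and bound: "\<And>b. (\<Sum>t\<in>F. b t)\<^sup>2 \<le> K * ((\<Sum>s\<in>F. \<Sum>t\<in>F. b s * b t * (LINT w|M. X s w * X t w)) + \<epsilon> * (\<Sum>t\<in>F. (b t)\<^sup>2))"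
  shows "exp (- L * (2 * v) * sqrt K - (2 * v * sqrt K)\<^sup>2 / 2) * (measure M {w \<in> space M. \<forall>t\<in>F. X t w < u} - exp (- L\<^sup>2 / 2))
     \<le> measure M {w \<in> space M. \<forall>t\<in>F. X t w < u - v}"
proof -
  interpret prob_space M by fact
  note [measurable] = cgp_measurable[OF M X]
  define R where "R = (\<lambda>s t. LINT w|M. X s w * X t w)"
  have Rsym: "R s t = R t s" for s t unfolding R_def by (simp add: mult.commute)
  define R' where "R' = (\<lambda>s t. R s t + (if s = t then \<epsilon> else 0))"
  have Q': "(\<Sum>s\<in>F. \<Sum>t\<in>F. b s * b t * R' s t) = (\<Sum>s\<in>F. \<Sum>t\<in>F. b s * b t * R s t) + \<epsilon> * (\<Sum>t\<in>F. (b t)\<^sup>2)" for b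
  proof -
    have "(\<Sum>t\<in>F. b s * b t * R' s t) = (\<Sum>t\<in>F. b s * b t * R s t) + \<epsilon> * (b s)\<^sup>2" if "s \<in> F" for s
    proof -
      have "(\<Sum>t\<in>F. b s * b t * R' s t) = (\<Sum>t\<in>F. b s * b t * R s t + (if s = t then b s * b t * \<epsilon> else 0))"
        unfolding R'_def by (intro sum.cong refl) (simp add: algebra_simps)
      also have "\<dots> = (\<Sum>t\<in>F. b s * b t * R s t) + (\<Sum>t\<in>F. if s = t then b s * b t * \<epsilon> else 0)"
        by (rule sum.distrib)
      also have "(\<Sum>t\<in>F. if s = t then b s * b t * \<epsilon> else 0) = \<epsilon> * (b s)\<^sup>2"
        using F that by (simp add: sum.delta' power2_eq_square)
      finally show ?thesis .
    qed
    then have "(\<Sum>s\<in>F. \<Sum>t\<in>F. b s * b t * R' s t) = (\<Sum>s\<in>F. (\<Sum>t\<in>F. b s * b t * R s t) + \<epsilon> * (b s)\<^sup>2)"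
      by (intro sum.cong refl)
    then show ?thesis by (simp add: sum.distrib sum_distrib_left)
  qed
  have Q0: "0 \<le> (\<Sum>s\<in>F. \<Sum>t\<in>F. b s * b t * R s t)" for b
    using cgp_comb_square[OF M X F, of b, symmetric] unfolding R_def by simp
  have S0: "0 \<le> \<epsilon> * (\<Sum>t\<in>F. (b t)\<^sup>2)" for b :: "'i \<Rightarrow> real" using \<epsilon> by (intro mult_nonneg_nonneg sum_nonneg) auto
  have bd: "(\<Sum>t\<in>F. b t)\<^sup>2 \<le> K * (\<Sum>s\<in>F. \<Sum>t\<in>F. b s * b t * R' s t)" for b
    using bound[of b] unfolding Q' R_def .
  have "\<exists>a. \<forall>s\<in>F. (\<Sum>t\<in>F. a t * R' t s) = 1"
  proof (rule psd_solve[OF F])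
    show "R' s t = R' t s" for s t unfolding R'_def using Rsym[of s t] by simp
    show "0 \<le> (\<Sum>s\<in>F. \<Sum>t\<in>F. b s * b t * R' s t)" for b unfolding Q' using Q0 S0 by (rule add_nonneg_nonneg)
    show "(\<Sum>s\<in>F. b s * 1) = 0" if "(\<Sum>s\<in>F. \<Sum>t\<in>F. b s * b t * R' s t) = 0" for b
      using bd[of b] unfolding that by simp
  qed
  \<comment> \<open>The coefficients represent the constant 1 for the regularised covariance. Their
    sum \<open>A\<close> is also the value of the form at \<open>a\<close>, so the hypothesis at
    \<open>a\<close> reads A^2 <= K A, that is \<open>A\<close> <= \<open>K\<close>.\<close>
  then obtain a where a: "\<And>s. s \<in> F \<Longrightarrow> (\<Sum>t\<in>F. a t * R' t s) = 1" by blast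
  define A where "A = (\<Sum>t\<in>F. a t)"
  have AQ: "(\<Sum>s\<in>F. \<Sum>t\<in>F. a s * a t * R' s t) = A"
  proof -
    have "(\<Sum>s\<in>F. \<Sum>t\<in>F. a s * a t * R' s t) = (\<Sum>t\<in>F. a t * (\<Sum>s\<in>F. a s * R' s t))"
      unfolding sum_distrib_left by (subst sum.swap) (intro sum.cong refl, simp add: mult_ac)
    also have "\<dots> = A" unfolding A_def using a by (intro sum.cong refl) simp
    finally show ?thesis .
  qed
  have A0: "A \<ge> 0" using add_nonneg_nonneg[OF Q0[of a] S0[of a]] unfolding AQ[symmetric] Q' .
  have AK: "A \<le> K"
  proof (cases "A = 0")
    case False
    have "A * A \<le> K * A" using bd[of a] unfolding AQ A_def[symmetric] by (simp add: power2_eq_square)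
    then show ?thesis using False A0 by simp
  qed (use K in simp)
  define \<phi> where "\<phi> = (\<lambda>t. \<Sum>s\<in>F. a s * (LINT w|M. X s w * X t w))"
  have \<phi>: "\<phi> t = 1 - \<epsilon> * a t" if "t \<in> F" for t
  proof -
    have "(\<Sum>s\<in>F. a s * R' s t) = (\<Sum>s\<in>F. a s * R s t + (if s = t then a s * \<epsilon> else 0))"
      unfolding R'_def by (intro sum.cong refl) (simp add: algebra_simps)
    also have "\<dots> = \<phi> t + \<epsilon> * a t"
      unfolding sum.distrib \<phi>_def R_def using F that by (simp add: sum.delta)
    finally show ?thesis using a[OF that] by simp
  qed
  have eA: "\<epsilon> * (\<Sum>t\<in>F. (a t)\<^sup>2) \<le> A" using AQ Q'[of a] Q0[of a] by simp
  \<comment> \<open>The error \<open>\<epsilon> * a t\<close> has square at most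
    \<open>\<epsilon>\<close> times \<open>\<epsilon> * (a t)\<^sup>2\<close> <= \<open>K\<close>,
    so at most 1/4 by the choice of \<open>\<epsilon>\<close>.\<close>
  have half: "\<phi> t \<ge> 1 / 2" if "t \<in> F" for t
  proof -
    have "(a t)\<^sup>2 \<le> (\<Sum>t\<in>F. (a t)\<^sup>2)" using that F by (intro member_le_sum) auto
    then have "\<epsilon> * (a t)\<^sup>2 \<le> K" using order_trans[OF mult_left_mono[OF _ \<epsilon>(1)] order_trans[OF eA AK]] by blast
    then have "\<epsilon> * (\<epsilon> * (a t)\<^sup>2) \<le> \<epsilon> * K" using \<epsilon> by (intro mult_left_mono) auto
    then have "(\<epsilon> * a t)\<^sup>2 \<le> (1 / 2)\<^sup>2" using \<epsilon> by (simp add: power2_eq_square mult_ac)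
    then have "\<bar>\<epsilon> * a t\<bar> \<le> 1 / 2" by (simp only: abs_le_square_iff[symmetric])
    then show ?thesis using \<phi>[OF that] by linarith
  qed
  have var: "(\<Sum>t\<in>F. a t * \<phi> t) \<le> (sqrt K)\<^sup>2"
  proof -
    have "(\<Sum>t\<in>F. a t * \<phi> t) = (\<Sum>t\<in>F. a t - \<epsilon> * (a t)\<^sup>2)"
      by (intro sum.cong refl) (simp only: \<phi>, simp add: power2_eq_square algebra_simps)
    also have "\<dots> = A - \<epsilon> * (\<Sum>t\<in>F. (a t)\<^sup>2)" by (simp add: A_def sum_subtractf sum_distrib_left)
    also have "\<dots> \<le> A" using S0[of a] by simp
    also have "\<dots> \<le> (sqrt K)\<^sup>2" using AK K by simp
    finally show ?thesis .
  qed
  have "exp (- L * (2 * v) * sqrt K - (2 * v * sqrt K)\<^sup>2 / 2) * (measure M {w \<in> space M. \<forall>t\<in>F. X t w < u} - exp (- L\<^sup>2 / 2))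
     \<le> measure M {w \<in> space M. \<forall>t\<in>F. X t w + (2 * v) * \<phi> t < u}"
    using cameron_martin[OF M X F var[unfolded \<phi>_def], of "2 * v" L "\<lambda>_. u"] K v L unfolding \<phi>_def by simp
  also have "\<dots> \<le> measure M {w \<in> space M. \<forall>t\<in>F. X t w < u - v}"
  proof (rule finite_measure_mono)
    show "{w \<in> space M. \<forall>t\<in>F. X t w < u - v} \<in> sets M" using F by measurable
    show "{w \<in> space M. \<forall>t\<in>F. X t w + (2 * v) * \<phi> t < u} \<subseteq> {w \<in> space M. \<forall>t\<in>F. X t w < u - v}"
    proof safe
      fix w t assume w: "\<forall>t\<in>F. X t w + (2 * v) * \<phi> t < u" and t: "t \<in> F"
      have "v = (2 * v) * (1 / 2)" by simp
      also have "\<dots> \<le> (2 * v) * \<phi> t" using half[OF t] v by (intro mult_left_mono) auto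
      finally show "X t w < u - v" using w t by force
    qed
  qed
  finally show ?thesis .
qed

text \<open>Records are counted from the centre outwards: a point of maximal norm sees the earlier ones
  inside a ball through it, so each step increases the expected maximum by the same amount.\<close>

lemma expected_max_lower:
  fixes \<xi> :: "'t::euclidean_space \<Rightarrow> 'w \<Rightarrow> real"
  assumes M: "prob_space M" and X: "centered_gaussian_process M \<xi>"
    and S: "finite S" "S \<noteq> {}"
    and q: "\<And>S' t. S' \<subseteq> S \<Longrightarrow> t \<in> S \<Longrightarrow> t \<notin> S' \<Longrightarrow> (\<forall>s\<in>S'. norm s \<le> norm t) \<Longrightarrow>
       q \<le> measure M {w \<in> space M. \<forall>s\<in>S'. \<xi> s w - \<xi> t w < - 1}"
  shows "\<exists>m. integrable M m \<and> (\<forall>w. \<exists>s\<in>S. m w = \<xi> s w) \<and> real (card S - 1) * q \<le> (LINT w|M. m w)"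
proof -
  interpret prob_space M by fact
  note [measurable] = cgp_measurable[OF M X]
  have "\<forall>S'. S' \<subseteq> S \<and> card S' = Suc n \<longrightarrow>
     (\<exists>m. integrable M m \<and> (\<forall>w. \<exists>s\<in>S'. m w = \<xi> s w) \<and> (\<forall>w. \<forall>s\<in>S'. \<xi> s w \<le> m w) \<and> real n * q \<le> (LINT w|M. m w))" for n
  proof (induction n)
    case 0
    show ?case
    proof (intro allI impI)
      fix S' assume "S' \<subseteq> S \<and> card S' = Suc 0"
      then obtain t where t: "S' = {t}" by (auto simp: card_Suc_eq)
      show "\<exists>m. integrable M m \<and> (\<forall>w. \<exists>s\<in>S'. m w = \<xi> s w) \<and> (\<forall>w. \<forall>s\<in>S'. \<xi> s w \<le> m w) \<and> real 0 * q \<le> (LINT w|M. m w)"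
        using cgp_integrable[OF M X, of t] cgp_single(2)[OF M X, of t] t by (intro exI[of _ "\<xi> t"]) auto
    qed
  next
    case (Suc n)
    show ?case
    proof (intro allI impI)
      fix S' assume S': "S' \<subseteq> S \<and> card S' = Suc (Suc n)"
      have fin: "finite S'" using S' S finite_subset by blast
      have ne: "S' \<noteq> {}" using S' by auto
      have "Max (norm ` S') \<in> norm ` S'" using fin ne by (intro Max_in) auto
      then obtain t where t: "Max (norm ` S') = norm t" "t \<in> S'" by (rule imageE)
      have tmax: "norm s \<le> norm t" if "s \<in> S'" for s unfolding t(1)[symmetric] using that fin by (intro Max_ge) auto
      define S'' where "S'' = S' - {t}"
      have S'': "S'' \<subseteq> S" "card S'' = Suc n" "finite S''" "t \<notin> S''" using S' t fin by (auto simp: S''_def)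
      have "\<exists>m. integrable M m \<and> (\<forall>w. \<exists>s\<in>S''. m w = \<xi> s w) \<and> (\<forall>w. \<forall>s\<in>S''. \<xi> s w \<le> m w) \<and> real n * q \<le> (LINT w|M. m w)"
        by (rule Suc.IH[rule_format, OF conjI[OF S''(1,2)]])
      then obtain m where mm: "integrable M m \<and> (\<forall>w. \<exists>s\<in>S''. m w = \<xi> s w) \<and> (\<forall>w. \<forall>s\<in>S''. \<xi> s w \<le> m w) \<and> real n * q \<le> (LINT w|M. m w)"
        by (rule exE)
      have m: "integrable M m" "\<And>w. \<exists>s\<in>S''. m w = \<xi> s w" "\<And>w s. s \<in> S'' \<Longrightarrow> \<xi> s w \<le> m w" "real n * q \<le> (LINT w|M. m w)"
        using mm by simp_all
      \<comment> \<open>On \<open>B\<close> the new point exceeds all earlier ones by more than 1,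
        so the running maximum gains at least 1; elsewhere it does not decrease.\<close>
      define B where "B = {w \<in> space M. \<forall>s\<in>S''. \<xi> s w - \<xi> t w < - 1}"
      have [measurable]: "B \<in> sets M" unfolding B_def using S''(3) by measurable
      have qB: "q \<le> measure M B" unfolding B_def by (rule q) (use S'' S' t tmax in \<open>auto simp: S''_def\<close>)
      define m' where "m' = (\<lambda>w. max (m w) (\<xi> t w))"
      have m'int: "integrable M m'" unfolding m'_def using m(1) cgp_integrable[OF M X] by (rule integrable_max)
      have ind: "integrable M (indicat_real B)" by (simp add: integrable_real_indicator emeasure_finite less_top[symmetric])
      have "real (Suc n) * q \<le> (LINT w|M. m w) + measure M B" using m(4) qB by (simp add: algebra_simps)
      also have "\<dots> = (LINT w|M. m w + indicat_real B w)" using m(1) ind by simp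
      also have "\<dots> \<le> (LINT w|M. m' w)"
      proof (rule integral_mono)
        fix w assume "w \<in> space M"
        obtain s where s: "s \<in> S''" "m w = \<xi> s w" using m(2) by blast
        show "m w + indicat_real B w \<le> m' w"
          using s unfolding m'_def by (auto simp: indicator_def B_def)
      qed (use m(1) ind m'int in auto)
      finally have 1: "real (Suc n) * q \<le> (LINT w|M. m' w)" .
      have 2: "\<exists>s\<in>S'. m' w = \<xi> s w" for w
        using m(2)[of w] t(2) unfolding m'_def S''_def max_def by auto
      have 3: "\<xi> s w \<le> m' w" if "s \<in> S'" for s w
        using m(3)[of s w] that unfolding m'_def S''_def by (cases "s = t") auto
      show "\<exists>m. integrable M m \<and> (\<forall>w. \<exists>s\<in>S'. m w = \<xi> s w) \<and> (\<forall>w. \<forall>s\<in>S'. \<xi> s w \<le> m w) \<and> real (Suc n) * q \<le> (LINT w|M. m w)"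
        using m'int 1 2 3 by (intro exI[of _ m'] conjI allI ballI)
    qed
  qed
  moreover have "card S = Suc (card S - 1)" using S by (simp add: card_gt_0_iff)
  ultimately have "\<exists>m. integrable M m \<and> (\<forall>w. \<exists>s\<in>S. m w = \<xi> s w) \<and> (\<forall>w. \<forall>s\<in>S. \<xi> s w \<le> m w) \<and> real (card S - 1) * q \<le> (LINT w|M. m w)"
    by (simp only: order_refl)
  then show ?thesis by blast
qed

lemma natvec_norm: "norm (natvec u :: real^'n) \<le> real CARD('n) * real N" if "u \<in> nat_cube N"
proof -
  have "norm (natvec u :: real^'n) \<le> (\<Sum>i\<in>UNIV. \<bar>natvec u $ i\<bar>)" by (rule norm_le_l1_cart)
  also have "\<dots> \<le> (\<Sum>i\<in>(UNIV::'n set). real N)"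
    using that by (intro sum_mono) (auto simp: natvec_def nat_cube_def less_imp_le)
  finally show ?thesis by simp
qed

lemma natvec_separated: "u \<noteq> u' \<Longrightarrow> norm (natvec u - natvec u' :: real^'n) \<ge> 1"
proof -
  assume "u \<noteq> u'"
  then obtain i where i: "u i \<noteq> u' i" by auto
  then have "1 \<le> \<bar>real (u i) - real (u' i)\<bar>" by linarith
  also have "\<dots> = \<bar>(natvec u - natvec u') $ i\<bar>" by (simp add: natvec_def)
  also have "\<dots> \<le> norm (natvec u - natvec u')" by (rule component_le_norm_cart)
  finally show ?thesis .
qed

lemma inj_natvec: "inj natvec"
  by (auto simp: inj_def natvec_def vec_eq_iff)

text \<open>Centering removes the value at the corner \<open>x0\<close>, and sqrt (ln W) <= W with
  mean of \<open>W\<close> at most 3 gives 1 + 3 = 4.\<close>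

lemma expected_max_upper:
  fixes \<xi> :: "real^'n \<Rightarrow> 'w \<Rightarrow> real"
  assumes M: "prob_space M" and X: "centered_gaussian_process M \<xi>" and H: "H > 0" and k: "k > 0"
    and inc: "\<And>s t. (LINT w|M. (\<xi> s w - \<xi> t w)\<^sup>2) \<le> k * norm (s - t) powr (2 * H)"
    and l: "l > 0"
    and m: "integrable M m" "\<And>w. \<exists>u\<in>nat_cube (2 ^ J). m w \<le> \<xi> (x0 + (l / 2 ^ J) *\<^sub>R natvec u) w"
  shows "(LINT w|M. m w) \<le> chaining_const CARD('n) H k * 4 * l powr H"
proof -
  interpret prob_space M by fact
  note [measurable] = cgp_measurable[OF M X]
  obtain W where W: "W \<in> borel_measurable M" "\<And>w. 1 \<le> W w" "(\<integral>\<^sup>+w. ennreal (W w) \<partial>M) \<le> 3"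
    "\<And>u w. u \<in> nat_cube (2 ^ J) \<Longrightarrow>
       \<bar>\<xi> (x0 + (l / 2 ^ J) *\<^sub>R natvec u) w - \<xi> x0 w\<bar>
          \<le> chaining_const CARD('n) H k * l powr H * (1 + sqrt (ln (W w)))"
    by (rule chaining[OF M X H k inc l, where J = J and ?x0.0 = x0]) (rule that; assumption)
  define c where "c = chaining_const CARD('n) H k * l powr H"
  have c0: "c \<ge> 0" unfolding c_def chaining_const_def using k by (intro mult_nonneg_nonneg divide_nonneg_nonneg) auto
  have W0: "0 \<le> W w" for w using W(2)[of w] by linarith
  have Wint: "integrable M W"
    by (rule integrableI_bounded[OF W(1)]) (use le_less_trans[OF W(3)] W0 in \<open>simp add: abs_of_nonneg\<close>)
  have WE: "(LINT w|M. W w) \<le> 3"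
    using W(3) nn_integral_eq_integral[OF Wint] W0 by (simp flip: ennreal_numeral)
  have le: "m w \<le> \<xi> x0 w + c * (1 + W w)" for w
  proof -
    obtain u where u: "u \<in> nat_cube (2 ^ J)" "m w \<le> \<xi> (x0 + (l / 2 ^ J) *\<^sub>R natvec u) w" using m(2) by blast
    have "sqrt (ln (W w)) \<le> W w"
    proof -
      have "ln (W w) \<le> W w" using W(2)[of w] ln_le_minus_one[of "W w"] by linarith
      also have "W w \<le> (W w)\<^sup>2" using W(2)[of w] by (simp add: self_le_power)
      finally show ?thesis using W(2)[of w] by (intro real_le_lsqrt) auto
    qed
    then have "c * (1 + sqrt (ln (W w))) \<le> c * (1 + W w)" using c0 by (intro mult_left_mono) auto
    then show ?thesis using W(4)[OF u(1), of w] u(2) unfolding c_def[symmetric] by linarith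
  qed
  have "(LINT w|M. m w) \<le> (LINT w|M. \<xi> x0 w + c * (1 + W w))"
    by (rule integral_mono[OF m(1)]) (use Wint cgp_integrable[OF M X] le in auto)
  also have "\<dots> = (LINT w|M. \<xi> x0 w) + c * (1 + (LINT w|M. W w))"
    using Wint cgp_integrable[OF M X] by (simp add: prob_space)
  also have "\<dots> \<le> 0 + c * (1 + 3)" using c0 WE cgp_single(2)[OF M X] by (intro add_mono mult_left_mono) auto
  finally show ?thesis by (simp add: c_def mult_ac)
qed

lemma lattice_scale:
  fixes y :: real
  assumes "y \<ge> 1"
  obtains J :: nat where "2 ^ J \<le> y" "y < 2 * 2 ^ J"
proof
  define J where "J = nat \<lfloor>log 2 y\<rfloor>"
  have l0: "log 2 y \<ge> 0" using assms by simp
  have e: "real J = real_of_int \<lfloor>log 2 y\<rfloor>" using l0 by (simp add: J_def)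
  have "2 powr real J \<le> 2 powr (log 2 y)" unfolding e by (intro powr_mono) auto
  then show "2 ^ J \<le> y" using assms by (simp add: powr_realpow)
  have "2 powr (log 2 y) < 2 powr (real J + 1)" unfolding e by (intro powr_less_mono) linarith+
  then show "y < 2 * 2 ^ J" using assms by (simp add: powr_add powr_realpow mult.commute)
qed

text \<open>Balls tangent at 0 to the same hyperplane, on the same side, are nested and touch each
  other only at 0.\<close>

lemma ball_through_boundary:
  fixes x \<nu> :: "'a::real_inner"
  assumes "norm \<nu> = 1" "norm (x - a *\<^sub>R \<nu>) \<le> a" "x \<noteq> 0" "a < \<rho>" "a \<ge> 0"
  shows "norm (x - \<rho> *\<^sub>R \<nu>) < \<rho>"
proof -
  have nn: "\<nu> \<bullet> \<nu> = 1" using assms(1) by (simp add: norm_eq_1)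
  have e: "(norm (x - c *\<^sub>R \<nu>))\<^sup>2 = x \<bullet> x - 2 * c * (x \<bullet> \<nu>) + c\<^sup>2" for c
    unfolding power2_norm_eq_inner using nn by (simp add: inner_diff_left inner_diff_right inner_commute power2_eq_square algebra_simps)
  have "(norm (x - a *\<^sub>R \<nu>))\<^sup>2 \<le> a\<^sup>2" using assms by (intro power_mono) auto
  then have 1: "x \<bullet> x \<le> 2 * a * (x \<bullet> \<nu>)" unfolding e by simp
  have xx: "x \<bullet> x > 0" using assms by simp
  have "a * (x \<bullet> \<nu>) > 0" using 1 xx by linarith
  then have xn: "x \<bullet> \<nu> > 0" using assms(5) by (simp add: zero_less_mult_iff)
  have "2 * a * (x \<bullet> \<nu>) < 2 * \<rho> * (x \<bullet> \<nu>)" using xn assms(4) by simp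
  then have "(norm (x - \<rho> *\<^sub>R \<nu>))\<^sup>2 < \<rho>\<^sup>2" unfolding e using 1 by linarith
  then show ?thesis using assms(4,5) by (intro power2_less_imp_less[of _ \<rho>]) auto
qed

text \<open>The conclusion speaks of any number \<open>p\<close> below all finite-set probabilities,
  so no event over a continuum of points has to be measurable. A lattice cube of side comparable to
  \<open>T\<close> has about T^d points; each later point adds at least \<open>q\<close> to the
  expected maximum, which is at most of order T^H; hence \<open>q\<close> is at most of order T^(H -
  d), and \<open>p\<close> exceeds \<open>q\<close> by the price of the shift only.\<close>

lemma persistence_upper_ball:
  fixes \<xi> :: "real^'n \<Rightarrow> 'w \<Rightarrow> real" and \<nu> :: "real^'n"
  assumes M: "prob_space M" and iso: "iso_field M V \<xi>" and H: "0 < H" "H < 1" and k: "k > 0"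
    and V: "\<And>x. x \<ge> 0 \<Longrightarrow> V x \<le> k * x powr (2 * H)"
    and K: "K \<ge> 0" and rk: "\<And>F b. finite F \<Longrightarrow> (\<And>t. t \<in> F \<Longrightarrow> norm t \<ge> 1) \<Longrightarrow>
      (\<Sum>t\<in>F. b t)\<^sup>2 \<le> K * (\<Sum>s\<in>F. \<Sum>t\<in>F. b s * b t * (LINT w|M. \<xi> s w * \<xi> t w))"
    and \<nu>: "norm \<nu> = 1" and r: "r > 0"
  shows "\<exists>C>0. \<forall>\<^sub>F T in at_top. \<forall>p.
    (\<forall>F. finite F \<and> F \<subseteq> ball ((r * T) *\<^sub>R \<nu>) (r * T) \<longrightarrow> p \<le> measure M {w \<in> space M. \<forall>s\<in>F. \<xi> s w < 1}) \<longrightarrow>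
      p \<le> exp (C * sqrt (ln T)) * T powr (H - real CARD('n))"
proof -
  interpret prob_space M by fact
  note cgp = iso_field_cgp[OF M iso]
  define d where "d = real CARD('n)"
  have d: "d \<ge> 1" unfolding d_def by (simp add: Suc_leI)
  have inc: "(LINT w|M. (\<xi> s w - \<xi> t w)\<^sup>2) \<le> k * norm (s - t) powr (2 * H)" for s t
    unfolding iso_field_increment_var[OF M iso] by (rule V) simp
  define cc where "cc = chaining_const CARD('n) H k"
  have cc0: "cc \<ge> 0" unfolding cc_def chaining_const_def using k by (intro mult_nonneg_nonneg divide_nonneg_nonneg) auto
  define \<kappa> where "\<kappa> = sqrt K"
  have \<kappa>: "\<kappa> \<ge> 0" "\<kappa>\<^sup>2 = K" using K by (auto simp: \<kappa>_def)
  define A where "A = 16 * cc * (r / (4 * d)) powr (H - d) * exp (8 * K)"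
  have A0: "A \<ge> 0" unfolding A_def using cc0 by simp
  \<comment> \<open>The three terms absorb the constant \<open>A\<close>, the price exp (4 L
    \<open>\<kappa>\<close>) of the shift, and the factor 2 in the case where \<open>p\<close> is
    already of order T^(-d).\<close>
  define C where "C = ln (max A 1) + 4 * \<kappa> * sqrt (2 * d) + 1"
  have C1: "C \<ge> 1" unfolding C_def using \<kappa> d by (simp add: add_nonneg_nonneg)
  have main: "p \<le> exp (C * sqrt (ln T)) * T powr (H - d)"
    if T: "T \<ge> exp 1" "r * T \<ge> 4 * d"
      and p: "\<And>F. finite F \<Longrightarrow> F \<subseteq> ball ((r * T) *\<^sub>R \<nu>) (r * T) \<Longrightarrow> p \<le> measure M {w \<in> space M. \<forall>s\<in>F. \<xi> s w < 1}"
    for T p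
  proof -
    have T0: "T > 0" using T(1) exp_gt_zero[of 1] by linarith
    have lnT: "ln T \<ge> 1" using T(1) T0 by (subst ln_ge_iff) auto
    define s where "s = sqrt (ln T)"
    have s: "s \<ge> 1" "s\<^sup>2 = ln T" using lnT by (auto simp: s_def)
    \<comment> \<open>Makes the truncation error exp (- L^2 / 2) equal to T^(-d); unless
      \<open>p\<close> is at most twice that, at least \<open>p / 2\<close> survives its
      subtraction.\<close>
    define L where "L = sqrt (2 * d) * s"
    have L: "L \<ge> 0" "exp (- L\<^sup>2 / 2) = T powr (- d)"
      using d s T0 by (auto simp: L_def power_mult_distrib powr_def)
    show ?thesis
    proof (cases "p \<le> 2 * T powr (- d)")
      case True
      have "2 \<le> exp (1::real)" using exp_ge_add_one_self[of 1] by simp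
      also have "exp 1 \<le> exp (C * s)" using mult_mono[OF C1 s(1)] C1 by simp
      finally have "2 \<le> exp (C * s)" .
      moreover have "T powr (- d) \<le> T powr (H - d)"
        using H T(1) exp_ge_add_one_self[of 1] by (intro powr_mono) linarith+
      ultimately have "2 * T powr (- d) \<le> exp (C * s) * T powr (H - d)" by (intro mult_mono) auto
      then show ?thesis using True by (simp add: s_def)
    next
      case False
      have "T powr (- d) > 0" using T0 by simp
      then have half: "p / 2 \<le> p - exp (- L\<^sup>2 / 2)" "p > 0" unfolding L(2) using False by linarith+
      define \<rho> where "\<rho> = r * T"
      have y: "\<rho> / (2 * d) \<ge> 2" using T(2) d by (simp add: \<rho>_def field_simps)
      \<comment> \<open>A power of 2 is required by the chaining bound; the size keeps all lattice
        points at norm less than \<open>\<rho>\<close>.\<close>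
      obtain J where J: "2 ^ J \<le> \<rho> / (2 * d)" "\<rho> / (2 * d) < 2 * 2 ^ J"
        using lattice_scale[of "\<rho> / (2 * d)"] y by auto
      have J2: "(2::real) ^ J > 1" using J(2) y by linarith
      define S where "S = (natvec ` nat_cube (2 ^ J) :: (real^'n) set)"
      have finS: "finite S" by (simp add: S_def)
      have cardS: "card S = (2 ^ J) ^ CARD('n)"
        unfolding S_def by (subst card_image) (auto intro: inj_on_subset[OF inj_natvec] simp: card_nat_cube)
      have neS: "S \<noteq> {}"
      proof -
        have "card S > 0" unfolding cardS by simp
        then show ?thesis by auto
      qed
      have normS: "norm t < \<rho>" if t: "t \<in> S" for t
      proof -
        obtain u where u: "u \<in> nat_cube (2 ^ J)" "t = natvec u" using t by (auto simp: S_def)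
        have "norm t \<le> d * 2 ^ J" using natvec_norm[OF u(1)] u(2) by (simp add: d_def)
        also have "\<dots> \<le> d * (\<rho> / (2 * d))" using J(1) d by (intro mult_left_mono) auto
        also have "\<dots> < \<rho>" using d y by (simp add: field_simps)
        finally show ?thesis .
      qed
      \<comment> \<open>Price of lowering the level from 1 to -1, a shift by 2.\<close>
      define q where "q = exp (- 4 * L * \<kappa> - 8 * K) * (p / 2)"
      have q: "q \<le> measure M {w \<in> space M. \<forall>s\<in>S'. \<xi> s w - \<xi> t w < - 1}"
        if S': "S' \<subseteq> S" "t \<in> S" "t \<notin> S'" "\<forall>s\<in>S'. norm s \<le> norm t" for S' t
      proof -
        have finS': "finite S'" using S'(1) finS by (rule finite_subset)
        have "norm (- t) = norm (norm t *\<^sub>R \<nu>)" using \<nu> by simp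
        \<comment> \<open>Seen from \<open>t\<close>, the earlier points lie in the ball of radius
          |t| about \<open>- t\<close>, which has 0 on its boundary. \<open>Q\<close> turns it into
          one tangent to the given ball at 0, hence contained in it. Lattice separation keeps the
          points outside the unit ball, where the kernel bound is available.\<close>
        then obtain Q where Q: "orthogonal_transformation Q" "Q (- t) = norm t *\<^sub>R \<nu>"
          using orthogonal_transformation_exists by blast
        have lin: "linear Q" using Q(1) by (simp add: orthogonal_transformation)
        define F where "F = (\<lambda>s. Q (s - t)) ` S'"
        have finF: "finite F" using finS' by (simp add: F_def)
        have F1: "norm x \<ge> 1" if "x \<in> F" for x
        proof -
          obtain s where s: "s \<in> S'" "x = Q (s - t)" using \<open>x \<in> F\<close> by (auto simp: F_def)
          have "s \<in> S" using s(1) S'(1) by blast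
          then obtain u where u: "s = natvec u" unfolding S_def by blast
          obtain u' where u': "t = natvec u'" using S'(2) unfolding S_def by blast
          have "u \<noteq> u'" using u u' s(1) S'(3) by auto
          then show ?thesis using natvec_separated[of u u'] u u' s(2) Q(1) by (simp add: orthogonal_transformation_norm)
        qed
        have FB: "F \<subseteq> ball (\<rho> *\<^sub>R \<nu>) \<rho>"
        proof
          fix x assume x: "x \<in> F"
          then obtain s where s: "s \<in> S'" "x = Q (s - t)" by (auto simp: F_def)
          have "x = Q s + norm t *\<^sub>R \<nu>" using s(2) Q(2) linear_add[OF lin, of s "- t"] by simp
          then have "norm (x - norm t *\<^sub>R \<nu>) \<le> norm t"
            using S'(4) s(1) Q(1) by (simp add: orthogonal_transformation_norm)
          moreover have "x \<noteq> 0" using F1[OF x] by auto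
          ultimately have "norm (x - \<rho> *\<^sub>R \<nu>) < \<rho>"
            using \<nu> normS[OF S'(2)] by (intro ball_through_boundary[of _ _ "norm t"]) auto
          then show "x \<in> ball (\<rho> *\<^sub>R \<nu>) \<rho>" by (simp add: dist_norm norm_minus_commute)
        qed
        have "q \<le> exp (- L * (2 * 2) * sqrt K - (2 * 2 * sqrt K)\<^sup>2 / 2) * (p - exp (- L\<^sup>2 / 2))"
        proof -
          have e: "- L * (2 * 2) * sqrt K - (2 * 2 * sqrt K)\<^sup>2 / 2 = - 4 * L * \<kappa> - 8 * K"
            using K by (simp add: \<kappa>_def power_mult_distrib)
          show ?thesis unfolding e q_def using half(1) by (intro mult_left_mono) auto
        qed
        also have "\<dots> \<le> exp (- L * (2 * 2) * sqrt K - (2 * 2 * sqrt K)\<^sup>2 / 2) * (measure M {w \<in> space M. \<forall>x\<in>F. \<xi> x w < 1} - exp (- L\<^sup>2 / 2))"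
          using p[OF finF FB[unfolded \<rho>_def]] by (intro mult_left_mono) auto
        also have "\<dots> \<le> measure M {w \<in> space M. \<forall>x\<in>F. \<xi> x w < 1 - 2}"
          using persistence_shift[OF M cgp finF K, of 0 L 2 1] rk[OF finF F1] L(1) by simp
        also have "\<dots> = measure M {w \<in> space M. \<forall>s\<in>S'. \<xi> (Q (s - t)) w < - 1}"
          by (simp add: F_def)
        also have "\<dots> = measure M {w \<in> space M. \<forall>s\<in>S'. \<xi> s w - \<xi> t w < - 1}"
          by (rule increments_rectangle[OF M iso finS' Q(1), symmetric])
        finally show ?thesis .
      qed
      have "\<exists>m. integrable M m \<and> (\<forall>w. \<exists>s\<in>S. m w = \<xi> s w) \<and> real (card S - 1) * q \<le> (LINT w|M. m w)"
        by (rule expected_max_lower[OF M cgp finS neS]) (rule q)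
      then obtain m where mm: "integrable M m \<and> (\<forall>w. \<exists>s\<in>S. m w = \<xi> s w) \<and> real (card S - 1) * q \<le> (LINT w|M. m w)"
        by (rule exE)
      then have m: "integrable M m" "\<And>w. \<exists>s\<in>S. m w = \<xi> s w" "real (card S - 1) * q \<le> (LINT w|M. m w)"
        by simp_all
      have "\<exists>u\<in>nat_cube (2 ^ J). m w \<le> \<xi> (0 + (2 ^ J / 2 ^ J) *\<^sub>R natvec u) w" for w
        using m(2)[of w] by (auto simp: S_def)
      from expected_max_upper[OF M cgp H(1) k inc _ m(1) this]
      have "(LINT w|M. m w) \<le> cc * 4 * (2 ^ J) powr H" by (simp add: cc_def)
      with m(3) have up: "real (card S - 1) * q \<le> cc * 4 * (2 ^ J) powr H" by linarith
      have q0: "q \<ge> 0" unfolding q_def using half(2) by simp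
      define P where "P = (2::real) ^ J"
      have P: "P \<ge> 2" "P \<ge> \<rho> / (4 * d)"
      proof -
        have "J \<ge> 1" using J2 by (cases J) auto
        then have "(2::real) ^ 1 \<le> 2 ^ J" by (intro power_increasing) auto
        then show "P \<ge> 2" by (simp add: P_def)
        show "P \<ge> \<rho> / (4 * d)" using J(2) by (simp add: P_def)
      qed
      have cS: "real (card S) = P powr d" using P by (simp add: cardS P_def d_def powr_realpow)
      have "P powr 1 \<le> P powr d" using P d by (intro powr_mono) auto
      then have "P powr d \<ge> 2" using P by simp
      then have "P powr d / 2 \<le> real (card S - 1)" using cS neS finS by (simp add: of_nat_diff card_gt_0_iff Suc_leI)
      then have "P powr d / 2 * q \<le> real (card S - 1) * q" by (rule mult_right_mono) (rule q0)
      then have "P powr d / 2 * q \<le> cc * 4 * P powr H" using up unfolding P_def by linarith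
      then have "q \<le> 8 * cc * (P powr H / P powr d)" using P by (simp add: field_simps)
      also have "P powr H / P powr d = P powr (H - d)" by (simp add: powr_diff)
      also have "8 * cc * P powr (H - d) \<le> 8 * cc * (r / (4 * d) * T) powr (H - d)"
        using P(2) T0 r d H cc0 by (intro mult_left_mono powr_mono2') (auto simp: \<rho>_def)
      also have "(r / (4 * d) * T) powr (H - d) = (r / (4 * d)) powr (H - d) * T powr (H - d)"
        by (rule powr_mult)
      finally have qb: "q \<le> 8 * cc * ((r / (4 * d)) powr (H - d) * T powr (H - d))" .
      have "p = 2 * exp (4 * L * \<kappa> + 8 * K) * q"
        unfolding q_def by (simp add: mult_exp_exp)
      also have "\<dots> \<le> 2 * exp (4 * L * \<kappa> + 8 * K) * (8 * cc * ((r / (4 * d)) powr (H - d) * T powr (H - d)))"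
        using qb by (intro mult_left_mono) auto
      also have "\<dots> = A * exp (4 * L * \<kappa>) * T powr (H - d)" by (simp add: A_def exp_add mult_ac)
      also have "\<dots> \<le> exp (ln (max A 1) * s) * exp (4 * L * \<kappa>) * T powr (H - d)"
      proof -
        have "A \<le> max A 1" by simp
        also have "max A 1 = exp (ln (max A 1))" by simp
        also have "\<dots> \<le> exp (ln (max A 1) * s)"
          unfolding exp_le_cancel_iff using s mult_left_mono[of 1 s "ln (max A 1)"] by simp
        finally show ?thesis by (intro mult_right_mono) auto
      qed
      also have "\<dots> \<le> exp (C * s) * T powr (H - d)"
        unfolding mult_exp_exp using s by (intro mult_right_mono) (auto simp: C_def L_def algebra_simps)
      finally show ?thesis by (simp add: s_def)
    qed
  qed
  show ?thesis
  proof (intro exI conjI)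
    show "C > 0" using C1 by simp
    show "\<forall>\<^sub>F T in at_top. \<forall>p.
      (\<forall>F. finite F \<and> F \<subseteq> ball ((r * T) *\<^sub>R \<nu>) (r * T) \<longrightarrow> p \<le> measure M {w \<in> space M. \<forall>s\<in>F. \<xi> s w < 1}) \<longrightarrow>
        p \<le> exp (C * sqrt (ln T)) * T powr (H - real CARD('n))"
      using eventually_ge_at_top[of "exp 1"] eventually_ge_at_top[of "4 * d / r"]
    proof eventually_elim
      case (elim T)
      have "r * T \<ge> 4 * d" using elim(2) r by (simp add: field_simps)
      show ?case
      proof (intro allI impI)
        fix p
        assume p: "\<forall>F. finite F \<and> F \<subseteq> ball ((r * T) *\<^sub>R \<nu>) (r * T) \<longrightarrow> p \<le> measure M {w \<in> space M. \<forall>s\<in>F. \<xi> s w < 1}"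
        show "p \<le> exp (C * sqrt (ln T)) * T powr (H - real CARD('n))"
          using main[OF elim(1) \<open>r * T \<ge> 4 * d\<close> p[rule_format, OF conjI]] unfolding d_def .
      qed
    qed
  qed
qed

section \<open>Lower bound on the lattice\<close>

definition intvec :: "('n::finite \<Rightarrow> int) \<Rightarrow> real^'n" where
  "intvec u = (\<chi> i. real_of_int (u i))"

definition int_cube :: "nat \<Rightarrow> ('n::finite \<Rightarrow> int) set" where
  "int_cube N = {u. \<forall>i. \<bar>u i\<bar> \<le> int N}"

lemma int_cube_PiE: "(int_cube N :: ('n::finite \<Rightarrow> int) set) = PiE UNIV (\<lambda>_. {- int N..int N})"
  by (auto simp: int_cube_def PiE_def Pi_def abs_le_iff) (metis minus_le_iff)+

lemma finite_int_cube [simp]: "finite (int_cube N :: ('n::finite \<Rightarrow> int) set)"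
  unfolding int_cube_PiE by (intro finite_PiE) auto

lemma card_int_cube: "card (int_cube N :: ('n::finite \<Rightarrow> int) set) = (2 * N + 1) ^ CARD('n)"
proof -
  have "nat (1 + int N + int N) = 2 * N + 1" by linarith
  then show ?thesis unfolding int_cube_PiE by (simp add: card_PiE)
qed

lemma markov_exp_tail:
  assumes M: "prob_space M" and [measurable]: "W \<in> borel_measurable M" and W1: "\<And>w. 1 \<le> W w"
    and WE: "(\<integral>\<^sup>+w. ennreal (W w) \<partial>M) \<le> 3"
  shows "measure M {w \<in> space M. W w > exp (z\<^sup>2)} \<le> 3 * exp (- z\<^sup>2)"
proof -
  interpret prob_space M by fact
  have "ennreal (measure M {w \<in> space M. W w > exp (z\<^sup>2)}) = (\<integral>\<^sup>+w. indicator {w \<in> space M. W w > exp (z\<^sup>2)} w \<partial>M)"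
    by (simp add: emeasure_eq_measure)
  also have "\<dots> \<le> (\<integral>\<^sup>+w. ennreal (exp (- z\<^sup>2)) * ennreal (W w) \<partial>M)"
  proof (rule nn_integral_mono)
    fix w
    show "indicator {w \<in> space M. W w > exp (z\<^sup>2)} w \<le> ennreal (exp (- z\<^sup>2)) * ennreal (W w)"
    proof (cases "W w > exp (z\<^sup>2)")
      case True
      have "1 = exp (- z\<^sup>2) * exp (z\<^sup>2)" by (simp add: mult_exp_exp)
      also have "\<dots> \<le> exp (- z\<^sup>2) * W w" using True by (intro mult_left_mono) auto
      finally have "1 \<le> ennreal (exp (- z\<^sup>2) * W w)" by simp
      then show ?thesis by (simp add: indicator_def ennreal_mult[symmetric] order_trans[OF zero_le_one W1])
    qed (simp add: indicator_def)
  qed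
  also have "\<dots> = ennreal (exp (- z\<^sup>2)) * (\<integral>\<^sup>+w. ennreal (W w) \<partial>M)" by (rule nn_integral_cmult) measurable
  also have "\<dots> \<le> ennreal (exp (- z\<^sup>2)) * 3" using WE by (rule mult_left_mono) simp
  also have "\<dots> = ennreal (3 * exp (- z\<^sup>2))"
    using ennreal_mult[of 3 "exp (- z\<^sup>2)"] by (simp add: mult.commute)
  finally show ?thesis by simp
qed

lemma oscillation_tail:
  fixes \<xi> :: "real^'n \<Rightarrow> 'w \<Rightarrow> real"
  assumes M: "prob_space M" and X: "centered_gaussian_process M \<xi>" and H: "H > 0" and k: "k > 0"
    and inc: "\<And>s t. (LINT w|M. (\<xi> s w - \<xi> t w)\<^sup>2) \<le> k * norm (s - t) powr (2 * H)"
    and l: "l > 0" and z: "z \<ge> 0"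
  shows "measure M {w \<in> space M. \<exists>u\<in>nat_cube (2 ^ J). \<bar>\<xi> (x0 + (l / 2 ^ J) *\<^sub>R natvec u) w - \<xi> x0 w\<bar>
      > chaining_const CARD('n) H k * l powr H * (1 + z)} \<le> 3 * exp (- z\<^sup>2)"
proof -
  interpret prob_space M by fact
  note [measurable] = cgp_measurable[OF M X]
  obtain W where W: "W \<in> borel_measurable M" "\<And>w. 1 \<le> W w" "(\<integral>\<^sup>+w. ennreal (W w) \<partial>M) \<le> 3"
    "\<And>u w. u \<in> nat_cube (2 ^ J) \<Longrightarrow>
       \<bar>\<xi> (x0 + (l / 2 ^ J) *\<^sub>R natvec u) w - \<xi> x0 w\<bar>
          \<le> chaining_const CARD('n) H k * l powr H * (1 + sqrt (ln (W w)))"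
    by (rule chaining[OF M X H k inc l, where J = J and ?x0.0 = x0]) (rule that; assumption)
  note [measurable] = W(1)
  define c where "c = chaining_const CARD('n) H k * l powr H"
  have c0: "c \<ge> 0" unfolding c_def chaining_const_def using k by (intro mult_nonneg_nonneg divide_nonneg_nonneg) auto
  have "measure M {w \<in> space M. \<exists>u\<in>nat_cube (2 ^ J). \<bar>\<xi> (x0 + (l / 2 ^ J) *\<^sub>R natvec u) w - \<xi> x0 w\<bar> > c * (1 + z)}
     \<le> measure M {w \<in> space M. W w > exp (z\<^sup>2)}"
  proof (rule finite_measure_mono)
    show "{w \<in> space M. W w > exp (z\<^sup>2)} \<in> sets M" by measurable
    show "{w \<in> space M. \<exists>u\<in>nat_cube (2 ^ J). \<bar>\<xi> (x0 + (l / 2 ^ J) *\<^sub>R natvec u) w - \<xi> x0 w\<bar> > c * (1 + z)} \<subseteq> {w \<in> space M. W w > exp (z\<^sup>2)}"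
    proof (rule subsetI, clarify)
      fix w u assume u: "u \<in> nat_cube (2 ^ J)" "\<bar>\<xi> (x0 + (l / 2 ^ J) *\<^sub>R natvec u) w - \<xi> x0 w\<bar> > c * (1 + z)"
      have "c * (1 + z) < c * (1 + sqrt (ln (W w)))" using W(4)[OF u(1), of w] u(2) unfolding c_def by linarith
      then have "z < sqrt (ln (W w))" using c0 by (simp add: mult_less_cancel_left)
      then have "z\<^sup>2 < (sqrt (ln (W w)))\<^sup>2" using z by (intro power_strict_mono) auto
      also have "\<dots> = ln (W w)" using W(2)[of w] by simp
      finally have "exp (z\<^sup>2) < exp (ln (W w))" by simp
      then show "exp (z\<^sup>2) < W w" using W(2)[of w] by simp
    qed
  qed
  also have "\<dots> \<le> 3 * exp (- z\<^sup>2)" by (rule markov_exp_tail[OF M W(1,2,3)])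
  finally show ?thesis unfolding c_def .
qed

section \<open>A low field on a whole annulus with positive probability\<close>

lemma fbm_kernel_scale:
  assumes "r > 0"
  shows "fbm_kernel H (r *\<^sub>R t) (r *\<^sub>R s) = r powr (2 * H) * fbm_kernel H t s"
proof -
  have "norm (r *\<^sub>R t - r *\<^sub>R s) = r * norm (t - s)"
    using assms by (simp add: scaleR_diff_right[symmetric])
  then show ?thesis using assms unfolding fbm_kernel_def by (simp add: powr_mult field_simps)
qed

text \<open>Integer points with sup norm between \<open>m\<close> and \<open>2 * m\<close>; dilated
  by \<open>q\<close> they form a net of mesh \<open>q\<close> in an annulus of radius
  \<open>m * q\<close>.\<close>

definition net :: "nat \<Rightarrow> (real^'n) set" where
  "net m = intvec ` {u \<in> int_cube (2 * m). \<exists>i. \<bar>u i\<bar> \<ge> int m}"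

lemma finite_net [simp]: "finite (net m :: (real^'n) set)"
  unfolding net_def by (intro finite_imageI) simp

lemma norm_net: "u \<in> net m \<Longrightarrow> norm u \<ge> real m"
proof -
  assume "u \<in> net m"
  then obtain v i where v: "u = intvec v" "\<bar>v i\<bar> \<ge> int m" by (auto simp: net_def)
  have "real m \<le> \<bar>real_of_int (v i)\<bar>" using v(2) by linarith
  also have "\<dots> = \<bar>u $ i\<bar>" by (simp add: v(1) intvec_def)
  also have "\<dots> \<le> norm u" by (rule component_le_norm_cart)
  finally show ?thesis .
qed

text \<open>Here \<open>q\<close> is a scale: the covariance of the rescaled field is that of fractional Brownian
  motion only in the limit of large \<open>q\<close>.\<close>

lemma rescaled_kernel_bound:
  fixes V :: "real \<Rightarrow> real" and F :: "'t::euclidean_space set"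
  assumes H: "0 < H" "H < 1" and c: "c > 0" and V0: "V 0 = 0"
    and asym: "((\<lambda>x. V x / x powr (2 * H)) \<longlongrightarrow> c\<^sup>2) at_top" and F: "finite F" and \<epsilon>: "\<epsilon> > 0"
  shows "\<forall>\<^sub>F q in at_top. \<forall>b. (\<Sum>s\<in>F. \<Sum>t\<in>F. b s * b t * fbm_kernel H s t) \<le>
     (\<Sum>s\<in>F. \<Sum>t\<in>F. b s * b t * ((V (q * norm s) + V (q * norm t) - V (q * norm (s - t))) / (2 * c\<^sup>2 * q powr (2 * H))))
     + \<epsilon> * (\<Sum>t\<in>F. (b t)\<^sup>2)"
proof -
  have lim: "((\<lambda>q. V (q * r) / (c\<^sup>2 * q powr (2 * H))) \<longlongrightarrow> r powr (2 * H)) at_top" if r: "r \<ge> 0" for r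
  proof (cases "r = 0")
    case True
    then show ?thesis using V0 H by simp
  next
    case False
    then have rp: "r > 0" using r by simp
    have "filterlim (\<lambda>q. q * r) at_top at_top"
      using rp by (intro filterlim_at_top_mult_tendsto_pos[OF tendsto_const _ filterlim_ident, of r, THEN filterlim_cong[THEN iffD1, rotated -1]]) (auto simp: mult.commute)
    from filterlim_compose[OF asym this]
    have "((\<lambda>q. (r powr (2 * H) / c\<^sup>2) * (V (q * r) / (q * r) powr (2 * H))) \<longlongrightarrow> (r powr (2 * H) / c\<^sup>2) * c\<^sup>2) at_top"
      by (intro tendsto_intros)
    moreover have "\<forall>\<^sub>F q in at_top. (r powr (2 * H) / c\<^sup>2) * (V (q * r) / (q * r) powr (2 * H)) = V (q * r) / (c\<^sup>2 * q powr (2 * H))"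
      using eventually_gt_at_top[of 0]
    proof eventually_elim
      case (elim q)
      then show ?case using rp c by (simp add: powr_mult field_simps)
    qed
    ultimately show ?thesis using c by (auto intro: Lim_transform_eventually)
  qed
  define E where "E = (\<lambda>q s t. (V (q * norm s) + V (q * norm t) - V (q * norm (s - t))) / (2 * c\<^sup>2 * q powr (2 * H)) - fbm_kernel H s (t::'t))"
  \<comment> \<open>Summing \<open>\<delta>\<close> (b_s^2 + b_t^2) / 2 over all pairs produces the
    factor \<open>card F\<close>; entrywise errors below \<open>\<delta>\<close> therefore cost at
    most \<open>\<epsilon>\<close> in the form.\<close>
  define \<delta> where "\<delta> = \<epsilon> / (1 + real (card F))"
  have \<delta>: "\<delta> > 0" using \<epsilon> by (simp add: \<delta>_def add_pos_nonneg)
  have limE: "((\<lambda>q. E q s t) \<longlongrightarrow> 0) at_top" for s t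
  proof -
    have "((\<lambda>q. (V (q * norm s) / (c\<^sup>2 * q powr (2 * H)) + V (q * norm t) / (c\<^sup>2 * q powr (2 * H)) - V (q * norm (s - t)) / (c\<^sup>2 * q powr (2 * H))) / 2 - fbm_kernel H s t)
      \<longlongrightarrow> (norm s powr (2 * H) + norm t powr (2 * H) - norm (s - t) powr (2 * H)) / 2 - fbm_kernel H s t) at_top"
      by (intro tendsto_intros lim) auto
    moreover have "(norm s powr (2 * H) + norm t powr (2 * H) - norm (s - t) powr (2 * H)) / 2 - fbm_kernel H s t = 0"
      by (simp add: fbm_kernel_def)
    moreover have "(V (q * norm s) / (c\<^sup>2 * q powr (2 * H)) + V (q * norm t) / (c\<^sup>2 * q powr (2 * H)) - V (q * norm (s - t)) / (c\<^sup>2 * q powr (2 * H))) / 2 - fbm_kernel H s t = E q s t" for q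
      unfolding E_def by (simp add: add_divide_distrib diff_divide_distrib mult_ac)
    ultimately show ?thesis by simp
  qed
  have "\<forall>\<^sub>F q in at_top. \<bar>E q s t\<bar> < \<delta>" for s t
    using order_tendstoD(2)[OF tendsto_rabs_zero[OF limE[of s t]] \<delta>] .
  then have "\<forall>\<^sub>F q in at_top. \<forall>p\<in>F \<times> F. \<bar>E q (fst p) (snd p)\<bar> < \<delta>"
    using F by (intro eventually_ball_finite) auto
  then show ?thesis
  proof eventually_elim
    case (elim q)
    show ?case
    proof
      fix b
      have le: "(\<Sum>s\<in>F. \<Sum>t\<in>F. b s * b t * (- E q s t)) \<le> \<epsilon> * (\<Sum>t\<in>F. (b t)\<^sup>2)"
      proof -
        have "(\<Sum>s\<in>F. \<Sum>t\<in>F. b s * b t * (- E q s t)) \<le> (\<Sum>s\<in>F. \<Sum>t\<in>F. \<delta> * (((b s)\<^sup>2 + (b t)\<^sup>2) / 2))"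
        proof (intro sum_mono)
          fix s t assume st: "s \<in> F" "t \<in> F"
          have e: "\<bar>E q s t\<bar> \<le> \<delta>" using elim st by force
          have "b s * b t * (- E q s t) \<le> \<bar>b s * b t\<bar> * \<bar>E q s t\<bar>"
            by (metis abs_ge_self abs_minus_cancel abs_mult)
          also have "\<dots> \<le> \<bar>b s * b t\<bar> * \<delta>" using e by (intro mult_left_mono) auto
          also have "\<dots> \<le> (((b s)\<^sup>2 + (b t)\<^sup>2) / 2) * \<delta>"
            using sum_squares_bound[of "\<bar>b s\<bar>" "\<bar>b t\<bar>"] \<delta> by (intro mult_right_mono) (auto simp: abs_mult)
          finally show "b s * b t * (- E q s t) \<le> \<delta> * (((b s)\<^sup>2 + (b t)\<^sup>2) / 2)" by (simp add: mult.commute)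
        qed
        also have "\<dots> = \<delta> * real (card F) * (\<Sum>t\<in>F. (b t)\<^sup>2)"
        proof -
          have "(\<Sum>s\<in>F. \<Sum>t\<in>F. \<delta> * (((b s)\<^sup>2 + (b t)\<^sup>2) / 2)) = \<delta> / 2 * (\<Sum>s\<in>F. \<Sum>t\<in>F. (b s)\<^sup>2 + (b t)\<^sup>2)"
            unfolding sum_distrib_left by (intro sum.cong refl) simp
          also have "(\<Sum>s\<in>F. \<Sum>t\<in>F. (b s)\<^sup>2 + (b t)\<^sup>2) = 2 * (real (card F) * (\<Sum>t\<in>F. (b t)\<^sup>2))"
            by (simp add: sum.distrib sum_distrib_left[symmetric])
          finally show ?thesis by simp
        qed
        also have "\<dots> \<le> \<epsilon> * (\<Sum>t\<in>F. (b t)\<^sup>2)"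
        proof (rule mult_right_mono)
          show "\<delta> * real (card F) \<le> \<epsilon>" using \<epsilon> by (simp add: \<delta>_def divide_simps add_pos_nonneg)
        qed (auto intro: sum_nonneg)
        finally show ?thesis .
      qed
      have "(\<Sum>s\<in>F. \<Sum>t\<in>F. b s * b t * fbm_kernel H s t) =
        (\<Sum>s\<in>F. \<Sum>t\<in>F. b s * b t * ((V (q * norm s) + V (q * norm t) - V (q * norm (s - t))) / (2 * c\<^sup>2 * q powr (2 * H))))
        + (\<Sum>s\<in>F. \<Sum>t\<in>F. b s * b t * (- E q s t))"
        unfolding sum.distrib[symmetric] by (intro sum.cong refl) (simp add: E_def algebra_simps)
      then show "(\<Sum>s\<in>F. \<Sum>t\<in>F. b s * b t * fbm_kernel H s t) \<le>
        (\<Sum>s\<in>F. \<Sum>t\<in>F. b s * b t * ((V (q * norm s) + V (q * norm t) - V (q * norm (s - t))) / (2 * c\<^sup>2 * q powr (2 * H))))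
        + \<epsilon> * (\<Sum>t\<in>F. (b t)\<^sup>2)" using le by linarith
    qed
  qed
qed

text \<open>The number of net points grows polynomially in \<open>m\<close>, the failure probability
  of a cell decays like exp (- a^2 m^(2H)). It is essential that \<open>p\<close> is fixed before
  \<open>m\<close>.\<close>

lemma union_bound_beats_net:
  assumes a: "a > 0" and H: "0 < H" and p: "p > 0"
  shows "\<exists>m::nat. m \<ge> 1 \<and> a * real m powr H \<ge> 1 \<and> (4 * real m + 1) ^ d * (3 * exp (- (a * real m powr H - 1)\<^sup>2)) \<le> p"
proof -
  have "((\<lambda>x::real. (4 * x + 1) powr real d * (3 * exp (- (a * x powr H - 1)\<^sup>2))) \<longlongrightarrow> 0) at_top"
    using a H by real_asymp
  then have "\<forall>\<^sub>F x in at_top. (4 * x + 1) powr real d * (3 * exp (- (a * x powr H - 1)\<^sup>2)) < p"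
    using p by (rule order_tendstoD(2))
  moreover have "filterlim (\<lambda>x::real. a * x powr H) at_top at_top" using a H by real_asymp
  then have "\<forall>\<^sub>F x in at_top. a * x powr H \<ge> 1" by (auto simp: filterlim_at_top)
  ultimately have "\<forall>\<^sub>F x in at_top. x \<ge> 1 \<and> a * x powr H \<ge> 1 \<and> (4 * x + 1) powr real d * (3 * exp (- (a * x powr H - 1)\<^sup>2)) \<le> p"
    using eventually_ge_at_top[of "1::real"] by eventually_elim auto
  then have "\<forall>\<^sub>F m in sequentially. real m \<ge> 1 \<and> a * real m powr H \<ge> 1 \<and> (4 * real m + 1) powr real d * (3 * exp (- (a * real m powr H - 1)\<^sup>2)) \<le> p"
    using filterlim_real_sequentially by (rule eventually_compose_filterlim)
  then obtain m :: nat where m: "real m \<ge> 1" "a * real m powr H \<ge> 1" "(4 * real m + 1) powr real d * (3 * exp (- (a * real m powr H - 1)\<^sup>2)) \<le> p"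
    using eventually_happens'[OF sequentially_bot] by blast
  then show ?thesis by (intro exI[of _ m]) (auto simp: powr_realpow)
qed

text \<open>By homogeneity of the kernel, support at distance \<open>r\<close> instead of 1 improves
  the constant by r^(-2H).\<close>

lemma fbm_rkhs_scaled:
  assumes K1: "\<And>F b. finite F \<and> (\<forall>t\<in>F. norm (t::'a::euclidean_space) \<ge> 1) \<Longrightarrow>
      (\<Sum>t\<in>F. b t)\<^sup>2 \<le> K1 * (\<Sum>t\<in>F. \<Sum>s\<in>F. b t * b s * fbm_kernel H t s)"
    and F: "finite F" "\<And>t. t \<in> F \<Longrightarrow> norm t \<ge> r" and r: "r > 0"
  shows "(\<Sum>t\<in>F. b t)\<^sup>2 \<le> K1 * r powr (- (2 * H)) * (\<Sum>t\<in>F. \<Sum>s\<in>F. b t * b s * fbm_kernel H t (s::'a))"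
proof -
  define f where "f = (\<lambda>t::'a. (1 / r) *\<^sub>R t)"
  have inj: "inj_on f F" using r by (auto simp: inj_on_def f_def)
  have b: "b (r *\<^sub>R f t) = b t" for t using r by (simp add: f_def)
  have 1: "(\<Sum>t\<in>f ` F. b (r *\<^sub>R t)) = (\<Sum>t\<in>F. b t)"
    unfolding sum.reindex[OF inj] o_def b ..
  have 2: "(\<Sum>t\<in>f ` F. \<Sum>s\<in>f ` F. b (r *\<^sub>R t) * b (r *\<^sub>R s) * fbm_kernel H t s) =
      r powr (- (2 * H)) * (\<Sum>t\<in>F. \<Sum>s\<in>F. b t * b s * fbm_kernel H t s)"
  proof -
    have "fbm_kernel H (f t) (f s) = r powr (- (2 * H)) * fbm_kernel H t s" for t s
      unfolding f_def using r by (subst fbm_kernel_scale) (auto simp: powr_divide powr_minus_divide)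
    then show ?thesis
      unfolding sum.reindex[OF inj] o_def b sum_distrib_left by (intro sum.cong refl) simp
  qed
  have "norm (f t) \<ge> 1" if "t \<in> F" for t using F(2)[OF that] r by (simp add: f_def)
  then have "finite (f ` F) \<and> (\<forall>t\<in>f ` F. norm t \<ge> 1)" using F(1) by blast
  from K1[OF this, of "\<lambda>t. b (r *\<^sub>R t)"] show ?thesis unfolding 1 2 by (simp add: mult.assoc)
qed

text \<open>Common setting for fractional Brownian motion and for fields satisfying (a) and (b): a
  radial variance with a power bound everywhere and exact power asymptotics at infinity.\<close>

locale regular_field =
  fixes \<xi> :: "real^'n \<Rightarrow> 'w \<Rightarrow> real" and M :: "'w measure" and V :: "real \<Rightarrow> real" and H k c :: real
  assumes M: "prob_space M" and iso: "iso_field M V \<xi>" and H: "0 < H" "H < 1" and k: "k > 0"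
    and V: "\<And>x. x \<ge> 0 \<Longrightarrow> V x \<le> k * x powr (2 * H)" and c: "c > 0"
    and asym: "((\<lambda>x. V x / x powr (2 * H)) \<longlongrightarrow> c\<^sup>2) at_top"
begin

sublocale prob_space M by (fact M)

lemma field_increment_bound: "(LINT w|M. (\<xi> s w - \<xi> t w)\<^sup>2) \<le> k * norm (s - t) powr (2 * H)"
  unfolding iso_field_increment_var[OF M iso] by (rule V) simp

lemma chaining_const_pos: "chaining_const CARD('n) H k > 0"
  unfolding chaining_const_def using k H
  by (intro divide_pos_pos mult_pos_pos) (auto simp: add_nonneg_pos)

lemma field_at_0: "AE w in M. \<xi> 0 w = 0"
proof -
  have "(LINT w|M. (\<xi> 0 w)\<^sup>2) = 0" using iso_field_var[OF M iso, of 0] iso_field_V0[OF M iso] by simp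
  then have "AE w in M. (\<xi> 0 w)\<^sup>2 = 0"
    using integral_nonneg_eq_0_iff_AE[of M "\<lambda>w. (\<xi> 0 w)\<^sup>2"] cgp_square_integrable[OF M iso_field_cgp[OF M iso]] by simp
  then show ?thesis by simp
qed

text \<open>The bound \<open>p0\<close> is the same for all \<open>m\<close>; only the threshold on
  \<open>q\<close> depends on \<open>m\<close>. After division by c q^H the field is, with large
  probability, below \<open>B * real m powr H\<close> on the net. Lowering it by (B + 2) m^H costs
  an amount depending only on the product of this height with sqrt K, and sqrt K scales like
  m^(-H).\<close>

lemma net_probability:
  "\<exists>p0>0. \<forall>m\<ge>1. \<forall>\<^sub>F q in at_top. p0 \<le> measure M {w \<in> space M. \<forall>u\<in>net m. \<xi> (q *\<^sub>R u) w < - 2 * c * (real m * q) powr H}"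
proof -
  note cgp = iso_field_cgp[OF M iso]
  note [measurable] = cgp_measurable[OF M cgp]
  define cc where "cc = chaining_const CARD('n) H k"
  have cc: "cc > 0" unfolding cc_def by (rule chaining_const_pos)
  obtain K1 where K1: "K1 \<ge> 0" "\<And>F b. finite F \<and> (\<forall>t\<in>F. norm (t::real^'n) \<ge> 1) \<Longrightarrow>
      (\<Sum>t\<in>F. b t)\<^sup>2 \<le> K1 * (\<Sum>t\<in>F. \<Sum>s\<in>F. b t * b s * fbm_kernel H t s)"
    using fbm_rkhs[OF H, where 'a="real^'n"] by blast
  \<comment> \<open>A value is compared with the corner of the cube and the corner with the value 0
    at the origin, each within 3 times the chaining bound (z = 2); the cube has side at most 10 m q.
    The summand 1 makes the inequality strict.\<close>
  define B where "B = 6 * cc * 10 powr H / c + 1"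
  have B: "B > 0" unfolding B_def using cc c by (intro add_pos_pos divide_pos_pos mult_pos_pos) auto
  define a where "a = (B + 2) * sqrt K1"
  define p0 where "p0 = exp (- 4 * a - (2 * a)\<^sup>2 / 2) * (1 / 2)"
  show ?thesis
  proof (intro exI conjI allI impI)
    show "p0 > 0" by (simp add: p0_def)
    fix m :: nat assume m: "m \<ge> 1"
    define F where "F = (net m :: (real^'n) set)"
    have F: "finite F" by (simp add: F_def)
    define K where "K = K1 * real m powr (- (2 * H))"
    have K: "K \<ge> 0" using K1(1) by (simp add: K_def)
    have sqrtK: "sqrt K = sqrt K1 * real m powr (- H)"
    proof -
      have "real m powr (- (2 * H)) = (real m powr (- H))\<^sup>2" using powr_double[of "real m" "- H"] by simp
      then show ?thesis by (simp add: K_def real_sqrt_mult)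
    qed
    define \<epsilon> where "\<epsilon> = 1 / (4 * (K + 1))"
    have \<epsilon>: "\<epsilon> > 0" "K * \<epsilon> \<le> 1 / 4" using K by (auto simp: \<epsilon>_def divide_simps)
    have Kb: "(\<Sum>t\<in>F. b t)\<^sup>2 \<le> K * (\<Sum>t\<in>F. \<Sum>s\<in>F. b t * b s * fbm_kernel H t s)" for b
      unfolding K_def by (rule fbm_rkhs_scaled[OF K1(2) F]) (use m norm_net in \<open>auto simp: F_def\<close>)
    obtain J where J: "2 ^ J \<ge> 4 * m + 1" "2 ^ J \<le> 10 * m"
    proof -
      obtain J where "2 ^ J \<le> 4 * real m + 1" "4 * real m + 1 < 2 * 2 ^ J" using lattice_scale[of "4 * real m + 1"] by auto
      then have "real (4 * m + 1) \<le> real (2 ^ Suc J)" "real (2 ^ Suc J) \<le> real (10 * m)" using m by auto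
      then show thesis by (intro that[of "Suc J"]) (simp_all only: of_nat_le_iff)
    qed
    show "\<forall>\<^sub>F q in at_top. p0 \<le> measure M {w \<in> space M. \<forall>u\<in>net m. \<xi> (q *\<^sub>R u) w < - 2 * c * (real m * q) powr H}"
      using rescaled_kernel_bound[OF H c iso_field_V0[OF M iso] asym F \<epsilon>(1)] eventually_gt_at_top[of 0]
    proof eventually_elim
      case (elim q)
      have q: "q > 0" by (fact elim(2))
      define X where "X = (\<lambda>u w. 1 / (c * q powr H) * \<xi> (q *\<^sub>R u) w)"
      have X: "centered_gaussian_process M X"
        by (rule cgp_linear_image[OF M cgp, where J = "\<lambda>u. {q *\<^sub>R u}" and c = "\<lambda>_ _. 1 / (c * q powr H)"]) (auto simp: X_def)
      have cov: "(LINT w|M. X s w * X t w) = (V (q * norm s) + V (q * norm t) - V (q * norm (s - t))) / (2 * c\<^sup>2 * q powr (2 * H))" for s t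
      proof -
        have n: "norm (q *\<^sub>R s - q *\<^sub>R t) = q * norm (s - t)" using q by (simp add: scaleR_diff_right[symmetric])
        have "(LINT w|M. X s w * X t w) = (LINT w|M. (1 / (c * q powr H))\<^sup>2 * (\<xi> (q *\<^sub>R s) w * \<xi> (q *\<^sub>R t) w))"
          unfolding X_def by (intro Bochner_Integration.integral_cong refl) (simp add: power2_eq_square)
        also have "\<dots> = (1 / (c * q powr H))\<^sup>2 * ((V (q * norm s) + V (q * norm t) - V (q * norm (s - t))) / 2)"
          using q by (simp add: iso_field_cov[OF M iso] n)
        also have "\<dots> = (V (q * norm s) + V (q * norm t) - V (q * norm (s - t))) / (2 * c\<^sup>2 * q powr (2 * H))"
          by (simp add: powr_double power_mult_distrib power_divide)
        finally show ?thesis .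
      qed
      have bound: "(\<Sum>t\<in>F. b t)\<^sup>2 \<le> K * ((\<Sum>s\<in>F. \<Sum>t\<in>F. b s * b t * (LINT w|M. X s w * X t w)) + \<epsilon> * (\<Sum>t\<in>F. (b t)\<^sup>2))" for b
        unfolding cov using order_trans[OF Kb mult_left_mono[OF elim(1)[rule_format] K]] .
      have big: "measure M {w \<in> space M. \<forall>t\<in>F. X t w < B * real m powr H} \<ge> 1 - 3 * exp (- 2\<^sup>2)"
      proof -
        \<comment> \<open>Lower corner of a cube that contains both the dilated net and the
          origin.\<close>
        define x0 where "x0 = q *\<^sub>R intvec (\<lambda>_::'n. - 2 * int m)"
        define l where "l = q * 2 ^ J"
        have l: "l > 0" "l \<le> q * (10 * real m)" "l / 2 ^ J = q"
          using q of_nat_mono[OF J(2), where 'a=real] by (auto simp: l_def)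
        define bad where "bad = {w \<in> space M. \<exists>u\<in>nat_cube (2 ^ J). \<bar>\<xi> (x0 + (l / 2 ^ J) *\<^sub>R natvec u) w - \<xi> x0 w\<bar> > cc * l powr H * (1 + 2)}"
        have badm: "bad \<in> sets M" unfolding bad_def by measurable
        have bad: "measure M bad \<le> 3 * exp (- 2\<^sup>2)"
          unfolding bad_def cc_def by (rule oscillation_tail[OF M cgp H(1) k field_increment_bound l(1)]) simp
        have "AE w in M. w \<in> space M - bad \<longrightarrow> w \<in> {w \<in> space M. \<forall>t\<in>F. X t w < B * real m powr H}"
          using field_at_0
        proof eventually_elim
          case (elim w)
          show ?case
          proof (intro impI CollectI conjI ballI)
            assume w: "w \<in> space M - bad"
            then show "w \<in> space M" by simp
            have nb: "\<bar>\<xi> (x0 + (l / 2 ^ J) *\<^sub>R natvec u) w - \<xi> x0 w\<bar> \<le> cc * l powr H * (1 + 2)" if "u \<in> nat_cube (2 ^ J)" for u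
              using w that unfolding bad_def by (simp add: not_less)
            have cell: "\<bar>\<xi> (q *\<^sub>R intvec u) w - \<xi> x0 w\<bar> \<le> cc * l powr H * 3" if u: "u \<in> int_cube (2 * m)" for u
            proof -
              define v where "v = (\<lambda>i. nat (u i + 2 * int m))"
              have u': "- (2 * int m) \<le> u i" "u i \<le> 2 * int m" for i
                using u by (auto simp: int_cube_def abs_le_iff minus_le_iff)
              have "v \<in> nat_cube (2 ^ J)"
              proof -
                have "v i < 2 ^ J" for i
                proof -
                  have "v i < 4 * m + 1" using u'[of i] unfolding v_def by linarith
                  then show ?thesis using J(1) by linarith
                qed
                then show ?thesis by (simp add: nat_cube_def)
              qed
              moreover have "x0 + (l / 2 ^ J) *\<^sub>R natvec v = q *\<^sub>R intvec u"
                proof -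
                have rn: "real (nat (u i + 2 * int m)) = real_of_int (u i) + 2 * real m" for i
                  using u'[of i] by simp
                show ?thesis unfolding l(3) x0_def v_def 
                  by (subst vec_eq_iff, rule allI)
                    (simp only: vector_add_component vector_scaleR_component natvec_def intvec_def vec_lambda_beta rn, simp add: algebra_simps)
              qed
              ultimately show ?thesis using nb[of v] by simp
            qed
            fix t assume "t \<in> F"
            then obtain u where u: "t = intvec u" "u \<in> int_cube (2 * m)" by (auto simp: F_def net_def)
            have z: "(\<lambda>_. 0) \<in> int_cube (2 * m)" "q *\<^sub>R intvec (\<lambda>_::'n. 0) = 0"
              by (auto simp: int_cube_def intvec_def vec_eq_iff)
            have "\<xi> (q *\<^sub>R t) w \<le> 6 * (cc * l powr H)"
              using cell[OF u(2)] cell[OF z(1)] elim unfolding z(2) u(1) by linarith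
            also have "\<dots> \<le> 6 * (cc * (q * (10 * real m)) powr H)"
              using l cc H by (intro mult_left_mono powr_mono2) auto
            also have "\<dots> = 6 * cc * 10 powr H * (q powr H * real m powr H)" by (simp add: powr_mult)
            also have "\<dots> = (B - 1) * c * (q powr H * real m powr H)" using c by (simp add: B_def)
            also have "\<dots> < B * c * (q powr H * real m powr H)"
              using c q m by (intro mult_strict_right_mono) auto
            finally have "1 / (c * q powr H) * \<xi> (q *\<^sub>R t) w < 1 / (c * q powr H) * (B * c * (q powr H * real m powr H))"
              using c q by (intro mult_strict_left_mono) auto
            also have "\<dots> = B * real m powr H" using c q by simp
            finally show "X t w < B * real m powr H" unfolding X_def .
          qed
        qed
        then have "measure M (space M - bad) \<le> measure M {w \<in> space M. \<forall>t\<in>F. X t w < B * real m powr H}"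
          using F by (intro finite_measure_mono_AE) (auto simp: X_def)
        moreover have "measure M (space M - bad) = 1 - measure M bad" using badm by (rule prob_compl)
        ultimately show ?thesis using bad by linarith
      qed
      \<comment> \<open>Brings the level from B m^H down to - 2 m^H; its product with sqrt K is the
        constant \<open>a\<close>, free of \<open>m\<close>.\<close>
      define v where "v = (B + 2) * real m powr H"
      have va: "v * sqrt K = a"
      proof -
        have "real m powr H * real m powr (- H) = 1" using m by (simp add: powr_add[symmetric])
        then show ?thesis unfolding v_def sqrtK a_def by (simp add: mult_ac)
      qed
      have num: "1 / 2 \<le> 1 - 3 * exp (- 2\<^sup>2) - exp (- 2\<^sup>2 / 2 :: real)"
      proof -
        have "(5::real) \<le> exp 2" using exp_lower_Taylor_quadratic[of 2] by simp
        then have "exp (- 2 :: real) \<le> 1 / 5" by (simp add: exp_minus field_simps)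
        moreover have "(13::real) \<le> exp 4" using exp_lower_Taylor_quadratic[of 4] by simp
        then have "exp (- 4 :: real) \<le> 1 / 13" by (simp add: exp_minus field_simps)
        moreover have "- 2\<^sup>2 / 2 = (- 2 :: real)" "- 2\<^sup>2 = (- 4 :: real)" by simp_all
        ultimately show ?thesis by (simp only:)
      qed
      have "p0 \<le> exp (- 2 * (2 * v) * sqrt K - (2 * v * sqrt K)\<^sup>2 / 2) * (measure M {w \<in> space M. \<forall>t\<in>F. X t w < B * real m powr H} - exp (- 2\<^sup>2 / 2))"
      proof -
        have e1: "- 2 * (2 * v) * sqrt K = - 4 * a" "2 * v * sqrt K = 2 * a" unfolding va[symmetric] by simp_all
        have "1 / 2 \<le> measure M {w \<in> space M. \<forall>t\<in>F. X t w < B * real m powr H} - exp (- 2\<^sup>2 / 2)"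
          using big num by linarith
        then show ?thesis unfolding e1 p0_def by (rule mult_left_mono) simp
      qed
      also have "\<dots> \<le> measure M {w \<in> space M. \<forall>t\<in>F. X t w < B * real m powr H - v}"
        by (rule persistence_shift[OF M X F K less_imp_le[OF \<epsilon>(1)] \<epsilon>(2) _ _ bound]) (use B in \<open>auto simp: v_def\<close>)
      also have "{w \<in> space M. \<forall>t\<in>F. X t w < B * real m powr H - v} = {w \<in> space M. \<forall>u\<in>net m. \<xi> (q *\<^sub>R u) w < - 2 * c * (real m * q) powr H}"
      proof -
        have "X t w < B * real m powr H - v \<longleftrightarrow> \<xi> (q *\<^sub>R t) w < - 2 * c * (real m * q) powr H" for t w
        proof -
          have e: "B * real m powr H - v = - 2 * real m powr H" by (simp add: v_def algebra_simps)
          have pos: "c * q powr H > 0" using c q by simp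
          have Xe: "X t w = \<xi> (q *\<^sub>R t) w / (c * q powr H)" by (simp add: X_def)
          have me: "- 2 * real m powr H * (c * q powr H) = - 2 * c * (real m * q) powr H" by (simp add: powr_mult)
          show ?thesis unfolding e Xe pos_divide_less_eq[OF pos] me ..
        qed
        then show ?thesis by (simp add: F_def)
      qed
      finally show ?case .
    qed
  qed
qed

end

context regular_field
begin

definition lattice_annulus :: "nat \<Rightarrow> nat \<Rightarrow> ('n \<Rightarrow> int) set" where
  "lattice_annulus n R = {u \<in> int_cube R. \<exists>i. \<bar>u i\<bar> \<ge> int n}"

lemma finite_lattice_annulus [simp]: "finite (lattice_annulus n R)"
  unfolding lattice_annulus_def by (rule finite_subset[OF _ finite_int_cube[of R]]) auto

text \<open>The net is at level - 2 x and the oscillation over each cell of side \<open>q\<close> is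
  at most x, except with a small probability; \<open>m\<close> is chosen so that the union bound
  over the cells costs at most half of \<open>p0\<close>.\<close>

lemma annulus_probability:
  "\<exists>p0>0. \<exists>m\<ge>1. \<forall>\<^sub>F q in sequentially. p0 \<le> measure M {w \<in> space M.
     \<forall>u\<in>lattice_annulus (m * q) (2 * (m * q)). \<xi> (intvec u) w < - c * (real m * real q) powr H}"
proof -
  note cgp = iso_field_cgp[OF M iso]
  note [measurable] = cgp_measurable[OF M cgp]
  define cc where "cc = chaining_const CARD('n) H k"
  have cc: "cc > 0" unfolding cc_def by (rule chaining_const_pos)
  obtain p0 where p0: "p0 > 0" "\<And>m. m \<ge> 1 \<Longrightarrow> \<forall>\<^sub>F q in at_top. p0 \<le> measure M {w \<in> space M. \<forall>u\<in>net m. \<xi> (q *\<^sub>R u) w < - 2 * c * (real m * q) powr H}"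
    using net_probability by blast
  \<comment> \<open>With 1 + z = a m^H and cells of side at most 2 q, the chaining bound for one
    cell is exactly at most c (m q)^H.\<close>
  define a where "a = c / (cc * 2 powr H)"
  have a: "a > 0" unfolding a_def using c cc by simp
  obtain m where m: "m \<ge> 1" "a * real m powr H \<ge> 1"
    "(4 * real m + 1) ^ CARD('n) * (3 * exp (- (a * real m powr H - 1)\<^sup>2)) \<le> p0 / 2"
    using union_bound_beats_net[OF a H(1), of "p0 / 2" "CARD('n)"] p0(1) by auto
  define z where "z = a * real m powr H - 1"
  have z: "z \<ge> 0" using m(2) by (simp add: z_def)
  have "\<forall>\<^sub>F q in sequentially. p0 \<le> measure M {w \<in> space M. \<forall>u\<in>net m. \<xi> (real q *\<^sub>R u) w < - 2 * c * (real m * real q) powr H}"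
    using p0(2)[OF m(1)] filterlim_real_sequentially by (rule eventually_compose_filterlim)
  then have "\<forall>\<^sub>F q in sequentially. p0 / 2 \<le> measure M {w \<in> space M.
     \<forall>u\<in>lattice_annulus (m * q) (2 * (m * q)). \<xi> (intvec u) w < - c * (real m * real q) powr H}"
    using eventually_gt_at_top[of 0]
  proof eventually_elim
    case (elim q)
    have q: "q \<ge> 1" using elim(2) by simp
    obtain J where J: "q \<le> 2 ^ J" "(2 ^ J :: real) \<le> 2 * real q"
    proof -
      obtain J where "2 ^ J \<le> real q" "real q < 2 * 2 ^ J" using lattice_scale[of "real q"] q by auto
      then have "real q \<le> real (2 ^ Suc J)" "2 ^ Suc J \<le> 2 * real q" by auto
      then show thesis by (intro that[of "Suc J"]) (simp_all only: of_nat_le_iff)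
    qed
    define l where "l = (2::real) ^ J"
    have l: "l > 0" "l \<le> 2 * real q" using J by (auto simp: l_def)
    let ?N = "net m :: (real^'n) set"
    define x where "x = c * (real m * real q) powr H"
    have xz: "cc * l powr H * (1 + z) \<le> x"
    proof -
      have "cc * l powr H * (1 + z) \<le> cc * (2 * real q) powr H * (1 + z)"
        using l cc z H by (intro mult_right_mono mult_left_mono powr_mono2) auto
      also have "\<dots> = x" unfolding x_def z_def a_def powr_mult using cc by simp
      finally show ?thesis .
    qed
    define good where "good = {w \<in> space M. \<forall>u\<in>?N. \<xi> (real q *\<^sub>R u) w < - 2 * x}"
    define bad where "bad = (\<lambda>p. {w \<in> space M. \<exists>u\<in>nat_cube (2 ^ J). \<bar>\<xi> (real q *\<^sub>R p + (l / 2 ^ J) *\<^sub>R natvec u) w - \<xi> (real q *\<^sub>R p) w\<bar> > cc * l powr H * (1 + z)})"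
    define goal where "goal = {w \<in> space M. \<forall>u\<in>lattice_annulus (m * q) (2 * (m * q)). \<xi> (intvec u) w < - x}"
    have [measurable]: "good \<in> sets M" unfolding good_def by measurable
    have [measurable]: "bad p \<in> sets M" for p unfolding bad_def by measurable
    have [measurable]: "goal \<in> sets M" unfolding goal_def by measurable
    have bad: "measure M (bad p) \<le> 3 * exp (- z\<^sup>2)" for p
      unfolding bad_def cc_def by (rule oscillation_tail[OF M cgp H(1) k field_increment_bound l(1) z])
    have cardN: "real (card ?N) \<le> (4 * real m + 1) ^ CARD('n)"
    proof -
      have "card ?N \<le> card {u \<in> (int_cube (2 * m) :: ('n \<Rightarrow> int) set). \<exists>i. \<bar>u i\<bar> \<ge> int m}"
        unfolding net_def by (rule card_image_le) simp
      also have "\<dots> \<le> card (int_cube (2 * m) :: ('n \<Rightarrow> int) set)" by (rule card_mono) auto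
      also have "\<dots> = (4 * m + 1) ^ CARD('n)" by (simp add: card_int_cube)
      finally have "real (card ?N) \<le> real ((4 * m + 1) ^ CARD('n))" by (simp only: of_nat_le_iff)
      then show ?thesis by (simp add: add.commute)
    qed
    have sub: "good \<subseteq> goal \<union> (\<Union>p\<in>?N. bad p)"
    proof
      fix w assume w: "w \<in> good"
      show "w \<in> goal \<union> (\<Union>p\<in>?N. bad p)"
      proof (rule ccontr)
        assume nw: "w \<notin> goal \<union> (\<Union>p\<in>?N. bad p)"
        have ws: "w \<in> space M" using w by (simp add: good_def)
        from nw ws obtain s where s: "s \<in> lattice_annulus (m * q) (2 * (m * q))" "\<xi> (intvec s) w \<ge> - x"
          unfolding goal_def by (auto simp: not_less)
        \<comment> \<open>The cell of \<open>s\<close>. Division rounds down, so multiples of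
          \<open>q\<close> are respected in both directions: bounds by 2 m q and a coordinate of
          modulus at least m q pass to bounds 2 m and m for \<open>u\<close>.\<close>
        define u where "u = (\<lambda>i. s i div int q)"
        define v where "v = (\<lambda>i. nat (s i mod int q))"
        have qi: "int q > 0" using q by simp
        have v: "v i < q" "int (v i) = s i mod int q" for i
          using pos_mod_bound[OF qi, of "s i"] pos_mod_sign[OF qi, of "s i"] by (auto simp: v_def nat_less_iff)
        have sv: "s i = int q * u i + int (v i)" for i unfolding u_def v(2) by simp
        have vJ: "v \<in> nat_cube (2 ^ J)" using v(1) J(1) by (auto simp: nat_cube_def intro: less_le_trans)
        have eq: "real q *\<^sub>R intvec u + (l / 2 ^ J) *\<^sub>R natvec v = intvec s"
          unfolding l_def by (simp add: vec_eq_iff intvec_def natvec_def sv)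
        have sb: "\<bar>s i\<bar> \<le> int (2 * m) * int q" for i using s(1) by (auto simp: lattice_annulus_def int_cube_def mult.assoc)
        have dm: "(N * int q) div int q = N" for N using qi by simp
        have ub: "\<bar>u i\<bar> \<le> int (2 * m)" for i
        proof -
          have "u i \<le> (int (2 * m) * int q) div int q" unfolding u_def using sb[of i] qi by (intro zdiv_mono1) auto
          moreover have "((- int (2 * m)) * int q) div int q \<le> u i" unfolding u_def using sb[of i] qi by (intro zdiv_mono1) auto
          ultimately show ?thesis unfolding dm by linarith
        qed
        obtain i where i: "\<bar>s i\<bar> \<ge> int m * int q" using s(1) by (auto simp: lattice_annulus_def)
        have "\<bar>u i\<bar> \<ge> int m"
        proof (cases "s i \<ge> 0")
          case True
          have "(int m * int q) div int q \<le> u i" unfolding u_def using i True qi by (intro zdiv_mono1) auto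
          then show ?thesis unfolding dm by linarith
        next
          case False
          have "u i \<le> ((- int m) * int q) div int q" unfolding u_def using i False qi by (intro zdiv_mono1) auto
          then show ?thesis unfolding dm by linarith
        qed
        then have uN: "intvec u \<in> ?N" unfolding net_def using ub by (intro imageI) (auto simp: int_cube_def)
        then have "w \<notin> bad (intvec u)" using nw by blast
        then have "\<bar>\<xi> (intvec s) w - \<xi> (real q *\<^sub>R intvec u) w\<bar> \<le> cc * l powr H * (1 + z)"
        proof -
          have "\<not> \<bar>\<xi> (real q *\<^sub>R intvec u + (l / 2 ^ J) *\<^sub>R natvec v) w - \<xi> (real q *\<^sub>R intvec u) w\<bar> > cc * l powr H * (1 + z)"
            using \<open>w \<notin> bad (intvec u)\<close> ws vJ unfolding bad_def by blast
          then show ?thesis unfolding eq by simp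
        qed
        moreover have "\<xi> (real q *\<^sub>R intvec u) w < - 2 * x" using w uN unfolding good_def by blast
        ultimately show False using s(2) xz by linarith
      qed
    qed
    have [measurable]: "(\<Union>p\<in>?N. bad p) \<in> sets M" by (rule sets.finite_UN) auto
    have "p0 \<le> measure M good" using elim(1) unfolding good_def x_def by (simp add: mult.assoc)
    also have "\<dots> \<le> measure M (goal \<union> (\<Union>p\<in>?N. bad p))"
      by (rule finite_measure_mono[OF sub]) measurable
    also have "\<dots> \<le> measure M goal + measure M (\<Union>p\<in>?N. bad p)" by (rule measure_Un_le) auto
    also have "measure M (\<Union>p\<in>?N. bad p) \<le> (\<Sum>p\<in>?N. measure M (bad p))"
      by (rule measure_UNION_le) auto
    also have "\<dots> \<le> real (card ?N) * (3 * exp (- z\<^sup>2))"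
      using sum_bounded_above[of ?N "\<lambda>p. measure M (bad p)" "3 * exp (- z\<^sup>2)"] bad by simp
    also have "\<dots> \<le> (4 * real m + 1) ^ CARD('n) * (3 * exp (- z\<^sup>2))" using cardN by (intro mult_right_mono) auto
    also have "\<dots> \<le> p0 / 2" using m(3) by (simp add: z_def)
    finally have "p0 / 2 \<le> measure M goal" by simp
    then show ?case unfolding goal_def x_def by simp
  qed
  then show ?thesis using p0(1) m(1) by (intro exI[of _ "p0 / 2"] conjI exI[of _ m]) auto
qed

end

section \<open>Outward steps and records on the integer lattice\<close>

definition sup_nm :: "('n::finite \<Rightarrow> int) \<Rightarrow> nat" where
  "sup_nm u = Max (range (\<lambda>i. nat \<bar>u i\<bar>))"

lemma sup_nm_ge: "nat \<bar>u i\<bar> \<le> sup_nm u"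
  unfolding sup_nm_def by (intro Max_ge) auto

lemma sup_nm_attained: "\<exists>i. nat \<bar>u i\<bar> = sup_nm u"
proof -
  have "Max (range (\<lambda>i. nat \<bar>u i\<bar>)) \<in> range (\<lambda>i. nat \<bar>u i\<bar>)" by (rule Max_in) auto
  then obtain i where "Max (range (\<lambda>i. nat \<bar>u i\<bar>)) = nat \<bar>u i\<bar>" by (rule imageE)
  then show ?thesis unfolding sup_nm_def by (intro exI[of _ i]) simp
qed

lemma sup_nm_le_iff: "sup_nm u \<le> N \<longleftrightarrow> (\<forall>i. \<bar>u i\<bar> \<le> int N)"
proof
  assume "sup_nm u \<le> N"
  show "\<forall>i. \<bar>u i\<bar> \<le> int N"
  proof
    fix i
    show "\<bar>u i\<bar> \<le> int N" using sup_nm_ge[of u i] \<open>sup_nm u \<le> N\<close> by linarith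
  qed
next
  assume a: "\<forall>i. \<bar>u i\<bar> \<le> int N"
  obtain i where "nat \<bar>u i\<bar> = sup_nm u" using sup_nm_attained by blast
  then show "sup_nm u \<le> N" using a[rule_format, of i] by linarith
qed

lemma int_cube_sup_nm: "u \<in> int_cube N \<longleftrightarrow> sup_nm u \<le> N"
  by (simp add: int_cube_def sup_nm_le_iff)

lemma sup_nm_geI: "int N \<le> \<bar>u i\<bar> \<Longrightarrow> N \<le> sup_nm u"
  using sup_nm_ge[of u i] by linarith

text \<open>Deterministic core of the record argument: the field at \<open>0\<close> exceeds its values far away
  only through points that dominate everything at least as far from \<open>0\<close> as themselves.\<close>

lemma value_at_0_by_records:
  fixes f :: "('n::finite \<Rightarrow> int) \<Rightarrow> real"
  assumes out: "\<And>u. n \<le> sup_nm u \<Longrightarrow> sup_nm u \<le> R \<Longrightarrow> f u \<le> B"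
    and \<sigma>: "\<And>u. sup_nm u < n \<Longrightarrow> sup_nm (\<sigma> u) = Suc (sup_nm u)" and nR: "n \<le> R"
    and h: "\<And>u. sup_nm u < n \<Longrightarrow> (\<And>s. sup_nm u \<le> sup_nm s \<Longrightarrow> sup_nm s \<le> R \<Longrightarrow> f s \<le> f u) \<Longrightarrow> f u - f (\<sigma> u) \<le> h u"
    and h0: "\<And>u. 0 \<le> h u"
  shows "f (\<lambda>_. 0) \<le> B + (\<Sum>u\<in>{u. sup_nm u < n}. h u)"
proof -
  have fin: "finite {u :: 'n \<Rightarrow> int. P u \<and> sup_nm u \<le> N}" for P N
    by (rule finite_subset[OF _ finite_int_cube[of N]]) (auto simp: int_cube_sup_nm)
  have fin': "finite {u :: 'n \<Rightarrow> int. P u \<and> sup_nm u < N}" for P N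
    by (rule finite_subset[OF _ finite_int_cube[of N]]) (auto simp: int_cube_sup_nm)
  have "\<forall>u. n - j \<le> sup_nm u \<and> sup_nm u \<le> R \<longrightarrow> f u \<le> B + (\<Sum>v\<in>{v. n - j \<le> sup_nm v \<and> sup_nm v < n}. h v)" if "j \<le> n" for j
    using that
  proof (induction j)
    case 0
    have e: "{v. n - 0 \<le> sup_nm v \<and> sup_nm v < n} = {}" by auto
    show ?case unfolding e using out by simp
  next
    case (Suc j)
    define \<rho> where "\<rho> = n - Suc j"
    have \<rho>: "n - j = Suc \<rho>" "\<rho> < n" using Suc.prems by (auto simp: \<rho>_def)
    have IH: "f u \<le> B + (\<Sum>v\<in>{v. Suc \<rho> \<le> sup_nm v \<and> sup_nm v < n}. h v)" if "Suc \<rho> \<le> sup_nm u" "sup_nm u \<le> R" for u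
      using Suc.IH Suc.prems that unfolding \<rho>(1) by simp
    define A where "A = {u :: 'n \<Rightarrow> int. \<rho> \<le> sup_nm u \<and> sup_nm u \<le> R}"
    have A: "finite A" unfolding A_def by (rule fin)
    show ?case unfolding \<rho>_def[symmetric]
    proof (intro allI impI)
      fix u :: "'n \<Rightarrow> int" assume u: "\<rho> \<le> sup_nm u \<and> sup_nm u \<le> R"
      have uA: "u \<in> A" using u by (simp add: A_def)
      have "Max (f ` A) \<in> f ` A" using uA A by (intro Max_in) auto
      \<comment> \<open>The induction moves inwards from radius \<open>n\<close>. Either the
        maximiser lies strictly further out, where the bound is known, or it lies at radius
        \<open>\<rho>\<close> and dominates everything outside; then one outward step reaches a
        known bound, and its increment is charged to \<open>h m\<close>. Thus each radius pays for
        at most one point.\<close>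
      then obtain m where m: "Max (f ` A) = f m" "m \<in> A" by (rule imageE)
      have mmax: "f s \<le> f m" if "s \<in> A" for s unfolding m(1)[symmetric] using that A by (intro Max_ge) auto
      have mono: "(\<Sum>v\<in>{v. Suc \<rho> \<le> sup_nm v \<and> sup_nm v < n}. h v) \<le> (\<Sum>v\<in>{v. \<rho> \<le> sup_nm v \<and> sup_nm v < n}. h v)"
        by (intro sum_mono2 fin' h0) auto
      have "f m \<le> B + (\<Sum>v\<in>{v. \<rho> \<le> sup_nm v \<and> sup_nm v < n}. h v)"
      proof (cases "Suc \<rho> \<le> sup_nm m")
        case True
        then show ?thesis using IH[of m] m(2) mono unfolding A_def by auto
      next
        case False
        then have mr: "sup_nm m = \<rho>" using m(2) by (auto simp: A_def)
        have s: "sup_nm (\<sigma> m) = Suc \<rho>" using \<sigma>[of m] mr \<rho>(2) by simp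
        have "f m - f (\<sigma> m) \<le> h m" using mr \<rho>(2) mmax by (intro h) (auto simp: A_def)
        moreover have "f (\<sigma> m) \<le> B + (\<Sum>v\<in>{v. Suc \<rho> \<le> sup_nm v \<and> sup_nm v < n}. h v)"
          using s \<rho>(2) nR by (intro IH) auto
        moreover have "h m + (\<Sum>v\<in>{v. Suc \<rho> \<le> sup_nm v \<and> sup_nm v < n}. h v) \<le> (\<Sum>v\<in>{v. \<rho> \<le> sup_nm v \<and> sup_nm v < n}. h v)"
        proof -
          have "h m + (\<Sum>v\<in>{v. Suc \<rho> \<le> sup_nm v \<and> sup_nm v < n}. h v) = (\<Sum>v\<in>insert m {v. Suc \<rho> \<le> sup_nm v \<and> sup_nm v < n}. h v)"
            using mr by (subst sum.insert) (auto simp: fin')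
          also have "\<dots> \<le> (\<Sum>v\<in>{v. \<rho> \<le> sup_nm v \<and> sup_nm v < n}. h v)"
            using mr \<rho>(2) by (intro sum_mono2 fin' h0) auto
          finally show ?thesis .
        qed
        ultimately show ?thesis by linarith
      qed
      then show "f u \<le> B + (\<Sum>v\<in>{v. \<rho> \<le> sup_nm v \<and> sup_nm v < n}. h v)"
        using mmax[OF uA] by linarith
    qed
  qed
  from this[of n] have "sup_nm (\<lambda>_::'n. 0) \<le> R \<Longrightarrow> f (\<lambda>_. 0) \<le> B + (\<Sum>v\<in>{v. sup_nm v < n}. h v)" by simp
  moreover have "sup_nm (\<lambda>_::'n. 0) \<le> R" by (simp add: sup_nm_le_iff)
  ultimately show ?thesis by blast
qed

text \<open>Exchanges coordinates \<open>i\<close> and \<open>e\<close> and multiplies coordinate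
  \<open>i\<close> by \<open>s\<close>. For a sign \<open>s\<close> it is orthogonal and, unlike a
  general rotation, preserves the integer lattice.\<close>

definition signed_swap :: "'n::finite \<Rightarrow> 'n \<Rightarrow> real \<Rightarrow> real^'n \<Rightarrow> real^'n" where
  "signed_swap i e s x = (\<chi> j. (if j = i then s else 1) * x $ (Transposition.transpose i e j))"

lemma orthogonal_signed_swap:
  assumes "\<bar>s\<bar> = 1"
  shows "orthogonal_transformation (signed_swap i e s)"
proof -
  have ss: "s * s = 1" using abs_mult_self_eq[of s] assms by simp
  have "signed_swap i e s x \<bullet> signed_swap i e s y = x \<bullet> y" for x y
  proof -
    have "signed_swap i e s x \<bullet> signed_swap i e s y = (\<Sum>j\<in>UNIV. x $ (Transposition.transpose i e j) * y $ (Transposition.transpose i e j))"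
      unfolding inner_vec_def
    proof (intro sum.cong refl)
      fix j
      define c where "c = (if j = i then s else 1)"
      have cc: "c * c = 1" using ss by (simp add: c_def)
      have "(c * p) * (c * q) = (c * c) * (p * q)" for p q :: real by (simp only: mult_ac)
      then show "signed_swap i e s x $ j \<bullet> signed_swap i e s y $ j = x $ (Transposition.transpose i e j) * y $ (Transposition.transpose i e j)"
        unfolding signed_swap_def c_def[symmetric] cc by (simp add: c_def[symmetric] cc)
    qed
    also have "\<dots> = (\<Sum>j\<in>UNIV. x $ j * y $ j)"
      by (rule sum.reindex_bij_betw[where h = "Transposition.transpose i e" and g = "\<lambda>j. x $ j * y $ j"]) (simp add: bij_transpose)
    finally show ?thesis by (simp add: inner_vec_def)
  qed
  moreover have "linear (signed_swap i e s)"
    by (rule linearI) (auto simp: signed_swap_def vec_eq_iff algebra_simps)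
  ultimately show ?thesis by (simp add: orthogonal_transformation_def)
qed

definition half_cube :: "'n::finite \<Rightarrow> nat \<Rightarrow> (real^'n) set" where
  "half_cube e N = intvec ` {v \<in> int_cube N. v e \<ge> 0}"

lemma finite_half_cube [simp]: "finite (half_cube e N)"
  unfolding half_cube_def by (intro finite_imageI) (rule finite_subset[OF _ finite_int_cube[of N]], auto)

definition outward :: "('n::finite \<Rightarrow> int) \<Rightarrow> ('n \<Rightarrow> int)" where
  "outward u = (let i = (SOME i. nat \<bar>u i\<bar> = sup_nm u) in u(i := u i + (if u i \<ge> 0 then 1 else - 1)))"

lemma outward:
  shows "sup_nm (outward u) = Suc (sup_nm u)" "norm (intvec u - intvec (outward u)) = 1"
proof -
  define i where "i = (SOME i. nat \<bar>u i\<bar> = sup_nm u)"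
  have i: "nat \<bar>u i\<bar> = sup_nm u" unfolding i_def using sup_nm_attained[of u] by (rule someI_ex)
  define s where "s = (if u i \<ge> 0 then 1 else - 1 :: int)"
  have o: "outward u = u(i := u i + s)" unfolding outward_def Let_def i_def[symmetric] s_def ..
  have oi: "\<bar>u i + s\<bar> = int (Suc (sup_nm u))" using i by (auto simp: s_def)
  show "sup_nm (outward u) = Suc (sup_nm u)"
  proof (rule antisym)
    show "sup_nm (outward u) \<le> Suc (sup_nm u)"
      unfolding sup_nm_le_iff
    proof
      fix j
      show "\<bar>outward u j\<bar> \<le> int (Suc (sup_nm u))"
        using oi sup_nm_ge[of u j] by (cases "j = i") (auto simp: o)
    qed
    show "Suc (sup_nm u) \<le> sup_nm (outward u)"
      by (rule sup_nm_geI[of _ _ i]) (simp add: o oi)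
  qed
  have "intvec u - intvec (outward u) = (- real_of_int s) *\<^sub>R axis i 1"
    by (auto simp: vec_eq_iff intvec_def o axis_def)
  then show "norm (intvec u - intvec (outward u)) = 1"
    by (simp only: norm_scaleR norm_axis_1) (simp add: s_def)
qed

lemma signed_swap_intvec:
  "signed_swap i e (real_of_int s) (intvec v) = intvec (\<lambda>j. (if j = i then s else 1) * v (Transposition.transpose i e j))"
  by (auto simp: signed_swap_def intvec_def vec_eq_iff)

context regular_field
begin

text \<open>Let \<open>i\<close> be a coordinate attaining the sup norm of \<open>u\<close>. Moving
  from \<open>u\<close> by a vector whose \<open>i\<close>-th component has the sign of
  \<open>u i\<close> does not decrease |u i|, so a copy of the half cube attached at
  \<open>u\<close> stays in the annulus; the outer radius \<open>2 * n\<close> is n + n. The lattice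
  symmetry \<open>T\<close> takes the half cube at 0 to this copy.\<close>

lemma view_half_cube:
  assumes u: "sup_nm u \<le> n"
  shows "measure M {w \<in> space M. \<forall>s\<in>lattice_annulus (sup_nm u) (2 * n). \<xi> (intvec s) w \<le> \<xi> (intvec u) w}
    \<le> measure M {w \<in> space M. \<forall>t\<in>half_cube e n. \<xi> t w < 1}"
proof -
  note [measurable] = cgp_measurable[OF M iso_field_cgp[OF M iso]]
  obtain i where i: "nat \<bar>u i\<bar> = sup_nm u" using sup_nm_attained by blast
  define s where "s = (if u i \<ge> 0 then 1 else - 1 :: int)"
  have s1: "\<bar>s\<bar> = 1" by (simp add: s_def)
  define T where "T = signed_swap i e (real_of_int s)"
  have T: "orthogonal_transformation T" unfolding T_def by (rule orthogonal_signed_swap) (simp add: s_def)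
  define Q where "Q = inv T"
  have Q: "orthogonal_transformation Q" unfolding Q_def by (rule orthogonal_transformation_inv[OF T])
  have QT: "Q (T x) = x" for x unfolding Q_def by (rule inv_f_f[OF orthogonal_transformation_inj[OF T]])
  define F where "F = (\<lambda>t. intvec u + T t) ` half_cube e n"
  have F: "finite F" by (simp add: F_def)
  have FA: "\<exists>s\<in>lattice_annulus (sup_nm u) (2 * n). x = intvec s" if "x \<in> F" for x
  proof -
    from that obtain h where h: "h \<in> half_cube e n" "x = intvec u + T h" unfolding F_def by (rule imageE)
    from h(1) obtain v where "h = intvec v" "v \<in> {v \<in> int_cube n. v e \<ge> 0}" unfolding half_cube_def by (rule imageE)
    with h(2) have v: "v \<in> int_cube n" "v e \<ge> 0" "x = intvec u + T (intvec v)" by auto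
    define y where "y = (\<lambda>j. u j + (if j = i then s else 1) * v (Transposition.transpose i e j))"
    have x: "x = intvec y" unfolding v(3) T_def signed_swap_intvec by (simp add: y_def intvec_def vec_eq_iff)
    have "\<bar>y j\<bar> \<le> int (2 * n)" for j
    proof -
      have "\<bar>(if j = i then s else 1) * v (Transposition.transpose i e j)\<bar> \<le> int n"
      proof -
        have "\<bar>v (Transposition.transpose i e j)\<bar> \<le> int n" using v(1) by (simp add: int_cube_def)
        then show ?thesis using s1 by (cases "j = i") (simp_all add: abs_mult)
      qed
      moreover have "\<bar>u j\<bar> \<le> int n" using u by (simp add: sup_nm_le_iff)
      ultimately show ?thesis unfolding y_def by linarith
    qed
    moreover have "int (sup_nm u) \<le> \<bar>y i\<bar>"
    proof -
      have "y i = u i + s * v e" by (simp add: y_def)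
      then show ?thesis using i v(2) by (auto simp: s_def split: if_splits)
    qed
    ultimately show ?thesis unfolding x by (intro bexI[of _ y] refl) (auto simp: lattice_annulus_def int_cube_def)
  qed
  have "measure M {w \<in> space M. \<forall>s\<in>lattice_annulus (sup_nm u) (2 * n). \<xi> (intvec s) w \<le> \<xi> (intvec u) w}
     \<le> measure M {w \<in> space M. \<forall>x\<in>F. \<xi> x w - \<xi> (intvec u) w < 1}"
  proof (rule finite_measure_mono)
    show "{w \<in> space M. \<forall>x\<in>F. \<xi> x w - \<xi> (intvec u) w < 1} \<in> sets M" using F by measurable
    show "{w \<in> space M. \<forall>s\<in>lattice_annulus (sup_nm u) (2 * n). \<xi> (intvec s) w \<le> \<xi> (intvec u) w} \<subseteq>
      {w \<in> space M. \<forall>x\<in>F. \<xi> x w - \<xi> (intvec u) w < 1}"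
    proof (rule subsetI, clarify)
      fix w x assume a: "\<forall>s\<in>lattice_annulus (sup_nm u) (2 * n). \<xi> (intvec s) w \<le> \<xi> (intvec u) w" and x: "x \<in> F"
      obtain s where "s \<in> lattice_annulus (sup_nm u) (2 * n)" "x = intvec s" using FA[OF x] by blast
      then have "\<xi> x w \<le> \<xi> (intvec u) w" using a by blast
      then show "\<xi> x w - \<xi> (intvec u) w < 1" by linarith
    qed
  qed
  also have "\<dots> = measure M {w \<in> space M. \<forall>x\<in>F. \<xi> (Q (x - intvec u)) w < 1}"
    by (rule increments_rectangle[OF M iso F Q])
  also have "{w \<in> space M. \<forall>x\<in>F. \<xi> (Q (x - intvec u)) w < 1} = {w \<in> space M. \<forall>t\<in>half_cube e n. \<xi> t w < 1}"
    unfolding F_def by (simp add: QT)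
  finally show ?thesis .
qed

text \<open>Up to \<open>L\<close> the increment is bounded by \<open>L\<close>. Beyond, y <= sqrt
  (8 k) exp (y^2 / (8 k)), and half of the exponent y^2 / (4 k), whose exponential moment is at most
  2, is traded for exp (- L^2 / (8 k)).\<close>

lemma truncated_step:
  assumes L: "L \<ge> 0" and k1: "V 1 \<le> k" and A: "A \<in> sets M" and st: "norm (s - t) = 1"
  shows "(\<integral>\<^sup>+w. ennreal (indicator A w * \<bar>\<xi> s w - \<xi> t w\<bar>) \<partial>M) \<le> ennreal (L * measure M A + 2 * sqrt (8 * k) * exp (- L\<^sup>2 / (8 * k)))"
proof -
  note [measurable] = cgp_measurable[OF M iso_field_cgp[OF M iso]] A
  define \<eta> where "\<eta> = (\<lambda>w. \<xi> s w - \<xi> t w)"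
  have [measurable]: "\<eta> \<in> borel_measurable M" unfolding \<eta>_def by measurable
  define \<beta> where "\<beta> = sqrt (8 * k) * exp (- L\<^sup>2 / (8 * k))"
  have \<beta>: "\<beta> \<ge> 0" using k by (simp add: \<beta>_def)
  have "gaussian_variable M \<eta>" "(LINT w|M. \<eta> w) = 0"
    unfolding \<eta>_def using cgp_single[OF M cgp_increments[OF M iso, of t], of s] by auto
  moreover have "(LINT w|M. (\<eta> w)\<^sup>2) \<le> (sqrt k)\<^sup>2"
    unfolding \<eta>_def iso_field_increment_var[OF M iso] st using k1 k by simp
  ultimately have E: "(\<integral>\<^sup>+w. ennreal (exp ((\<eta> w)\<^sup>2 / (4 * (sqrt k)\<^sup>2))) \<partial>M) \<le> 2"
    using k by (intro gaussian_exp_square[OF M]) auto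
  have pt: "indicator A w * \<bar>\<eta> w\<bar> \<le> L * indicator A w + \<beta> * exp ((\<eta> w)\<^sup>2 / (4 * (sqrt k)\<^sup>2))" for w
  proof (cases "\<bar>\<eta> w\<bar> \<le> L")
    case True
    then have "indicator A w * \<bar>\<eta> w\<bar> \<le> L * indicator A w" by (auto simp: indicator_def)
    moreover have "0 \<le> \<beta> * exp ((\<eta> w)\<^sup>2 / (4 * (sqrt k)\<^sup>2))" using \<beta> by simp
    ultimately show ?thesis by linarith
  next
    case False
    define y where "y = \<bar>\<eta> w\<bar>"
    have y: "y > L" "y \<ge> 0" using False by (auto simp: y_def)
    have "y \<le> \<beta> * exp (y\<^sup>2 / (4 * k))"
    proof -
      define r where "r = y / sqrt (8 * k)"
      have r2: "r\<^sup>2 = y\<^sup>2 / (8 * k)" using k by (simp add: r_def power_divide)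
      have "r \<le> 1 + r\<^sup>2" using sum_squares_bound[of r 1] by (simp add: power2_eq_square) (smt (verit) zero_le_square)
      also have "\<dots> \<le> exp (r\<^sup>2)" using exp_ge_add_one_self[of "r\<^sup>2"] by simp
      finally have "r \<le> exp (y\<^sup>2 / (8 * k))" unfolding r2 .
      then have 1: "y \<le> sqrt (8 * k) * exp (y\<^sup>2 / (8 * k))" using k by (simp add: r_def field_simps)
      have "L\<^sup>2 \<le> y\<^sup>2" using y L by (intro power_mono) auto
      then have "L\<^sup>2 / (8 * k) \<le> y\<^sup>2 / (8 * k)" using k by (intro divide_right_mono) auto
      then have "y\<^sup>2 / (8 * k) \<le> - L\<^sup>2 / (8 * k) + y\<^sup>2 / (4 * k)" by (simp add: field_simps)
      then have "exp (y\<^sup>2 / (8 * k)) \<le> exp (- L\<^sup>2 / (8 * k)) * exp (y\<^sup>2 / (4 * k))" by (simp add: mult_exp_exp)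
      then have "sqrt (8 * k) * exp (y\<^sup>2 / (8 * k)) \<le> sqrt (8 * k) * (exp (- L\<^sup>2 / (8 * k)) * exp (y\<^sup>2 / (4 * k)))"
        using k by (intro mult_left_mono) auto
      then show ?thesis using 1 by (simp add: \<beta>_def mult.assoc)
    qed
    moreover have "indicator A w * \<bar>\<eta> w\<bar> \<le> y" unfolding y_def by (auto simp: indicator_def)
    moreover have "0 \<le> L * indicator A w" using L by simp
    ultimately show ?thesis using k by (simp add: y_def)
  qed
  have "(\<integral>\<^sup>+w. ennreal (indicator A w * \<bar>\<eta> w\<bar>) \<partial>M) \<le> (\<integral>\<^sup>+w. ennreal L * indicator A w + ennreal \<beta> * ennreal (exp ((\<eta> w)\<^sup>2 / (4 * (sqrt k)\<^sup>2))) \<partial>M)"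
  proof (rule nn_integral_mono)
    fix w
    have "ennreal (indicator A w * \<bar>\<eta> w\<bar>) \<le> ennreal (L * indicator A w + \<beta> * exp ((\<eta> w)\<^sup>2 / (4 * (sqrt k)\<^sup>2)))"
      by (rule ennreal_leI[OF pt])
    also have "\<dots> = ennreal (L * indicator A w) + ennreal (\<beta> * exp ((\<eta> w)\<^sup>2 / (4 * (sqrt k)\<^sup>2)))"
      using L \<beta> by (intro ennreal_plus) auto
    also have "\<dots> = ennreal L * indicator A w + ennreal \<beta> * ennreal (exp ((\<eta> w)\<^sup>2 / (4 * (sqrt k)\<^sup>2)))"
      using L \<beta> by (auto simp: ennreal_mult indicator_def)
    finally show "ennreal (indicator A w * \<bar>\<eta> w\<bar>) \<le> ennreal L * indicator A w + ennreal \<beta> * ennreal (exp ((\<eta> w)\<^sup>2 / (4 * (sqrt k)\<^sup>2)))" .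
  qed
  also have "\<dots> = ennreal L * emeasure M A + ennreal \<beta> * (\<integral>\<^sup>+w. ennreal (exp ((\<eta> w)\<^sup>2 / (4 * (sqrt k)\<^sup>2))) \<partial>M)"
    by (subst nn_integral_add) (auto simp: nn_integral_cmult)
  also have "\<dots> \<le> ennreal L * emeasure M A + ennreal \<beta> * 2"
    using E by (intro add_left_mono mult_left_mono) auto
  also have "\<dots> = ennreal (L * measure M A + 2 * \<beta>)"
    using L \<beta> by (simp add: emeasure_eq_measure ennreal_mult_two ennreal_mult[symmetric] del: ennreal_plus flip: ennreal_plus)
  finally show ?thesis unfolding \<eta>_def \<beta>_def by (simp add: mult.assoc)
qed

text \<open>On the event that the annulus is below \<open>- x\<close>, the vanishing of the field at
  0 forces the increments at records inside radius \<open>n\<close> to add up to at least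
  \<open>x\<close>. Taking expectations, each of at most (2 n)^d points contributes a truncated step
  on an event no more likely than half cube persistence.\<close>

lemma record_inequality:
  assumes n: "n \<ge> 1" and x: "x \<ge> 0" and L: "L \<ge> 0"
  shows "x * measure M {w \<in> space M. \<forall>u\<in>lattice_annulus n (2 * n). \<xi> (intvec u) w < - x}
    \<le> (2 * real n) ^ CARD('n) * (L * measure M {w \<in> space M. \<forall>t\<in>half_cube e n. \<xi> t w < 1} + 2 * sqrt (8 * k) * exp (- L\<^sup>2 / (8 * k)))"
proof -
  note [measurable] = cgp_measurable[OF M iso_field_cgp[OF M iso]]
  have k1: "V 1 \<le> k" using V[of 1] by simp
  define p where "p = measure M {w \<in> space M. \<forall>t\<in>half_cube e n. \<xi> t w < 1}"
  define G where "G = {w \<in> space M. \<forall>u\<in>lattice_annulus n (2 * n). \<xi> (intvec u) w < - x}"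
  have [measurable]: "G \<in> sets M" unfolding G_def by measurable
  define A where "A = (\<lambda>u. {w \<in> space M. \<forall>s\<in>lattice_annulus (sup_nm u) (2 * n). \<xi> (intvec s) w \<le> \<xi> (intvec u) w})"
  have Am [measurable]: "A u \<in> sets M" for u unfolding A_def by measurable
  define h where "h = (\<lambda>u w. indicator (A u) w * \<bar>\<xi> (intvec u) w - \<xi> (intvec (outward u)) w\<bar>)"
  have h0: "h u w \<ge> 0" for u w by (simp add: h_def)
  have [measurable]: "h u \<in> borel_measurable M" for u unfolding h_def by measurable
  define I where "I = {u :: 'n \<Rightarrow> int. sup_nm u < n}"
  have Isub: "I \<subseteq> int_cube (n - 1)" using n by (auto simp: I_def int_cube_sup_nm)
  have finI: "finite I" using Isub by (rule finite_subset) simp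
  define \<gamma> where "\<gamma> = 2 * sqrt (8 * k) * exp (- L\<^sup>2 / (8 * k))"
  have \<gamma>: "\<gamma> \<ge> 0" using k by (simp add: \<gamma>_def)
  have cardI: "real (card I) \<le> (2 * real n) ^ CARD('n)"
  proof -
    have "card I \<le> (2 * (n - 1) + 1) ^ CARD('n)" using card_mono[OF finite_int_cube Isub] by (simp only: card_int_cube)
    also have "\<dots> \<le> (2 * n) ^ CARD('n)" using n by (intro power_mono) auto
    finally have "real (card I) \<le> real ((2 * n) ^ CARD('n))" by (simp only: of_nat_le_iff)
    then show ?thesis by simp
  qed
  have pt: "AE w in M. ennreal (x * indicator G w) \<le> (\<Sum>u\<in>I. ennreal (h u w))"
    using field_at_0
  proof eventually_elim
    case (elim w)
    have s0: "(\<Sum>u\<in>I. ennreal (h u w)) = ennreal (\<Sum>u\<in>I. h u w)" by (rule sum_ennreal) (rule h0)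
    show ?case
    proof (cases "w \<in> G")
      case True
      then have ws: "w \<in> space M" by (simp add: G_def)
      have "\<xi> (intvec (\<lambda>_. 0)) w \<le> - x + (\<Sum>u\<in>{u. sup_nm u < n}. h u w)"
      proof (rule value_at_0_by_records[where \<sigma> = outward and R = "2 * n"])
        fix u :: "'n \<Rightarrow> int" assume u: "n \<le> sup_nm u" "sup_nm u \<le> 2 * n"
        obtain i where "nat \<bar>u i\<bar> = sup_nm u" using sup_nm_attained by blast
        then have "int n \<le> \<bar>u i\<bar>" using u(1) by linarith
        then have "u \<in> lattice_annulus n (2 * n)" using u(2) by (auto simp: lattice_annulus_def int_cube_sup_nm)
        then have "\<xi> (intvec u) w < - x" using True unfolding G_def by blast
        then show "\<xi> (intvec u) w \<le> - x" by simp
      next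
        fix u :: "'n \<Rightarrow> int" assume u: "sup_nm u < n"
          and mx: "\<And>s. sup_nm u \<le> sup_nm s \<Longrightarrow> sup_nm s \<le> 2 * n \<Longrightarrow> \<xi> (intvec s) w \<le> \<xi> (intvec u) w"
        have "w \<in> A u" unfolding A_def
        proof (intro CollectI conjI ballI ws)
          fix s assume s: "s \<in> lattice_annulus (sup_nm u) (2 * n)"
          then obtain i where "int (sup_nm u) \<le> \<bar>s i\<bar>" by (auto simp: lattice_annulus_def)
          then have "sup_nm u \<le> sup_nm s" by (rule sup_nm_geI)
          then show "\<xi> (intvec s) w \<le> \<xi> (intvec u) w" using s by (intro mx) (auto simp: lattice_annulus_def int_cube_sup_nm)
        qed
        then show "\<xi> (intvec u) w - \<xi> (intvec (outward u)) w \<le> h u w" by (simp add: h_def)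
      qed (use outward n h0 in auto)
      moreover have "intvec (\<lambda>_::'n. 0) = 0" by (simp add: intvec_def vec_eq_iff)
      ultimately have "x \<le> (\<Sum>u\<in>I. h u w)" using elim by (simp add: I_def)
      then show ?thesis unfolding s0 using True by (simp add: ennreal_leI)
    qed simp
  qed
  have "ennreal (x * measure M G) = (\<integral>\<^sup>+w. ennreal x * indicator G w \<partial>M)"
    using x by (simp add: nn_integral_cmult emeasure_eq_measure ennreal_mult)
  also have "\<dots> = (\<integral>\<^sup>+w. ennreal (x * indicator G w) \<partial>M)"
    by (intro nn_integral_cong) (auto simp: indicator_def)
  also have "\<dots> \<le> (\<integral>\<^sup>+w. (\<Sum>u\<in>I. ennreal (h u w)) \<partial>M)" by (rule nn_integral_mono_AE[OF pt])
  also have "\<dots> = (\<Sum>u\<in>I. (\<integral>\<^sup>+w. ennreal (h u w) \<partial>M))" by (rule nn_integral_sum) measurable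
  also have "\<dots> \<le> (\<Sum>u\<in>I. ennreal (L * p + \<gamma>))"
  proof (rule sum_mono)
    fix u assume u: "u \<in> I"
    have "(\<integral>\<^sup>+w. ennreal (h u w) \<partial>M) \<le> ennreal (L * measure M (A u) + \<gamma>)"
      unfolding h_def \<gamma>_def by (rule truncated_step[OF L k1 Am outward(2)])
    also have "\<dots> \<le> ennreal (L * p + \<gamma>)"
      unfolding A_def p_def using u L by (intro ennreal_leI add_right_mono mult_left_mono view_half_cube) (auto simp: I_def)
    finally show "(\<integral>\<^sup>+w. ennreal (h u w) \<partial>M) \<le> ennreal (L * p + \<gamma>)" .
  qed
  also have "\<dots> = ennreal (real (card I) * (L * p + \<gamma>))"
    using of_nat_mult_ennreal[of "L * p + \<gamma>" "card I"] L \<gamma> by (simp add: p_def)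
  finally have "x * measure M G \<le> real (card I) * (L * p + \<gamma>)"
    using L \<gamma> by (subst (asm) ennreal_le_iff) (auto simp: p_def)
  also have "\<dots> \<le> (2 * real n) ^ CARD('n) * (L * p + \<gamma>)"
    using cardI L \<gamma> by (intro mult_right_mono) (auto simp: p_def)
  finally show ?thesis unfolding G_def p_def \<gamma>_def .
qed

end

section \<open>Persistence probability of lattice half cubes\<close>

lemma half_cube_mono: "N \<le> N' \<Longrightarrow> half_cube e N \<subseteq> half_cube e N'"
  unfolding half_cube_def int_cube_def by (intro image_mono) (auto intro: order_trans)

context regular_field
begin

lemma half_cube_event [measurable]: "{w \<in> space M. \<forall>t\<in>half_cube e N. \<xi> t w < 1} \<in> sets M"
proof -
  note [measurable] = cgp_measurable[OF M iso_field_cgp[OF M iso]]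
  show ?thesis by measurable
qed

text \<open>The truncation level \<open>L = sqrt (8 k (d + 1) ln n)\<close> makes the Gaussian tail in the record
  inequality of order \<open>1 / n\<close>; it is the source of the factor \<open>sqrt (ln n)\<close>.\<close>

lemma half_cube_lower_multiples:
  "\<exists>a>0. \<exists>m\<ge>1. \<forall>\<^sub>F q in sequentially. a * real (m * q) powr (H - CARD('n)) / sqrt (ln (real (m * q)))
     \<le> measure M {w \<in> space M. \<forall>t\<in>half_cube e (m * q). \<xi> t w < 1}"
proof -
  define d where "d = CARD('n)"
  obtain p0 m where p0: "p0 > 0" and m: "m \<ge> 1" and G: "\<forall>\<^sub>F q in sequentially. p0 \<le> measure M {w \<in> space M.
     \<forall>u\<in>lattice_annulus (m * q) (2 * (m * q)). \<xi> (intvec u) w < - c * (real m * real q) powr H}"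
    using annulus_probability by blast
  \<comment> \<open>Half of \<open>c * p0\<close> pays for the tail term (2 n)^d n^(-d-1), which is
    of order 1 / n; the rest is divided by the 2^d of the point count and the constant in
    \<open>L\<close>.\<close>
  define a where "a = c * p0 / (2 * 2 ^ d * sqrt (8 * k * (real d + 1)))"
  have apos: "a > 0" using c p0 k by (simp add: a_def)
  have "\<forall>\<^sub>F x in at_top. 2 ^ d * (2 * sqrt (8 * k)) / x \<le> c * p0 / 2 * (x::real) powr H"
    using c p0 H by real_asymp
  moreover have fm: "filterlim (\<lambda>q. real (m * q)) at_top sequentially"
  proof -
    have "filterlim (\<lambda>q. m * q) sequentially sequentially"
      using m by (intro filterlim_subseq strict_monoI) auto
    then show ?thesis by (rule filterlim_compose[OF filterlim_real_sequentially])
  qed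
  ultimately have ev1: "\<forall>\<^sub>F q in sequentially. 2 ^ d * (2 * sqrt (8 * k)) / real (m * q) \<le> c * p0 / 2 * real (m * q) powr H"
    by (rule eventually_compose_filterlim)
  have ev2: "\<forall>\<^sub>F q::nat in sequentially. q \<ge> 3" by (rule eventually_ge_at_top)
  have "\<forall>\<^sub>F q in sequentially. a * real (m * q) powr (H - d) / sqrt (ln (real (m * q)))
     \<le> measure M {w \<in> space M. \<forall>t\<in>half_cube e (m * q). \<xi> t w < 1}"
    using G ev1 ev2
  proof eventually_elim
    case (elim q)
    define n where "n = m * q"
    define x where "x = real n"
    have "q \<le> n" using m by (simp add: n_def)
    then have n: "n \<ge> 3" using elim(3) by simp
    then have x: "x \<ge> 3" by (simp add: x_def)
    define l where "l = ln x"
    have l: "l > 0" using x by (simp add: l_def)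
    define L where "L = sqrt (8 * k * (real d + 1)) * sqrt l"
    have L: "L > 0" using k l by (simp add: L_def)
    have L2: "- L\<^sup>2 / (8 * k) = - (real d + 1) * l"
      using k l by (simp add: L_def power_mult_distrib field_simps)
    have E: "exp (- L\<^sup>2 / (8 * k)) = 1 / x ^ (d + 1)"
    proof -
      have "exp (- L\<^sup>2 / (8 * k)) = x powr (- (real (d + 1)))"
        unfolding L2 powr_def l_def using x by (simp add: algebra_simps)
      also have "\<dots> = inverse (x powr real (d + 1))" by (rule powr_minus)
      also have "\<dots> = inverse (x ^ (d + 1))" using x by (subst powr_realpow) auto
      finally show ?thesis by (simp add: inverse_eq_divide)
    qed
    define p where "p = measure M {w \<in> space M. \<forall>t\<in>half_cube e n. \<xi> t w < 1}"
    have "c * x powr H * p0 \<le> c * x powr H * measure M {w \<in> space M. \<forall>u\<in>lattice_annulus n (2 * n). \<xi> (intvec u) w < - (c * x powr H)}"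
      using elim(1) c by (intro mult_left_mono) (auto simp: n_def x_def)
    also have "\<dots> \<le> (2 * real n) ^ d * (L * p + 2 * sqrt (8 * k) * exp (- L\<^sup>2 / (8 * k)))"
      unfolding p_def d_def using n c L by (intro record_inequality) auto
    also have "\<dots> = (2 * x) ^ d * L * p + 2 ^ d * (2 * sqrt (8 * k)) / x"
      unfolding E x_def[symmetric] using x by (simp add: field_simps)
    also have "\<dots> \<le> (2 * x) ^ d * L * p + c * p0 / 2 * x powr H"
      using elim(2) by (simp add: x_def n_def)
    finally have "c * p0 / 2 * x powr H \<le> (2 * x) ^ d * L * p" by (simp add: algebra_simps)
    then have "c * p0 / 2 * x powr H / ((2 * x) ^ d * L) \<le> p" using x L by (simp add: field_simps)
    moreover have "c * p0 / 2 * x powr H / ((2 * x) ^ d * L) = a * x powr (H - d) / sqrt l"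
      using x by (simp add: a_def L_def powr_diff powr_realpow power_mult_distrib)
    ultimately show ?case by (simp add: p_def x_def n_def l_def)
  qed
  then show ?thesis unfolding d_def using apos m by blast
qed

text \<open>The radius \<open>b * r\<close> is rounded up to a multiple of \<open>m\<close>, which
  enlarges the half cube and so only lowers its persistence probability; the constants absorb the
  change of radius.\<close>

lemma half_cube_lower:
  assumes b: "b > 0"
  shows "\<exists>a>0. \<forall>\<^sub>F r in at_top. a * r powr (H - CARD('n)) / sqrt (ln r)
     \<le> measure M {w \<in> space M. \<forall>t\<in>half_cube e (nat \<lceil>b * r\<rceil>). \<xi> t w < 1}"
proof -
  obtain a m where a: "a > 0" and m: "m \<ge> 1" and ev: "\<forall>\<^sub>F q in sequentially. a * real (m * q) powr (H - CARD('n)) / sqrt (ln (real (m * q)))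
     \<le> measure M {w \<in> space M. \<forall>t\<in>half_cube e (m * q). \<xi> t w < 1}"
    using half_cube_lower_multiples by blast
  define D where "D = H - real CARD('n)"
  have D: "D \<le> 0" using H by (simp add: D_def) (smt (verit) card_0_eq finite UNIV_not_empty of_nat_0_less_iff One_nat_def Suc_leI neq0_conv of_nat_1 of_nat_mono)
  define a' where "a' = a * (b + 1) powr D / 2"
  have a': "a' > 0" using a b by (simp add: a'_def)
  define q where "q = (\<lambda>r. nat \<lceil>b * r / m\<rceil>)"
  have fq: "filterlim q sequentially at_top"
  proof -
    have "filterlim (\<lambda>r::real. b * r / m) at_top at_top" using b m by real_asymp
    then have "filterlim (\<lambda>r. real (q r)) at_top at_top"
    proof (rule filterlim_at_top_mono)
      show "\<forall>\<^sub>F r in at_top. b * r / m \<le> real (q r)" unfolding q_def by (intro always_eventually allI real_nat_ceiling_ge)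
    qed
    then show ?thesis by (simp add: filterlim_sequentially_iff_filterlim_real)
  qed
  have e1: "\<forall>\<^sub>F r in at_top. real m + 1 < r \<and> 2 < b * r \<and> ln ((b + 1) * r) \<le> 4 * ln (r::real)"
    using b by (intro eventually_conj; real_asymp)
  have "\<forall>\<^sub>F r in at_top. a' * r powr D / sqrt (ln r)
     \<le> measure M {w \<in> space M. \<forall>t\<in>half_cube e (nat \<lceil>b * r\<rceil>). \<xi> t w < 1}"
    using eventually_compose_filterlim[OF ev fq] e1
  proof eventually_elim
    case (elim r)
    define n where "n = m * q r"
    have "b * r / m \<ge> 0" using elim(2) m b by simp
    then have qr: "b * r / m \<le> real (q r)" "real (q r) \<le> b * r / m + 1"
      unfolding q_def by linarith+
    have n1: "b * r \<le> real n" using qr(1) m by (simp add: n_def field_simps)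
    have "real n \<le> b * r + m" using qr(2) m by (simp add: n_def field_simps)
    then have n2: "real n \<le> (b + 1) * r" using elim(2) by (simp add: algebra_simps)
    have n3: "real n > 2" using n1 elim(2) by simp
    have r: "r > 1" using elim(2) by simp
    have ld: "ln (real n) \<le> 4 * ln r"
    proof -
      have "ln (real n) \<le> ln ((b + 1) * r)" using n2 n3 by (intro ln_mono) auto
      then show ?thesis using elim(2) by simp
    qed
    have "sqrt (ln (real n)) \<le> sqrt (4 * ln r)" using ld by simp
    then have s: "sqrt (ln (real n)) \<le> 2 * sqrt (ln r)" by (simp add: real_sqrt_mult)
    have P: "((b + 1) * r) powr D \<le> real n powr D" using n2 n3 D by (intro powr_mono2') auto
    have "a' * r powr D / sqrt (ln r) = a * ((b + 1) * r) powr D / (2 * sqrt (ln r))"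
      using b r by (simp add: a'_def powr_mult)
    also have "\<dots> \<le> a * real n powr D / sqrt (ln (real n))"
      using P a s n3 r by (intro frac_le mult_left_mono) auto
    also have "\<dots> \<le> measure M {w \<in> space M. \<forall>t\<in>half_cube e n. \<xi> t w < 1}"
      using elim(1) by (simp add: n_def D_def)
    also have "\<dots> \<le> measure M {w \<in> space M. \<forall>t\<in>half_cube e (nat \<lceil>b * r\<rceil>). \<xi> t w < 1}"
    proof (rule finite_measure_mono)
      have "nat \<lceil>b * r\<rceil> \<le> n" using n1 by (simp add: nat_le_iff ceiling_le_iff)
      then have "half_cube e (nat \<lceil>b * r\<rceil>) \<subseteq> half_cube e n" by (rule half_cube_mono)
      then show "{w \<in> space M. \<forall>t\<in>half_cube e n. \<xi> t w < 1} \<subseteq> {w \<in> space M. \<forall>t\<in>half_cube e (nat \<lceil>b * r\<rceil>). \<xi> t w < 1}"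
        by blast
    qed (rule half_cube_event)
    finally show ?case .
  qed
  then show ?thesis unfolding D_def using a' by blast
qed

end

section \<open>Convex domains with smooth boundary at the origin\<close>

lemma differentiable_along_line:
  fixes \<phi> :: "'a::euclidean_space \<Rightarrow> real"
  assumes "\<phi> differentiable (at (y + t *\<^sub>R x))"
  shows "((\<lambda>t. \<phi> (y + t *\<^sub>R x)) has_real_derivative frechet_derivative \<phi> (at (y + t *\<^sub>R x)) x) (at t)"
proof -
  define L where "L = frechet_derivative \<phi> (at (y + t *\<^sub>R x))"
  have L: "(\<phi> has_derivative L) (at (y + t *\<^sub>R x))" unfolding L_def using assms by (simp add: frechet_derivative_works)
  have "((\<lambda>t. y + t *\<^sub>R x) has_derivative (\<lambda>h. h *\<^sub>R x)) (at t)" by (auto intro!: derivative_eq_intros)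
  from has_derivative_compose[OF this L] have "((\<lambda>t. \<phi> (y + t *\<^sub>R x)) has_derivative (\<lambda>h. L (h *\<^sub>R x))) (at t)" .
  moreover have "L (h *\<^sub>R x) = L x * h" for h using linear_scale[OF has_derivative_linear[OF L], of h x] by simp
  ultimately show ?thesis unfolding has_field_derivative_def L_def by (simp add: fun_eq_iff)
qed

text \<open>\<open>\<phi>\<close> is positive along \<open>v + e w\<close> and negative along
  \<open>v - e w\<close> close to 0, so on the segment between them it has a zero. This takes the
  place of the implicit function theorem.\<close>

lemma zero_near_kernel_direction:
  fixes \<phi> :: "'a::euclidean_space \<Rightarrow> real"
  assumes U: "open U" "0 \<in> U" and d: "\<And>x. x \<in> U \<Longrightarrow> \<phi> differentiable (at x)" and 0: "\<phi> 0 = 0"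
    and v: "frechet_derivative \<phi> (at 0) v = 0" and w: "frechet_derivative \<phi> (at 0) w > 0" and e: "e > 0"
  shows "\<exists>s>0. \<exists>\<theta>. \<bar>\<theta>\<bar> \<le> e \<and> s *\<^sub>R (v + \<theta> *\<^sub>R w) \<in> U \<and> \<phi> (s *\<^sub>R (v + \<theta> *\<^sub>R w)) = 0"
proof -
  define L where "L = frechet_derivative \<phi> (at 0)"
  have L: "(\<phi> has_derivative L) (at 0)" unfolding L_def using d[OF U(2)] by (simp add: frechet_derivative_works)
  note lin = has_derivative_linear[OF L]
  have Lv: "L v = 0" using v by (simp add: L_def)
  have Lp: "L (v + \<theta> *\<^sub>R w) = \<theta> * L w" for \<theta>
    by (simp add: linear_add[OF lin] linear_scale[OF lin] Lv)
  have w': "L w > 0" using w by (simp add: L_def)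
  have der: "((\<lambda>s. \<phi> (s *\<^sub>R x)) has_real_derivative L x) (at 0)" for x
    using differentiable_along_line[of \<phi> 0 0 x] d[OF U(2)] by (simp add: L_def)
  have Lpos: "L (v + e *\<^sub>R w) > 0" and Lneg: "L (v + (- e) *\<^sub>R w) < 0" unfolding Lp using w' e by auto
  obtain d1 where d1: "d1 > 0" "\<And>s. 0 < s \<Longrightarrow> s < d1 \<Longrightarrow> 0 < \<phi> (s *\<^sub>R (v + e *\<^sub>R w))"
    using DERIV_pos_inc_right[OF der Lpos] by (simp only: scaleR_zero_left 0 add_0) blast
  obtain d2 where d2: "d2 > 0" "\<And>s. 0 < s \<Longrightarrow> s < d2 \<Longrightarrow> \<phi> (s *\<^sub>R (v + (- e) *\<^sub>R w)) < 0"
    using DERIV_neg_dec_right[OF der Lneg] by (simp only: scaleR_zero_left 0 add_0) blast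
  obtain r where r: "r > 0" "ball 0 r \<subseteq> U" by (rule openE[OF U])
  define B where "B = norm v + e * norm w + 1"
  have B: "B > 0" using e by (simp add: B_def add_nonneg_pos)
  define m where "m = min (min d1 d2) (r / B)"
  have "m > 0" "m \<le> d1" "m \<le> d2" "m \<le> r / B" using d1(1) d2(1) r(1) B by (auto simp: m_def)
  moreover define s where "s = m / 2"
  ultimately have s: "s > 0" "s < d1" "s < d2" "s < r / B" unfolding s_def by linarith+
  have inU: "s *\<^sub>R (v + \<theta> *\<^sub>R w) \<in> U" if "\<bar>\<theta>\<bar> \<le> e" for \<theta>
  proof -
    have "norm (v + \<theta> *\<^sub>R w) \<le> norm v + \<bar>\<theta>\<bar> * norm w"
      using norm_triangle_ineq[of v "\<theta> *\<^sub>R w"] by simp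
    also have "\<dots> \<le> B" using mult_right_mono[OF that norm_ge_zero[of w]] by (simp add: B_def)
    finally have "norm (s *\<^sub>R (v + \<theta> *\<^sub>R w)) \<le> s * B" using s(1) by (simp add: mult_left_mono)
    also have "s * B < r" using s(4) B by (simp add: field_simps)
    finally have "s *\<^sub>R (v + \<theta> *\<^sub>R w) \<in> ball 0 r" by simp
    then show ?thesis using r(2) by blast
  qed
  have "\<exists>\<theta>. - e \<le> \<theta> \<and> \<theta> \<le> e \<and> \<phi> (s *\<^sub>R (v + \<theta> *\<^sub>R w)) = 0"
  proof (rule IVT')
    show "\<phi> (s *\<^sub>R (v + (- e) *\<^sub>R w)) \<le> 0" using d2(2)[OF s(1,3)] by (rule less_imp_le)
    show "0 \<le> \<phi> (s *\<^sub>R (v + e *\<^sub>R w))" using d1(2)[OF s(1,2)] by (rule less_imp_le)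
    have c: "continuous_on U \<phi>"
      by (rule differentiable_imp_continuous_on) (simp add: differentiable_on_def differentiable_at_withinI[OF d])
    show "continuous_on {- e..e} (\<lambda>\<theta>. \<phi> (s *\<^sub>R (v + \<theta> *\<^sub>R w)))"
      by (rule continuous_on_compose2[OF c]) (auto intro!: continuous_intros inU)
  qed (use e in auto)
  then obtain \<theta> where "- e \<le> \<theta>" "\<theta> \<le> e" "\<phi> (s *\<^sub>R (v + \<theta> *\<^sub>R w)) = 0" by blast
  then show ?thesis using s(1) inU[of \<theta>] by (intro exI[of _ s] conjI exI[of _ \<theta>]) auto
qed

lemma local_defining_functionE:
  assumes "local_defining_function D p \<phi>"
  obtains U where "open U" "p \<in> U" "\<And>k. Ck_on k \<phi> U" "frontier D \<inter> U = {x \<in> U. \<phi> x = 0}"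
    "\<exists>v. frechet_derivative \<phi> (at p) v \<noteq> 0"
  using assms unfolding local_defining_function_def by blast

lemma Ck_on_differentiable: "Ck_on (Suc k) f S \<Longrightarrow> x \<in> S \<Longrightarrow> f differentiable (at x)"
  by simp

text \<open>Zeros of \<open>\<phi>\<close> near 0 are frontier points, hence on the nonnegative side
  of \<open>a\<close>. They approximate every kernel direction after rescaling, so \<open>a\<close>
  is nonnegative on the kernel; applied to \<open>v\<close> and \<open>- v\<close> this gives
  0.\<close>

lemma kernel_is_tangent:
  fixes \<phi> :: "'a::euclidean_space \<Rightarrow> real"
  assumes \<phi>: "local_defining_function D 0 \<phi>" and 0: "0 \<in> frontier D"
    and a: "\<And>y. y \<in> closure D \<Longrightarrow> a \<bullet> y \<ge> 0"
    and v: "frechet_derivative \<phi> (at 0) v = 0"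
  shows "a \<bullet> v = 0"
proof -
  obtain U where U: "open U" "0 \<in> U" and C: "\<And>k. Ck_on k \<phi> U" and fr: "frontier D \<inter> U = {x \<in> U. \<phi> x = 0}"
    and nz: "\<exists>v. frechet_derivative \<phi> (at 0) v \<noteq> 0"
    using local_defining_functionE[OF \<phi>] by metis
  have d: "\<phi> differentiable (at x)" if "x \<in> U" for x using Ck_on_differentiable[OF C[of 1, unfolded One_nat_def] that] .
  have p0: "\<phi> 0 = 0" using fr 0 U(2) by blast
  define L where "L = frechet_derivative \<phi> (at 0)"
  have "(\<phi> has_derivative L) (at 0)" unfolding L_def using d[OF U(2)] by (simp add: frechet_derivative_works)
  note lin = has_derivative_linear[OF this]
  obtain w0 where w0: "L w0 \<noteq> 0" using nz unfolding L_def by blast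
  define w where "w = (if L w0 > 0 then w0 else - w0)"
  have w: "L w > 0" using w0 by (auto simp: w_def linear_neg[OF lin])
  have nonneg: "a \<bullet> v \<ge> 0" if "L v = 0" for v
  proof (rule field_le_epsilon)
    fix e :: real assume e: "e > 0"
    define e' where "e' = e / (\<bar>a \<bullet> w\<bar> + 1)"
    have e': "e' > 0" using e by (simp add: e'_def add_nonneg_pos)
    have "\<exists>s>0. \<exists>\<theta>. \<bar>\<theta>\<bar> \<le> e' \<and> s *\<^sub>R (v + \<theta> *\<^sub>R w) \<in> U \<and> \<phi> (s *\<^sub>R (v + \<theta> *\<^sub>R w)) = 0"
      by (rule zero_near_kernel_direction[OF U d p0 that[unfolded L_def] w[unfolded L_def] e'])
    then obtain s \<theta> where s: "s > 0" "\<bar>\<theta>\<bar> \<le> e'" "s *\<^sub>R (v + \<theta> *\<^sub>R w) \<in> U" "\<phi> (s *\<^sub>R (v + \<theta> *\<^sub>R w)) = 0"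
      by (elim exE conjE)
    then have "s *\<^sub>R (v + \<theta> *\<^sub>R w) \<in> closure D" using fr by (auto simp: frontier_def)
    from a[OF this] s(1) have "0 \<le> a \<bullet> v + \<theta> * (a \<bullet> w)" by (simp add: inner_add_right zero_le_mult_iff)
    moreover have "\<theta> * (a \<bullet> w) \<le> e"
    proof -
      have "\<theta> * (a \<bullet> w) \<le> \<bar>\<theta>\<bar> * \<bar>a \<bullet> w\<bar>" by (metis abs_ge_self abs_mult)
      also have "\<dots> \<le> e' * (\<bar>a \<bullet> w\<bar> + 1)" using s(2) e' by (intro mult_mono) auto
      also have "\<dots> = e" by (simp add: e'_def)
      finally show ?thesis .
    qed
    ultimately show "0 \<le> a \<bullet> v + e" by linarith
  qed
  have Lv: "L v = 0" using v by (simp add: L_def)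
  have "L (- v) = 0" by (simp add: linear_neg[OF lin] Lv)
  from nonneg[OF Lv] nonneg[OF this] show ?thesis by simp
qed

lemma supporting_normal:
  fixes D :: "'a::euclidean_space set"
  assumes "convex D" "interior D \<noteq> {}" "0 \<in> frontier D"
  obtains \<nu> where "norm \<nu> = 1" "\<And>y. y \<in> closure D \<Longrightarrow> \<nu> \<bullet> y \<ge> 0"
proof -
  have "0 \<in> closure D" "0 \<notin> rel_interior D"
    using assms by (auto simp: frontier_def rel_interior_nonempty_interior)
  then show ?thesis
  proof (rule supporting_hyperplane_relative_frontier[OF assms(1)], goal_cases)
    case a: (1 a)
    show ?thesis
    proof (rule that)
    show "norm ((1 / norm a) *\<^sub>R a) = 1" using a(1) by simp
    show "(1 / norm a) *\<^sub>R a \<bullet> y \<ge> 0" if "y \<in> closure D" for y using a(2)[OF that] by simp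
    qed
  qed
qed

text \<open>A supporting normal is orthogonal to the tangent plane, hence a multiple of the
  coordinate vector of \<open>e\<close>. Its sign is not determined by the hypothesis, whence the
  disjunction.\<close>

lemma tangent_plane_supports:
  fixes D :: "(real^'n) set"
  assumes D: "convex D" "interior D \<noteq> {}" "0 \<in> frontier D" and T: "tangent_plane_at D 0 {t. t $ e = 0}"
  shows "(\<forall>t\<in>D. t $ e \<ge> 0) \<or> (\<forall>t\<in>D. t $ e \<le> 0)"
proof -
  obtain \<phi> where \<phi>: "local_defining_function D 0 \<phi>" and P: "{t. t $ e = 0} = {x. frechet_derivative \<phi> (at 0) (x - 0) = 0}"
    using T unfolding tangent_plane_at_def by blast
  obtain \<nu> where \<nu>: "norm \<nu> = 1" "\<And>y. y \<in> closure D \<Longrightarrow> \<nu> \<bullet> y \<ge> 0" using supporting_normal[OF D] by blast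
  have k: "\<nu> \<bullet> v = 0" if "v $ e = 0" for v
  proof -
    have "v \<in> {t. t $ e = 0}" using that by simp
    then have "frechet_derivative \<phi> (at 0) v = 0" unfolding P by simp
    with \<nu>(2) show ?thesis by (rule kernel_is_tangent[OF \<phi> D(3)])
  qed
  have i: "\<nu> \<bullet> t = t $ e * \<nu> $ e" for t
  proof -
    have "\<nu> \<bullet> (t - (t $ e) *\<^sub>R axis e 1) = 0" by (rule k) simp
    then show ?thesis by (simp add: inner_diff_right inner_axis)
  qed
  have "\<nu> $ e \<noteq> 0"
  proof
    assume "\<nu> $ e = 0"
    then have "\<nu> \<bullet> \<nu> = 0" using i by simp
    then show False using \<nu>(1) by simp
  qed
  then consider "\<nu> $ e > 0" | "\<nu> $ e < 0" by linarith
  then show ?thesis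
  proof cases
    case 1
    have "t $ e \<ge> 0" if "t \<in> D" for t using \<nu>(2)[of t] that 1 closure_subset[of D] unfolding i by (auto simp: zero_le_mult_iff)
    then show ?thesis by blast
  next
    case 2
    have "t $ e \<le> 0" if "t \<in> D" for t using \<nu>(2)[of t] that 2 closure_subset[of D] unfolding i by (auto simp: zero_le_mult_iff)
    then show ?thesis by blast
  qed
qed

text \<open>The mean value theorem along the segment from 0 to \<open>x\<close>, with derivatives in
  basis directions that are Lipschitz at 0 because they are differentiable there.\<close>

lemma quadratic_remainder:
  fixes \<phi> :: "'a::euclidean_space \<Rightarrow> real"
  assumes U: "open U" "0 \<in> U" and C: "Ck_on 2 \<phi> U" and 0: "\<phi> 0 = 0"
  shows "\<exists>C\<ge>0. \<exists>r>0. \<forall>x. norm x < r \<longrightarrow> \<bar>\<phi> x - frechet_derivative \<phi> (at 0) x\<bar> \<le> C * (norm x)\<^sup>2"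
proof -
  have C2: "\<And>x. x \<in> U \<Longrightarrow> \<phi> differentiable (at x)" "\<And>v x. x \<in> U \<Longrightarrow> (\<lambda>x. frechet_derivative \<phi> (at x) v) differentiable (at x)"
    using C by (auto simp: numeral_2_eq_2)
  define L where "L = (\<lambda>x. frechet_derivative \<phi> (at x))"
  have lin: "linear (L x)" if "x \<in> U" for x
    unfolding L_def using C2(1)[OF that] by (simp add: frechet_derivative_works has_derivative_linear)
  have lip: "\<exists>c d. d > 0 \<and> (\<forall>y. norm y < d \<longrightarrow> \<bar>L y b - L 0 b\<bar> \<le> c * norm y)" for b
  proof -
    define g where "g = (\<lambda>y. L y b)"
    define g' where "g' = frechet_derivative g (at 0)"
    have g: "(g has_derivative g') (at 0)" unfolding g_def g'_def L_def using C2(2)[OF U(2)] by (simp add: frechet_derivative_works)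
    obtain K where K: "\<And>x. norm (g' x) \<le> norm x * K" "K \<ge> 0" using bounded_linear.nonneg_bounded[OF has_derivative_bounded_linear[OF g]] by blast
    obtain d where d: "d > 0" "\<And>y. norm (y - 0) < d \<Longrightarrow> norm (g y - g 0 - g' (y - 0)) \<le> 1 * norm (y - 0)"
      using g[unfolded has_derivative_at_alt] by (metis zero_less_one)
    have "\<bar>g y - g 0\<bar> \<le> (K + 1) * norm y" if "norm y < d" for y
      using d(2)[of y] K(1)[of y] that by (simp add: algebra_simps)
    then show ?thesis using d(1) unfolding g_def by blast
  qed
  obtain c d where cd: "\<And>b. d b > 0" "\<And>b y. norm y < d b \<Longrightarrow> \<bar>L y b - L 0 b\<bar> \<le> c b * norm y"
    using lip by metis
  obtain r0 where r0: "r0 > 0" "ball 0 r0 \<subseteq> U" by (rule openE[OF U])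
  define r where "r = min r0 (Min (d ` Basis))"
  have r: "r > 0" using r0(1) cd(1) by (simp add: r_def)
  have rd: "r \<le> d b" if "b \<in> Basis" for b
  proof -
    have "Min (d ` Basis) \<le> d b" using that by (intro Min_le) auto
    then show ?thesis by (simp add: r_def)
  qed
  define K where "K = (\<Sum>b\<in>Basis. \<bar>c b\<bar>)"
  have "\<bar>\<phi> x - L 0 x\<bar> \<le> K * (norm x)\<^sup>2" if x: "norm x < r" for x
  proof -
    have tU: "t *\<^sub>R x \<in> U" if "0 \<le> t" "t \<le> 1" for t
    proof -
      have "norm (t *\<^sub>R x) \<le> norm x" using that by (simp add: mult_left_le_one_le)
      then have "t *\<^sub>R x \<in> ball 0 r0" using x by (simp add: r_def)
      then show ?thesis using r0(2) by blast
    qed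
    have "\<exists>z>0. z < 1 \<and> (\<phi> (1 *\<^sub>R x) - 1 * L 0 x) - (\<phi> (0 *\<^sub>R x) - 0 * L 0 x) = (1 - 0) * (L (z *\<^sub>R x) x - L 0 x)"
    proof (rule MVT2)
      fix t :: real assume t: "0 \<le> t" "t \<le> 1"
      show "((\<lambda>t. \<phi> (t *\<^sub>R x) - t * L 0 x) has_real_derivative L (t *\<^sub>R x) x - L 0 x) (at t)"
        using differentiable_along_line[of \<phi> 0 t x] C2(1)[OF tU[OF t]]
        by (auto intro!: derivative_eq_intros simp: L_def)
    qed simp
    then obtain z where z: "0 < z" "z < 1" "\<phi> x - L 0 x = L (z *\<^sub>R x) x - L 0 x" by (auto simp: 0)
    have nz: "norm (z *\<^sub>R x) \<le> norm x" using z by (simp add: mult_left_le_one_le)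
    have ex: "L y x = (\<Sum>b\<in>Basis. (x \<bullet> b) * L y b)" if "y \<in> U" for y
    proof -
      have "L y (\<Sum>b\<in>Basis. (x \<bullet> b) *\<^sub>R b) = (\<Sum>b\<in>Basis. (x \<bullet> b) * L y b)"
        by (simp add: linear_sum[OF lin[OF that]] linear_scale[OF lin[OF that]])
      then show ?thesis by (simp add: euclidean_representation)
    qed
    have "L (z *\<^sub>R x) x - L 0 x = (\<Sum>b\<in>Basis. (x \<bullet> b) * (L (z *\<^sub>R x) b - L 0 b))"
      using z U(2) by (simp add: ex[OF tU[of z]] ex[OF U(2)] algebra_simps sum_subtractf)
    also have "\<bar>\<dots>\<bar> \<le> (\<Sum>b\<in>Basis. \<bar>(x \<bullet> b) * (L (z *\<^sub>R x) b - L 0 b)\<bar>)" by (rule sum_abs)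
    also have "\<dots> \<le> (\<Sum>b\<in>Basis. \<bar>c b\<bar> * (norm x)\<^sup>2)"
    proof (rule sum_mono)
      fix b :: 'a assume b: "b \<in> Basis"
      have "norm (z *\<^sub>R x) < d b" using nz x rd[OF b] by linarith
      from cd(2)[OF this] have "\<bar>L (z *\<^sub>R x) b - L 0 b\<bar> \<le> c b * norm (z *\<^sub>R x)" .
      also have "\<dots> \<le> \<bar>c b\<bar> * norm x" using nz by (intro mult_mono) auto
      finally have "\<bar>x \<bullet> b\<bar> * \<bar>L (z *\<^sub>R x) b - L 0 b\<bar> \<le> norm x * (\<bar>c b\<bar> * norm x)"
        using Basis_le_norm[OF b] by (intro mult_mono) auto
      then show "\<bar>(x \<bullet> b) * (L (z *\<^sub>R x) b - L 0 b)\<bar> \<le> \<bar>c b\<bar> * (norm x)\<^sup>2"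
        by (simp add: abs_mult power2_eq_square mult_ac)
    qed
    finally show ?thesis unfolding z(3) by (simp add: K_def sum_distrib_right)
  qed
  then show ?thesis using r unfolding L_def by (intro exI[of _ K] conjI exI[of _ r]) (auto simp: K_def sum_nonneg)
qed

text \<open>By the quadratic remainder the frontier near 0 stays within a paraboloid's distance of
  the tangent plane, so a small tangent ball misses it. Being connected and meeting
  \<open>D\<close>, the ball then lies in \<open>D\<close>.\<close>

lemma interior_ball_at_0:
  fixes D :: "'a::euclidean_space set"
  assumes D: "convex D" "interior D \<noteq> {}" "0 \<in> frontier D" "smooth_boundary_near D 0"
  obtains \<nu> r where "norm \<nu> = 1" "r > 0" "ball (r *\<^sub>R \<nu>) r \<subseteq> D"
proof -
  obtain \<phi> where \<phi>: "local_defining_function D 0 \<phi>" using D(4) unfolding smooth_boundary_near_def by blast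
  obtain U where U: "open U" "0 \<in> U" and C: "\<And>k. Ck_on k \<phi> U" and fr: "frontier D \<inter> U = {x \<in> U. \<phi> x = 0}"
    and nz: "\<exists>v. frechet_derivative \<phi> (at 0) v \<noteq> 0"
    using local_defining_functionE[OF \<phi>] by metis
  have p0: "\<phi> 0 = 0" using fr D(3) U(2) by blast
  define L where "L = frechet_derivative \<phi> (at 0)"
  have "\<phi> differentiable (at 0)" using Ck_on_differentiable[OF C[of 1, unfolded One_nat_def] U(2)] .
  then have lin: "linear L" unfolding L_def by (simp add: frechet_derivative_works has_derivative_linear)
  obtain \<nu> where \<nu>: "norm \<nu> = 1" "\<And>y. y \<in> closure D \<Longrightarrow> \<nu> \<bullet> y \<ge> 0" using supporting_normal[OF D(1,2,3)] by blast
  have ker: "\<nu> \<bullet> v = 0" if "L v = 0" for v using kernel_is_tangent[OF \<phi> D(3) \<nu>(2)] that unfolding L_def by blast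
  obtain w where w: "L w \<noteq> 0" using nz unfolding L_def by blast
  \<comment> \<open>The kernel of the differential is orthogonal to \<open>\<nu>\<close>, so the
    differential is the multiple \<open>l\<close> of the inner product with
    \<open>\<nu>\<close>.\<close>
  have Lw: "\<nu> \<bullet> x * L w = L x * (\<nu> \<bullet> w)" for x
  proof -
    have "\<nu> \<bullet> (x - (L x / L w) *\<^sub>R w) = 0" by (rule ker) (simp add: linear_diff[OF lin] linear_scale[OF lin] w)
    then show ?thesis using w by (simp add: inner_diff_right field_simps)
  qed
  have nn: "\<nu> \<bullet> \<nu> = 1" using \<nu>(1) by (simp add: dot_square_norm)
  have nuw: "\<nu> \<bullet> w \<noteq> 0" using Lw[of \<nu>] w nn by auto
  define l where "l = L w / (\<nu> \<bullet> w)"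
  have l: "l \<noteq> 0" using w nuw by (simp add: l_def)
  have Lx: "L x = l * (\<nu> \<bullet> x)" for x using Lw[of x] nuw by (simp add: l_def field_simps)
  obtain K r0 where K: "K \<ge> 0" "r0 > 0" "\<And>x. norm x < r0 \<Longrightarrow> \<bar>\<phi> x - L x\<bar> \<le> K * (norm x)\<^sup>2"
    using quadratic_remainder[OF U C p0] unfolding L_def by blast
  obtain r1 where r1: "r1 > 0" "ball 0 r1 \<subseteq> U" by (rule openE[OF U])
  \<comment> \<open>In the ball |x|^2 < 2 r (\<open>\<nu>\<close> . x), while a frontier point
    satisfies |l| (\<open>\<nu>\<close> . x) <= K |x|^2; the first entry makes these incompatible.
    The second keeps the ball, of diameter 2 r, where the estimates hold.\<close>
  define r where "r = min (\<bar>l\<bar> / (2 * (K + 1))) (min r0 r1 / 2)"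
  have r: "r > 0" using l K r1 by (simp add: r_def)
  have r2: "2 * r \<le> r0" "2 * r \<le> r1" unfolding r_def by linarith+
  have "r \<le> \<bar>l\<bar> / (2 * (K + 1))" by (simp add: r_def)
  then have rl: "2 * r * (K + 1) \<le> \<bar>l\<bar>" using K(1) by (simp add: field_simps)
  have nsq: "(norm (x - r *\<^sub>R \<nu>))\<^sup>2 = x \<bullet> x - 2 * r * (\<nu> \<bullet> x) + r\<^sup>2" for x
  proof -
    have "(norm (x - r *\<^sub>R \<nu>))\<^sup>2 = x \<bullet> x - 2 * r * (\<nu> \<bullet> x) + r * r * (\<nu> \<bullet> \<nu>)"
      unfolding power2_norm_eq_inner by (simp add: inner_diff_left inner_diff_right inner_commute[of x \<nu>] algebra_simps)
    then show ?thesis unfolding nn by (simp add: power2_eq_square)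
  qed
  have sq: "(norm x)\<^sup>2 < 2 * r * (\<nu> \<bullet> x)" if "x \<in> ball (r *\<^sub>R \<nu>) r" for x
  proof -
    have "norm (x - r *\<^sub>R \<nu>) < r" using that by (simp add: dist_norm norm_minus_commute)
    then have "(norm (x - r *\<^sub>R \<nu>))\<^sup>2 < r\<^sup>2" by (intro power_strict_mono) auto
    then have "x \<bullet> x < 2 * r * (\<nu> \<bullet> x)" unfolding nsq by linarith
    then show ?thesis by (simp add: power2_norm_eq_inner)
  qed
  have disj: "ball (r *\<^sub>R \<nu>) r \<inter> frontier D = {}"
  proof (rule ccontr)
    assume "ball (r *\<^sub>R \<nu>) r \<inter> frontier D \<noteq> {}"
    then obtain x where x: "x \<in> ball (r *\<^sub>R \<nu>) r" "x \<in> frontier D" by blast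
    have "norm (x - r *\<^sub>R \<nu>) < r" using x(1) by (simp add: dist_norm norm_minus_commute)
    moreover have "norm x \<le> norm (x - r *\<^sub>R \<nu>) + norm (r *\<^sub>R \<nu>)" using norm_triangle_ineq[of "x - r *\<^sub>R \<nu>" "r *\<^sub>R \<nu>"] by simp
    ultimately have n: "norm x < 2 * r" using \<nu>(1) r by simp
    then have "x \<in> ball 0 r1" using r2 by simp
    then have "x \<in> frontier D \<inter> U" using r1 x by blast
    then have "\<phi> x = 0" using fr by blast
    then have "\<bar>l\<bar> * \<bar>\<nu> \<bullet> x\<bar> \<le> K * (norm x)\<^sup>2" using K(3)[of x] n r2 by (simp add: Lx abs_mult)
    moreover have nx: "\<nu> \<bullet> x > 0"
    proof -
      have "0 < (2 * r) * (\<nu> \<bullet> x)" using sq[OF x(1)] zero_le_power2[of "norm x"] by linarith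
      then show ?thesis by (rule zero_less_mult_pos) (use r in simp)
    qed
    moreover have "(2 * r * (K + 1)) * (\<nu> \<bullet> x) \<le> \<bar>l\<bar> * \<bar>\<nu> \<bullet> x\<bar>" using rl nx by (intro mult_mono) auto
    moreover have "(K + 1) * (norm x)\<^sup>2 < (K + 1) * (2 * r * (\<nu> \<bullet> x))" using sq[OF x(1)] K by (intro mult_strict_left_mono) auto
    ultimately show False using zero_le_power2[of "norm x"] by (simp add: algebra_simps)
  qed
  obtain q where q: "q \<in> interior D" using D(2) by blast
  have nuq: "\<nu> \<bullet> q > 0"
  proof -
    obtain e where e: "e > 0" "ball q e \<subseteq> D" using q by (auto simp: mem_interior)
    have "q - (e / 2) *\<^sub>R \<nu> \<in> ball q e" using e(1) \<nu>(1) by (simp add: dist_norm)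
    from subsetD[OF closure_subset subsetD[OF e(2) this]] have "q - (e / 2) *\<^sub>R \<nu> \<in> closure D" .
    from \<nu>(2)[OF this] show ?thesis using e(1) nn by (simp add: inner_diff_right)
  qed
  \<comment> \<open>An interior point \<open>q\<close> is shrunk towards 0: it stays in
    \<open>D\<close> by convexity and enters the tangent ball because its
    \<open>\<nu>\<close>-component is positive.\<close>
  define s where "s = min 1 (r * (\<nu> \<bullet> q) / ((norm q)\<^sup>2 + 1))"
  have pos1: "(norm q)\<^sup>2 + 1 > 0" by (simp add: add_nonneg_pos)
  have s: "0 < s" "s \<le> 1" using r nuq pos1 by (auto simp: s_def)
  have "s \<le> r * (\<nu> \<bullet> q) / ((norm q)\<^sup>2 + 1)" by (simp add: s_def)
  then have s3: "s * ((norm q)\<^sup>2 + 1) \<le> r * (\<nu> \<bullet> q)" using pos1 by (simp add: field_simps)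
  have "0 - s *\<^sub>R (0 - q) \<in> interior D"
    by (rule mem_interior_closure_convex_shrink[OF D(1) q _ s]) (use D(3) in \<open>simp add: frontier_def\<close>)
  then have sqD: "s *\<^sub>R q \<in> D" using interior_subset by auto
  have "s *\<^sub>R q \<in> ball (r *\<^sub>R \<nu>) r"
  proof -
    have "s * (q \<bullet> q) < 2 * r * (\<nu> \<bullet> q)" using s3 s(1) mult_pos_pos[OF r nuq] unfolding power2_norm_eq_inner distrib_left by linarith
    then have "s * (s * (q \<bullet> q)) < s * (2 * r * (\<nu> \<bullet> q))" using s(1) by (intro mult_strict_left_mono)
    then have "(norm (s *\<^sub>R q - r *\<^sub>R \<nu>))\<^sup>2 < r\<^sup>2" unfolding nsq by (simp add: mult.assoc mult.left_commute)
    then have "norm (s *\<^sub>R q - r *\<^sub>R \<nu>) < r" by (rule power_less_imp_less_base) (use r in simp)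
    then show ?thesis by (simp only: mem_ball dist_norm norm_minus_commute)
  qed
  from IntI[OF this sqD] have ne: "ball (r *\<^sub>R \<nu>) r \<inter> D \<noteq> {}" by (rule ex_in_conv[THEN iffD1, OF exI])
  have co: "connected (ball (r *\<^sub>R \<nu>) r)" by (rule convex_connected[OF convex_ball])
  have "ball (r *\<^sub>R \<nu>) r - D = {}"
  proof (rule ccontr)
    assume "ball (r *\<^sub>R \<nu>) r - D \<noteq> {}"
    from connected_Int_frontier[OF co ne this] disj show False by (rule notE)
  qed
  then have "ball (r *\<^sub>R \<nu>) r \<subseteq> D" by (simp only: Diff_eq_empty_iff)
  with \<nu>(1) r show ?thesis by (rule that)
qed

section \<open>Passage to the domain\<close>

lemma regular_field_stationary:
  fixes \<xi> :: "real^'n \<Rightarrow> 'w \<Rightarrow> real"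
  assumes M: "prob_space M" and H: "0 < H" "H < 1" and X: "centered_gaussian_process M \<xi>"
    and iso: "isotropic M \<xi>" and st: "stationary_increments M \<xi>" and gr: "variance_growth M H \<xi>"
  shows "\<exists>V k c. regular_field \<xi> M V H k c"
proof -
  fix e :: 'n
  define v where "v = (\<lambda>t. LINT w|M. (\<xi> t w)\<^sup>2)"
  define V where "V = (\<lambda>r. v (r *\<^sub>R axis e 1))"
  have IF: "iso_field M V \<xi>" unfolding V_def v_def by (rule iso_field_stationary[OF M X iso st])
  obtain k c where k: "\<And>t. t \<noteq> 0 \<Longrightarrow> v t < k * norm t powr (2 * H)" and c: "c > 0"
    and eq: "v \<sim>[at_infinity] (\<lambda>t. c\<^sup>2 * norm t powr (2 * H))"
    using gr unfolding variance_growth_def v_def by blast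
  have na: "norm (r *\<^sub>R axis e 1 :: real^'n) = r" if "r \<ge> 0" for r using that by (simp add: norm_axis_1)
  have "k > 0"
  proof -
    have "0 \<le> v (1 *\<^sub>R axis e 1)" unfolding v_def by simp
    also have "\<dots> < k * norm (1 *\<^sub>R axis e 1 :: real^'n) powr (2 * H)" by (rule k) simp
    finally show ?thesis unfolding na[of 1, simplified] by simp
  qed
  moreover have "V x \<le> k * x powr (2 * H)" if "x \<ge> 0" for x
  proof (cases "x = 0")
    case True
    then show ?thesis using iso_field_V0[OF M IF] by simp
  next
    case False
    have "v (x *\<^sub>R axis e 1) < k * norm (x *\<^sub>R axis e 1 :: real^'n) powr (2 * H)" by (rule k) (use False in simp)
    then show ?thesis unfolding na[OF that] V_def by simp
  qed
  moreover have "((\<lambda>x. V x / x powr (2 * H)) \<longlongrightarrow> c\<^sup>2) at_top"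
  proof -
    have inf: "filterlim (\<lambda>r. r *\<^sub>R axis e 1 :: real^'n) at_infinity at_top"
      unfolding filterlim_at_infinity_conv_norm_at_top
    proof (rule filterlim_at_top_mono[OF filterlim_ident])
      show "\<forall>\<^sub>F r in at_top. r \<le> norm (r *\<^sub>R axis e 1 :: real^'n)"
        using eventually_ge_at_top[of 0] by eventually_elim (simp only: na)
    qed
    have "\<forall>\<^sub>F t in at_infinity. v t \<noteq> 0 \<or> c\<^sup>2 * norm (t :: real^'n) powr (2 * H) \<noteq> 0"
    proof -
      have "\<forall>\<^sub>F t :: real^'n in at_infinity. norm t \<ge> 1" by (rule eventually_at_infinityI) 
      then show ?thesis by eventually_elim (use c in auto)
    qed
    from asymp_equivD_strong[OF eq this]
    have "((\<lambda>t. v t / (c\<^sup>2 * norm t powr (2 * H))) \<longlongrightarrow> 1) at_infinity" .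
    from filterlim_compose[OF this inf]
    have "((\<lambda>r. V r / (c\<^sup>2 * norm (r *\<^sub>R axis e 1 :: real^'n) powr (2 * H))) \<longlongrightarrow> 1) at_top" unfolding V_def .
    from tendsto_mult[OF tendsto_const[of "c\<^sup>2"] this]
    have "((\<lambda>r. c\<^sup>2 * (V r / (c\<^sup>2 * norm (r *\<^sub>R axis e 1 :: real^'n) powr (2 * H)))) \<longlongrightarrow> c\<^sup>2) at_top" by simp
    then show ?thesis
    proof (rule Lim_transform_eventually)
      show "\<forall>\<^sub>F r in at_top. c\<^sup>2 * (V r / (c\<^sup>2 * norm (r *\<^sub>R axis e 1 :: real^'n) powr (2 * H))) = V r / r powr (2 * H)"
        using eventually_ge_at_top[of 0]
      proof eventually_elim
        case (elim r)
        show ?case unfolding na[OF elim] using c by simp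
      qed
    qed
  qed
  ultimately have "regular_field \<xi> M V H k c" using M IF H c by (intro regular_field.intro) auto
  then show ?thesis by blast
qed

lemma regular_field_fbm:
  fixes \<xi> :: "real^'n \<Rightarrow> 'w \<Rightarrow> real"
  assumes "prob_space M" "0 < H" "H < 1" "fractional_brownian_motion M H \<xi>"
  shows "regular_field \<xi> M (\<lambda>r. r powr (2 * H)) H 1 1"
proof (rule regular_field.intro)
  show "((\<lambda>x::real. x powr (2 * H) / x powr (2 * H)) \<longlongrightarrow> 1\<^sup>2) at_top"
    by (rule tendsto_eventually) (use eventually_gt_at_top[of 0] in eventually_elim, simp)
qed (use assms iso_field_fbm in auto)

lemma regular_field_transform:
  fixes Q :: "real^'n \<Rightarrow> real^'n"
  assumes "regular_field \<xi> M V H k c" "orthogonal_transformation Q"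
  shows "regular_field (\<lambda>t. \<xi> (Q t)) M V H k c"
proof -
  interpret regular_field \<xi> M V H k c by fact
  show ?thesis
    by (rule regular_field.intro[OF M iso_field_transform[OF M iso assms(2)] H k V c asym])
qed

lemma mem_half_cube:
  assumes "t \<in> integer_lattice" "t $ e \<ge> 0" "\<And>i. \<bar>t $ i\<bar> \<le> real N"
  shows "t \<in> half_cube e N"
proof -
  have *: "real_of_int \<lfloor>t $ i\<rfloor> = t $ i" for i using assms(1) by (simp add: integer_lattice_def)
  have t: "t = intvec (\<lambda>i. \<lfloor>t $ i\<rfloor>)" unfolding intvec_def by (simp add: * vec_eq_iff)
  have "\<bar>\<lfloor>t $ i\<rfloor>\<bar> \<le> int N" for i
  proof -
    have "\<bar>real_of_int \<lfloor>t $ i\<rfloor>\<bar> \<le> real_of_int (int N)" unfolding * using assms(3)[of i] by simp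
    then show ?thesis by linarith
  qed
  then show ?thesis unfolding half_cube_def using assms(2) by (rule_tac image_eqI[where x = "\<lambda>i. \<lfloor>t $ i\<rfloor>"]) (simp_all only: t[symmetric], simp add: int_cube_def)
qed

context regular_field
begin

text \<open>The exponent \<open>l\<close> > 1/2 leaves a positive power of ln T to absorb the
  constant \<open>a\<close> of the half cube bound.\<close>

lemma lattice_persistence_lower:
  assumes D: "bounded D" "\<And>t. t \<in> D \<Longrightarrow> t $ e \<ge> 0" and l: "l > 1 / 2"
  shows "\<forall>\<^sub>F T in at_top. T powr (H - CARD('n)) * ln T powr (- l) \<le> persistence_prob M \<xi> (dilate T D \<inter> integer_lattice)"
proof -
  note [measurable] = cgp_measurable[OF M iso_field_cgp[OF M iso]]
  obtain b where b: "b > 0" "\<And>t. t \<in> D \<Longrightarrow> norm t \<le> b" using D(1) unfolding bounded_pos by blast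
  obtain a where a: "a > 0" and ev: "\<forall>\<^sub>F r in at_top. a * r powr (H - CARD('n)) / sqrt (ln r)
     \<le> measure M {w \<in> space M. \<forall>t\<in>half_cube e (nat \<lceil>b * r\<rceil>). \<xi> t w < 1}"
    using half_cube_lower[OF b(1)] by blast
  have "l - 1 / 2 > 0" using l by simp
  then have "\<forall>\<^sub>F T in at_top. 1 \<le> a * ln (T::real) powr (l - 1 / 2)" using a by real_asymp
  with ev show ?thesis using eventually_gt_at_top[of 1]
  proof eventually_elim
    case (elim T)
    have lT: "ln T > 0" using elim by simp
    have sub: "dilate T D \<inter> integer_lattice \<subseteq> half_cube e (nat \<lceil>b * T\<rceil>)"
    proof
      fix t assume t: "t \<in> dilate T D \<inter> integer_lattice"
      then obtain x where x: "x \<in> D" "t = T *\<^sub>R x" by (auto simp: dilate_def)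
      show "t \<in> half_cube e (nat \<lceil>b * T\<rceil>)"
      proof (rule mem_half_cube)
        show "t \<in> integer_lattice" using t by simp
        show "t $ e \<ge> 0" using D(2)[OF x(1)] elim x(2) by simp
        fix i
        have "\<bar>t $ i\<bar> \<le> norm t" by (rule component_le_norm_cart)
        also have "\<dots> \<le> b * T" using b(2)[OF x(1)] elim x(2) by (simp add: mult.commute)
        also have "\<dots> \<le> real (nat \<lceil>b * T\<rceil>)" by (rule real_nat_ceiling_ge)
        finally show "\<bar>t $ i\<bar> \<le> real (nat \<lceil>b * T\<rceil>)" .
      qed
    qed
    then have fin: "finite (dilate T D \<inter> integer_lattice)" by (rule finite_subset) simp
    have "1 * ln T powr (- l) \<le> (a * ln T powr (l - 1 / 2)) * ln T powr (- l)"
      using elim by (intro mult_right_mono) auto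
    also have "\<dots> = a * ln T powr (- (1 / 2))" by (simp add: mult.assoc powr_add[symmetric])
    also have "\<dots> = a / sqrt (ln T)" using lT by (simp add: powr_minus_divide powr_half_sqrt)
    finally have "T powr (H - CARD('n)) * ln T powr (- l) \<le> T powr (H - CARD('n)) * (a / sqrt (ln T))"
      by (intro mult_left_mono) auto
    also have "\<dots> = a * T powr (H - CARD('n)) / sqrt (ln T)" by simp
    also have "\<dots> \<le> measure M {w \<in> space M. \<forall>t\<in>half_cube e (nat \<lceil>b * T\<rceil>). \<xi> t w < 1}" by fact
    also have "\<dots> \<le> persistence_prob M \<xi> (dilate T D \<inter> integer_lattice)"
      unfolding persistence_prob_def
    proof (rule finite_measure_mono)
      show "{w \<in> space M. \<forall>t\<in>half_cube e (nat \<lceil>b * T\<rceil>). \<xi> t w < 1} \<subseteq> {w \<in> space M. \<forall>t\<in>dilate T D \<inter> integer_lattice. \<xi> t w < 1}"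
        using sub by blast
      show "{w \<in> space M. \<forall>t\<in>dilate T D \<inter> integer_lattice. \<xi> t w < 1} \<in> sets M" using fin by measurable
    qed
    finally show ?case .
  qed
qed

end

text \<open>If the domain lies on the negative side of its tangent plane, the field is reflected at
  0; the reflection preserves the lattice and the law.\<close>

lemma lattice_persistence_tangent:
  fixes D :: "(real^'n) set"
  assumes R: "regular_field \<xi> M V H k c" and D: "convex D" "interior D \<noteq> {}" "0 \<in> frontier D" "bounded D"
    and T: "tangent_plane_at D 0 {t. t $ e = 0}" and l: "l > 1 / 2"
  shows "\<forall>\<^sub>F T in at_top. T powr (H - CARD('n)) * ln T powr (- l) \<le> persistence_prob M \<xi> (dilate T D \<inter> integer_lattice)"
proof -
  interpret regular_field \<xi> M V H k c by fact
  have orth: "orthogonal_transformation (uminus :: real^'n \<Rightarrow> _)"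
    by (simp add: orthogonal_transformation_def linear_iff)
  interpret neg: regular_field "\<lambda>t. \<xi> (- t)" M V H k c by (rule regular_field_transform[OF R orth])
  from tangent_plane_supports[OF D(1-3) T] show ?thesis
  proof
    assume "\<forall>t\<in>D. t $ e \<ge> 0"
    then show ?thesis using lattice_persistence_lower[OF D(4) _ l, of e] by blast
  next
    assume "\<forall>t\<in>D. t $ e \<le> 0"
    then have "t $ e \<ge> 0" if "t \<in> uminus ` D" for t using that by auto
    moreover have "bounded (uminus ` D)" using D(4) by simp
    ultimately have *: "\<forall>\<^sub>F T in at_top. T powr (H - CARD('n)) * ln T powr (- l) \<le> persistence_prob M (\<lambda>t. \<xi> (- t)) (dilate T (uminus ` D) \<inter> integer_lattice)"
      by (intro neg.lattice_persistence_lower[OF _ _ l])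
    have im: "dilate T (uminus ` D) \<inter> integer_lattice = uminus ` (dilate T D \<inter> integer_lattice)" for T
    proof -
      have il: "- t \<in> integer_lattice \<longleftrightarrow> t \<in> integer_lattice" for t :: "real^'n"
        by (simp add: integer_lattice_def)
      show ?thesis by (auto simp: dilate_def image_iff il)
    qed
    have "persistence_prob M (\<lambda>t. \<xi> (- t)) (dilate T (uminus ` D) \<inter> integer_lattice) = persistence_prob M \<xi> (dilate T D \<inter> integer_lattice)" for T
      unfolding persistence_prob_def im by simp
    then show ?thesis using * by simp
  qed
qed

text \<open>A bounded set of type F-sigma is a countable union of compact sets. On a compact set the
  supremum is attained, so being below 1 means being at most 1 - 1/m, for some m, on a countable
  dense subset.\<close>

lemma persistence_event:
  fixes \<xi> :: "'t::euclidean_space \<Rightarrow> 'w \<Rightarrow> real"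
  assumes [measurable]: "\<And>t. \<xi> t \<in> borel_measurable M" and c: "continuous_paths M \<xi>"
    and D: "fsigma D" "bounded D"
  shows "{w \<in> space M. \<forall>t\<in>dilate T D. \<xi> t w < 1} \<in> sets M"
proof -
  have cont: "continuous_on UNIV (\<lambda>t. \<xi> t w)" if "w \<in> space M" for w
    using c that by (simp add: continuous_paths_def)
  have comp: "{w \<in> space M. \<forall>t\<in>K. \<xi> t w < 1} \<in> sets M" if K: "compact K" for K
  proof -
    obtain A where A: "countable A" "A \<subseteq> K" "K \<subseteq> closure A" by (rule separable)
    have "(\<forall>t\<in>K. \<xi> t w < 1) \<longleftrightarrow> (\<exists>m. \<forall>t\<in>A. \<xi> t w \<le> 1 - 1 / real (Suc m))" if w: "w \<in> space M" for w
    proof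
      assume l: "\<forall>t\<in>K. \<xi> t w < 1"
      show "\<exists>m. \<forall>t\<in>A. \<xi> t w \<le> 1 - 1 / real (Suc m)"
      proof (cases "K = {}")
        case True
        then have "A = {}" using A(2) by simp
        then show ?thesis by simp
      next
        case False
        have "\<exists>x\<in>K. \<forall>y\<in>K. \<xi> y w \<le> \<xi> x w"
          by (rule continuous_attains_sup[OF K False continuous_on_subset[OF cont[OF w] subset_UNIV]])
        then obtain x where x: "x \<in> K" "\<forall>y\<in>K. \<xi> y w \<le> \<xi> x w" by (rule bexE)
        have "0 < 1 - \<xi> x w" using l x(1) by simp
        from reals_Archimedean[OF this] obtain m where m: "inverse (real (Suc m)) < 1 - \<xi> x w" by (rule exE)
        have "\<xi> t w \<le> 1 - 1 / real (Suc m)" if "t \<in> A" for t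
        proof -
          have "t \<in> K" using that A(2) by (rule subsetD[rotated])
          with x(2) have "\<xi> t w \<le> \<xi> x w" by (rule bspec)
          then show ?thesis using m unfolding inverse_eq_divide by linarith
        qed
        then show ?thesis by (intro exI[of _ m] ballI)
      qed
    next
      assume "\<exists>m. \<forall>t\<in>A. \<xi> t w \<le> 1 - 1 / real (Suc m)"
      then obtain m where m: "\<forall>t\<in>A. \<xi> t w \<le> 1 - 1 / real (Suc m)" by (rule exE)
      have cl: "closed {t. \<xi> t w \<le> 1 - 1 / real (Suc m)}"
        by (intro closed_Collect_le cont[OF w] continuous_on_const)
      have "A \<subseteq> {t. \<xi> t w \<le> 1 - 1 / real (Suc m)}" using m by (simp add: subset_iff)
      then have "closure A \<subseteq> {t. \<xi> t w \<le> 1 - 1 / real (Suc m)}" by (rule closure_minimal[OF _ cl])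
      then have le: "\<xi> t w \<le> 1 - 1 / real (Suc m)" if "t \<in> K" for t using that A(3) by (simp add: subset_iff)
      show "\<forall>t\<in>K. \<xi> t w < 1"
      proof
        fix t assume "t \<in> K"
        from le[OF this] show "\<xi> t w < 1" using of_nat_0_less_iff[of "Suc m", where 'a = real] by (smt (verit) divide_pos_pos zero_less_Suc)
      qed
    qed
    then have "{w \<in> space M. \<forall>t\<in>K. \<xi> t w < 1} = {w \<in> space M. \<exists>m. \<forall>t\<in>A. \<xi> t w \<le> 1 - 1 / real (Suc m)}" by blast
    also have "\<dots> \<in> sets M" using A(1) by measurable
    finally show ?thesis .
  qed
  from D(1) show ?thesis
  proof cases
    case (1 F)
    have "compact (F n)" for n
    proof -
      have "bounded (F n)" by (rule bounded_subset[OF D(2)]) (auto simp: 1(1))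
      then show ?thesis using 1(2) by (simp add: compact_eq_bounded_closed)
    qed
    then have "compact (dilate T (F n))" for n unfolding dilate_def by (rule compact_scaling)
    from comp[OF this] have "(\<Inter>n. {w \<in> space M. \<forall>t\<in>dilate T (F n). \<xi> t w < 1}) \<in> sets M" by auto
    also have "(\<Inter>n. {w \<in> space M. \<forall>t\<in>dilate T (F n). \<xi> t w < 1}) = {w \<in> space M. \<forall>t\<in>dilate T D. \<xi> t w < 1}"
      unfolding 1(1) dilate_def by auto
    finally show ?thesis .
  qed
qed

definition dyadic_oscillation :: "(real^'n \<Rightarrow> 'w \<Rightarrow> real) \<Rightarrow> real \<Rightarrow> real^'n \<Rightarrow> real \<Rightarrow> 'w \<Rightarrow> bool" where
  "dyadic_oscillation \<xi> l x a w \<longleftrightarrow> (\<exists>J. \<exists>u\<in>nat_cube (2 ^ J). \<bar>\<xi> (x + (l / 2 ^ J) *\<^sub>R natvec u) w - \<xi> x w\<bar> > a)"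

text \<open>The events for single levels \<open>J\<close> increase, since doubling the coordinates
  embeds each level in the next, and their bound is uniform in \<open>J\<close>.\<close>

lemma dyadic_oscillation_tail:
  fixes \<xi> :: "real^'n \<Rightarrow> 'w \<Rightarrow> real"
  assumes M: "prob_space M" and X: "centered_gaussian_process M \<xi>" and H: "H > 0" and k: "k > 0"
    and inc: "\<And>s t. (LINT w|M. (\<xi> s w - \<xi> t w)\<^sup>2) \<le> k * norm (s - t) powr (2 * H)"
    and l: "l > 0" and z: "z \<ge> 0"
  shows "measure M {w \<in> space M. dyadic_oscillation \<xi> l x (chaining_const CARD('n) H k * l powr H * (1 + z)) w} \<le> 3 * exp (- z\<^sup>2)"
proof -
  interpret prob_space M by fact
  note [measurable] = cgp_measurable[OF M X]
  define a where "a = chaining_const CARD('n) H k * l powr H * (1 + z)"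
  define B where "B = (\<lambda>J. {w \<in> space M. \<exists>u\<in>nat_cube (2 ^ J). \<bar>\<xi> (x + (l / 2 ^ J) *\<^sub>R natvec u) w - \<xi> x w\<bar> > a})"
  have "incseq B"
  proof (rule incseq_SucI, rule subsetI)
    fix J w assume "w \<in> B J"
    then obtain u where u: "u \<in> nat_cube (2 ^ J)" "\<bar>\<xi> (x + (l / 2 ^ J) *\<^sub>R natvec u) w - \<xi> x w\<bar> > a" and w: "w \<in> space M"
      unfolding B_def by auto
    have 1: "(\<lambda>i. 2 * u i) \<in> nat_cube (2 ^ Suc J)" using u(1) by (simp add: nat_cube_def)
    have "natvec (\<lambda>i. 2 * u i) = 2 *\<^sub>R (natvec u :: real^'n)" by (simp add: natvec_def vec_eq_iff)
    then have "x + (l / 2 ^ Suc J) *\<^sub>R natvec (\<lambda>i. 2 * u i) = x + (l / 2 ^ J) *\<^sub>R natvec u" by simp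
    then have "\<bar>\<xi> (x + (l / 2 ^ Suc J) *\<^sub>R natvec (\<lambda>i. 2 * u i)) w - \<xi> x w\<bar> > a" using u(2) by simp
    then show "w \<in> B (Suc J)" unfolding B_def using w 1 by blast
  qed
  moreover have "range B \<subseteq> sets M" unfolding B_def by (intro image_subsetI) measurable
  ultimately have "(\<lambda>J. measure M (B J)) \<longlonglongrightarrow> measure M (\<Union>J. B J)" by (intro finite_Lim_measure_incseq)
  moreover have "measure M (B J) \<le> 3 * exp (- z\<^sup>2)" for J
    unfolding B_def a_def by (rule oscillation_tail[OF M X H k inc l z])
  ultimately have "measure M (\<Union>J. B J) \<le> 3 * exp (- z\<^sup>2)" by (intro LIMSEQ_le_const2) auto
  moreover have "(\<Union>J. B J) = {w \<in> space M. dyadic_oscillation \<xi> l x a w}"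
    unfolding B_def dyadic_oscillation_def by blast
  ultimately show ?thesis unfolding a_def by simp
qed

text \<open>Rounding down at level \<open>J\<close> gives dyadic points converging to
  \<open>y\<close>; the half-open range of the coordinates keeps them in the index cube. Continuity
  of the path passes to the limit.\<close>

lemma not_dyadic_oscillation:
  fixes \<xi> :: "real^'n \<Rightarrow> 'w \<Rightarrow> real"
  assumes c: "continuous_on UNIV (\<lambda>t. \<xi> t w)" and n: "\<not> dyadic_oscillation \<xi> l x a w"
    and y: "\<And>i. 0 \<le> y $ i" "\<And>i. y $ i < 1"
  shows "\<bar>\<xi> (x + l *\<^sub>R y) w - \<xi> x w\<bar> \<le> a"
proof -
  define v where "v = (\<lambda>J. (1 / 2 ^ J) *\<^sub>R (natvec (\<lambda>i. nat \<lfloor>2 ^ J * y $ i\<rfloor>) :: real^'n))"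
  have v: "v \<longlonglongrightarrow> y"
  proof (rule vec_tendstoI)
    fix i
    have "(\<lambda>J. real_of_int \<lfloor>2 ^ J * y $ i\<rfloor> / 2 ^ J) \<longlonglongrightarrow> y $ i"
    proof (rule tendsto_sandwich)
      show "\<forall>\<^sub>F J in sequentially. real_of_int \<lfloor>2 ^ J * y $ i\<rfloor> / 2 ^ J \<le> y $ i"
        by (intro always_eventually allI) (simp add: field_simps)
      show "\<forall>\<^sub>F J in sequentially. y $ i - (1 / 2) ^ J \<le> real_of_int \<lfloor>2 ^ J * y $ i\<rfloor> / 2 ^ J"
      proof (intro always_eventually allI)
        fix J :: nat
        have "2 ^ J * y $ i - 1 \<le> real_of_int \<lfloor>2 ^ J * y $ i\<rfloor>" by linarith
        then have "(2 ^ J * y $ i - 1) / 2 ^ J \<le> real_of_int \<lfloor>2 ^ J * y $ i\<rfloor> / 2 ^ J" by (rule divide_right_mono) simp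
        then show "y $ i - (1 / 2) ^ J \<le> real_of_int \<lfloor>2 ^ J * y $ i\<rfloor> / 2 ^ J" by (simp add: diff_divide_distrib power_one_over)
      qed
      have "(\<lambda>J. y $ i - (1 / 2) ^ J) \<longlonglongrightarrow> y $ i - 0" by (intro tendsto_diff tendsto_const LIMSEQ_power_zero) simp
      then show "(\<lambda>J. y $ i - (1 / 2) ^ J) \<longlonglongrightarrow> y $ i" by simp
    qed simp
    then show "(\<lambda>J. v J $ i) \<longlonglongrightarrow> y $ i" using y(1) by (simp add: v_def natvec_def)
  qed
  have b: "\<bar>\<xi> (x + l *\<^sub>R v J) w - \<xi> x w\<bar> \<le> a" for J
  proof -
    have "(\<lambda>i. nat \<lfloor>2 ^ J * y $ i\<rfloor>) \<in> nat_cube (2 ^ J)"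
      unfolding nat_cube_def
    proof (intro CollectI allI)
      fix i
      have "2 ^ J * y $ i < 2 ^ J" using y(2)[of i] by simp
      then have "\<lfloor>2 ^ J * y $ i\<rfloor> < 2 ^ J" by (simp add: floor_less_iff)
      then show "nat \<lfloor>2 ^ J * y $ i\<rfloor> < 2 ^ J" by (simp add: nat_less_iff y(1))
    qed
    then have "\<bar>\<xi> (x + (l / 2 ^ J) *\<^sub>R natvec (\<lambda>i. nat \<lfloor>2 ^ J * y $ i\<rfloor>)) w - \<xi> x w\<bar> \<le> a"
      using n unfolding dyadic_oscillation_def not_less[symmetric] by blast
    then show ?thesis unfolding v_def by simp
  qed
  have lim: "(\<lambda>J. \<bar>\<xi> (x + l *\<^sub>R v J) w - \<xi> x w\<bar>) \<longlonglongrightarrow> \<bar>\<xi> (x + l *\<^sub>R y) w - \<xi> x w\<bar>"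
  proof -
    have "isCont (\<lambda>t. \<xi> t w) (x + l *\<^sub>R y)" using c by (simp add: continuous_on_eq_continuous_at)
    then have "(\<lambda>J. \<xi> (x + l *\<^sub>R v J) w) \<longlonglongrightarrow> \<xi> (x + l *\<^sub>R y) w"
      by (rule isCont_tendsto_compose) (intro tendsto_intros v)
    then show ?thesis by (intro tendsto_intros)
  qed
  show ?thesis by (rule LIMSEQ_le_const2[OF lim]) (use b in blast)
qed

lemma fbm_half_cube_scale:
  fixes \<xi> :: "real^'n \<Rightarrow> 'w \<Rightarrow> real"
  assumes M: "prob_space M" and B: "fractional_brownian_motion M H \<xi>" and h: "h > 0" and F: "finite F"
  shows "measure M {w \<in> space M. \<forall>t\<in>F. \<xi> ((1 / h) *\<^sub>R t) w < h powr (- H)} = measure M {w \<in> space M. \<forall>t\<in>F. \<xi> t w < 1}"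
proof -
  have X: "centered_gaussian_process M \<xi>"
    and cov: "\<And>t s. (LINT w|M. \<xi> t w * \<xi> s w) = (norm t powr (2 * H) + norm s powr (2 * H) - norm (t - s) powr (2 * H)) / 2"
    using B by (auto simp: fractional_brownian_motion_def)
  have Y1: "centered_gaussian_process M (\<lambda>t w. h powr H * \<xi> ((1 / h) *\<^sub>R t) w)"
    by (rule cgp_linear_image[OF M X, where J = "\<lambda>t. {(1 / h) *\<^sub>R t}" and c = "\<lambda>_ _. h powr H"]) auto
  have n: "norm ((1 / h) *\<^sub>R t) powr (2 * H) = norm t powr (2 * H) * h powr (- (2 * H))" for t :: "real^'n"
    using h by (simp add: powr_divide powr_minus_divide)
  have "measure M {w \<in> space M. \<forall>t\<in>F. h powr H * \<xi> ((1 / h) *\<^sub>R t) w \<in> {..<1}} = measure M {w \<in> space M. \<forall>t\<in>F. \<xi> t w \<in> {..<1}}"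
  proof (rule cgp_rectangle_eq[OF M M F Y1 X])
    fix t s :: "real^'n"
    have "(LINT w|M. h powr H * \<xi> ((1 / h) *\<^sub>R t) w * (h powr H * \<xi> ((1 / h) *\<^sub>R s) w)) =
        (LINT w|M. (h powr H * h powr H) * (\<xi> ((1 / h) *\<^sub>R t) w * \<xi> ((1 / h) *\<^sub>R s) w))"
      by (intro Bochner_Integration.integral_cong refl) (simp add: mult_ac)
    also have "\<dots> = (h powr H * h powr H) * (LINT w|M. \<xi> ((1 / h) *\<^sub>R t) w * \<xi> ((1 / h) *\<^sub>R s) w)"
      by simp
    also have "\<dots> = (h powr H * h powr H) * h powr (- (2 * H)) * (LINT w|M. \<xi> t w * \<xi> s w)"
      unfolding cov scaleR_diff_right[symmetric] n by (simp add: field_simps)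
    also have "(h powr H * h powr H) * h powr (- (2 * H)) = 1" using h by (simp add: powr_add[symmetric])
    finally show "(LINT w|M. h powr H * \<xi> ((1 / h) *\<^sub>R t) w * (h powr H * \<xi> ((1 / h) *\<^sub>R s) w)) = (LINT w|M. \<xi> t w * \<xi> s w)" by simp
  qed simp
  moreover have "h powr H * y < 1 \<longleftrightarrow> y < h powr (- H)" for y using h by (simp add: powr_minus field_simps)
  ultimately show ?thesis by simp
qed

text \<open>At the corners of cubes of side 1 / h the field is required to be below h^(-H), which by
  self-similarity has the probability of level 1 on the integer half cube. The condition on
  \<open>h\<close> says that this level and the oscillation over one cube add up to at most
  1.\<close>

lemma persistence_by_cubes:
  fixes \<xi> :: "real^'n \<Rightarrow> 'w \<Rightarrow> real"
  assumes M: "prob_space M" and H: "0 < H" and B: "fractional_brownian_motion M H \<xi>" and c: "continuous_paths M \<xi>"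
    and ev: "{w \<in> space M. \<forall>t\<in>E. \<xi> t w < 1} \<in> sets M"
    and E: "\<And>t. t \<in> E \<Longrightarrow> t $ e \<ge> 0" "\<And>t i. t \<in> E \<Longrightarrow> \<bar>t $ i\<bar> \<le> R" and R: "R \<ge> 0"
    and z: "z \<ge> 0" and h: "h > 0" "1 + chaining_const CARD('n) H 1 * (1 + z) \<le> h powr H"
  shows "measure M {w \<in> space M. \<forall>t\<in>half_cube e (nat \<lceil>h * R\<rceil>). \<xi> t w < 1}
      - (2 * (h * R + 1) + 1) ^ CARD('n) * (3 * exp (- z\<^sup>2)) \<le> measure M {w \<in> space M. \<forall>t\<in>E. \<xi> t w < 1}"
proof -
  interpret prob_space M by fact
  have X: "centered_gaussian_process M \<xi>" using B by (simp add: fractional_brownian_motion_def)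
  note [measurable] = cgp_measurable[OF M X]
  define N where "N = nat \<lceil>h * R\<rceil>"
  have N: "h * R \<le> real N" "real N \<le> h * R + 1"
  proof -
    have "h * R \<ge> 0" using h R by simp
    then show "h * R \<le> real N" "real N \<le> h * R + 1" unfolding N_def by linarith+
  qed
  define g where "g = chaining_const CARD('n) H 1 * (1 / h) powr H * (1 + z)"
  define A where "A = {w \<in> space M. \<forall>t\<in>half_cube e N. \<xi> ((1 / h) *\<^sub>R t) w < h powr (- H)}"
  define Osc where "Osc = (\<lambda>t. {w \<in> space M. dyadic_oscillation \<xi> (1 / h) ((1 / h) *\<^sub>R t) g w})"
  define G where "G = {w \<in> space M. \<forall>t\<in>E. \<xi> t w < 1}"
  have fin: "finite (half_cube e N)" by simp
  have Am: "A \<in> sets M" unfolding A_def using fin by measurable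
  have Om: "Osc t \<in> sets M" for t unfolding Osc_def dyadic_oscillation_def by measurable
  have inc: "(LINT w|M. (\<xi> s w - \<xi> t w)\<^sup>2) \<le> 1 * norm (s - t) powr (2 * H)" for s t
    using iso_field_increment_var[OF M iso_field_fbm[OF B], of s t] by simp
  have Op: "measure M (Osc t) \<le> 3 * exp (- z\<^sup>2)" for t
    unfolding Osc_def g_def by (rule dyadic_oscillation_tail[OF M X H _ inc _ z]) (use h in auto)
  have bound: "h powr (- H) + g \<le> 1"
  proof -
    have "g = chaining_const CARD('n) H 1 * (1 + z) * h powr (- H)"
      using h unfolding g_def by (simp add: powr_divide powr_minus_divide)
    then have "h powr (- H) + g = (1 + chaining_const CARD('n) H 1 * (1 + z)) * h powr (- H)"
      by (simp add: algebra_simps)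
    also have "\<dots> \<le> h powr H * h powr (- H)" using h(2) by (intro mult_right_mono) auto
    also have "\<dots> = 1" using h by (simp add: powr_add[symmetric])
    finally show ?thesis .
  qed
  have sub: "A \<subseteq> G \<union> (\<Union>t\<in>half_cube e N. Osc t)"
  proof
    fix w assume w: "w \<in> A"
    show "w \<in> G \<union> (\<Union>t\<in>half_cube e N. Osc t)"
    proof (rule ccontr)
      assume n: "w \<notin> G \<union> (\<Union>t\<in>half_cube e N. Osc t)"
      have ws: "w \<in> space M" using w by (simp add: A_def)
      from n ws obtain t where t: "t \<in> E" "\<not> \<xi> t w < 1" unfolding G_def by blast
      \<comment> \<open>The lower corner of the cube containing \<open>t\<close>. Rounding down a
        nonnegative coordinate keeps it nonnegative, so corners stay in the half cube.\<close>
      define u where "u = (\<chi> i. real_of_int \<lfloor>h * t $ i\<rfloor>)"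
      define y where "y = h *\<^sub>R t - u"
      have y: "0 \<le> y $ i" "y $ i < 1" for i unfolding y_def u_def by simp_all linarith+
      have u: "u \<in> half_cube e N"
      proof (rule mem_half_cube)
        show "u \<in> integer_lattice" unfolding u_def by (simp add: integer_lattice_def)
        show "u $ e \<ge> 0" unfolding u_def using E(1)[OF t(1)] h by simp
        fix i
        have "\<bar>h * t $ i\<bar> \<le> h * R" using E(2)[OF t(1), of i] h by (simp add: abs_mult)
        then have "\<bar>h * t $ i\<bar> \<le> real N" using N(1) by linarith
        then have "real_of_int (- int N) \<le> h * t $ i" "h * t $ i \<le> real_of_int (int N)" by auto
        then have "- int N \<le> \<lfloor>h * t $ i\<rfloor>" "\<lfloor>h * t $ i\<rfloor> \<le> int N" by (simp_all only: le_floor_iff floor_le_iff)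
        then show "\<bar>u $ i\<bar> \<le> real N" unfolding u_def by simp
      qed
      have "w \<notin> Osc u" using n u by blast
      then have no: "\<not> dyadic_oscillation \<xi> (1 / h) ((1 / h) *\<^sub>R u) g w" using ws by (simp add: Osc_def)
      have teq: "t = (1 / h) *\<^sub>R u + (1 / h) *\<^sub>R y" using h by (simp add: y_def algebra_simps)
      have "continuous_on UNIV (\<lambda>t. \<xi> t w)" using c ws by (simp add: continuous_paths_def)
      from not_dyadic_oscillation[OF this no y]
      have "\<bar>\<xi> t w - \<xi> ((1 / h) *\<^sub>R u) w\<bar> \<le> g" unfolding teq .
      moreover have "\<xi> ((1 / h) *\<^sub>R u) w < h powr (- H)" using w u by (simp add: A_def)
      ultimately show False using bound t(2) by linarith
    qed
  qed
  have "measure M A \<le> measure M (G \<union> (\<Union>t\<in>half_cube e N. Osc t))"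
    using ev Om fin unfolding G_def[symmetric] by (intro finite_measure_mono[OF sub] sets.Un sets.finite_UN) auto
  also have "\<dots> \<le> measure M G + measure M (\<Union>t\<in>half_cube e N. Osc t)"
    using ev Om fin unfolding G_def[symmetric] by (intro measure_Un_le sets.finite_UN) auto
  also have "measure M (\<Union>t\<in>half_cube e N. Osc t) \<le> (\<Sum>t\<in>half_cube e N. measure M (Osc t))"
    using fin Om by (intro finite_measure_subadditive_finite) auto
  also have "\<dots> \<le> (\<Sum>t\<in>half_cube e N. 3 * exp (- z\<^sup>2))" by (intro sum_mono Op)
  also have "\<dots> = real (card (half_cube e N)) * (3 * exp (- z\<^sup>2))" by simp
  also have "\<dots> \<le> (2 * (h * R + 1) + 1) ^ CARD('n) * (3 * exp (- z\<^sup>2))"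
  proof (rule mult_right_mono)
    have "card (half_cube e N) \<le> card {v \<in> int_cube N. v e \<ge> 0}"
      unfolding half_cube_def by (intro card_image_le) simp
    also have "\<dots> \<le> card (int_cube N :: ('n \<Rightarrow> int) set)" by (intro card_mono) auto
    finally have "real (card (half_cube e N)) \<le> real ((2 * N + 1) ^ CARD('n))" unfolding card_int_cube by (simp only: of_nat_le_iff)
    also have "\<dots> = (2 * real N + 1) ^ CARD('n)" by (simp add: add.commute)
    also have "\<dots> \<le> (2 * (h * R + 1) + 1) ^ CARD('n)" using N by (intro power_mono) auto
    finally show "real (card (half_cube e N)) \<le> (2 * (h * R + 1) + 1) ^ CARD('n)" .
  qed simp
  finally have "measure M A \<le> measure M G + (2 * (h * R + 1) + 1) ^ CARD('n) * (3 * exp (- z\<^sup>2))" by simp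
  moreover have "measure M A = measure M {w \<in> space M. \<forall>t\<in>half_cube e N. \<xi> t w < 1}"
    unfolding A_def by (rule fbm_half_cube_scale[OF M B h(1) fin])
  ultimately show ?thesis unfolding G_def N_def by simp
qed

text \<open>Cubes of side \<open>1 / h\<close> with \<open>h\<close> of order \<open>(ln T) powr (1 / (2 H))\<close>: the oscillation over
  one cube is then a small fraction of \<open>1\<close>, except with probability \<open>T powr (- 2 d)\<close>.\<close>

lemma fbm_persistence_lower_axis:
  fixes \<xi> :: "real^'n \<Rightarrow> 'w \<Rightarrow> real"
  assumes M: "prob_space M" and H: "0 < H" "H < 1" and B: "fractional_brownian_motion M H \<xi>" and c: "continuous_paths M \<xi>"
    and ev: "\<And>T. {w \<in> space M. \<forall>t\<in>dilate T D. \<xi> t w < 1} \<in> sets M"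
    and D: "bounded D" "\<And>t. t \<in> D \<Longrightarrow> t $ e \<ge> 0" and l: "l > real CARD('n) / (2 * H)"
  shows "\<forall>\<^sub>F T in at_top. T powr (H - CARD('n)) * ln T powr (- l) \<le> persistence_prob M \<xi> (dilate T D)"
proof -
  interpret rf: regular_field \<xi> M "\<lambda>r. r powr (2 * H)" H 1 1 by (rule regular_field_fbm[OF M H B])
  define d where "d = real CARD('n)"
  have d: "d \<ge> 1" unfolding d_def by (simp add: Suc_leI)
  obtain b where b: "b > 0" "\<And>t. t \<in> D \<Longrightarrow> norm t \<le> b" using D(1) unfolding bounded_pos by blast
  obtain a where a: "a > 0" and lo: "\<forall>\<^sub>F r in at_top. a * r powr (H - d) / sqrt (ln r)
     \<le> measure M {w \<in> space M. \<forall>t\<in>half_cube e (nat \<lceil>b * r\<rceil>). \<xi> t w < 1}"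
    using rf.half_cube_lower[OF b(1)] unfolding d_def by blast
  define cc where "cc = chaining_const CARD('n) H 1"
  have cc: "cc > 0" unfolding cc_def by (rule rf.chaining_const_pos)
  \<comment> \<open>Makes h^H equal to (1 + cc (1 + sqrt (2 d))) sqrt (ln T), enough for the
    oscillation level z = sqrt (2 d ln T).\<close>
  define C where "C = (1 + cc * (1 + sqrt (2 * d))) powr (1 / H)"
  have C0: "1 + cc * (1 + sqrt (2 * d)) > 0" using cc d by (simp add: add_pos_nonneg)
  then have C: "C > 0" by (simp add: C_def)
  define \<beta> where "\<beta> = 1 / (2 * H)"
  have \<beta>: "\<beta> > 0" using H by (simp add: \<beta>_def)
  define h where "h = (\<lambda>T::real. C * ln T powr \<beta>)"
  have fl: "filterlim (\<lambda>T. h T * T) at_top at_top" unfolding h_def using C \<beta> by real_asymp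
  define a' where "a' = a * C powr (H - d) / sqrt 2"
  have a': "a' > 0" using a C by (simp add: a'_def)
  \<comment> \<open>The half cube has radius of order h T, and (h T)^(H - d) / sqrt (ln (h T)) is
    T^(H - d) times (ln T) to the power (H - d) / (2 H) - 1/2 = - d / (2 H), up to constants. This
    is the origin of the exponent.\<close>
  have l': "l - d / (2 * H) > 0" using l by (simp add: d_def)
  have e1: "\<forall>\<^sub>F T in at_top. ln (C * ln T powr \<beta> * T) \<le> 2 * ln (T::real)" using C \<beta> by real_asymp
  \<comment> \<open>Twice the target is secured here, since the union bound in \<open>e3\<close>
    takes one copy away.\<close>
  have e2: "\<forall>\<^sub>F T in at_top. 2 \<le> a' * ln (T::real) powr (l - d / (2 * H))" using a' l' by real_asymp
  \<comment> \<open>About T^d cubes, each failing with probability of order T^(-2 d), leave T^(-d)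
    up to logarithms, smaller than the target by a factor T^(-H).\<close>
  have e3: "\<forall>\<^sub>F T in at_top. (2 * (C * ln T powr \<beta> * (b * T) + 1) + 1) powr d * (3 * T powr (- (2 * d))) \<le> T powr (H - d) * ln (T::real) powr (- l)"
  proof -
    have "\<forall>\<^sub>F T in at_top. 2 * (C * ln T powr \<beta> * (b * T) + 1) + 1 \<le> T * (ln (T::real) powr (\<beta> + 1))"
      using C b(1) \<beta> by real_asymp
    moreover have "\<forall>\<^sub>F T in at_top. ln (T::real) powr ((\<beta> + 1) * d + l) * 3 \<le> T powr H"
      using H(1) by real_asymp
    ultimately show ?thesis using eventually_gt_at_top[of 1]
    proof eventually_elim
      case (elim T)
      have lT: "ln T > 0" using elim by simp
      have "(2 * (C * ln T powr \<beta> * (b * T) + 1) + 1) powr d \<le> (T * ln T powr (\<beta> + 1)) powr d"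
        using elim C b d by (intro powr_mono2) auto
      also have "\<dots> = T powr d * ln T powr ((\<beta> + 1) * d)" using elim by (simp add: powr_mult powr_powr)
      finally have "(2 * (C * ln T powr \<beta> * (b * T) + 1) + 1) powr d * (3 * T powr (- (2 * d))) \<le>
          T powr d * ln T powr ((\<beta> + 1) * d) * (3 * T powr (- (2 * d)))" by (intro mult_right_mono) auto
      also have "\<dots> = (ln T powr ((\<beta> + 1) * d + l) * 3) * (T powr (- d) * ln T powr (- l))"
      proof -
        have "T powr d * T powr (- (2 * d)) = T powr (- d)" by (simp add: powr_add[symmetric])
        moreover have "ln T powr ((\<beta> + 1) * d + l) * ln T powr (- l) = ln T powr ((\<beta> + 1) * d)"
          by (simp add: powr_add[symmetric])
        moreover have "A * B * (3 * C) = (A * C) * (3 * B)" "(A' * 3) * (B' * C') = B' * (3 * (A' * C'))" for A B C A' B' C' :: real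
          by simp_all
        ultimately show ?thesis by metis
      qed
      also have "\<dots> \<le> T powr H * (T powr (- d) * ln T powr (- l))" using elim by (intro mult_right_mono) auto
      also have "\<dots> = T powr (H - d) * ln T powr (- l)" by (simp add: powr_add[symmetric])
      finally show ?case .
    qed
  qed
  have e4: "\<forall>\<^sub>F T in at_top. ln (T::real) \<ge> 1 \<and> C * ln T powr \<beta> * T > 1" using C \<beta> by (intro eventually_conj; real_asymp)
  show ?thesis using eventually_compose_filterlim[OF lo fl] e1 e2 e3 e4 eventually_gt_at_top[of 1]
  proof eventually_elim
    case (elim T)
    define L where "L = ln T"
    have L: "L \<ge> 1" using elim by (simp add: L_def)
    define z where "z = sqrt (2 * d) * sqrt L"
    have z: "z \<ge> 0" using L d by (simp add: z_def)
    have z2: "exp (- z\<^sup>2) = T powr (- (2 * d))"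
      using elim L d by (simp add: z_def power_mult_distrib powr_def L_def)
    have hpos: "h T > 0" using C L by (simp add: h_def L_def)
    have hH: "h T powr H = (1 + cc * (1 + sqrt (2 * d))) * sqrt L"
      using C C0 L H by (simp add: h_def L_def powr_mult C_def powr_powr \<beta>_def powr_half_sqrt)
    have s1: "sqrt L \<ge> 1" using L by simp
    have hz: "1 + cc * (1 + z) \<le> h T powr H"
    proof -
      have "1 + cc * (1 + z) = 1 + cc + cc * z" by (simp add: algebra_simps)
      also have "\<dots> \<le> (1 + cc) * sqrt L + cc * z" using mult_left_mono[OF s1, of "1 + cc"] cc by simp
      also have "\<dots> = h T powr H" unfolding hH z_def by (simp add: algebra_simps)
      finally show ?thesis .
    qed
    have "measure M {w \<in> space M. \<forall>t\<in>half_cube e (nat \<lceil>h T * (b * T)\<rceil>). \<xi> t w < 1}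
      - (2 * (h T * (b * T) + 1) + 1) ^ CARD('n) * (3 * exp (- z\<^sup>2)) \<le> measure M {w \<in> space M. \<forall>t\<in>dilate T D. \<xi> t w < 1}"
    proof (rule persistence_by_cubes[OF M H(1) B c ev _ _ _ z hpos hz[unfolded cc_def]])
      fix t assume "t \<in> dilate T D"
      then obtain x where x: "x \<in> D" "t = T *\<^sub>R x" by (auto simp: dilate_def)
      show "t $ e \<ge> 0" using D(2)[OF x(1)] elim x(2) by simp
      fix i
      have "\<bar>t $ i\<bar> \<le> norm t" by (rule component_le_norm_cart)
      also have "\<dots> \<le> b * T" using b(2)[OF x(1)] elim x(2) by (simp add: mult.commute)
      finally show "\<bar>t $ i\<bar> \<le> b * T" .
    qed (use b elim in auto)
    moreover have "(2 * (h T * (b * T) + 1) + 1) ^ CARD('n) * (3 * exp (- z\<^sup>2)) \<le> T powr (H - d) * L powr (- l)"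
    proof -
      have "2 * (h T * (b * T) + 1) + 1 > 0" using hpos b elim by (simp add: add_pos_nonneg)
      then have "(2 * (h T * (b * T) + 1) + 1) ^ CARD('n) = (2 * (C * ln T powr \<beta> * (b * T) + 1) + 1) powr d"
        unfolding d_def h_def by (simp add: powr_realpow)
      then show ?thesis using elim unfolding z2 L_def by simp
    qed
    moreover have "2 * (T powr (H - d) * L powr (- l)) \<le> measure M {w \<in> space M. \<forall>t\<in>half_cube e (nat \<lceil>h T * (b * T)\<rceil>). \<xi> t w < 1}"
    proof -
      have "2 * L powr (- l) \<le> (a' * L powr (l - d / (2 * H))) * L powr (- l)"
        using elim by (intro mult_right_mono) (auto simp: L_def)
      also have "\<dots> = a' * L powr (- d / (2 * H))" by (simp add: mult.assoc powr_add[symmetric])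
      finally have "T powr (H - d) * (2 * L powr (- l)) \<le> T powr (H - d) * (a' * L powr (- d / (2 * H)))"
        by (intro mult_left_mono) auto
      also have "\<dots> = a * (h T * T) powr (H - d) / (sqrt 2 * sqrt L)"
      proof -
        have "(h T * T) powr (H - d) = C powr (H - d) * L powr (\<beta> * (H - d)) * T powr (H - d)"
          using C L elim by (simp add: h_def L_def powr_mult powr_powr)
        moreover have "L powr (\<beta> * (H - d)) / sqrt L = L powr (- d / (2 * H))"
        proof -
          have "L powr (\<beta> * (H - d)) / sqrt L = L powr (\<beta> * (H - d) - 1 / 2)"
            using L by (simp add: powr_diff powr_half_sqrt)
          also have "\<beta> * (H - d) - 1 / 2 = - d / (2 * H)" using H by (simp add: \<beta>_def field_simps)
          finally show ?thesis .
        qed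
        moreover have "T powr (H - d) * (a' * (E / sqrt L)) = a * (C powr (H - d) * E * T powr (H - d)) / (sqrt 2 * sqrt L)" for E
          unfolding a'_def by (simp add: mult_ac)
        ultimately show ?thesis by metis
      qed
      also have "\<dots> \<le> a * (h T * T) powr (H - d) / sqrt (ln (h T * T))"
      proof (rule divide_left_mono)
        have "sqrt (ln (h T * T)) \<le> sqrt (2 * L)" using elim by (simp add: h_def L_def)
        then show "sqrt (ln (h T * T)) \<le> sqrt 2 * sqrt L" by (simp add: real_sqrt_mult)
        have "ln (h T * T) > 0" using elim by (simp add: h_def)
        then show "0 < sqrt 2 * sqrt L * sqrt (ln (h T * T))" using L by simp
      qed (use a in simp)
      also have "\<dots> \<le> measure M {w \<in> space M. \<forall>t\<in>half_cube e (nat \<lceil>b * (h T * T)\<rceil>). \<xi> t w < 1}" by fact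
      also have "b * (h T * T) = h T * (b * T)" by simp
      finally show ?thesis by (simp add: mult.left_commute)
    qed
    ultimately show ?case unfolding persistence_prob_def d_def[symmetric] L_def by linarith
  qed
qed

text \<open>An orthogonal map takes a coordinate axis to a supporting normal at 0, so the preimage
  of the domain lies in a coordinate half space. The domain here is not tied to the lattice, so any
  such map is allowed.\<close>

lemma fbm_persistence_lower:
  fixes \<xi> :: "real^'n \<Rightarrow> 'w \<Rightarrow> real"
  assumes M: "prob_space M" and H: "0 < H" "H < 1" and B: "fractional_brownian_motion M H \<xi>" and c: "continuous_paths M \<xi>"
    and D: "convex D" "interior D \<noteq> {}" "0 \<in> frontier D" "bounded D" "fsigma D"
    and l: "l > real CARD('n) / (2 * H)"
  shows "\<forall>\<^sub>F T in at_top. T powr (H - CARD('n)) * ln T powr (- l) \<le> persistence_prob M \<xi> (dilate T D)"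
proof -
  have X: "centered_gaussian_process M \<xi>" using B by (simp add: fractional_brownian_motion_def)
  fix e :: 'n
  obtain \<nu> where \<nu>: "norm \<nu> = 1" "\<And>y. y \<in> closure D \<Longrightarrow> \<nu> \<bullet> y \<ge> 0" using supporting_normal[OF D(1-3)] by blast
  have "norm (axis e 1 :: real^'n) = norm \<nu>" using \<nu>(1) by simp
  then obtain Q :: "real^'n \<Rightarrow> real^'n" where Q: "orthogonal_transformation Q" and Qe: "Q (axis e 1) = \<nu>"
    by (rule orthogonal_transformation_exists)
  have lin: "linear Q" using Q by (rule orthogonal_transformation_linear)
  have nQ: "norm (Q x) = norm x" for x using Q by (rule orthogonal_transformation_norm)
  have surj: "surj Q" using Q by (rule orthogonal_transformation_surj)
  define D' where "D' = Q -` D"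
  have im: "Q ` dilate T D' = dilate T D" for T
  proof -
    have "Q ` dilate T D' = (\<lambda>t. T *\<^sub>R Q t) ` D'"
      unfolding dilate_def image_image by (simp add: linear_scale[OF lin])
    also have "\<dots> = (\<lambda>t. T *\<^sub>R t) ` (Q ` D')" by (simp only: image_image)
    also have "Q ` D' = D" unfolding D'_def using surj by (rule surj_image_vimage_eq)
    finally show ?thesis by (simp only: dilate_def)
  qed
  have ev: "{w \<in> space M. \<forall>t\<in>dilate T D'. \<xi> (Q t) w < 1} = {w \<in> space M. \<forall>t\<in>dilate T D. \<xi> t w < 1}" for T
    unfolding im[symmetric] by simp
  have "\<forall>\<^sub>F T in at_top. T powr (H - CARD('n)) * ln T powr (- l) \<le> persistence_prob M (\<lambda>t. \<xi> (Q t)) (dilate T D')"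
  proof (rule fbm_persistence_lower_axis[OF M H _ _ _ _ _ l, of _ _ e])
    have "iso_field M (\<lambda>r. r powr (2 * H)) (\<lambda>t. \<xi> (Q t))" by (rule iso_field_transform[OF M iso_field_fbm[OF B] Q])
    then show "fractional_brownian_motion M H (\<lambda>t. \<xi> (Q t))"
      by (simp add: iso_field_def fractional_brownian_motion_def)
    have "continuous_on UNIV Q" using lin by (simp add: linear_continuous_on linear_conv_bounded_linear)
    then show "continuous_paths M (\<lambda>t. \<xi> (Q t))"
      using c unfolding continuous_paths_def by (auto intro: continuous_on_compose2)
    show "{w \<in> space M. \<forall>t\<in>dilate T D'. \<xi> (Q t) w < 1} \<in> sets M" for T
      unfolding ev by (rule persistence_event[OF cgp_measurable[OF M X] c D(5,4)])
    obtain b where "\<And>x. x \<in> D \<Longrightarrow> norm x \<le> b" using D(4) unfolding bounded_iff by blast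
    then have "norm x \<le> b" if "x \<in> D'" for x using that nQ[of x] unfolding D'_def by fastforce
    then show "bounded D'" unfolding bounded_iff by blast
    show "t $ e \<ge> 0" if "t \<in> D'" for t
    proof -
      have "Q t \<in> closure D" using that closure_subset unfolding D'_def by blast
      then have "0 \<le> Q (axis e 1) \<bullet> Q t" unfolding Qe by (rule \<nu>(2))
      also have "\<dots> = axis e 1 \<bullet> t" using Q by (simp add: orthogonal_transformation_def)
      finally show ?thesis by (simp add: inner_axis inner_commute)
    qed
  qed
  then show ?thesis unfolding persistence_prob_def ev .
qed

text \<open>A ball inside the domain and tangent to its boundary at 0 suffices: persistence on the
  domain implies persistence on every finite subset of the dilated ball.\<close>

lemma persistence_upper:
  fixes \<xi> :: "real^'n \<Rightarrow> 'w \<Rightarrow> real"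
  assumes R: "regular_field \<xi> M V H k c"
    and D: "convex D" "interior D \<noteq> {}" "0 \<in> frontier D" "smooth_boundary_near D 0"
    and K: "K \<ge> 0" and rk: "\<And>F b. finite F \<Longrightarrow> (\<And>t. t \<in> F \<Longrightarrow> norm t \<ge> 1) \<Longrightarrow>
      (\<Sum>t\<in>F. b t)\<^sup>2 \<le> K * (\<Sum>s\<in>F. \<Sum>t\<in>F. b s * b t * (LINT w|M. \<xi> s w * \<xi> t w))"
  shows "\<exists>C>0. \<forall>\<^sub>F T in at_top. persistence_prob M \<xi> (dilate T D) \<le> exp (C * sqrt (ln T)) * T powr (H - real CARD('n))"
proof -
  interpret rf: regular_field \<xi> M V H k c by fact
  note [measurable] = cgp_measurable[OF rf.M iso_field_cgp[OF rf.M rf.iso]]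
  obtain \<nu> r where \<nu>: "norm \<nu> = 1" and r: "r > 0" and ball: "ball (r *\<^sub>R \<nu>) r \<subseteq> D"
    by (rule interior_ball_at_0[OF D])
  obtain C where C: "C > 0" and ub: "\<forall>\<^sub>F T in at_top. \<forall>p.
    (\<forall>F. finite F \<and> F \<subseteq> ball ((r * T) *\<^sub>R \<nu>) (r * T) \<longrightarrow> p \<le> measure M {w \<in> space M. \<forall>s\<in>F. \<xi> s w < 1}) \<longrightarrow>
      p \<le> exp (C * sqrt (ln T)) * T powr (H - real CARD('n))"
    using persistence_upper_ball[OF rf.M rf.iso rf.H rf.k rf.V K rk \<nu> r] by blast
  have "\<forall>\<^sub>F T in at_top. persistence_prob M \<xi> (dilate T D) \<le> exp (C * sqrt (ln T)) * T powr (H - real CARD('n))"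
    using ub eventually_gt_at_top[of 0]
  proof eventually_elim
    case (elim T)
    have sub: "ball ((r * T) *\<^sub>R \<nu>) (r * T) \<subseteq> dilate T D"
    proof
      fix x assume x: "x \<in> ball ((r * T) *\<^sub>R \<nu>) (r * T)"
      have "(r * T) *\<^sub>R \<nu> - x = T *\<^sub>R (r *\<^sub>R \<nu> - (1 / T) *\<^sub>R x)"
        using elim(2) by (simp add: scaleR_diff_right mult.commute)
      then have "T * norm (r *\<^sub>R \<nu> - (1 / T) *\<^sub>R x) < r * T" using x elim(2) by (simp add: dist_norm)
      then have "norm (r *\<^sub>R \<nu> - (1 / T) *\<^sub>R x) < r" using elim(2) by (simp add: mult.commute)
      then have "(1 / T) *\<^sub>R x \<in> D" using ball by (simp add: subset_iff dist_norm)
      moreover have "x = T *\<^sub>R ((1 / T) *\<^sub>R x)" using elim(2) by simp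
      ultimately show "x \<in> dilate T D" unfolding dilate_def by (rule image_eqI[rotated])
    qed
    have "persistence_prob M \<xi> (dilate T D) \<le> measure M {w \<in> space M. \<forall>s\<in>F. \<xi> s w < 1}"
      if F: "finite F" "F \<subseteq> ball ((r * T) *\<^sub>R \<nu>) (r * T)" for F
      unfolding persistence_prob_def
    proof (rule rf.finite_measure_mono)
      show "{w \<in> space M. \<forall>s\<in>F. \<xi> s w < 1} \<in> sets M" using F(1) by measurable
      have "F \<subseteq> dilate T D" using F(2) sub by (rule subset_trans)
      then show "{w \<in> space M. \<forall>t\<in>dilate T D. \<xi> t w < 1} \<subseteq> {w \<in> space M. \<forall>s\<in>F. \<xi> s w < 1}" by blast
    qed
    then show ?case using elim(1) by simp
  qed
  with C show ?thesis by blast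
qed

section \<open>The spectral hypothesis, and the assembly of the three statements\<close>

lemma spectral_quadratic_form:
  fixes \<xi> :: "'t::euclidean_space \<Rightarrow> 'w \<Rightarrow> real"
  assumes f: "has_spectral_density M \<xi> f" and F: "finite F"
  shows "has_bochner_integral lborel (\<lambda>x. (cmod (\<Sum>t\<in>F. complex_of_real (b t) * (iexp (t \<bullet> x) - 1)))\<^sup>2 * f x)
    (\<Sum>s\<in>F. \<Sum>t\<in>F. b s * b t * (LINT w|M. \<xi> s w * \<xi> t w))"
proof -
  define h where "h = (\<lambda>s t x. (iexp (s \<bullet> x) - 1) * (exp (- \<i> * complex_of_real (t \<bullet> x)) - 1) * complex_of_real (f x))"
  define S where "S = (\<lambda>x. \<Sum>t\<in>F. complex_of_real (b t) * (iexp (t \<bullet> x) - 1))"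
  define v where "v = (\<Sum>s\<in>F. \<Sum>t\<in>F. b s * b t * (LINT w|M. \<xi> s w * \<xi> t w))"
  have h: "has_bochner_integral lborel (h s t) (complex_of_real (LINT w|M. \<xi> s w * \<xi> t w))" for s t
    using f unfolding has_spectral_density_def Let_def h_def has_bochner_integral_iff by simp
  have "has_bochner_integral lborel (\<lambda>x. \<Sum>s\<in>F. \<Sum>t\<in>F. complex_of_real (b s * b t) * h s t x)
      (\<Sum>s\<in>F. \<Sum>t\<in>F. complex_of_real (b s * b t) * complex_of_real (LINT w|M. \<xi> s w * \<xi> t w))"
    by (intro has_bochner_integral_sum has_bochner_integral_mult_right h)
  moreover have "(\<Sum>s\<in>F. \<Sum>t\<in>F. complex_of_real (b s * b t) * h s t x) = complex_of_real ((cmod (S x))\<^sup>2 * f x)" for x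
  proof -
    have c: "exp (- \<i> * complex_of_real (t \<bullet> x)) - 1 = cnj (iexp (t \<bullet> x) - 1)" for t
      by (simp add: exp_cnj)
    have "complex_of_real ((cmod (S x))\<^sup>2 * f x) = S x * cnj (S x) * complex_of_real (f x)"
      unfolding of_real_mult complex_norm_square ..
    also have "S x * cnj (S x) = (\<Sum>s\<in>F. \<Sum>t\<in>F. complex_of_real (b s) * (iexp (s \<bullet> x) - 1) * (complex_of_real (b t) * cnj (iexp (t \<bullet> x) - 1)))"
      unfolding S_def cnj_sum sum_product by simp
    finally have "complex_of_real ((cmod (S x))\<^sup>2 * f x) = (\<Sum>s\<in>F. \<Sum>t\<in>F. complex_of_real (b s) * (iexp (s \<bullet> x) - 1) * (complex_of_real (b t) * cnj (iexp (t \<bullet> x) - 1))) * complex_of_real (f x)" .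
    then show ?thesis unfolding h_def c by (simp only: sum_distrib_right) (simp add: mult_ac)
  qed
  ultimately have "has_bochner_integral lborel (\<lambda>x. complex_of_real ((cmod (S x))\<^sup>2 * f x)) (complex_of_real v)"
    unfolding v_def by simp
  from has_bochner_integral_Re[OF this] show ?thesis unfolding v_def S_def by simp
qed

lemma spectral_rkhs:
  fixes \<xi> :: "'t::euclidean_space \<Rightarrow> 'w \<Rightarrow> real"
  assumes f: "has_spectral_density M \<xi> f" and g: "spectral_minorant g" and fg: "AE x in lborel. f x > g (norm x)"
  shows "\<exists>K\<ge>0. \<forall>F b. finite F \<and> (\<forall>t\<in>F. norm t \<ge> 1) \<longrightarrow>
      (\<Sum>t\<in>F. b t)\<^sup>2 \<le> K * (\<Sum>s\<in>F. \<Sum>t\<in>F. b s * b t * (LINT w|M. \<xi> s w * \<xi> t w))"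
proof -
  have g': "\<And>x. x \<ge> 0 \<Longrightarrow> g x > 0" "\<And>x y. 0 \<le> x \<Longrightarrow> x \<le> y \<Longrightarrow> g y \<le> g x" "continuous_on {0..} g"
    using g by (auto simp: spectral_minorant_def monotone_on_def)
  obtain K where K: "K > 0" and rk: "\<forall>F b. finite F \<and> (\<forall>t\<in>F. norm (t::'t) \<ge> 1) \<longrightarrow>
    ennreal ((\<Sum>t\<in>F. b t)\<^sup>2) \<le> ennreal K *
      (\<integral>\<^sup>+x. ennreal ((cmod (\<Sum>t\<in>F. complex_of_real (b t) * (iexp (t \<bullet> x) - 1)))\<^sup>2 * g (norm x)) \<partial>lborel)"
    using rkhs_constant[OF g' minorant_summable[OF g]] by blast
  have "(\<Sum>t\<in>F. b t)\<^sup>2 \<le> K * (\<Sum>s\<in>F. \<Sum>t\<in>F. b s * b t * (LINT w|M. \<xi> s w * \<xi> t w))"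
    if F: "finite F" "\<forall>t\<in>F. norm t \<ge> 1" for F b
  proof -
    define S where "S = (\<lambda>x. (cmod (\<Sum>t\<in>F. complex_of_real (b t) * (iexp (t \<bullet> x) - 1)))\<^sup>2)"
    define v where "v = (\<Sum>s\<in>F. \<Sum>t\<in>F. b s * b t * (LINT w|M. \<xi> s w * \<xi> t w))"
    have q: "has_bochner_integral lborel (\<lambda>x. S x * f x) v"
      unfolding S_def v_def by (rule spectral_quadratic_form[OF f F(1)])
    have nn: "AE x in lborel. 0 \<le> S x * f x"
      using f unfolding has_spectral_density_def S_def by auto
    have qi: "integrable lborel (\<lambda>x. S x * f x)" "(LINT x|lborel. S x * f x) = v"
      using q by (simp_all add: has_bochner_integral_iff)
    have v0: "v \<ge> 0" using integral_nonneg_AE[OF nn] qi(2) by simp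
    have "ennreal ((\<Sum>t\<in>F. b t)\<^sup>2) \<le> ennreal K * (\<integral>\<^sup>+x. ennreal (S x * g (norm x)) \<partial>lborel)"
      unfolding S_def by (rule rk[rule_format]) (use F in blast)
    also have "\<dots> \<le> ennreal K * (\<integral>\<^sup>+x. ennreal (S x * f x) \<partial>lborel)"
    proof (intro mult_left_mono nn_integral_mono_AE)
      show "AE x in lborel. ennreal (S x * g (norm x)) \<le> ennreal (S x * f x)"
        using fg
      proof eventually_elim
        case (elim x)
        then show ?case unfolding S_def by (intro ennreal_leI mult_left_mono) auto
      qed
    qed simp
    also have "(\<integral>\<^sup>+x. ennreal (S x * f x) \<partial>lborel) = ennreal v"
      using nn_integral_eq_integral[OF qi(1) nn] qi(2) by simp
    also have "ennreal K * ennreal v = ennreal (K * v)" using K v0 by (simp add: ennreal_mult)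
    finally show ?thesis unfolding v_def[symmetric] using K v0 by (subst (asm) ennreal_le_iff) auto
  qed
  then show ?thesis using K by (intro exI[of _ K]) auto
qed

text \<open>After division by ln T the corrections are of order ln (ln T) / ln T from below and 1 /
  sqrt (ln T) from above.\<close>

lemma log_ratio_limit:
  assumes lo: "\<forall>\<^sub>F T in at_top. T powr a * ln T powr (- l) \<le> p T"
    and up: "\<forall>\<^sub>F T in at_top. p T \<le> exp (C * sqrt (ln T)) * T powr (a::real)"
  shows "((\<lambda>T. ln (p T) / ln T) \<longlongrightarrow> a) at_top"
proof (rule tendsto_sandwich)
  have "\<forall>\<^sub>F T in at_top. a - l * (ln (ln T) / ln T) \<le> ln (p T) / ln T \<and> ln (p T) / ln T \<le> a + C * (sqrt (ln T) / ln T)"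
    using lo up eventually_gt_at_top[of "exp 1"]
  proof eventually_elim
    case (elim T)
    have "exp (1::real) > 1" by simp
    then have T: "T > 0" "T > 1" using elim(3) by linarith+
    have lT: "ln T > 0" using T by simp
    have pos: "0 < T powr a * ln T powr (- l)" using T lT by simp
    then have p: "p T > 0" using elim by linarith
    have "a * ln T - l * ln (ln T) = ln (T powr a * ln T powr (- l))"
      using T lT by (subst ln_mult) (auto simp: ln_powr)
    also have "\<dots> \<le> ln (p T)" using pos elim by (intro ln_mono) auto
    finally have 1: "(a * ln T - l * ln (ln T)) / ln T \<le> ln (p T) / ln T" using lT by (intro divide_right_mono) auto
    have "ln (p T) \<le> ln (exp (C * sqrt (ln T)) * T powr a)" using p elim by (intro ln_mono) auto
    also have "\<dots> = C * sqrt (ln T) + a * ln T" using T by (subst ln_mult) (auto simp: ln_powr)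
    finally have 2: "ln (p T) / ln T \<le> (C * sqrt (ln T) + a * ln T) / ln T" using lT by (intro divide_right_mono) auto
    from 1 2 show ?case using lT by (simp add: diff_divide_distrib add_divide_distrib)
  qed
  then show "\<forall>\<^sub>F T in at_top. a - l * (ln (ln T) / ln T) \<le> ln (p T) / ln T"
    and "\<forall>\<^sub>F T in at_top. ln (p T) / ln T \<le> a + C * (sqrt (ln T) / ln T)"
    by (simp_all add: eventually_conj_iff)
  have "((\<lambda>T::real. ln (ln T) / ln T) \<longlongrightarrow> 0) at_top" by real_asymp
  from tendsto_diff[OF tendsto_const tendsto_mult[OF tendsto_const this]]
  show "((\<lambda>T. a - l * (ln (ln T) / ln T)) \<longlongrightarrow> a) at_top" by (metis mult_zero_right diff_zero)
  have "((\<lambda>T::real. sqrt (ln T) / ln T) \<longlongrightarrow> 0) at_top" by real_asymp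
  from tendsto_add[OF tendsto_const tendsto_mult[OF tendsto_const this]]
  show "((\<lambda>T. a + C * (sqrt (ln T) / ln T)) \<longlongrightarrow> a) at_top" by (metis mult_zero_right add_0_right)
qed

theorem proposition1:
  fixes \<Delta> :: "(real^'n) set" and e :: 'n
    and M :: "'w measure" and \<xi> :: "real^'n \<Rightarrow> 'w \<Rightarrow> real" and H :: real
  assumes "smooth_convex_domain_at_0 \<Delta>"
    and "0 < H" and "H < 1"
    and "prob_space M"
    and "continuous_paths M \<xi>"
  shows
    "(fractional_brownian_motion M H \<xi> \<longrightarrow>
        ((\<lambda>T. ln (persistence_prob M \<xi> (dilate T \<Delta>)) / ln T) \<longlongrightarrow> H - real CARD('n)) at_top)
     \<and>
     (centered_gaussian_process M \<xi> \<and> isotropic M \<xi> \<and> stationary_increments M \<xi> \<and>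
      variance_growth M H \<xi> \<longrightarrow>
        (tangent_plane_at \<Delta> 0 {t. t $ e = 0} \<longrightarrow>
          (\<forall>l > 1/2. \<forall>\<^sub>F T in at_top.
             T powr (H - real CARD('n)) * ln T powr (- l)
               \<le> persistence_prob M \<xi> (dilate T \<Delta> \<inter> integer_lattice)) \<and>
          (fractional_brownian_motion M H \<xi> \<longrightarrow>
            (\<forall>l > real CARD('n) / (2 * H). \<forall>\<^sub>F T in at_top.
               T powr (H - real CARD('n)) * ln T powr (- l)
                 \<le> persistence_prob M \<xi> (dilate T \<Delta>))))
        \<and>
        ((\<exists>f g. has_spectral_density M \<xi> f \<and> spectral_minorant g \<and>
                (AE x in lborel. f x > g (norm x))) \<longrightarrow>
          (\<exists>C>0. \<forall>\<^sub>F T in at_top.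
             persistence_prob M \<xi> (dilate T \<Delta>)
               \<le> exp (C * sqrt (ln T)) * T powr (- real CARD('n) + H))))"
proof -
  note H = assms(2,3) and M = assms(4) and c = assms(5)
  have D: "convex \<Delta>" "interior \<Delta> \<noteq> {}" "0 \<in> frontier \<Delta>" "bounded \<Delta>" "fsigma \<Delta>" "smooth_boundary_near \<Delta> 0"
    using assms(1) by (auto simp: smooth_convex_domain_at_0_def)
  have lower: "\<forall>\<^sub>F T in at_top. T powr (H - real CARD('n)) * ln T powr (- l) \<le> persistence_prob M \<xi> (dilate T \<Delta>)"
    if "fractional_brownian_motion M H \<xi>" "l > real CARD('n) / (2 * H)" for l
    by (rule fbm_persistence_lower[OF M H that(1) c D(1-5) that(2)])
  show ?thesis
  proof (intro conjI impI)
    assume B: "fractional_brownian_motion M H \<xi>"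
    obtain K where K: "K \<ge> 0" and rk: "\<forall>F b. finite F \<and> (\<forall>t\<in>F. norm (t::real^'n) \<ge> 1) \<longrightarrow>
        (\<Sum>t\<in>F. b t)\<^sup>2 \<le> K * (\<Sum>t\<in>F. \<Sum>s\<in>F. b t * b s * fbm_kernel H t s)"
      using fbm_rkhs[OF H, where 'a="real^'n"] by blast
    have ker: "(LINT w|M. \<xi> s w * \<xi> t w) = fbm_kernel H s t" for s t
      using B by (simp add: fractional_brownian_motion_def fbm_kernel_def)
    have "\<exists>C>0. \<forall>\<^sub>F T in at_top. persistence_prob M \<xi> (dilate T \<Delta>) \<le> exp (C * sqrt (ln T)) * T powr (H - real CARD('n))"
      by (rule persistence_upper[OF regular_field_fbm[OF M H B] D(1-3,6) K]) (simp only: ker, rule rk[rule_format], blast)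
    then show "((\<lambda>T. ln (persistence_prob M \<xi> (dilate T \<Delta>)) / ln T) \<longlongrightarrow> H - real CARD('n)) at_top"
      using log_ratio_limit[OF lower[OF B, of "real CARD('n) / (2 * H) + 1"]] by auto
  next
    assume A: "centered_gaussian_process M \<xi> \<and> isotropic M \<xi> \<and> stationary_increments M \<xi> \<and> variance_growth M H \<xi>"
    then obtain V k c' where R: "regular_field \<xi> M V H k c'"
      using regular_field_stationary[OF M H] by blast
    {
      assume T: "tangent_plane_at \<Delta> 0 {t. t $ e = 0}"
      show "\<forall>l > 1/2. \<forall>\<^sub>F T in at_top. T powr (H - real CARD('n)) * ln T powr (- l)
               \<le> persistence_prob M \<xi> (dilate T \<Delta> \<inter> integer_lattice)"
        using lattice_persistence_tangent[OF R D(1-4) T] by blast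
    next
      assume "fractional_brownian_motion M H \<xi>"
      then show "\<forall>l > real CARD('n) / (2 * H). \<forall>\<^sub>F T in at_top. T powr (H - real CARD('n)) * ln T powr (- l)
                 \<le> persistence_prob M \<xi> (dilate T \<Delta>)"
        using lower by blast
    next
      assume "\<exists>f g. has_spectral_density M \<xi> f \<and> spectral_minorant g \<and> (AE x in lborel. f x > g (norm x))"
      then obtain f g where fg: "has_spectral_density M \<xi> f" "spectral_minorant g" "AE x in lborel. f x > g (norm x)" by blast
      obtain K where K: "K \<ge> 0" and rk: "\<forall>F b. finite F \<and> (\<forall>t\<in>F. norm t \<ge> 1) \<longrightarrow>
          (\<Sum>t\<in>F. b t)\<^sup>2 \<le> K * (\<Sum>s\<in>F. \<Sum>t\<in>F. b s * b t * (LINT w|M. \<xi> s w * \<xi> t w))"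
        using spectral_rkhs[OF fg] by blast
      have "\<exists>C>0. \<forall>\<^sub>F T in at_top. persistence_prob M \<xi> (dilate T \<Delta>) \<le> exp (C * sqrt (ln T)) * T powr (H - real CARD('n))"
        by (rule persistence_upper[OF R D(1-3,6) K]) (rule rk[rule_format], blast)
      moreover have "H - real CARD('n) = - real CARD('n) + H" by simp
      ultimately show "\<exists>C>0. \<forall>\<^sub>F T in at_top. persistence_prob M \<xi> (dilate T \<Delta>) \<le> exp (C * sqrt (ln T)) * T powr (- real CARD('n) + H)"
        by (simp only:)
    }
  qed
qed

end
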